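(* Let $\rho:G\to\mathrm{GL}_F(V)$ be a finite dimensional $F$-linear representation of $G=G(L/K)$ and $n$ a positive integer. Then $$L(n,\rho)=\prod_{\mathfrak p\in\mathrm{Max}(\mathcal O_K)}\frac{|V^*\otimes_{k[G]}\mathrm{Lie}(C^{\otimes n})(\mathcal O_L/\mathfrak p\mathcal O_L)|_{F[t]}}{|V^*\otimes_{k[G]}C^{\otimes n}(\mathcal O_L/\mathfrak p\mathcal O_L)|_{F[t]}}\in1+t^{-1}F[[t^{-1}]].$$
   Context: Let $k$ be a finite field with $q$ elements, $F$ a finite extension of $k$, $K$ a finite extension of $k(t)$, $L/K$ a finite Galois extension with group $G$; $\mathcal O_K,\mathcal O_L$ are the integral closures of $k[t]$ in $K,L$, and $z$ is the image of $t$ in $\mathcal O_K$ and $\mathcal O_L$. For each maximal ideal $\mathfrak p$ of $\mathcal O_K$ choose a prime $\mathfrak P$ of $\mathcal O_L$ above $\mathfrak p$, with residue fields $\kappa_{\mathfrak p},\kappa_{\mathfrak P}$, decomposition group $G_{\mathfrak P}$, inertia group $I_{\mathfrak P}$; $\mathrm{Frob}_{\mathfrak P}\in G_{\mathfrak P}/I_{\mathfrak P}\simeq G(\kappa_{\mathfrak P}/\kappa_{\mathfrak p})$ is the element acting as $x\mapsto x^{\#\kappa_{\mathfrak p}}$. For a finite $F[t]$-module $M$, $|M|_{F[t]}=\det_{F[t]}(1\otimes t-t\otimes1,\ M\otimes_FF[t])$ is the characteristic polynomial, in the variable $t$, of $t$ acting on $M$. In particular $|\kappa_{\mathfrak p}|_{k[t]}=\prod_{\delta\in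 G(\kappa_{\mathfrak p}/k)}(t-\delta(z))\in k[t]$. The $L$-value is the convergent product $$L(n,\rho)=\prod_{\mathfrak p\in\mathrm{Max}(\mathcal O_K)}\det{}_{F[[t^{-1}]]}\Big(1-\frac{\rho(\mathrm{Frob}_{\mathfrak P})}{|\kappa_{\mathfrak p}|_{k[t]}^n},\ V^{I_{\mathfrak P}}[[t^{-1}]]\Big)^{-1},$$ where $W[[t^{-1}]]=W\widehat\otimes_kk[[t^{-1}]]$. $C^{\otimes n}$ is the $n$-th tensor power of the Carlitz module: for an $\mathcal O_K$-algebra $B$, $C^{\otimes n}(B)$ is $B^n$ with $t$ acting by $(x_1,\dots,x_n)\mapsto(zx_1+x_2,\dots,zx_{n-1}+x_n,zx_n+x_1^q)$, and $\mathrm{Lie}(C^{\otimes n})(B)$ is $B^n$ with $t$ acting by $(x_1,\dots,x_n)\mapsto(zx_1+x_2,\dots,zx_{n-1}+x_n,zx_n)$. $V^*=\mathrm{Hom}_F(V,F)$ is a right $F[G]$-module by $(\varphi g)(v)=\varphi(\rho(g)v)$. For a left $k[t][G]$-module $M$, $V^*\otimes_{k[G]}M$ is an $F[t]$-module ($F$ acts on $V^*$, $t$ acts on $M$). *)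

theory Defs
  imports
    "HOL-Algebra.QuotRing"
    "HOL-Algebra.Module"
    "HOL-Algebra.Free_Abelian_Groups"
    "HOL-Algebra.Generated_Groups"
    "HOL-Computational_Algebra.Fraction_Field"
    "HOL-Computational_Algebra.Formal_Laurent_Series"
    "Jordan_Normal_Form.Char_Poly"
begin

text \<open>
  The fields \<open>k\<close>, \<open>F\<close>, \<open>k(t)\<close>, \<open>K\<close>, \<open>L\<close> are the types \<^typ>\<open>'k\<close>, \<^typ>\<open>'f\<close>,
  \<^typ>\<open>'k poly fract\<close>, \<^typ>\<open>'K\<close>, \<^typ>\<open>'L\<close>, and field extensions are given by embeddings
  \<open>\<iota> : k \<rightarrow> F\<close>, \<open>a : k(t) \<rightarrow> K\<close>, \<open>b : K \<rightarrow> L\<close>. Subrings, ideals, quotients and modules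
  are HOL-Algebra records.
\<close>

definition finite_ext :: "('a::field \<Rightarrow> 'b::field) \<Rightarrow> bool" where
  "finite_ext h \<longleftrightarrow>
     field_hom h \<and> (\<exists>B. finite B \<and> Modules.module.span (\<lambda>c x. h c * x) B = UNIV)"

definition Gal :: "('a::field \<Rightarrow> 'b::field) \<Rightarrow> ('b \<Rightarrow> 'b) monoid" where
  "Gal b = \<lparr>carrier = {g. field_hom g \<and> bij g \<and> (\<forall>x. g (b x) = b x)},
            monoid.mult = (\<circ>), one = id\<rparr>"

definition finite_galois_ext :: "('a::field \<Rightarrow> 'b::field) \<Rightarrow> bool" where
  "finite_galois_ext b \<longleftrightarrow>
     finite_ext b \<and> {x. \<forall>g\<in>carrier (Gal b). g x = x} = range b"

definition poly_emb :: "('k::field poly fract \<Rightarrow> 'b::field) \<Rightarrow> 'k poly \<Rightarrow> 'b" where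
  "poly_emb h p = h (Fraction_Field.Fract p 1)"

definition integral_over :: "('a::comm_ring_1 \<Rightarrow> 'b::comm_ring_1) \<Rightarrow> 'b \<Rightarrow> bool" where
  "integral_over h x \<longleftrightarrow> (\<exists>p::'a poly. lead_coeff p = 1 \<and> poly (map_poly h p) x = 0)"

text \<open>\<open>int_ring h\<close> is the integral closure of \<open>k[t]\<close> in the extension \<open>h\<close> of \<open>k(t)\<close>.\<close>

definition int_ring :: "('k::field poly fract \<Rightarrow> 'b::field) \<Rightarrow> 'b ring" where
  "int_ring h = \<lparr>carrier = {x. integral_over (poly_emb h) x},
                 monoid.mult = (*), one = 1, ring.zero = 0, ring.add = (+)\<rparr>"

definition Max_ideals :: "'a ring \<Rightarrow> 'a set set" where
  "Max_ideals R = {\<pp>. maximalideal \<pp> R}"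

definition lies_above ::
  "('k::field poly fract \<Rightarrow> 'K::field) \<Rightarrow> ('K \<Rightarrow> 'L::field) \<Rightarrow> 'L set \<Rightarrow> 'K set \<Rightarrow> bool" where
  "lies_above a b \<PP> \<pp> \<longleftrightarrow>
     primeideal \<PP> (int_ring (b \<circ> a)) \<and> {x \<in> carrier (int_ring a). b x \<in> \<PP>} = \<pp>"

text \<open>An automorphism \<open>g\<close> acts on a residue ring, whose elements are cosets, by \<open>X \<mapsto> g ` X\<close>.\<close>

definition decomp_group ::
  "('k::field poly fract \<Rightarrow> 'K::field) \<Rightarrow> ('K \<Rightarrow> 'L::field) \<Rightarrow> 'L set \<Rightarrow> ('L \<Rightarrow> 'L) monoid" where
  "decomp_group a b \<PP> = (Gal b)\<lparr>carrier := {g \<in> carrier (Gal b). g ` \<PP> = \<PP>}\<rparr>"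

definition inertia ::
  "('k::field poly fract \<Rightarrow> 'K::field) \<Rightarrow> ('K \<Rightarrow> 'L::field) \<Rightarrow> 'L set \<Rightarrow> ('L \<Rightarrow> 'L) set" where
  "inertia a b \<PP> =
     {g \<in> carrier (decomp_group a b \<PP>). \<forall>X\<in>carrier (int_ring (b \<circ> a) Quot \<PP>). g ` X = X}"

definition Frob ::
  "('k::field poly fract \<Rightarrow> 'K::field) \<Rightarrow> ('K \<Rightarrow> 'L::field) \<Rightarrow> 'K set \<Rightarrow> 'L set \<Rightarrow> ('L \<Rightarrow> 'L) set" where
  "Frob a b \<pp> \<PP> =
     (THE C. C \<in> carrier (decomp_group a b \<PP> Mod inertia a b \<PP>) \<and>
        (\<forall>g\<in>C. \<forall>X\<in>carrier (int_ring (b \<circ> a) Quot \<PP>).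
           g ` X = X [^]\<^bsub>int_ring (b \<circ> a) Quot \<PP>\<^esub> card (carrier (int_ring a Quot \<pp>))))"

text \<open>Only the additive group and the scalar multiplication of a module record are
  meaningful; its ring multiplication and unit are left unspecified.\<close>

definition mk_module :: "'m set \<Rightarrow> 'm \<Rightarrow> ('m \<Rightarrow> 'm \<Rightarrow> 'm) \<Rightarrow> ('c \<Rightarrow> 'm \<Rightarrow> 'm) \<Rightarrow> ('c, 'm) module" where
  "mk_module C z ad sm =
     \<lparr>carrier = C, monoid.mult = undefined, one = undefined, ring.zero = z, ring.add = ad, smult = sm\<rparr>"

definition lin_comb :: "('c, 'm) module \<Rightarrow> 'c list \<Rightarrow> 'm list \<Rightarrow> 'm" where
  "lin_comb M cs bs = (\<Oplus>\<^bsub>M\<^esub>i\<in>{..<length bs}. cs ! i \<odot>\<^bsub>M\<^esub> bs ! i)"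

definition ordered_basis :: "('c, 'm) module \<Rightarrow> 'm list \<Rightarrow> bool" where
  "ordered_basis M bs \<longleftrightarrow> set bs \<subseteq> carrier M \<and>
     (\<forall>x\<in>carrier M. \<exists>!cs. length cs = length bs \<and> lin_comb M cs bs = x)"

definition coords :: "('c, 'm) module \<Rightarrow> 'm list \<Rightarrow> 'm \<Rightarrow> 'c list" where
  "coords M bs x = (THE cs. length cs = length bs \<and> lin_comb M cs bs = x)"

text \<open>The matrix with respect to some unspecified basis; it is only used inside
  determinants, which do not depend on that choice.\<close>

definition endo_mat :: "('c, 'm) module \<Rightarrow> ('m \<Rightarrow> 'm) \<Rightarrow> 'c mat" where
  "endo_mat M f = (let bs = (SOME bs. ordered_basis M bs) in
     mat (length bs) (length bs) (\<lambda>(i, j). coords M bs (f (bs ! j)) ! i))"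

text \<open>\<open>|M|\<close> for an \<open>F[t]\<close>-module \<open>M\<close>, given as an \<open>F\<close>-vector space with the action of \<open>t\<close>.\<close>

definition mod_size :: "('c::field, 'm) module \<Rightarrow> ('m \<Rightarrow> 'm) \<Rightarrow> 'c poly" where
  "mod_size M t = char_poly (endo_mat M t)"

text \<open>A \<open>k[t]\<close>-algebra is a ring record \<open>B\<close> together with its structure map \<open>\<eta>\<close>, so
  \<open>z = \<eta> t\<close>. Elements of \<open>B\<^sup>n\<close> are lists of length \<open>n\<close>.\<close>

definition alg_power :: "('k::field poly \<Rightarrow> 'b) \<Rightarrow> 'b ring \<Rightarrow> nat \<Rightarrow> ('k, 'b list) module" where
  "alg_power \<eta> B n =
     mk_module {xs. length xs = n \<and> set xs \<subseteq> carrier B} (replicate n \<zero>\<^bsub>B\<^esub>)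
       (map2 (\<oplus>\<^bsub>B\<^esub>)) (\<lambda>c. map (\<lambda>x. \<eta> [:c:] \<otimes>\<^bsub>B\<^esub> x))"

definition carlitz_t ::
  "('k::{field,finite} poly \<Rightarrow> 'b) \<Rightarrow> 'b ring \<Rightarrow> nat \<Rightarrow> 'b list \<Rightarrow> 'b list" where
  "carlitz_t \<eta> B n xs =
     map (\<lambda>i. \<eta> [:0, 1:] \<otimes>\<^bsub>B\<^esub> xs ! i \<oplus>\<^bsub>B\<^esub>
              (if Suc i < n then xs ! Suc i else (xs ! 0) [^]\<^bsub>B\<^esub> card (UNIV :: 'k set))) [0..<n]"

definition lie_carlitz_t :: "('k::field poly \<Rightarrow> 'b) \<Rightarrow> 'b ring \<Rightarrow> nat \<Rightarrow> 'b list \<Rightarrow> 'b list" where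
  "lie_carlitz_t \<eta> B n xs =
     map (\<lambda>i. \<eta> [:0, 1:] \<otimes>\<^bsub>B\<^esub> xs ! i \<oplus>\<^bsub>B\<^esub>
              (if Suc i < n then xs ! Suc i else \<zero>\<^bsub>B\<^esub>)) [0..<n]"

definition quot_emb :: "('k::field poly fract \<Rightarrow> 'b::field) \<Rightarrow> 'b set \<Rightarrow> 'k poly \<Rightarrow> 'b set" where
  "quot_emb h I p = I +>\<^bsub>int_ring h\<^esub> poly_emb h p"

definition ext_ideal ::
  "('k::field poly fract \<Rightarrow> 'K::field) \<Rightarrow> ('K \<Rightarrow> 'L::field) \<Rightarrow> 'K set \<Rightarrow> 'L set" where
  "ext_ideal a b \<pp> = Idl\<^bsub>int_ring (b \<circ> a)\<^esub> (b ` \<pp>)"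

text \<open>\<open>|\<kappa>\<^sub>\<pp>|\<close>, the characteristic polynomial of multiplication by \<open>z\<close> on \<open>\<kappa>\<^sub>\<pp> = \<O>\<^sub>K/\<pp>\<close>.\<close>

definition residue_size :: "('k::field poly fract \<Rightarrow> 'K::field) \<Rightarrow> 'K set \<Rightarrow> 'k poly" where
  "residue_size a \<pp> =
     (let \<kappa> = int_ring a Quot \<pp>; \<eta> = quot_emb a \<pp> in
      mod_size (mk_module (carrier \<kappa>) \<zero>\<^bsub>\<kappa>\<^esub> (\<oplus>\<^bsub>\<kappa>\<^esub>) (\<lambda>c x. \<eta> [:c:] \<otimes>\<^bsub>\<kappa>\<^esub> x))
        (\<lambda>x. \<eta> [:0, 1:] \<otimes>\<^bsub>\<kappa>\<^esub> x))"

text \<open>The tensor product of a right \<open>R\<close>-module \<open>A\<close> (action \<open>ra\<close>) and a left \<open>R\<close>-module \<open>M\<close>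
  (action \<open>la\<close>) as the free abelian group on \<open>A \<times> M\<close> modulo the usual relations.
  Only the underlying set of \<open>R\<close> enters.\<close>

definition tensor_rels ::
  "'r set \<Rightarrow> ('c, 'x) module \<Rightarrow> ('x \<Rightarrow> 'r \<Rightarrow> 'x) \<Rightarrow> ('d, 'm) module \<Rightarrow> ('r \<Rightarrow> 'm \<Rightarrow> 'm)
     \<Rightarrow> (('x \<times> 'm) \<Rightarrow>\<^sub>0 int) set" where
  "tensor_rels R A ra M la =
     {frag_of (x \<oplus>\<^bsub>A\<^esub> y, m) - frag_of (x, m) - frag_of (y, m) | x y m.
        x \<in> carrier A \<and> y \<in> carrier A \<and> m \<in> carrier M} \<union>
     {frag_of (x, m \<oplus>\<^bsub>M\<^esub> m') - frag_of (x, m) - frag_of (x, m') | x m m'.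
        x \<in> carrier A \<and> m \<in> carrier M \<and> m' \<in> carrier M} \<union>
     {frag_of (ra x r, m) - frag_of (x, la r m) | x r m.
        x \<in> carrier A \<and> r \<in> R \<and> m \<in> carrier M}"

definition tensor_group ::
  "'r set \<Rightarrow> ('c, 'x) module \<Rightarrow> ('x \<Rightarrow> 'r \<Rightarrow> 'x) \<Rightarrow> ('d, 'm) module \<Rightarrow> ('r \<Rightarrow> 'm \<Rightarrow> 'm)
     \<Rightarrow> (('x \<times> 'm) \<Rightarrow>\<^sub>0 int) set monoid" where
  "tensor_group R A ra M la =
     (let Z = free_Abelian_group (carrier A \<times> carrier M)
      in Z Mod generate Z (tensor_rels R A ra M la))"

text \<open>The map \<open>u \<otimes> v\<close> on the tensor product: the image of a coset is the coset of the image
  of any of its elements.\<close>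

definition tensor_map ::
  "'r set \<Rightarrow> ('c, 'x) module \<Rightarrow> ('x \<Rightarrow> 'r \<Rightarrow> 'x) \<Rightarrow> ('d, 'm) module \<Rightarrow> ('r \<Rightarrow> 'm \<Rightarrow> 'm)
     \<Rightarrow> ('x \<Rightarrow> 'x) \<Rightarrow> ('m \<Rightarrow> 'm) \<Rightarrow> (('x \<times> 'm) \<Rightarrow>\<^sub>0 int) set \<Rightarrow> (('x \<times> 'm) \<Rightarrow>\<^sub>0 int) set" where
  "tensor_map R A ra M la u v X =
     (let Z = free_Abelian_group (carrier A \<times> carrier M)
      in \<Union>w\<in>X. generate Z (tensor_rels R A ra M la)
           #>\<^bsub>Z\<^esub> frag_extend (\<lambda>(x, m). frag_of (u x, v m)) w)"

definition tensor_module ::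
  "'r set \<Rightarrow> ('c, 'x) module \<Rightarrow> ('x \<Rightarrow> 'r \<Rightarrow> 'x) \<Rightarrow> ('d, 'm) module \<Rightarrow> ('r \<Rightarrow> 'm \<Rightarrow> 'm)
     \<Rightarrow> ('c, (('x \<times> 'm) \<Rightarrow>\<^sub>0 int) set) module" where
  "tensor_module R A ra M la =
     (let T = tensor_group R A ra M la
      in mk_module (carrier T) \<one>\<^bsub>T\<^esub> (\<otimes>\<^bsub>T\<^esub>)
           (\<lambda>c. tensor_map R A ra M la (\<lambda>x. c \<odot>\<^bsub>A\<^esub> x) id))"

definition finite_dim_space :: "('f::field \<Rightarrow> 'v::ab_group_add \<Rightarrow> 'v) \<Rightarrow> bool" where
  "finite_dim_space sc \<longleftrightarrow>
     vector_space sc \<and> (\<exists>B. finite B \<and> Modules.module.span sc B = UNIV)"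

definition GL :: "('f::field \<Rightarrow> 'v::ab_group_add \<Rightarrow> 'v) \<Rightarrow> ('v \<Rightarrow> 'v) monoid" where
  "GL sc = \<lparr>carrier = {f. Vector_Spaces.linear sc sc f \<and> bij f}, monoid.mult = (\<circ>), one = id\<rparr>"

definition dual_space ::
  "('f::field \<Rightarrow> 'v::ab_group_add \<Rightarrow> 'v) \<Rightarrow> ('f, 'v \<Rightarrow> 'f) module" where
  "dual_space sc = mk_module {\<phi>. Vector_Spaces.linear sc (*) \<phi>}
     (\<lambda>_. 0) (\<lambda>\<phi> \<psi> v. \<phi> v + \<psi> v) (\<lambda>c \<phi> v. c * \<phi> v)"

text \<open>An element \<open>r = \<Sum>\<^sub>g r\<^sub>g g\<close> of \<open>k[G]\<close>, for finite \<open>G\<close>, is the function \<open>g \<mapsto> r\<^sub>g\<close> on \<open>G\<close>.\<close>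

definition group_ring :: "'g monoid \<Rightarrow> ('g \<Rightarrow> 'k) set" where
  "group_ring G = (carrier G \<rightarrow>\<^sub>E UNIV)"

definition dual_act ::
  "('k \<Rightarrow> 'f::field) \<Rightarrow> 'g monoid \<Rightarrow> ('g \<Rightarrow> 'v \<Rightarrow> 'v) \<Rightarrow> ('v \<Rightarrow> 'f) \<Rightarrow> ('g \<Rightarrow> 'k) \<Rightarrow> 'v \<Rightarrow> 'f" where
  "dual_act \<iota> G \<rho> \<phi> r v = (\<Sum>g\<in>carrier G. \<iota> (r g) * \<phi> (\<rho> g v))"

definition left_act ::
  "'g monoid \<Rightarrow> ('k, 'm) module \<Rightarrow> ('g \<Rightarrow> 'm \<Rightarrow> 'm) \<Rightarrow> ('g \<Rightarrow> 'k) \<Rightarrow> 'm \<Rightarrow> 'm" where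
  "left_act G M act r m = (\<Oplus>\<^bsub>M\<^esub>g\<in>carrier G. r g \<odot>\<^bsub>M\<^esub> act g m)"

text \<open>\<open>|V\<^sup>* \<otimes>\<^bsub>k[G]\<^esub> M|\<close> for a \<open>k[t][G]\<close>-module \<open>M\<close>, on which \<open>G\<close> acts by \<open>act\<close> and \<open>t\<close> by \<open>tM\<close>.\<close>

definition dual_tensor_size ::
  "('k::field \<Rightarrow> 'f::field) \<Rightarrow> 'g monoid \<Rightarrow> ('f \<Rightarrow> 'v::ab_group_add \<Rightarrow> 'v) \<Rightarrow> ('g \<Rightarrow> 'v \<Rightarrow> 'v)
     \<Rightarrow> ('k, 'm) module \<Rightarrow> ('g \<Rightarrow> 'm \<Rightarrow> 'm) \<Rightarrow> ('m \<Rightarrow> 'm) \<Rightarrow> 'f poly" where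
  "dual_tensor_size \<iota> G sc \<rho> M act tM =
     (let A = dual_space sc; R = group_ring G; ra = dual_act \<iota> G \<rho>; la = left_act G M act
      in mod_size (tensor_module R A ra M la) (tensor_map R A ra M la id tM))"

text \<open>\<open>F((t\<^sup>-\<^sup>1))\<close> is \<^typ>\<open>'f fls\<close> with its valuation topology, \<open>fls_X\<close> playing the role of
  \<open>t\<^sup>-\<^sup>1\<close>; hence \<open>t\<close> is \<open>fls_X_inv\<close>, and \<open>F[[t\<^sup>-\<^sup>1]]\<close> is the image of \<open>fps_to_fls\<close>.\<close>

definition poly_at_t :: "'f::field poly \<Rightarrow> 'f fls" where
  "poly_at_t p = poly (map_poly fls_const p) fls_X_inv"

definition has_uncond_prod :: "('i \<Rightarrow> 'a::{comm_monoid_mult,topological_space}) \<Rightarrow> 'i set \<Rightarrow> 'a \<Rightarrow> bool" where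
  "has_uncond_prod f I l \<longleftrightarrow> ((\<lambda>S. \<Prod>i\<in>S. f i) \<longlongrightarrow> l) (finite_subsets_at_top I)"

definition invariants ::
  "('f::field \<Rightarrow> 'v::ab_group_add \<Rightarrow> 'v) \<Rightarrow> ('g \<Rightarrow> 'v \<Rightarrow> 'v) \<Rightarrow> 'g set \<Rightarrow> ('f, 'v) module" where
  "invariants sc \<rho> H = mk_module {v. \<forall>g\<in>H. \<rho> g v = v} 0 (+) sc"

text \<open>All elements of the coset \<open>Frob\<close> act in the same way on the inertia invariants. The
  endomorphism of \<open>V\<^sup>I[[t\<^sup>-\<^sup>1]]\<close> has the matrix of that action as its matrix, with the
  entries regarded as constant series.\<close>

definition L_factor ::
  "('k::field \<Rightarrow> 'f::field) \<Rightarrow> ('k poly fract \<Rightarrow> 'K::field) \<Rightarrow> ('K \<Rightarrow> 'L::field)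
     \<Rightarrow> ('f \<Rightarrow> 'v::ab_group_add \<Rightarrow> 'v) \<Rightarrow> (('L \<Rightarrow> 'L) \<Rightarrow> 'v \<Rightarrow> 'v) \<Rightarrow> nat
     \<Rightarrow> 'K set \<Rightarrow> 'L set \<Rightarrow> 'f fls" where
  "L_factor \<iota> a b sc \<rho> n \<pp> \<PP> =
     (let A = endo_mat (invariants sc \<rho> (inertia a b \<PP>)) (\<rho> (SOME g. g \<in> Frob a b \<pp> \<PP>));
          u = inverse (poly_at_t (map_poly \<iota> (residue_size a \<pp>)) ^ n)
      in inverse (Determinant.det (1\<^sub>m (dim_row A) - u \<cdot>\<^sub>m map_mat fls_const A)))"

definition L_value ::
  "('k::field \<Rightarrow> 'f::field) \<Rightarrow> ('k poly fract \<Rightarrow> 'K::field) \<Rightarrow> ('K \<Rightarrow> 'L::field)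
     \<Rightarrow> ('f \<Rightarrow> 'v::ab_group_add \<Rightarrow> 'v) \<Rightarrow> (('L \<Rightarrow> 'L) \<Rightarrow> 'v \<Rightarrow> 'v) \<Rightarrow> ('K set \<Rightarrow> 'L set) \<Rightarrow> nat
     \<Rightarrow> 'f fls" where
  "L_value \<iota> a b sc \<rho> PP n =
     (THE l. has_uncond_prod (\<lambda>\<pp>. L_factor \<iota> a b sc \<rho> n \<pp> (PP \<pp>)) (Max_ideals (int_ring a)) l)"

text \<open>The sizes of \<open>V\<^sup>* \<otimes>\<^bsub>k[G]\<^esub> M\<close> for \<open>M = C\<^sup>\<otimes>\<^sup>n(\<O>\<^sub>L/\<pp>\<O>\<^sub>L)\<close> and \<open>M = Lie(C\<^sup>\<otimes>\<^sup>n)(\<O>\<^sub>L/\<pp>\<O>\<^sub>L)\<close>.\<close>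

definition carlitz_size ::
  "('k::{field,finite} \<Rightarrow> 'f::field) \<Rightarrow> ('k poly fract \<Rightarrow> 'K::field) \<Rightarrow> ('K \<Rightarrow> 'L::field)
     \<Rightarrow> ('f \<Rightarrow> 'v::ab_group_add \<Rightarrow> 'v) \<Rightarrow> (('L \<Rightarrow> 'L) \<Rightarrow> 'v \<Rightarrow> 'v) \<Rightarrow> nat \<Rightarrow> 'K set \<Rightarrow> 'f poly" where
  "carlitz_size \<iota> a b sc \<rho> n \<pp> =
     (let I = ext_ideal a b \<pp>; B = int_ring (b \<circ> a) Quot I; \<eta> = quot_emb (b \<circ> a) I
      in dual_tensor_size \<iota> (Gal b) sc \<rho> (alg_power \<eta> B n) (\<lambda>g. map ((`) g)) (carlitz_t \<eta> B n))"

definition lie_carlitz_size ::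
  "('k::{field,finite} \<Rightarrow> 'f::field) \<Rightarrow> ('k poly fract \<Rightarrow> 'K::field) \<Rightarrow> ('K \<Rightarrow> 'L::field)
     \<Rightarrow> ('f \<Rightarrow> 'v::ab_group_add \<Rightarrow> 'v) \<Rightarrow> (('L \<Rightarrow> 'L) \<Rightarrow> 'v \<Rightarrow> 'v) \<Rightarrow> nat \<Rightarrow> 'K set \<Rightarrow> 'f poly" where
  "lie_carlitz_size \<iota> a b sc \<rho> n \<pp> =
     (let I = ext_ideal a b \<pp>; B = int_ring (b \<circ> a) Quot I; \<eta> = quot_emb (b \<circ> a) I
      in dual_tensor_size \<iota> (Gal b) sc \<rho> (alg_power \<eta> B n) (\<lambda>g. map ((`) g)) (lie_carlitz_t \<eta> B n))"

end

theory Submission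
  imports Defs "HOL-Algebra.Algebraic_Closure_Type"
begin

unbundle no fps_syntax
hide_const (open) up_ring.coeff up_ring.monom Polynomials.degree Polynomials.lead_coeff
  Divisibility.irreducible Divisibility.prime

text \<open>
  Fix a prime and let \<open>\<Omega>\<close> be an algebraic closure of \<open>F\<close>. The \<open>\<Omega>\<close>-dual of the tensor product is
  a space \<open>U\<close> of equivariant families of \<open>k\<close>-linear functionals on \<open>\<O>\<^sub>L/\<pp>\<O>\<^sub>L\<close>, on which \<open>t\<close> acts by
  \<open>L\<close> for the Lie algebra and by \<open>L + \<sigma>\<close> for the Carlitz module, where \<open>\<sigma>\<close> is composition with
  the Frobenius. Put \<open>E = (s - L)\<inverse> \<sigma>\<close> for generic \<open>s\<close>. Functionals vanishing on nilpotents are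
  combinations of characters, \<open>E\<close> moves a character \<open>\<chi>\<close> to a multiple of its Frobenius twist, and
  following the characters once around the orbit of length \<open>d\<close> reduces \<open>det (1 - E)\<close> to the
  determinant of \<open>1 - c(s)\<close> times Frobenius on the inertia invariants. All but finitely many local
  factors are congruent to 1 modulo any given power of \<open>t\<inverse>\<close>.
\<close>

text \<open>The tensor product over k[G] is awkward to compute directly: the order of G may be
  divisible by the characteristic, so averaging over G fails, and for a ramified prime O_L/pO_L is
  not reduced and multiplication by z need not be diagonalizable. Passing to \<Omega>-valued
  functionals turns coinvariants into equivariant functions, which can be written down through
  characters. Nilpotents are not split off: \<open>E\<close> strictly raises a filtration by
  Frobenius exponents, so they contribute only a unipotent factor to 1 - E. The scalar c(s) is
  |kappa_p|(s)^(-n). On a character, the resolvent of the Jordan block of length n in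
  \<open>L\<close> contributes (s - lambda)^(-n), where lambda runs through the d conjugates of the
  image of z; over a full turn the factors s - lambda multiply to the characteristic polynomial of z
  on kappa_p. The comparison is made at elements s of \<Omega> outside finitely many roots. As
  \<Omega> is infinite, it becomes an identity of polynomials over F, in which t may then be
  substituted inside F((t^(-1))).\<close>

section \<open>Determinants of 1 minus a matrix\<close>

text \<open>Sylvester's identity. Multiplying the block matrix with rows (1, Y) and (P, 1) by the
  same unipotent \<open>?N\<close> on the right or on the left clears its lower left block and
  leaves 1 - Y P or 1 - P Y as the nontrivial diagonal block; both products have the same
  determinant.\<close>

lemma det_one_minus_mult_commute:
  fixes Y P :: "'a::idom mat"
  assumes Y: "Y \<in> carrier_mat m r" and P: "P \<in> carrier_mat r m"
  shows "det (1\<^sub>m m - Y * P) = det (1\<^sub>m r - P * Y)"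
proof -
  let ?M = "four_block_mat (1\<^sub>m m) Y P (1\<^sub>m r)"
  let ?N = "four_block_mat (1\<^sub>m m) (0\<^sub>m m r) (- P) (1\<^sub>m r)"
  have M: "?M \<in> carrier_mat (m + r) (m + r)" and N: "?N \<in> carrier_mat (m + r) (m + r)"
    by (rule four_block_carrier_mat; simp)+
  have detN: "det ?N = 1"
    by (subst det_four_block_mat_upper_right_zero[of _ m _ r]) (use P in auto)
  have MN: "?M * ?N = four_block_mat (1\<^sub>m m - Y * P) Y (0\<^sub>m r m) (1\<^sub>m r)"
    by (subst mult_four_block_mat[of _ m m _ r _ r])
       (use Y P in \<open>auto intro!: arg_cong2[of _ _ _ _ "%A B. four_block_mat A _ B _"] eq_matI\<close>)
  have NM: "?N * ?M = four_block_mat (1\<^sub>m m) Y (0\<^sub>m r m) (1\<^sub>m r - P * Y)"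
    by (subst mult_four_block_mat[of _ m m _ r _ r])
       (use Y P in \<open>auto intro!: arg_cong2[of _ _ _ _ "%A B. four_block_mat _ _ A B"] eq_matI\<close>)
  have "det (?M * ?N) = det (1\<^sub>m m - Y * P)"
    unfolding MN by (subst det_four_block_mat_lower_left_zero[of _ m _ r]) (use Y P in auto)
  moreover have "det (?N * ?M) = det (1\<^sub>m r - P * Y)"
    unfolding NM by (subst det_four_block_mat_lower_left_zero[of _ m _ r]) (use Y P in auto)
  ultimately show ?thesis
    using det_mult[OF M N] det_mult[OF N M] by (simp add: mult.commute)
qed

text \<open>Since 1 - N^2 = (1 - N)(1 + N), the determinant of 1 - N divides that of 1 - N^2, and
  repeated squaring ends at N = 0; hence the exponents that are powers of two. The ring is arbitrary
  because the lemma is applied over polynomials.\<close>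

lemma det_one_minus_nilpotent_dvd_one:
  fixes N :: "'a::comm_ring_1 mat"
  assumes "N \<in> carrier_mat m m" "N ^\<^sub>m (2 ^ k) = 0\<^sub>m m m"
  shows "det (1\<^sub>m m - N) dvd 1"
  using assms
proof (induction k arbitrary: N)
  case 0
  then have "N = 0\<^sub>m m m" by simp
  then have "1\<^sub>m m - N = 1\<^sub>m m" by auto
  then show ?case by simp
next
  case (Suc k)
  note N = Suc.prems(1)
  have sq: "(N * N) ^\<^sub>m j = N ^\<^sub>m (2 * j)" for j
  proof (induction j)
    case (Suc j)
    have "(N * N) ^\<^sub>m Suc j = (N ^\<^sub>m (2 * j)) * (N * N)" using Suc by simp
    also have "\<dots> = (N ^\<^sub>m (2 * j)) * N * N"
      by (rule assoc_mult_mat[symmetric]) (use N in \<open>auto intro: pow_carrier_mat\<close>)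
    finally show ?case by simp
  qed (use N in simp)
  have fac: "(1\<^sub>m m - N) * (1\<^sub>m m + N) = 1\<^sub>m m - N * N"
  proof -
    have "(1\<^sub>m m - N) * (1\<^sub>m m + N) = (1\<^sub>m m + N) - N * (1\<^sub>m m + N)"
      using N by (subst minus_mult_distrib_mat[of _ m m]) auto
    also have "N * (1\<^sub>m m + N) = N + N * N"
      using N by (subst mult_add_distrib_mat[of _ m m]) auto
    finally show ?thesis using N by (auto intro!: eq_matI)
  qed
  have "det (1\<^sub>m m - N * N) dvd 1"
    by (rule Suc.IH) (use Suc.prems sq in auto)
  moreover have "det (1\<^sub>m m - N * N) = det (1\<^sub>m m - N) * det (1\<^sub>m m + N)"
    unfolding fac[symmetric] by (rule det_mult) (use N in auto)
  ultimately show ?case by (metis dvd_mult_left)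
qed

lemma pow_mat_eq_zero_mono:
  fixes N :: "'a::comm_ring_1 mat"
  assumes N: "N \<in> carrier_mat m m" and "N ^\<^sub>m k = 0\<^sub>m m m" "k \<le> l"
  shows "N ^\<^sub>m l = 0\<^sub>m m m"
  using assms(3)
proof (induction l rule: dec_induct)
  case (step l)
  then show ?case using N by auto
qed (use assms in simp)

text \<open>Scaling \<open>N\<close> by an indeterminate keeps it nilpotent, so the determinant
  becomes a unit of the polynomial ring, that is, a constant. Its value at 0 is 1, and its value at
  1 is the determinant in question.\<close>

lemma det_one_minus_nilpotent:
  fixes N :: "'a::idom mat"
  assumes N: "N \<in> carrier_mat m m" and nil: "N ^\<^sub>m k = 0\<^sub>m m m"
  shows "det (1\<^sub>m m - N) = 1"
proof -
  define h :: "'a => 'a poly" where "h = (%c. Polynomial.monom c 1)"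
  define Q where "Q = map_mat h N"
  have Q: "Q \<in> carrier_mat m m" using N by (simp add: Q_def)
  have pow: "Q ^\<^sub>m j = map_mat (%c. Polynomial.monom c j) (N ^\<^sub>m j)" for j
  proof (induction j)
    case 0
    then show ?case using N by (auto simp: Q_def monom_0 pCons_one intro!: eq_matI)
  next
    case (Suc j)
    have Nj: "N ^\<^sub>m j \<in> carrier_mat m m" using N by (rule pow_carrier_mat)
    show ?case
      unfolding pow_mat.simps Suc
      by (rule eq_matI)
        (use N Nj in \<open>auto simp: Q_def h_def scalar_prod_def mult_monom
            monom_sum\<close>)
  qed
  have "k \<le> 2 ^ k" by (simp add: less_imp_le)
  then have "N ^\<^sub>m (2 ^ k) = 0\<^sub>m m m" using pow_mat_eq_zero_mono[OF N nil] by blast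
  then have "Q ^\<^sub>m (2 ^ k) = 0\<^sub>m m m" unfolding pow by auto
  then have "det (1\<^sub>m m - Q) dvd 1"
    by (rule det_one_minus_nilpotent_dvd_one[OF Q])
  then obtain c where c: "det (1\<^sub>m m - Q) = [:c:]"
    by (auto simp: is_unit_poly_iff)
  have ev: "poly (det (1\<^sub>m m - Q)) x = det (1\<^sub>m m - x \<cdot>\<^sub>m N)" for x
    by (rule poly_det_cong[of _ m]) (use N in \<open>auto simp: Q_def h_def poly_monom\<close>)
  have "det (1\<^sub>m m - 0 \<cdot>\<^sub>m N) = det (1\<^sub>m m - 1 \<cdot>\<^sub>m N)"
    using ev[of 0] ev[of 1] by (simp add: c)
  moreover have "1\<^sub>m m - 0 \<cdot>\<^sub>m N = 1\<^sub>m m" "1 \<cdot>\<^sub>m N = N" using N by (auto intro!: eq_matI)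
  ultimately show ?thesis by simp
qed

section \<open>Linear maps between function spaces in coordinates\<close>

text \<open>Spaces of functionals occur as sets of functions with pointwise operations, not as
  types. A linear bijection onto column vectors plays the part of a basis and lets maps between such
  sets be handled as matrices.\<close>

definition coord_iso :: "('y => 'o::field) set => (('y => 'o) => 'o vec) => nat => bool" where
  "coord_iso U kp m \<longleftrightarrow>
     (\<forall>u\<in>U. \<forall>v\<in>U. (%y. u y + v y) \<in> U \<and> kp (%y. u y + v y) = kp u + kp v) \<and>
     (\<forall>c. \<forall>u\<in>U. (%y. c * u y) \<in> U \<and> kp (%y. c * u y) = c \<cdot>\<^sub>v kp u) \<and>
     bij_betw kp U (carrier_vec m)"

definition lin_on :: "('y => 'o::field) set => ('x => 'o) set => (('y => 'o) => 'x => 'o) => bool" where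
  "lin_on U U' T \<longleftrightarrow>
     (\<forall>u\<in>U. T u \<in> U') \<and>
     (\<forall>u\<in>U. \<forall>v\<in>U. T (%y. u y + v y) = (%x. T u x + T v x)) \<and>
     (\<forall>c. \<forall>u\<in>U. T (%y. c * u y) = (%x. c * T u x))"

lemma coord_iso_carrier: "coord_iso U kp m ==> u \<in> U ==> kp u \<in> carrier_vec m"
  by (auto simp: coord_iso_def bij_betw_def)

lemma coord_iso_inj: "coord_iso U kp m ==> u \<in> U ==> v \<in> U ==> kp u = kp v ==> u = v"
  by (auto simp: coord_iso_def bij_betw_def inj_on_def)

lemma coord_iso_ex: "coord_iso U kp m ==> v \<in> carrier_vec m ==> \<exists>u\<in>U. kp u = v"
  unfolding coord_iso_def bij_betw_def by (metis image_iff)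

lemma coord_iso_add:
  "coord_iso U kp m ==> u \<in> U ==> v \<in> U ==> (%y. u y + v y) \<in> U"
  "coord_iso U kp m ==> u \<in> U ==> v \<in> U ==> kp (%y. u y + v y) = kp u + kp v"
  by (auto simp: coord_iso_def)

lemma coord_iso_scale:
  "coord_iso U kp m ==> u \<in> U ==> (%y. c * u y) \<in> U"
  "coord_iso U kp m ==> u \<in> U ==> kp (%y. c * u y) = c \<cdot>\<^sub>v kp u"
  by (auto simp: coord_iso_def)

lemma coord_iso_diff:
  assumes "coord_iso U kp m" "u \<in> U" "v \<in> U"
  shows "(%y. u y - v y) \<in> U" and "kp (%y. u y - v y) = kp u - kp v"
proof -
  have 1: "(%y. (-1) * v y) \<in> U" "kp (%y. (-1) * v y) = (-1) \<cdot>\<^sub>v kp v"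
    using assms coord_iso_scale by blast+
  have eq: "(%y. u y - v y) = (%y. u y + (-1) * v y)" by auto
  have c: "kp u \<in> carrier_vec m" "kp v \<in> carrier_vec m" using assms coord_iso_carrier by blast+
  show "(%y. u y - v y) \<in> U" unfolding eq using assms 1 coord_iso_add by blast
  have "kp (%y. u y + (-1) * v y) = kp u + (-1) \<cdot>\<^sub>v kp v"
    using assms 1 coord_iso_add(2)[of U kp m u "%y. (-1) * v y"] by simp
  then show "kp (%y. u y - v y) = kp u - kp v" unfolding eq using c by auto
qed

lemma lin_on_mat:
  assumes U: "coord_iso U kp m" and U': "coord_iso U' kp' m'" and T: "lin_on U U' T"
  shows "\<exists>A\<in>carrier_mat m' m. \<forall>u\<in>U. kp' (T u) = A *\<^sub>v kp u"
proof -
  define e where "e = (%j. SOME u. u \<in> U \<and> kp u = unit_vec m j)"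
  have e: "e j \<in> U" "kp (e j) = unit_vec m j" for j
    using someI_ex[of "%u. u \<in> U \<and> kp u = unit_vec m j"] coord_iso_ex[OF U, of "unit_vec m j"]
    unfolding e_def by (metis (mono_tags) unit_vec_carrier)+
  define A where "A = mat m' m (%(i, j). kp' (T (e j)) $ i)"
  have A: "A \<in> carrier_mat m' m" by (simp add: A_def)
  have T1: "T u \<in> U'" if "u \<in> U" for u using T that by (auto simp: lin_on_def)
  have colA: "A *\<^sub>v unit_vec m j = kp' (T (e j))" if "j < m" for j
    using that coord_iso_carrier[OF U' T1[OF e(1)], of j] A
    by (auto simp: A_def mat_of_cols_def scalar_prod_right_unit row_def intro!: eq_vecI)
  \<comment> \<open>Induction on the length of the initial segment that supports the coordinates of
    \<open>u\<close>; the step splits off the multiple of \<open>e k\<close> that carries the last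
    of them.\<close>
  have main: "(\<forall>i\<ge>k. i < m \<longrightarrow> kp u $ i = 0) ==> k \<le> m ==> u \<in> U ==> kp' (T u) = A *\<^sub>v kp u" for k u
  proof (induction k arbitrary: u)
    case 0
    have u0: "kp u = 0\<^sub>v m" using 0 coord_iso_carrier[OF U] by (intro eq_vecI) auto
    have "kp (%y. 0 * u y) = 0 \<cdot>\<^sub>v kp u" "(%y. 0 * u y) \<in> U" using 0 U coord_iso_scale by blast+
    then have "u = (%y. 0 * u y)" using 0 u0 by (intro coord_iso_inj[OF U]) auto
    then have "T u = (%x. 0 * T u x)" using T 0 unfolding lin_on_def by metis
    then have "kp' (T u) = 0 \<cdot>\<^sub>v kp' (T u)" using coord_iso_scale(2)[OF U' T1[OF \<open>u \<in> U\<close>], of 0] by simp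
    then show ?case using A u0 coord_iso_carrier[OF U' T1[OF \<open>u \<in> U\<close>]] by (auto simp: smult_vec_def)
  next
    case (Suc k)
    define c where "c = kp u $ k"
    define v where "v = (%y. c * e k y)"
    define w where "w = (%y. u y - v y)"
    have k: "k < m" using Suc by simp
    have v: "v \<in> U" "kp v = c \<cdot>\<^sub>v unit_vec m k" using coord_iso_scale[OF U e(1)] e(2) by (auto simp: v_def)
    have w: "w \<in> U" "kp w = kp u - kp v" using coord_iso_diff[OF U Suc.prems(3) v(1)] by (auto simp: w_def)
    have cu: "kp u \<in> carrier_vec m" "kp v \<in> carrier_vec m" "kp w \<in> carrier_vec m"
      using Suc.prems w v coord_iso_carrier[OF U] by auto
    have "kp' (T w) = A *\<^sub>v kp w"
    proof (rule Suc.IH)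
      show "\<forall>i\<ge>k. i < m \<longrightarrow> kp w $ i = 0"
        unfolding w(2) v(2) using Suc.prems(1) k cu
        by (auto simp: c_def unit_vec_def)
    qed (use Suc w in auto)
    moreover have "kp' (T v) = A *\<^sub>v kp v"
    proof -
      have "T v = (%x. c * T (e k) x)" using T e(1) unfolding lin_on_def v_def by blast
      then have "kp' (T v) = c \<cdot>\<^sub>v kp' (T (e k))" using coord_iso_scale(2)[OF U' T1[OF e(1)]] by simp
      also have "\<dots> = c \<cdot>\<^sub>v (A *\<^sub>v unit_vec m k)" using colA[OF k] by simp
      also have "\<dots> = A *\<^sub>v (c \<cdot>\<^sub>v unit_vec m k)" using A by (simp add: mult_mat_vec)
      finally show ?thesis using v by simp
    qed
    moreover have "u = (%y. w y + v y)" by (auto simp: w_def)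
    then have "T u = (%x. T w x + T v x)" using T w(1) v(1) unfolding lin_on_def by metis
    then have "kp' (T u) = kp' (T w) + kp' (T v)" using coord_iso_add(2)[OF U' T1[OF w(1)] T1[OF v(1)]] by simp
    moreover have "kp u = kp w + kp v" unfolding w(2) using cu by auto
    ultimately show ?case using A cu by (simp add: mult_add_distrib_mat_vec)
  qed
  have "kp' (T u) = A *\<^sub>v kp u" if "u \<in> U" for u by (rule main[of m]) (use that in auto)
  then show ?thesis using A by blast
qed

lemma mat_eqI_mult_vec:
  fixes A B :: "'a::comm_ring_1 mat"
  assumes "A \<in> carrier_mat m' m" "B \<in> carrier_mat m' m" "!!v. v \<in> carrier_vec m ==> A *\<^sub>v v = B *\<^sub>v v"
  shows "A = B"
proof (rule eq_matI)
  fix i j assume ij: "i < dim_row B" "j < dim_col B"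
  have "(A *\<^sub>v unit_vec m j) $ i = (B *\<^sub>v unit_vec m j) $ i" using assms(3) by simp
  then show "A $$ (i, j) = B $$ (i, j)" using assms(1,2) ij by (simp add: scalar_prod_right_unit)
qed (use assms in auto)

lemma coord_iso_mat_eqI:
  assumes "coord_iso U kp m" "A \<in> carrier_mat m' m" "B \<in> carrier_mat m' m"
    "!!u. u \<in> U ==> A *\<^sub>v kp u = B *\<^sub>v kp u"
  shows "A = B"
  by (rule mat_eqI_mult_vec[OF assms(2,3)]) (metis assms(1,4) coord_iso_ex)

lemma one_minus_diff_cancel_mat:
  fixes A B M N Z :: "'a::comm_ring_1 mat"
  assumes "A \<in> carrier_mat m m" "B \<in> carrier_mat m m" "M \<in> carrier_mat m m" "N = M - B" "Z = A + B"
  shows "(1\<^sub>m m - Z) - (N - A) = 1\<^sub>m m - M"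
  unfolding assms(4,5) using assms(1-3) by (intro eq_matI) auto

text \<open>With \<open>E' = E - E \<circ> emb \<circ> P\<close> the hypotheses say \<open>1 - E = (1 - E') (1 - Y P)\<close>; the first
  factor is unipotent.\<close>

lemma det_one_minus_reduce:
  fixes U :: "('y => 'o::field) set" and W :: "('x => 'o) set"
  assumes U: "coord_iso U kp m" and W: "coord_iso W kp' r"
    and E: "lin_on U U E" and emb: "lin_on W U emb" and P: "lin_on U W P" and Y: "lin_on W U Y"
    and EM: "EM \<in> carrier_mat m m" "!!u. u \<in> U ==> kp (E u) = EM *\<^sub>v kp u"
    and PM: "\<Phi> \<in> carrier_mat r r" "!!w. w \<in> W ==> kp' (P (Y w)) = \<Phi> *\<^sub>v kp' w"
    and nil: "!!u. u \<in> U ==> ((%u. E (%y. u y - emb (P u) y)) ^^ k) u = (%_. 0)"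
    and eq: "!!w. w \<in> W ==> Y w = (%y. E (%y. Y w y - emb (P (Y w)) y) y + E (emb w) y)"
  shows "det (1\<^sub>m m - EM) = det (1\<^sub>m r - \<Phi>)"
proof -
  obtain Em where Em: "Em \<in> carrier_mat m r" "!!w. w \<in> W ==> kp (emb w) = Em *\<^sub>v kp' w"
    using lin_on_mat[OF W U emb] by blast
  obtain Pm where Pm: "Pm \<in> carrier_mat r m" "!!u. u \<in> U ==> kp' (P u) = Pm *\<^sub>v kp u"
    using lin_on_mat[OF U W P] by blast
  obtain Ym where Ym: "Ym \<in> carrier_mat m r" "!!w. w \<in> W ==> kp (Y w) = Ym *\<^sub>v kp' w"
    using lin_on_mat[OF W U Y] by blast
  define N where "N = EM - EM * Em * Pm"
  have N: "N \<in> carrier_mat m m" using EM(1) Em(1) Pm(1) unfolding N_def by (intro minus_carrier_mat mult_carrier_mat)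
  define E' where "E' = (%u. E (%y. u y - emb (P u) y))"
  have inU: "E u \<in> U" "emb w \<in> U" "P u \<in> W" "Y w \<in> U" if "u \<in> U" "w \<in> W" for u w
    using E emb P Y that by (auto simp: lin_on_def)
  note cU = coord_iso_carrier[OF U] and cW = coord_iso_carrier[OF W]
  have PU: "P u \<in> W" "emb (P u) \<in> U" if "u \<in> U" for u
    using P emb that by (auto simp: lin_on_def)
  have EU: "E u \<in> U" if "u \<in> U" for u using E that by (auto simp: lin_on_def)
  have E'U: "E' u \<in> U" and E'm: "kp (E' u) = N *\<^sub>v kp u" if u: "u \<in> U" for u
  proof -
    have d: "(%y. u y - emb (P u) y) \<in> U" "kp (%y. u y - emb (P u) y) = kp u - kp (emb (P u))"
      using coord_iso_diff[OF U u PU(2)[OF u]] by auto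
    show "E' u \<in> U" unfolding E'_def using EU[OF d(1)] .
    have "kp (E' u) = EM *\<^sub>v (kp u - Em *\<^sub>v (Pm *\<^sub>v kp u))"
      unfolding E'_def using EM(2)[OF d(1)] d(2) Em(2)[OF PU(1)[OF u]] Pm(2)[OF u] by simp
    also have "\<dots> = N *\<^sub>v kp u"
      unfolding N_def using EM(1) Em(1) Pm(1) cU[OF u]
      by (simp add: minus_mult_distrib_mat_vec mult_minus_distrib_mat_vec assoc_mult_mat_vec[of _ m _ _ m]
          assoc_mult_mat_vec[of _ m r _ m] assoc_mult_mat_vec[of _ m m _ r])
    finally show "kp (E' u) = N *\<^sub>v kp u" .
  qed
  have pow: "(E' ^^ j) u \<in> U \<and> kp ((E' ^^ j) u) = (N ^\<^sub>m j) *\<^sub>v kp u" if u: "u \<in> U" for u j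
    using u
  proof (induction j arbitrary: u)
    case (Suc j)
    have "kp ((E' ^^ j) (E' u)) = N ^\<^sub>m j *\<^sub>v (N *\<^sub>v kp u)"
      using Suc E'U E'm by simp
    also have "\<dots> = (N ^\<^sub>m Suc j) *\<^sub>v kp u"
      using N pow_carrier_mat[OF N, of j] cU[OF Suc.prems] by (simp add: assoc_mult_mat_vec[of _ m m])
    finally show ?case using Suc.IH[OF E'U[OF Suc.prems]] by (simp add: funpow_swap1)
  qed (use N cU in auto)
  have z: "kp (%_. 0) = 0\<^sub>v m" if "u \<in> U" for u
  proof -
    have "(%_. 0) = (%y. u y - u y)" by simp
    then show ?thesis using coord_iso_diff(2)[OF U that that] cU[OF that] by simp
  qed
  have "N ^\<^sub>m k = 0\<^sub>m m m"
  proof (rule coord_iso_mat_eqI[OF U, of _ m])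
    fix u assume u: "u \<in> U"
    have "0\<^sub>m m m *\<^sub>v kp u = 0\<^sub>v m" using cU[OF u] by (intro eq_vecI) auto
    then show "N ^\<^sub>m k *\<^sub>v kp u = 0\<^sub>m m m *\<^sub>v kp u"
      using pow[OF u, of k] nil[OF u] z[OF u] cU[OF u] by (auto simp: E'_def)
  qed (simp_all add: pow_carrier_mat[OF N])
  then have det1: "det (1\<^sub>m m - N) = 1" by (rule det_one_minus_nilpotent[OF N])
  have YN: "Ym = N * Ym + EM * Em"
  proof (rule coord_iso_mat_eqI[OF W, of _ m])
    fix w assume w: "w \<in> W"
    have Yw: "Y w \<in> U" "E (emb w) \<in> U" "emb w \<in> U" using w Y emb E by (auto simp: lin_on_def)
    have "kp (Y w) = kp (%y. E' (Y w) y + E (emb w) y)"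
      using eq[OF w] unfolding E'_def by simp
    also have "\<dots> = N *\<^sub>v kp (Y w) + EM *\<^sub>v kp (emb w)"
      using coord_iso_add(2)[OF U E'U[OF Yw(1)] Yw(2)] E'm[OF Yw(1)] EM(2)[OF Yw(3)] by simp
    finally show "Ym *\<^sub>v kp' w = (N * Ym + EM * Em) *\<^sub>v kp' w"
      using Ym(2)[OF w] Em(2)[OF w] cW[OF w] N Ym(1) Em(1) EM(1)
      by (simp add: add_mult_distrib_mat_vec[of _ m r] assoc_mult_mat_vec[of _ m m _ r])
  qed (use N Ym(1) Em(1) EM(1) in auto)
  have PYm: "Pm * Ym = \<Phi>"
  proof (rule coord_iso_mat_eqI[OF W, of _ r])
    fix w assume w: "w \<in> W"
    have "Y w \<in> U" using w Y by (auto simp: lin_on_def)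
    then have "Pm *\<^sub>v (Ym *\<^sub>v kp' w) = \<Phi> *\<^sub>v kp' w"
      using PM(2)[OF w] Pm(2) Ym(2)[OF w] by simp
    then show "Pm * Ym *\<^sub>v kp' w = \<Phi> *\<^sub>v kp' w"
      using Pm(1) Ym(1) cW[OF w] by (simp add: assoc_mult_mat_vec)
  qed (use Pm(1) Ym(1) PM(1) in auto)
  have "(1\<^sub>m m - N) * (1\<^sub>m m - Ym * Pm) = 1\<^sub>m m - EM"
  proof -
    have YP: "Ym * Pm \<in> carrier_mat m m" using Ym(1) Pm(1) by simp
    have C: "1\<^sub>m m - Ym * Pm \<in> carrier_mat m m" using YP by (rule minus_carrier_mat)
    have "(1\<^sub>m m - N) * (1\<^sub>m m - Ym * Pm) = 1\<^sub>m m * (1\<^sub>m m - Ym * Pm) - N * (1\<^sub>m m - Ym * Pm)"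
      by (rule minus_mult_distrib_mat[OF one_carrier_mat N C])
    also have "1\<^sub>m m * (1\<^sub>m m - Ym * Pm) = 1\<^sub>m m - Ym * Pm" by (rule left_mult_one_mat[OF C])
    also have "N * (1\<^sub>m m - Ym * Pm) = N * 1\<^sub>m m - N * (Ym * Pm)"
      by (rule mult_minus_distrib_mat[OF N one_carrier_mat YP])
    also have "N * 1\<^sub>m m = N" by (rule right_mult_one_mat[OF N])
    finally have 1: "(1\<^sub>m m - N) * (1\<^sub>m m - Ym * Pm) = (1\<^sub>m m - Ym * Pm) - (N - N * (Ym * Pm))" .
    \<comment> \<open>This is \<open>YN\<close> multiplied by \<open>Pm\<close>. In the expanded
      product it replaces the terms containing \<open>Ym\<close> by \<open>EM * Em * Pm\<close>,
      exactly what distinguishes \<open>N\<close> from \<open>EM\<close>.\<close>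
    have 2: "Ym * Pm = N * (Ym * Pm) + EM * Em * Pm"
    proof -
      have "Ym * Pm = (N * Ym + EM * Em) * Pm" by (subst YN[symmetric]) (rule refl)
      also have "\<dots> = N * Ym * Pm + EM * Em * Pm"
        by (rule add_mult_distrib_mat) (use N Ym(1) Em(1) EM(1) Pm(1) in auto)
      also have "N * Ym * Pm = N * (Ym * Pm)" by (rule assoc_mult_mat) (use N Ym(1) Pm(1) in auto)
      finally show ?thesis .
    qed
    have NYP: "N * (Ym * Pm) \<in> carrier_mat m m" using N YP by (rule mult_carrier_mat)
    have Z: "EM * Em * Pm \<in> carrier_mat m m" using EM(1) Em(1) Pm(1) by (intro mult_carrier_mat)
    show ?thesis unfolding 1 by (rule one_minus_diff_cancel_mat[OF NYP Z EM(1) N_def 2])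
  qed
  then have "det (1\<^sub>m m - EM) = det ((1\<^sub>m m - N) * (1\<^sub>m m - Ym * Pm))" by (rule arg_cong[OF sym])
  also have "\<dots> = det (1\<^sub>m m - N) * det (1\<^sub>m m - Ym * Pm)"
    by (rule det_mult[OF minus_carrier_mat[OF N] minus_carrier_mat[OF mult_carrier_mat[OF Ym(1) Pm(1)]]])
  also have "\<dots> = det (1\<^sub>m r - Pm * Ym)"
    using det1 det_one_minus_mult_commute[OF Ym(1) Pm(1)] by simp
  finally show ?thesis using PYm by simp
qed

section \<open>Bases and functionals of module records\<close>

text \<open>The scalars form a whole field type, and only the additive group and the scalar
  multiplication are constrained, because records built by \<open>mk_module\<close> leave ring
  multiplication and unit unspecified.\<close>

locale vector_record =
  fixes M :: "('c::field, 'm) module"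
  assumes ab: "abelian_group M"
    and smult_closed: "!!c x. x \<in> carrier M ==> c \<odot>\<^bsub>M\<^esub> x \<in> carrier M"
    and smult_l_distr: "!!c d x. x \<in> carrier M ==> (c + d) \<odot>\<^bsub>M\<^esub> x = c \<odot>\<^bsub>M\<^esub> x \<oplus>\<^bsub>M\<^esub> d \<odot>\<^bsub>M\<^esub> x"
    and smult_r_distr: "!!c x y. x \<in> carrier M ==> y \<in> carrier M ==>
        c \<odot>\<^bsub>M\<^esub> (x \<oplus>\<^bsub>M\<^esub> y) = c \<odot>\<^bsub>M\<^esub> x \<oplus>\<^bsub>M\<^esub> c \<odot>\<^bsub>M\<^esub> y"
    and smult_assoc: "!!c d x. x \<in> carrier M ==> c \<odot>\<^bsub>M\<^esub> (d \<odot>\<^bsub>M\<^esub> x) = (c * d) \<odot>\<^bsub>M\<^esub> x"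
    and smult_one: "!!x. x \<in> carrier M ==> 1 \<odot>\<^bsub>M\<^esub> x = x"
begin

sublocale abelian_group M by (rule ab)

lemma smult_zero: "x \<in> carrier M ==> 0 \<odot>\<^bsub>M\<^esub> x = \<zero>\<^bsub>M\<^esub>"
  using smult_l_distr[of x 0 0] smult_closed[of x 0]
  by (metis add.r_cancel_one' add_0)

lemma smult_zero_r: "c \<odot>\<^bsub>M\<^esub> \<zero>\<^bsub>M\<^esub> = \<zero>\<^bsub>M\<^esub>"
  using smult_r_distr[of "\<zero>\<^bsub>M\<^esub>" "\<zero>\<^bsub>M\<^esub>" c] smult_closed[of "\<zero>\<^bsub>M\<^esub>" c]
  by (metis add.r_cancel_one' r_zero zero_closed)

lemma smult_finsum:
  "f \<in> A \<rightarrow> carrier M ==> c \<odot>\<^bsub>M\<^esub> (\<Oplus>\<^bsub>M\<^esub>i\<in>A. f i) = (\<Oplus>\<^bsub>M\<^esub>i\<in>A. c \<odot>\<^bsub>M\<^esub> f i)"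
proof (induction A rule: infinite_finite_induct)
  case (insert x F)
  then have f: "f x \<in> carrier M" "f \<in> F \<rightarrow> carrier M" by auto
  then have "(%i. c \<odot>\<^bsub>M\<^esub> f i) \<in> F \<rightarrow> carrier M" using smult_closed by auto
  then show ?case using insert f smult_closed by (simp add: smult_r_distr)
qed (auto simp: smult_zero_r)

lemma lin_comb_closed: "set bs \<subseteq> carrier M ==> lin_comb M cs bs \<in> carrier M"
  unfolding lin_comb_def by (intro finsum_closed) (auto intro!: smult_closed simp: subset_iff)

lemma lin_comb_add:
  assumes "set bs \<subseteq> carrier M" "length cs = length bs" "length ds = length bs"
  shows "lin_comb M cs bs \<oplus>\<^bsub>M\<^esub> lin_comb M ds bs = lin_comb M (map2 (+) cs ds) bs"
proof -
  have "bs ! i \<in> carrier M" if "i < length bs" for i using assms that by auto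
  then have "lin_comb M cs bs \<oplus>\<^bsub>M\<^esub> lin_comb M ds bs =
      (\<Oplus>\<^bsub>M\<^esub>i\<in>{..<length bs}. cs ! i \<odot>\<^bsub>M\<^esub> bs ! i \<oplus>\<^bsub>M\<^esub> ds ! i \<odot>\<^bsub>M\<^esub> bs ! i)"
    unfolding lin_comb_def by (intro finsum_addf[symmetric]) (auto intro: smult_closed)
  also have "\<dots> = lin_comb M (map2 (+) cs ds) bs"
    unfolding lin_comb_def using assms \<open>!!i. i < length bs ==> bs ! i \<in> carrier M\<close>
    by (intro finsum_cong') (auto simp: smult_l_distr intro!: smult_closed)
  finally show ?thesis .
qed

lemma lin_comb_smult:
  assumes "set bs \<subseteq> carrier M" "length cs = length bs"
  shows "c \<odot>\<^bsub>M\<^esub> lin_comb M cs bs = lin_comb M (map ((*) c) cs) bs"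
proof -
  have b: "bs ! i \<in> carrier M" if "i < length bs" for i using assms that by auto
  then have "c \<odot>\<^bsub>M\<^esub> lin_comb M cs bs = (\<Oplus>\<^bsub>M\<^esub>i\<in>{..<length bs}. c \<odot>\<^bsub>M\<^esub> (cs ! i \<odot>\<^bsub>M\<^esub> bs ! i))"
    unfolding lin_comb_def by (intro smult_finsum) (auto intro: smult_closed)
  also have "\<dots> = lin_comb M (map ((*) c) cs) bs"
    unfolding lin_comb_def using assms b by (intro finsum_cong') (auto simp: smult_assoc intro!: smult_closed)
  finally show ?thesis .
qed

lemma lin_comb_unit:
  assumes "set bs \<subseteq> carrier M" "j < length bs"
  shows "lin_comb M (map (%i. if i = j then 1 else 0) [0..<length bs]) bs = bs ! j"
proof -
  have b: "bs ! i \<in> carrier M" if "i < length bs" for i using assms that by auto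
  have "lin_comb M (map (%i. if i = j then 1 else 0) [0..<length bs]) bs =
      (\<Oplus>\<^bsub>M\<^esub>i\<in>{..<length bs}. if j = i then bs ! i else \<zero>\<^bsub>M\<^esub>)"
    unfolding lin_comb_def using b by (intro finsum_cong') (auto simp: smult_zero smult_one)
  also have "\<dots> = bs ! j" using assms b by (intro add.finprod_singleton) auto
  finally show ?thesis .
qed

definition spanning :: "'m list => bool" where
  "spanning bs \<longleftrightarrow> set bs \<subseteq> carrier M \<and> (\<forall>x\<in>carrier M. \<exists>cs. length cs = length bs \<and> lin_comb M cs bs = x)"

lemma spanning_shrink:
  assumes sp: "spanning bs" and rel: "length cs = length bs" "lin_comb M cs bs = \<zero>\<^bsub>M\<^esub>"
    and k: "k < length bs" "cs ! k ~= 0"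
  shows "spanning (take k bs @ drop (Suc k) bs)"
proof -
  define ds where "ds = take k bs @ drop (Suc k) bs"
  have bs: "set bs \<subseteq> carrier M" using sp by (auto simp: spanning_def)
  have len: "length ds = length bs - 1" using k by (simp add: ds_def)
  have sub: "set ds \<subseteq> carrier M"
    using bs by (auto simp: ds_def dest: in_set_takeD in_set_dropD)
  define s where "s = (%i. if i < k then i else Suc i)"
  have dsn: "ds ! i = bs ! s i" if "i < length ds" for i
    using that k unfolding len by (auto simp: ds_def s_def nth_append)
  have b: "bs ! i \<in> carrier M" if "i < length bs" for i using bs that by auto
  have im: "s ` {..<length ds} = {..<length bs} - {k}"
  proof
    show "{..<length bs} - {k} \<subseteq> s ` {..<length ds}"
    proof
      fix i assume i: "i \<in> {..<length bs} - {k}"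
      show "i \<in> s ` {..<length ds}"
      proof (cases "i < k")
        case True
        then show ?thesis using i k len by (auto simp: s_def intro!: image_eqI[of _ _ i])
      next
        case False
        then show ?thesis using i k len by (auto simp: s_def intro!: image_eqI[of _ _ "i - 1"])
      qed
    qed
  qed (use k len in \<open>auto simp: s_def\<close>)
  have sb: "bs ! s i \<in> carrier M" if "i < length ds" for i
  proof -
    have "s i \<in> {..<length bs}" using im that by blast
    then show ?thesis using b by simp
  qed
  have inj: "inj_on s A" for A by (auto simp: s_def inj_on_def split: if_splits)
  have drop: "lin_comb M es bs = lin_comb M (map (%i. es ! s i) [0..<length ds]) ds"
    if "es ! k = 0" for es
  proof -
    have "lin_comb M es bs = (\<Oplus>\<^bsub>M\<^esub>i\<in>{..<length bs} - {k}. es ! i \<odot>\<^bsub>M\<^esub> bs ! i)"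
      unfolding lin_comb_def using that b
      by (intro add.finprod_mono_neutral_cong_right) (auto simp: smult_zero intro!: smult_closed)
    also have "\<dots> = (\<Oplus>\<^bsub>M\<^esub>i\<in>{..<length ds}. es ! s i \<odot>\<^bsub>M\<^esub> bs ! s i)"
      unfolding im[symmetric] using inj sb by (intro finsum_reindex) (auto intro!: smult_closed)
    also have "\<dots> = lin_comb M (map (%i. es ! s i) [0..<length ds]) ds"
      unfolding lin_comb_def using sb by (intro finsum_cong') (auto simp: dsn intro!: smult_closed)
    finally show ?thesis .
  qed
  show ?thesis
    unfolding spanning_def ds_def[symmetric]
  proof (intro conjI ballI sub)
    fix x assume x: "x \<in> carrier M"
    then obtain es where es: "length es = length bs" "lin_comb M es bs = x"
      using sp by (auto simp: spanning_def)
    \<comment> \<open>Adding \<open>t\<close> times the given relation cancels the coefficient at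
      position \<open>k\<close> without changing the represented element.\<close>
    define t where "t = - (es ! k / cs ! k)"
    define fs where "fs = map2 (+) es (map ((*) t) cs)"
    have "lin_comb M fs bs = x \<oplus>\<^bsub>M\<^esub> t \<odot>\<^bsub>M\<^esub> \<zero>\<^bsub>M\<^esub>"
      unfolding fs_def using lin_comb_add[OF bs es(1), of "map ((*) t) cs"] lin_comb_smult[OF bs rel(1)] rel es
      by simp
    then have "lin_comb M fs bs = x" using x by (simp add: smult_zero_r)
    moreover have "fs ! k = 0" using k es rel by (simp add: fs_def t_def)
    ultimately show "\<exists>cs. length cs = length ds \<and> lin_comb M cs ds = x"
      using drop[of fs] by (intro exI[of _ "map (%i. fs ! s i) [0..<length ds]"]) auto
  qed
qed

text \<open>A spanning list with a nontrivial relation can be shortened. One without is a basis,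
  because two representations of the same element differ by a relation.\<close>

lemma ordered_basis_exists:
  assumes "spanning bs"
  shows "\<exists>bs. ordered_basis M bs"
  using assms
proof (induction "length bs" arbitrary: bs rule: less_induct)
  case less
  have bs: "set bs \<subseteq> carrier M" using less.prems by (auto simp: spanning_def)
  show ?case
  proof (cases "\<exists>cs. length cs = length bs \<and> lin_comb M cs bs = \<zero>\<^bsub>M\<^esub> \<and> (\<exists>k<length bs. cs ! k ~= 0)")
    case True
    then obtain cs k where "length cs = length bs" "lin_comb M cs bs = \<zero>\<^bsub>M\<^esub>" "k < length bs" "cs ! k ~= 0"
      by blast
    from spanning_shrink[OF less.prems this] \<open>k < length bs\<close> show ?thesis
      by (intro less.hyps[of "take k bs @ drop (Suc k) bs"]) auto
  next
    case False
    have "cs = ds" if len: "length cs = length bs" "length ds = length bs"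
      and eq: "lin_comb M cs bs = lin_comb M ds bs" for cs ds
    proof -
      define es where "es = map2 (+) cs (map ((*) (-1)) ds)"
      have "lin_comb M es bs = lin_comb M cs bs \<oplus>\<^bsub>M\<^esub> (-1) \<odot>\<^bsub>M\<^esub> lin_comb M ds bs"
        unfolding es_def using lin_comb_add[OF bs len(1), of "map ((*) (-1)) ds"] lin_comb_smult[OF bs len(2), of "-1"] len
        by simp
      also have "\<dots> = (1 + (-1)) \<odot>\<^bsub>M\<^esub> lin_comb M cs bs"
        using lin_comb_closed[OF bs, of cs] eq by (simp only: smult_l_distr smult_one)
      also have "\<dots> = \<zero>\<^bsub>M\<^esub>" using lin_comb_closed[OF bs, of cs] by (simp add: smult_zero)
      finally have "\<forall>k<length bs. es ! k = 0" using False len by (auto simp: es_def)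
      then show "cs = ds" using len by (intro nth_equalityI) (auto simp: es_def)
    qed
    then have "ordered_basis M bs" unfolding ordered_basis_def using bs less.prems
      by (auto simp: spanning_def)
    then show ?thesis by blast
  qed
qed

lemma coords:
  assumes "ordered_basis M bs" "x \<in> carrier M"
  shows "length (coords M bs x) = length bs" "lin_comb M (coords M bs x) bs = x"
  using theI'[of "%cs. length cs = length bs \<and> lin_comb M cs bs = x"] assms
  by (auto simp: ordered_basis_def coords_def)

lemma coords_unique:
  assumes "ordered_basis M bs" "x \<in> carrier M" "length cs = length bs" "lin_comb M cs bs = x"
  shows "coords M bs x = cs"
  using coords[OF assms(1,2)] assms unfolding ordered_basis_def by blast

definition some_basis :: "'m list" where "some_basis = (SOME bs. ordered_basis M bs)"

lemma endo_mat_eq: "endo_mat M f = mat (length some_basis) (length some_basis) (%(i, j). coords M some_basis (f (some_basis ! j)) ! i)"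
  by (simp add: endo_mat_def some_basis_def Let_def)

text \<open>The list of all elements spans. This is enough for residue fields and for invariants in
  V, which are finite sets.\<close>

lemma finite_spanning:
  assumes "finite (carrier M)"
  shows "\<exists>bs. spanning bs"
proof -
  obtain bs where bs: "set bs = carrier M" using assms finite_list by blast
  have "\<exists>cs. length cs = length bs \<and> lin_comb M cs bs = x" if "x \<in> carrier M" for x
  proof -
    have "x \<in> set bs" using that bs by simp
    then obtain j where j: "j < length bs" "bs ! j = x" by (auto simp: in_set_conv_nth)
    have "lin_comb M (map (%i. if i = j then 1 else 0) [0..<length bs]) bs = x"
      using lin_comb_unit[OF eq_refl[OF bs] j(1)] unfolding j(2) .
    moreover have "length (map (%i. if i = j then 1 else 0 :: 'c) [0..<length bs]) = length bs" by simp
    ultimately show ?thesis by blast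
  qed
  then show ?thesis using bs by (auto simp: spanning_def)
qed

lemma additive_zero:
  fixes u :: "'m => 'o::field"
  assumes "!!x y. x \<in> carrier M ==> y \<in> carrier M ==> u (x \<oplus>\<^bsub>M\<^esub> y) = u x + u y"
  shows "u \<zero>\<^bsub>M\<^esub> = 0"
  using assms[of "\<zero>\<^bsub>M\<^esub>" "\<zero>\<^bsub>M\<^esub>"] by (metis add_cancel_left_left l_zero zero_closed)

lemma additive_finsum:
  fixes u :: "'m => 'o::field"
  assumes "!!x y. x \<in> carrier M ==> y \<in> carrier M ==> u (x \<oplus>\<^bsub>M\<^esub> y) = u x + u y"
    and "finite A" "f \<in> A \<rightarrow> carrier M"
  shows "u (\<Oplus>\<^bsub>M\<^esub>i\<in>A. f i) = (\<Sum>i\<in>A. u (f i))"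
  using assms(2,3)
proof (induction A)
  case (insert x F)
  have f: "f x \<in> carrier M" "f \<in> F \<rightarrow> carrier M" using insert.prems by auto
  then show ?case using insert assms(1)[of "f x" "\<Oplus>\<^bsub>M\<^esub>i\<in>F. f i"] finsum_closed[of f F]
    by (simp add: finsum_insert)
qed (use additive_zero[of u] assms(1) in simp)

lemma functional_lin_comb:
  fixes u :: "'m => 'o::field"
  assumes "!!x y. x \<in> carrier M ==> y \<in> carrier M ==> u (x \<oplus>\<^bsub>M\<^esub> y) = u x + u y"
    and "!!c x. x \<in> carrier M ==> u (c \<odot>\<^bsub>M\<^esub> x) = j c * u x"
    and bs: "set bs \<subseteq> carrier M"
  shows "u (lin_comb M cs bs) = (\<Sum>i<length bs. j (cs ! i) * u (bs ! i))"
proof -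
  have b: "bs ! i \<in> carrier M" if "i < length bs" for i using bs that by auto
  show ?thesis unfolding lin_comb_def using b assms(2)
    by (subst additive_finsum[OF assms(1)]) (auto intro!: smult_closed)
qed

lemma coords_add:
  assumes bs: "ordered_basis M bs" and "x \<in> carrier M" "y \<in> carrier M" "i < length bs"
  shows "coords M bs (x \<oplus>\<^bsub>M\<^esub> y) ! i = coords M bs x ! i + coords M bs y ! i"
proof -
  have s: "set bs \<subseteq> carrier M" using bs by (simp add: ordered_basis_def)
  have "coords M bs (x \<oplus>\<^bsub>M\<^esub> y) = map2 (+) (coords M bs x) (coords M bs y)"
    using assms coords[OF bs] lin_comb_add[OF s]
    by (intro coords_unique[OF bs]) (auto simp flip: lin_comb_add[OF s])
  then show ?thesis using assms coords[OF bs] by simp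
qed

lemma coords_smult:
  assumes bs: "ordered_basis M bs" and "x \<in> carrier M" "i < length bs"
  shows "coords M bs (c \<odot>\<^bsub>M\<^esub> x) ! i = c * coords M bs x ! i"
proof -
  have s: "set bs \<subseteq> carrier M" using bs by (simp add: ordered_basis_def)
  have "coords M bs (c \<odot>\<^bsub>M\<^esub> x) = map ((*) c) (coords M bs x)"
    using assms coords[OF bs] smult_closed
    by (intro coords_unique[OF bs]) (auto simp flip: lin_comb_smult[OF s])
  then show ?thesis using assms coords[OF bs] by simp
qed

lemma coords_basis:
  assumes bs: "ordered_basis M bs" and "k < length bs" "i < length bs"
  shows "coords M bs (bs ! k) ! i = (if i = k then 1 else 0)"
proof -
  have s: "set bs \<subseteq> carrier M" using bs by (simp add: ordered_basis_def)
  have "coords M bs (bs ! k) = map (%i. if i = k then 1 else 0) [0..<length bs]"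
    using assms s lin_comb_unit[OF s] by (intro coords_unique[OF bs]) auto
  then show ?thesis using assms by simp
qed

text \<open>The values extend through the coordinates. The homomorphism \<open>j\<close> lets
  functionals on a space over a finite field take values in an extension field.\<close>

lemma functional_exists:
  fixes w :: "'o::field vec"
  assumes bs: "ordered_basis M bs" and j: "field_hom j" and w: "w \<in> carrier_vec (length bs)"
  shows "\<exists>u. (\<forall>x\<in>carrier M. \<forall>y\<in>carrier M. u (x \<oplus>\<^bsub>M\<^esub> y) = u x + u y) \<and>
     (\<forall>c. \<forall>x\<in>carrier M. u (c \<odot>\<^bsub>M\<^esub> x) = j c * u x) \<and> (\<forall>i<length bs. u (bs ! i) = w $ i)"
proof -
  interpret j: field_hom j by (rule j)
  define u where "u = (%x. \<Sum>i<length bs. j (coords M bs x ! i) * w $ i)"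
  have "u (bs ! k) = w $ k" if "k < length bs" for k
  proof -
    have "u (bs ! k) = (\<Sum>i<length bs. if i = k then w $ i else 0)"
      unfolding u_def using that coords_basis[OF bs that] by (intro sum.cong) auto
    then show ?thesis using that by simp
  qed
  then show ?thesis
    by (intro exI[of _ u])
       (auto simp: u_def coords_add[OF bs] coords_smult[OF bs] algebra_simps j.hom_add j.hom_mult sum.distrib sum_distrib_left)
qed

end

section \<open>Formal sums and functionals on the tensor product\<close>

text \<open>The homomorphism that the universal property of the free abelian group attaches to
  \<open>f\<close>.\<close>

definition frag_eval :: "('i => 'o::comm_ring_1) => ('i \<Rightarrow>\<^sub>0 int) => 'o" where
  "frag_eval f w = (\<Sum>i\<in>Poly_Mapping.keys w. of_int (Poly_Mapping.lookup w i) * f i)"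

lemma frag_eval_superset:
  assumes "finite A" "Poly_Mapping.keys w \<subseteq> A"
  shows "frag_eval f w = (\<Sum>i\<in>A. of_int (Poly_Mapping.lookup w i) * f i)"
  unfolding frag_eval_def using assms by (intro sum.mono_neutral_left) (auto simp: in_keys_iff)

lemma frag_eval_zero [simp]: "frag_eval f 0 = 0"
  by (simp add: frag_eval_def)

lemma frag_eval_of [simp]: "frag_eval f (frag_of a) = f a"
  by (simp add: frag_eval_def)

lemma frag_eval_diff: "frag_eval f (a - b) = frag_eval f a - frag_eval f b"
proof -
  let ?A = "Poly_Mapping.keys a \<union> Poly_Mapping.keys b"
  have "Poly_Mapping.keys (a - b) \<subseteq> ?A" by (rule keys_diff)
  then have "frag_eval f (a - b) = (\<Sum>i\<in>?A. of_int (Poly_Mapping.lookup (a - b) i) * f i)"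
    by (intro frag_eval_superset) auto
  also have "\<dots> = (\<Sum>i\<in>?A. of_int (Poly_Mapping.lookup a i) * f i) - (\<Sum>i\<in>?A. of_int (Poly_Mapping.lookup b i) * f i)"
    by (simp add: lookup_minus algebra_simps flip: sum_subtractf)
  also have "\<dots> = frag_eval f a - frag_eval f b"
    by (subst (1 2) frag_eval_superset[of ?A]) auto
  finally show ?thesis .
qed

lemma frag_eval_minus: "frag_eval f (- a) = - frag_eval f a"
  using frag_eval_diff[of f 0 a] by simp

lemma frag_eval_add: "frag_eval f (a + b) = frag_eval f a + frag_eval f b"
  using frag_eval_diff[of f a "- b"] frag_eval_minus[of f b] by simp

locale tensor_setup = A: vector_record A + M: abelian_group M
  for A :: "('f::field, 'x) module" and M :: "('d, 'm) module" +
  fixes R :: "'r set" and ra :: "'x => 'r => 'x" and la :: "'r => 'm => 'm"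
  assumes ra_closed: "!!x r. x \<in> carrier A ==> r \<in> R ==> ra x r \<in> carrier A"
    and la_closed: "!!m r. m \<in> carrier M ==> r \<in> R ==> la r m \<in> carrier M"
    and ra_smult: "!!c x r. x \<in> carrier A ==> r \<in> R ==> c \<odot>\<^bsub>A\<^esub> ra x r = ra (c \<odot>\<^bsub>A\<^esub> x) r"
    and finA: "finite (carrier A)" and finM: "finite (carrier M)"
begin

definition "Sp = carrier A \<times> carrier M"
definition "Z = free_Abelian_group Sp"
definition "rels = tensor_rels R A ra M la"
definition "N = generate Z rels"
definition "T = tensor_group R A ra M la"
definition "TM = tensor_module R A ra M la"
definition "cls w = N #>\<^bsub>Z\<^esub> w"
definition "pure x m = cls (frag_of (x, m))"

sublocale Zg: comm_group Z
  unfolding Z_def by (rule abelian_free_Abelian_group)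

lemma carrier_Z: "w \<in> carrier Z \<longleftrightarrow> Poly_Mapping.keys w \<subseteq> Sp"
  by (simp add: Z_def)

lemma Z_simps [simp]: "a \<otimes>\<^bsub>Z\<^esub> b = a + b" "\<one>\<^bsub>Z\<^esub> = 0"
  by (simp_all add: Z_def)

lemma Z_inv: "a \<in> carrier Z ==> inv\<^bsub>Z\<^esub> a = - a"
  by (simp add: Z_def)

lemma Z_diff: "a \<in> carrier Z ==> b \<in> carrier Z ==> a - b \<in> carrier Z"
  using Zg.m_closed[of a "inv\<^bsub>Z\<^esub> b"] Zg.inv_closed[of b] by (simp add: Z_inv)

lemma frag_of_Z: "x \<in> carrier A ==> m \<in> carrier M ==> frag_of (x, m) \<in> carrier Z"
  by (simp add: Z_def Sp_def)

lemma rels_cases: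
  assumes "w \<in> rels"
  obtains x y m where "x \<in> carrier A" "y \<in> carrier A" "m \<in> carrier M"
      "w = frag_of (x \<oplus>\<^bsub>A\<^esub> y, m) - frag_of (x, m) - frag_of (y, m)"
    | x m m' where "x \<in> carrier A" "m \<in> carrier M" "m' \<in> carrier M"
      "w = frag_of (x, m \<oplus>\<^bsub>M\<^esub> m') - frag_of (x, m) - frag_of (x, m')"
    | x r m where "x \<in> carrier A" "r \<in> R" "m \<in> carrier M" "w = frag_of (ra x r, m) - frag_of (x, la r m)"
  using assms unfolding rels_def tensor_rels_def
  by (elim UnE CollectE exE conjE) (rule that; assumption)+

lemma relsI:
  "x \<in> carrier A ==> y \<in> carrier A ==> m \<in> carrier M ==>
      frag_of (x \<oplus>\<^bsub>A\<^esub> y, m) - frag_of (x, m) - frag_of (y, m) \<in> rels"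
  "x \<in> carrier A ==> m \<in> carrier M ==> m' \<in> carrier M ==>
      frag_of (x, m \<oplus>\<^bsub>M\<^esub> m') - frag_of (x, m) - frag_of (x, m') \<in> rels"
  "x \<in> carrier A ==> r \<in> R ==> m \<in> carrier M ==> frag_of (ra x r, m) - frag_of (x, la r m) \<in> rels"
  unfolding rels_def tensor_rels_def by blast+

lemma rels_Z: "rels \<subseteq> carrier Z"
proof
  fix w assume "w \<in> rels"
  then show "w \<in> carrier Z"
  proof (cases rule: rels_cases)
    case (1 x y m)
    show ?thesis unfolding 1(4) by (intro Z_diff frag_of_Z A.a_closed 1(1-3))
  next
    case (2 x m m')
    show ?thesis unfolding 2(4) by (intro Z_diff frag_of_Z M.a_closed 2(1-3))
  next
    case (3 x r m)
    show ?thesis unfolding 3(4) by (intro Z_diff frag_of_Z ra_closed la_closed 3(1-3))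
  qed
qed

lemma N_subgroup: "subgroup N Z"
  unfolding N_def by (rule Zg.generate_is_subgroup[OF rels_Z])

lemma N_Z: "N \<subseteq> carrier Z" using N_subgroup by (rule subgroup.subset)

lemma N_zero: "0 \<in> N" using subgroup.one_closed[OF N_subgroup] by simp

lemma N_add: "a \<in> N ==> b \<in> N ==> a + b \<in> N" using subgroup.m_closed[OF N_subgroup, of a b] by simp

lemma N_minus: "a \<in> N ==> - a \<in> N"
  using subgroup.m_inv_closed[OF N_subgroup, of a] Z_inv[of a] N_Z by auto

lemma N_diff: "a \<in> N ==> b \<in> N ==> a - b \<in> N" using N_add[of a "- b"] N_minus[of b] by simp

lemma rels_N: "rels \<subseteq> N" unfolding N_def by (auto intro: generate.incl)

lemma N_induct [consumes 1]:
  assumes "w \<in> N" "!!w. w \<in> rels ==> P w" "P 0" "!!a. P a ==> P (- a)" "!!a b. P a ==> P b ==> P (a + b)"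
  shows "P w"
  using assms(1) unfolding N_def
proof (induction rule: generate.induct)
  case (inv h)
  then show ?case using assms(2,4) rels_Z Z_inv[of h] by auto
qed (use assms in auto)

lemma cls_eq: "cls w = (%n. n + w) ` N"
  by (auto simp: cls_def r_coset_def)

lemma in_cls: "v \<in> cls w \<longleftrightarrow> v - w \<in> N"
proof
  assume "v \<in> cls w"
  then obtain n where "n \<in> N" "v = n + w" unfolding cls_eq by (rule imageE)
  then show "v - w \<in> N" by simp
next
  assume "v - w \<in> N"
  then show "v \<in> cls w" unfolding cls_eq by (intro image_eqI[of _ _ "v - w"]) simp_all
qed

lemma cls_self: "w \<in> cls w" by (simp add: in_cls N_zero)

lemma cls_eq_iff: "cls v = cls w \<longleftrightarrow> v - w \<in> N"
proof
  assume vw: "v - w \<in> N"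
  have "u - v \<in> N \<longleftrightarrow> u - w \<in> N" for u
  proof
    assume "u - v \<in> N"
    from N_add[OF this vw] show "u - w \<in> N" by simp
  next
    assume "u - w \<in> N"
    from N_diff[OF this vw] show "u - v \<in> N" by simp
  qed
  then show "cls v = cls w" by (simp add: set_eq_iff in_cls)
next
  assume "cls v = cls w"
  then show "v - w \<in> N" using cls_self[of v] by (simp add: in_cls)
qed

lemma T_def': "T = Z Mod N"
  by (simp add: T_def tensor_group_def Z_def N_def rels_def Sp_def Let_def)

lemma carrier_T: "carrier T = cls ` carrier Z"
  by (auto simp: T_def' FactGroup_def RCOSETS_def cls_def)

lemma T_mult:
  assumes "v \<in> carrier Z" "w \<in> carrier Z"
  shows "cls v \<otimes>\<^bsub>T\<^esub> cls w = cls (v + w)"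
proof -
  have "N \<lhd> Z" using Zg.normal_iff_subgroup N_subgroup by blast
  then have "(N #>\<^bsub>Z\<^esub> v) <#>\<^bsub>Z\<^esub> (N #>\<^bsub>Z\<^esub> w) = N #>\<^bsub>Z\<^esub> (v \<otimes>\<^bsub>Z\<^esub> w)"
    using assms by (rule normal.rcos_sum)
  then show ?thesis by (simp add: T_def' FactGroup_def cls_def)
qed

lemma T_one: "\<one>\<^bsub>T\<^esub> = cls 0"
  unfolding cls_eq by (simp add: T_def' FactGroup_def)

lemma T_comm_group: "comm_group T"
  unfolding T_def' by (rule Zg.abelian_FactGroup[OF N_subgroup])

lemma TM_simps:
  "carrier TM = carrier T" "\<zero>\<^bsub>TM\<^esub> = cls 0" "(\<oplus>\<^bsub>TM\<^esub>) = (\<otimes>\<^bsub>T\<^esub>)"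
  "c \<odot>\<^bsub>TM\<^esub> q = tensor_map R A ra M la (%x. c \<odot>\<^bsub>A\<^esub> x) id q"
  using T_one by (simp_all add: TM_def tensor_module_def T_def Let_def mk_module_def)

lemma TM_cls: "w \<in> carrier Z ==> cls w \<in> carrier TM"
  by (simp add: TM_simps carrier_T)

lemma TM_add: "v \<in> carrier Z ==> w \<in> carrier Z ==> cls v \<oplus>\<^bsub>TM\<^esub> cls w = cls (v + w)"
  by (simp add: TM_simps T_mult)

lemma TM_cases:
  assumes "q \<in> carrier TM"
  obtains w where "w \<in> carrier Z" "q = cls w"
  using assms by (auto simp: TM_simps carrier_T)

lemma TM_abelian: "abelian_group TM"
proof -
  interpret T: comm_group T by (rule T_comm_group)
  show ?thesis
    by (rule abelian_groupI)
       (simp_all add: TM_simps T_one[symmetric] T.m_ac T.l_inv_ex)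
qed

definition ext :: "('x => 'x) => ('m => 'm) => ('x \<times> 'm \<Rightarrow>\<^sub>0 int) => ('x \<times> 'm \<Rightarrow>\<^sub>0 int)" where
  "ext u v = frag_extend (%(x, m). frag_of (u x, v m))"

definition A_hom :: "('x => 'x) => bool" where
  "A_hom u \<longleftrightarrow> (\<forall>x\<in>carrier A. u x \<in> carrier A) \<and>
     (\<forall>x\<in>carrier A. \<forall>y\<in>carrier A. u (x \<oplus>\<^bsub>A\<^esub> y) = u x \<oplus>\<^bsub>A\<^esub> u y) \<and>
     (\<forall>x\<in>carrier A. \<forall>r\<in>R. u (ra x r) = ra (u x) r)"

definition M_hom :: "('m => 'm) => bool" where
  "M_hom v \<longleftrightarrow> (\<forall>x\<in>carrier M. v x \<in> carrier M) \<and>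
     (\<forall>x\<in>carrier M. \<forall>y\<in>carrier M. v (x \<oplus>\<^bsub>M\<^esub> y) = v x \<oplus>\<^bsub>M\<^esub> v y) \<and>
     (\<forall>x\<in>carrier M. \<forall>r\<in>R. v (la r x) = la r (v x))"

lemma A_hom_id: "A_hom id" and M_hom_id: "M_hom id"
  by (auto simp: A_hom_def M_hom_def)

lemma A_hom_smult: "A_hom (%x. c \<odot>\<^bsub>A\<^esub> x)"
  by (auto simp: A_hom_def A.smult_closed A.smult_r_distr ra_smult)

lemma ext_Z:
  assumes "A_hom u" "M_hom v" "w \<in> carrier Z"
  shows "ext u v w \<in> carrier Z"
proof -
  have "Poly_Mapping.keys w \<subseteq> Sp" using assms carrier_Z by blast
  then show ?thesis
  proof (induction rule: frag_induction)
    case (diff a b)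
    then show ?case using Z_diff[of "ext u v a" "ext u v b"] by (simp add: ext_def frag_extend_diff)
  next
    case zero
    show ?case using Zg.one_closed by (simp add: ext_def del: Zg.one_closed)
  next
    case (one x)
    then show ?case using assms by (auto simp: ext_def Sp_def A_hom_def M_hom_def frag_of_Z)
  qed
qed

lemma ext_N:
  assumes u: "A_hom u" and v: "M_hom v" and w: "w \<in> N"
  shows "ext u v w \<in> N"
  using w
proof (induction rule: N_induct)
  fix w assume "w \<in> rels"
  then show "ext u v w \<in> N"
  proof (cases rule: rels_cases)
    case (1 x y m)
    then have "ext u v w = frag_of (u x \<oplus>\<^bsub>A\<^esub> u y, v m) - frag_of (u x, v m) - frag_of (u y, v m)"
      using u by (simp add: ext_def frag_extend_diff A_hom_def)
    then show ?thesis using 1 u v relsI(1)[of "u x" "u y" "v m"] rels_N by (auto simp: A_hom_def M_hom_def)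
  next
    case (2 x m m')
    then have "ext u v w = frag_of (u x, v m \<oplus>\<^bsub>M\<^esub> v m') - frag_of (u x, v m) - frag_of (u x, v m')"
      using v by (simp add: ext_def frag_extend_diff M_hom_def)
    then show ?thesis using 2 u v relsI(2)[of "u x" "v m" "v m'"] rels_N by (auto simp: A_hom_def M_hom_def)
  next
    case (3 x r m)
    then have "ext u v w = frag_of (ra (u x) r, v m) - frag_of (u x, la r (v m))"
      using u v by (simp add: ext_def frag_extend_diff A_hom_def M_hom_def)
    then show ?thesis using 3 u v relsI(3)[of "u x" r "v m"] rels_N by (auto simp: A_hom_def M_hom_def)
  qed
qed (auto simp: ext_def N_zero N_add N_minus frag_extend_add frag_extend_minus)

text \<open>\<open>tensor_map\<close> is a union over the representatives of a coset. The union
  collapses because \<open>ext u v\<close> maps the subgroup of relations into itself, so that all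
  representatives give the same coset.\<close>

lemma tensor_map_cls:
  assumes u: "A_hom u" and v: "M_hom v"
  shows "tensor_map R A ra M la u v (cls w) = cls (ext u v w)"
proof -
  have "tensor_map R A ra M la u v (cls w) = (\<Union>w'\<in>cls w. cls (ext u v w'))"
    by (simp add: tensor_map_def ext_def cls_def Z_def N_def rels_def Sp_def Let_def)
  also have "\<dots> = (\<Union>w'\<in>cls w. cls (ext u v w))"
  proof (rule SUP_cong[OF refl])
    fix w' assume "w' \<in> cls w"
    then have "ext u v (w' - w) \<in> N" by (intro ext_N[OF u v]) (simp only: in_cls)
    then show "cls (ext u v w') = cls (ext u v w)"
      by (simp only: cls_eq_iff ext_def frag_extend_diff)
  qed
  also have "\<dots> = cls (ext u v w)"
  proof -
    have "cls w ~= {}" using cls_self[of w] by (metis empty_iff)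
    then show ?thesis by (simp only: UN_constant if_False)
  qed
  finally show ?thesis .
qed

lemma smult_cls: "c \<odot>\<^bsub>TM\<^esub> cls w = cls (ext (%x. c \<odot>\<^bsub>A\<^esub> x) id w)"
  by (simp add: TM_simps tensor_map_cls A_hom_smult M_hom_id)

lemma smult_pure: "c \<odot>\<^bsub>TM\<^esub> pure x m = pure (c \<odot>\<^bsub>A\<^esub> x) m"
  by (simp add: smult_cls pure_def ext_def)

lemma pure_TM: "x \<in> carrier A ==> m \<in> carrier M ==> pure x m \<in> carrier TM"
  unfolding pure_def by (intro TM_cls frag_of_Z)

lemma pure_add_left:
  assumes "x \<in> carrier A" "y \<in> carrier A" "m \<in> carrier M"
  shows "pure (x \<oplus>\<^bsub>A\<^esub> y) m = pure x m \<oplus>\<^bsub>TM\<^esub> pure y m"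
  unfolding pure_def using assms relsI(1)[OF assms] rels_N
  by (subst TM_add) (auto simp: frag_of_Z cls_eq_iff algebra_simps)

lemma pure_add_right:
  assumes "x \<in> carrier A" "m \<in> carrier M" "m' \<in> carrier M"
  shows "pure x (m \<oplus>\<^bsub>M\<^esub> m') = pure x m \<oplus>\<^bsub>TM\<^esub> pure x m'"
  unfolding pure_def using assms relsI(2)[OF assms] rels_N
  by (subst TM_add) (auto simp: frag_of_Z cls_eq_iff algebra_simps)

lemma pure_balanced:
  assumes "x \<in> carrier A" "r \<in> R" "m \<in> carrier M"
  shows "pure (ra x r) m = pure x (la r m)"
  unfolding pure_def using relsI(3)[OF assms] rels_N by (auto simp: cls_eq_iff)

text \<open>Elements of the tensor module are differences of sums of pure tensors.\<close>

lemma TM_induct: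
  assumes q: "q \<in> carrier TM"
    and zero: "P \<zero>\<^bsub>TM\<^esub>"
    and pure: "!!x m. x \<in> carrier A ==> m \<in> carrier M ==> P (pure x m)"
    and diff: "!!p q. p \<in> carrier TM ==> q \<in> carrier TM ==> P p ==> P q ==> P (p \<ominus>\<^bsub>TM\<^esub> q)"
  shows "P q"
proof -
  interpret TMg: abelian_group TM by (rule TM_abelian)
  obtain w where w: "w \<in> carrier Z" "q = cls w" using q by (rule TM_cases)
  have "Poly_Mapping.keys w \<subseteq> Sp" using w carrier_Z by blast
  then have "w \<in> carrier Z \<and> P (cls w)"
  proof (induction rule: frag_induction)
    case zero
    show ?case using assms(2) Zg.one_closed by (simp add: TM_simps del: Zg.one_closed)
  next
    case (one z)
    then show ?case using pure by (auto simp: Sp_def pure_def frag_of_Z)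
  next
    case (diff a b)
    then have Z: "a \<in> carrier Z" "b \<in> carrier Z" "a - b \<in> carrier Z" by (auto intro: Z_diff)
    have "cls a = cls (a - b) \<oplus>\<^bsub>TM\<^esub> cls b" using Z by (simp add: TM_add)
    then have "cls a \<ominus>\<^bsub>TM\<^esub> cls b = cls (a - b)"
      using Z TM_cls by (simp add: TMg.minus_eq TMg.a_assoc TMg.r_neg)
    then show ?case using diff assms(4)[of "cls a" "cls b"] Z TM_cls by auto
  qed
  then show ?thesis using w by simp
qed

lemma TM_vector_record: "vector_record TM"
proof -
  interpret TMg: abelian_group TM by (rule TM_abelian)
  have cl: "c \<odot>\<^bsub>TM\<^esub> q \<in> carrier TM" if q: "q \<in> carrier TM" for c q
  proof -
    obtain w where w: "w \<in> carrier Z" "q = cls w" using q by (rule TM_cases)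
    show ?thesis unfolding w(2) smult_cls by (intro TM_cls ext_Z A_hom_smult M_hom_id w(1))
  qed
  have rd: "c \<odot>\<^bsub>TM\<^esub> (p \<oplus>\<^bsub>TM\<^esub> q) = c \<odot>\<^bsub>TM\<^esub> p \<oplus>\<^bsub>TM\<^esub> c \<odot>\<^bsub>TM\<^esub> q"
    if p: "p \<in> carrier TM" and q: "q \<in> carrier TM" for c p q
  proof -
    obtain v w where vw: "v \<in> carrier Z" "p = cls v" "w \<in> carrier Z" "q = cls w"
      using p q by (metis TM_cases)
    have "ext (%x. c \<odot>\<^bsub>A\<^esub> x) id (v + w) = ext (%x. c \<odot>\<^bsub>A\<^esub> x) id v + ext (%x. c \<odot>\<^bsub>A\<^esub> x) id w"
      by (simp add: ext_def frag_extend_add)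
    then show ?thesis
      unfolding vw(2,4) TM_add[OF vw(1,3)] smult_cls
      by (subst TM_add) (auto intro!: ext_Z A_hom_smult M_hom_id vw)
  qed
  \<comment> \<open>\<open>TM_induct\<close> builds tensors by differences, so compatibility with
    differences is what carries the remaining laws over from pure tensors, where they are the laws
    of \<open>A\<close>.\<close>
  have rdiff: "c \<odot>\<^bsub>TM\<^esub> (p \<ominus>\<^bsub>TM\<^esub> q) = c \<odot>\<^bsub>TM\<^esub> p \<ominus>\<^bsub>TM\<^esub> c \<odot>\<^bsub>TM\<^esub> q"
    if p: "p \<in> carrier TM" and q: "q \<in> carrier TM" for c p q
  proof -
    have "c \<odot>\<^bsub>TM\<^esub> p = c \<odot>\<^bsub>TM\<^esub> (p \<ominus>\<^bsub>TM\<^esub> q) \<oplus>\<^bsub>TM\<^esub> c \<odot>\<^bsub>TM\<^esub> q"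
      using rd[of "p \<ominus>\<^bsub>TM\<^esub> q" q c] p q by (simp add: TMg.minus_eq TMg.a_assoc TMg.l_neg)
    then show ?thesis using p q cl by (simp add: TMg.minus_eq TMg.a_assoc TMg.r_neg)
  qed
  have zr: "c \<odot>\<^bsub>TM\<^esub> \<zero>\<^bsub>TM\<^esub> = \<zero>\<^bsub>TM\<^esub>" for c
    using rdiff[of "\<zero>\<^bsub>TM\<^esub>" "\<zero>\<^bsub>TM\<^esub>" c] cl[of "\<zero>\<^bsub>TM\<^esub>" c]
    by (simp add: TMg.minus_eq TMg.r_neg)
  show ?thesis
  proof
    fix c d q assume q: "q \<in> carrier TM"
    show "(c + d) \<odot>\<^bsub>TM\<^esub> q = c \<odot>\<^bsub>TM\<^esub> q \<oplus>\<^bsub>TM\<^esub> d \<odot>\<^bsub>TM\<^esub> q"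
      using q
    proof (rule TM_induct)
      fix p q assume pq: "p \<in> carrier TM" "q \<in> carrier TM"
        "(c + d) \<odot>\<^bsub>TM\<^esub> p = c \<odot>\<^bsub>TM\<^esub> p \<oplus>\<^bsub>TM\<^esub> d \<odot>\<^bsub>TM\<^esub> p" "(c + d) \<odot>\<^bsub>TM\<^esub> q = c \<odot>\<^bsub>TM\<^esub> q \<oplus>\<^bsub>TM\<^esub> d \<odot>\<^bsub>TM\<^esub> q"
      then show "(c + d) \<odot>\<^bsub>TM\<^esub> (p \<ominus>\<^bsub>TM\<^esub> q) = c \<odot>\<^bsub>TM\<^esub> (p \<ominus>\<^bsub>TM\<^esub> q) \<oplus>\<^bsub>TM\<^esub> d \<odot>\<^bsub>TM\<^esub> (p \<ominus>\<^bsub>TM\<^esub> q)"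
        unfolding rdiff[OF pq(1,2)] pq(3,4)
        by (simp add: pq(1,2) cl TMg.minus_eq TMg.minus_add TMg.a_ac)
    qed (simp_all add: zr smult_pure A.smult_l_distr pure_add_left A.smult_closed)
    show "c \<odot>\<^bsub>TM\<^esub> (d \<odot>\<^bsub>TM\<^esub> q) = (c * d) \<odot>\<^bsub>TM\<^esub> q"
      using q by (rule TM_induct) (simp_all add: zr smult_pure A.smult_assoc A.smult_closed rdiff cl)
    show "1 \<odot>\<^bsub>TM\<^esub> q = q"
      using q by (rule TM_induct) (simp_all add: zr smult_pure A.smult_one rdiff cl)
  qed (use cl rd TM_abelian in auto)
qed

sublocale TMv: vector_record TM by (rule TM_vector_record)

text \<open>Both carriers are finite, so all pure tensors fit into one list. Differences are covered
  because the scalar -1 acts as negation.\<close>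

lemma TM_spanning: "\<exists>bs. TMv.spanning bs"
proof -
  obtain ps where ps: "set ps = carrier A \<times> carrier M" using finA finM finite_list[of "carrier A \<times> carrier M"] by auto
  define bs where "bs = map (%(x, m). pure x m) ps"
  have bs: "set bs \<subseteq> carrier TM" using ps pure_TM by (auto simp: bs_def)
  have "\<exists>cs. length cs = length bs \<and> lin_comb TM cs bs = q" if q: "q \<in> carrier TM" for q
    using q
  proof (rule TM_induct)
    have "lin_comb TM (replicate (length bs) 0) bs = \<zero>\<^bsub>TM\<^esub>"
      unfolding lin_comb_def using bs by (intro TMv.add.finprod_one_eqI) (auto intro!: TMv.smult_zero)
    then show "\<exists>cs. length cs = length bs \<and> lin_comb TM cs bs = \<zero>\<^bsub>TM\<^esub>"
      by (intro exI[of _ "replicate (length bs) 0"]) simp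
  next
    fix x m assume "x \<in> carrier A" "m \<in> carrier M"
    then have "pure x m \<in> set bs" using ps by (force simp: bs_def)
    then obtain k where k: "k < length bs" "bs ! k = pure x m" by (auto simp: in_set_conv_nth)
    show "\<exists>cs. length cs = length bs \<and> lin_comb TM cs bs = pure x m"
      using TMv.lin_comb_unit[OF bs k(1)] k
      by (intro exI[of _ "map (%i. if i = k then 1 else 0) [0..<length bs]"]) simp
  next
    fix p q assume "p \<in> carrier TM" "q \<in> carrier TM"
      "\<exists>cs. length cs = length bs \<and> lin_comb TM cs bs = p" "\<exists>cs. length cs = length bs \<and> lin_comb TM cs bs = q"
    then obtain cs ds where cd: "length cs = length bs" "lin_comb TM cs bs = p" "length ds = length bs" "lin_comb TM ds bs = q"
      by blast
    have "(-1) \<odot>\<^bsub>TM\<^esub> q = \<ominus>\<^bsub>TM\<^esub> q"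
    proof (rule TMv.minus_equality[symmetric])
      have "(-1 + 1) \<odot>\<^bsub>TM\<^esub> q = (-1) \<odot>\<^bsub>TM\<^esub> q \<oplus>\<^bsub>TM\<^esub> 1 \<odot>\<^bsub>TM\<^esub> q"
        using \<open>q \<in> carrier TM\<close> by (rule TMv.smult_l_distr)
      then show "(-1) \<odot>\<^bsub>TM\<^esub> q \<oplus>\<^bsub>TM\<^esub> q = \<zero>\<^bsub>TM\<^esub>"
        using \<open>q \<in> carrier TM\<close> by (simp add: TMv.smult_zero TMv.smult_one)
    qed (use \<open>q \<in> carrier TM\<close> TMv.smult_closed in auto)
    then have "lin_comb TM (map2 (+) cs (map ((*) (-1)) ds)) bs = p \<ominus>\<^bsub>TM\<^esub> q"
      using TMv.lin_comb_add[OF bs cd(1), of "map ((*) (-1)) ds"] TMv.lin_comb_smult[OF bs cd(3), of "-1"] cd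
      by (simp add: TMv.minus_eq)
    then show "\<exists>cs. length cs = length bs \<and> lin_comb TM cs bs = p \<ominus>\<^bsub>TM\<^esub> q"
      using cd by (intro exI[of _ "map2 (+) cs (map ((*) (-1)) ds)"]) simp
  qed
  then show ?thesis using bs by (auto simp: TMv.spanning_def)
qed

lemma TM_basis: "ordered_basis TM TMv.some_basis"
  unfolding TMv.some_basis_def using TM_spanning TMv.ordered_basis_exists by (metis someI_ex)

text \<open>Functionals on the tensor product, twisted along \<open>j\<close>, seen through its
  universal property as balanced biadditive maps. The value 0 outside \<open>Sp\<close> makes the
  function representing a functional unique.\<close>

definition Bal :: "('f => 'o::field) => ('x \<times> 'm => 'o) set" where
  "Bal j = {\<beta>. (\<forall>x\<in>carrier A. \<forall>y\<in>carrier A. \<forall>m\<in>carrier M. \<beta> (x \<oplus>\<^bsub>A\<^esub> y, m) = \<beta> (x, m) + \<beta> (y, m)) \<and>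
     (\<forall>x\<in>carrier A. \<forall>m\<in>carrier M. \<forall>m'\<in>carrier M. \<beta> (x, m \<oplus>\<^bsub>M\<^esub> m') = \<beta> (x, m) + \<beta> (x, m')) \<and>
     (\<forall>x\<in>carrier A. \<forall>r\<in>R. \<forall>m\<in>carrier M. \<beta> (ra x r, m) = \<beta> (x, la r m)) \<and>
     (\<forall>c. \<forall>x\<in>carrier A. \<forall>m\<in>carrier M. \<beta> (c \<odot>\<^bsub>A\<^esub> x, m) = j c * \<beta> (x, m)) \<and>
     (\<forall>p. p \<notin> Sp \<longrightarrow> \<beta> p = 0)}"

text \<open>The functional induced on cosets. The chosen representative does not matter for elements
  of \<open>Bal\<close>, since these kill the relations (\<open>frag_eval_N\<close>).\<close>

definition hat :: "('x \<times> 'm => 'o::field) => ('x \<times> 'm \<Rightarrow>\<^sub>0 int) set => 'o" where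
  "hat \<beta> q = frag_eval \<beta> (SOME w. w \<in> q)"

lemma frag_eval_N:
  assumes \<beta>: "\<beta> \<in> Bal j" and w: "w \<in> N"
  shows "frag_eval \<beta> w = 0"
  using w
proof (induction rule: N_induct)
  fix w assume "w \<in> rels"
  then show "frag_eval \<beta> w = 0"
    by (cases rule: rels_cases) (use \<beta> in \<open>simp_all add: Bal_def frag_eval_diff\<close>)
qed (simp_all add: frag_eval_add frag_eval_minus)

lemma hat_cls:
  assumes "\<beta> \<in> Bal j"
  shows "hat \<beta> (cls w) = frag_eval \<beta> w"
proof -
  have "(SOME v. v \<in> cls w) \<in> cls w" using cls_self someI_ex[of "%v. v \<in> cls w"] by blast
  then have "frag_eval \<beta> ((SOME v. v \<in> cls w) - w) = 0" using frag_eval_N[OF assms] by (simp add: in_cls)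
  then show ?thesis by (simp add: hat_def frag_eval_diff)
qed

lemma hat_pure: "\<beta> \<in> Bal j ==> hat \<beta> (pure x m) = \<beta> (x, m)"
  by (simp add: pure_def hat_cls)

lemma hat_add:
  assumes "\<beta> \<in> Bal j" "p \<in> carrier TM" "q \<in> carrier TM"
  shows "hat \<beta> (p \<oplus>\<^bsub>TM\<^esub> q) = hat \<beta> p + hat \<beta> q"
proof -
  obtain v w where vw: "v \<in> carrier Z" "p = cls v" "w \<in> carrier Z" "q = cls w"
    using assms(2,3) by (metis TM_cases)
  show ?thesis unfolding vw(2,4) TM_add[OF vw(1,3)] hat_cls[OF assms(1)] by (rule frag_eval_add)
qed

lemma additive_diff:
  fixes u :: "_ => 'o::field"
  assumes "!!p q. p \<in> carrier TM ==> q \<in> carrier TM ==> u (p \<oplus>\<^bsub>TM\<^esub> q) = u p + u q"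
    and "p \<in> carrier TM" "q \<in> carrier TM"
  shows "u (p \<ominus>\<^bsub>TM\<^esub> q) = u p - u q"
proof -
  have "u ((p \<ominus>\<^bsub>TM\<^esub> q) \<oplus>\<^bsub>TM\<^esub> q) = u (p \<ominus>\<^bsub>TM\<^esub> q) + u q" using assms(2,3) by (intro assms(1)) auto
  then show ?thesis using assms(2,3) by (simp add: TMv.minus_eq TMv.a_assoc TMv.l_neg)
qed

lemma additive_eqI:
  fixes u v :: "_ => 'o::field"
  assumes u: "!!p q. p \<in> carrier TM ==> q \<in> carrier TM ==> u (p \<oplus>\<^bsub>TM\<^esub> q) = u p + u q"
    and v: "!!p q. p \<in> carrier TM ==> q \<in> carrier TM ==> v (p \<oplus>\<^bsub>TM\<^esub> q) = v p + v q"
    and eq: "!!x m. x \<in> carrier A ==> m \<in> carrier M ==> u (pure x m) = v (pure x m)"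
    and q: "q \<in> carrier TM"
  shows "u q = v q"
  using q
proof (rule TM_induct)
  have "u \<zero>\<^bsub>TM\<^esub> = 0" using TMv.additive_zero[of u] u by blast
  moreover have "v \<zero>\<^bsub>TM\<^esub> = 0" using TMv.additive_zero[of v] v by blast
  ultimately show "u \<zero>\<^bsub>TM\<^esub> = v \<zero>\<^bsub>TM\<^esub>" by simp
qed (auto simp: eq additive_diff[of u, OF u] additive_diff[of v, OF v])

lemma hat_smult:
  assumes "field_hom j" "\<beta> \<in> Bal j" "q \<in> carrier TM"
  shows "hat \<beta> (c \<odot>\<^bsub>TM\<^esub> q) = j c * hat \<beta> q"
  by (rule additive_eqI[OF _ _ _ assms(3)])
     (use assms hat_add[OF assms(2)] in \<open>auto simp: TMv.smult_r_distr TMv.smult_closed distrib_left smult_pure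
        hat_pure[OF assms(2)] Bal_def\<close>)

lemma Bal_outside:
  assumes "\<beta> \<in> Bal j" "p \<notin> Sp"
  shows "\<beta> p = 0"
proof -
  have "\<forall>p. p \<notin> Sp \<longrightarrow> \<beta> p = 0"
    using assms(1) unfolding Bal_def mem_Collect_eq by (elim conjE)
  then show ?thesis using assms(2) by blast
qed

lemma Bal_ext:
  fixes \<beta> \<gamma> :: "'x \<times> 'm => 'o::field"
  assumes "\<beta> \<in> Bal j" "\<gamma> \<in> Bal j" "!!x m. x \<in> carrier A ==> m \<in> carrier M ==> \<beta> (x, m) = \<gamma> (x, m)"
  shows "\<beta> = \<gamma>"
proof
  fix p show "\<beta> p = \<gamma> p"
  proof (cases "p \<in> Sp")
    case True
    then obtain x m where "x \<in> carrier A" "m \<in> carrier M" "p = (x, m)" by (auto simp: Sp_def)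
    then show ?thesis using assms(3) by simp
  next
    case False
    show ?thesis by (simp only: Bal_outside[OF assms(1) False] Bal_outside[OF assms(2) False])
  qed
qed

text \<open>Coordinates with respect to the dual of the chosen basis.\<close>

definition kap :: "('x \<times> 'm => 'o::field) => 'o vec" where
  "kap \<beta> = vec (length TMv.some_basis) (%i. hat \<beta> (TMv.some_basis ! i))"

lemma some_basis_carrier: "i < length TMv.some_basis ==> TMv.some_basis ! i \<in> carrier TM"
  using TM_basis by (auto simp: ordered_basis_def)

lemma Bal_add: "\<beta> \<in> Bal j ==> \<gamma> \<in> Bal j ==> (%y. \<beta> y + \<gamma> y) \<in> Bal j"
  unfolding Bal_def by (auto simp: algebra_simps)

lemma Bal_scale: "\<beta> \<in> Bal j ==> (%y. c * \<beta> y) \<in> Bal j"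
  unfolding Bal_def by (auto simp: algebra_simps)

lemma frag_eval_add_fun: "frag_eval (%y. \<beta> y + \<gamma> y) w = frag_eval \<beta> w + frag_eval \<gamma> w"
  by (simp add: frag_eval_def algebra_simps sum.distrib)

lemma frag_eval_scale_fun: "frag_eval (%y. c * \<beta> y) w = c * frag_eval \<beta> w"
  by (simp add: frag_eval_def algebra_simps sum_distrib_left)

text \<open>A functional is determined by its values on a basis. Conversely, prescribed values
  define a functional on the tensor product, and its restriction to pure tensors is
  balanced.\<close>

lemma kap_bij:
  fixes j :: "'f => 'o::field"
  assumes j: "field_hom j"
  shows "bij_betw kap (Bal j) (carrier_vec (length TMv.some_basis))"
  unfolding bij_betw_def
proof
  let ?bs = "TMv.some_basis"
  show "inj_on kap (Bal j)"
  proof (rule inj_onI)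
    fix \<beta> \<gamma> assume b: "\<beta> \<in> Bal j" "\<gamma> \<in> Bal j" "kap \<beta> = kap \<gamma>"
    have eqb: "hat \<beta> (?bs ! i) = hat \<gamma> (?bs ! i)" if "i < length ?bs" for i
      using b(3) that by (metis index_vec kap_def)
    have s: "set ?bs \<subseteq> carrier TM" using TM_basis by (simp add: ordered_basis_def)
    have "hat \<beta> q = hat \<gamma> q" if q: "q \<in> carrier TM" for q
    proof -
      have "hat \<beta> (lin_comb TM (coords TM ?bs q) ?bs) = hat \<gamma> (lin_comb TM (coords TM ?bs q) ?bs)"
        using TMv.functional_lin_comb[of "hat \<beta>" j, OF hat_add[OF b(1)] hat_smult[OF j b(1)] s]
          TMv.functional_lin_comb[of "hat \<gamma>" j, OF hat_add[OF b(2)] hat_smult[OF j b(2)] s] eqb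
        by simp
      then show ?thesis using TMv.coords(2)[OF TM_basis q] by simp
    qed
    then show "\<beta> = \<gamma>" using pure_TM hat_pure[OF b(1)] hat_pure[OF b(2)] by (intro Bal_ext[OF b(1,2)]) metis
  qed
  show "kap ` Bal j = carrier_vec (length ?bs)"
  proof
    show "carrier_vec (length ?bs) \<subseteq> kap ` Bal j"
    proof
      fix w :: "'o vec" assume w: "w \<in> carrier_vec (length ?bs)"
      obtain u where u: "!!x y. x \<in> carrier TM ==> y \<in> carrier TM ==> u (x \<oplus>\<^bsub>TM\<^esub> y) = u x + u y"
        "!!c x. x \<in> carrier TM ==> u (c \<odot>\<^bsub>TM\<^esub> x) = j c * u x" "!!i. i < length ?bs ==> u (?bs ! i) = w $ i"
        using TMv.functional_exists[OF TM_basis j w] by blast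
      define \<beta> where "\<beta> = (%p. if p \<in> Sp then u (pure (fst p) (snd p)) else 0)"
      have \<beta>: "\<beta> \<in> Bal j"
        unfolding Bal_def \<beta>_def
        using u(1,2) pure_TM
        by (auto simp: Sp_def pure_add_left pure_add_right pure_balanced ra_closed la_closed A.smult_closed simp flip: smult_pure)
      have hp: "hat \<beta> (pure x m) = u (pure x m)" if "x \<in> carrier A" "m \<in> carrier M" for x m
        unfolding hat_pure[OF \<beta>] using that by (simp add: \<beta>_def Sp_def)
      have hq: "hat \<beta> q = u q" if "q \<in> carrier TM" for q
        by (rule additive_eqI[OF hat_add[OF \<beta>] u(1) hp that])
      have "kap \<beta> = w" unfolding kap_def using w by (intro eq_vecI) (simp_all add: hq[OF some_basis_carrier] u(3))
      then show "w \<in> kap ` Bal j" using \<beta> by blast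
    qed
  qed (auto simp: kap_def)
qed

lemma coord_iso_kap:
  assumes j: "field_hom j"
  shows "coord_iso (Bal j) kap (length TMv.some_basis)"
  unfolding coord_iso_def
proof (intro conjI ballI allI)
  fix \<beta> \<gamma> assume b: "\<beta> \<in> Bal j" "\<gamma> \<in> Bal j"
  show "(%y. \<beta> y + \<gamma> y) \<in> Bal j" by (rule Bal_add[OF b])
  show "kap (%y. \<beta> y + \<gamma> y) = kap \<beta> + kap \<gamma>"
    by (rule eq_vecI) (auto simp: kap_def hat_def frag_eval_add_fun)
next
  fix c \<beta> assume b: "\<beta> \<in> Bal j"
  show "(%y. c * \<beta> y) \<in> Bal j" by (rule Bal_scale[OF b])
  show "kap (%y. c * \<beta> y) = c \<cdot>\<^sub>v kap \<beta>"
    by (rule eq_vecI) (auto simp: kap_def hat_def frag_eval_scale_fun)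
qed (rule kap_bij[OF j])

definition pull :: "('m => 'm) => ('x \<times> 'm => 'o::field) => ('x \<times> 'm => 'o)" where
  "pull t \<beta> = (%(x, m). if (x, m) \<in> Sp then \<beta> (x, t m) else 0)"

lemma pull_Bal: "M_hom t ==> \<beta> \<in> Bal j ==> pull t \<beta> \<in> Bal j"
  unfolding Bal_def pull_def M_hom_def Sp_def by (auto simp: ra_closed la_closed A.smult_closed)

lemma endo_mat_carrier:
  "endo_mat TM f \<in> carrier_mat (length TMv.some_basis) (length TMv.some_basis)"
  by (simp add: TMv.endo_mat_eq)

text \<open>In dual coordinates, precomposition with an endomorphism has the transposed matrix.
  Determinants do not notice the transposition, so the characteristic polynomial on the tensor
  module can be computed on \<open>Bal\<close>.\<close>

lemma kap_pull:
  fixes j :: "'f => 'o::field"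
  assumes j: "field_hom j" and t: "M_hom t" and \<beta>: "\<beta> \<in> Bal j"
  shows "kap (pull t \<beta>) = transpose_mat (map_mat j (endo_mat TM (tensor_map R A ra M la id t))) *\<^sub>v kap \<beta>"
proof -
  let ?bs = "TMv.some_basis" and ?\<tau> = "tensor_map R A ra M la id t"
  have s: "set ?bs \<subseteq> carrier TM" using TM_basis by (simp add: ordered_basis_def)
  have \<tau>c: "?\<tau> q \<in> carrier TM" if q: "q \<in> carrier TM" for q
  proof -
    obtain w where w: "w \<in> carrier Z" "q = cls w" using q by (rule TM_cases)
    show ?thesis unfolding w(2) tensor_map_cls[OF A_hom_id t] by (intro TM_cls ext_Z A_hom_id t w(1))
  qed
  have \<tau>a: "?\<tau> (p \<oplus>\<^bsub>TM\<^esub> q) = ?\<tau> p \<oplus>\<^bsub>TM\<^esub> ?\<tau> q" if pq: "p \<in> carrier TM" "q \<in> carrier TM" for p q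
  proof -
    obtain v w where vw: "v \<in> carrier Z" "p = cls v" "w \<in> carrier Z" "q = cls w"
      using pq by (metis TM_cases)
    have "ext id t (v + w) = ext id t v + ext id t w" by (simp add: ext_def frag_extend_add)
    then show ?thesis
      unfolding vw(2,4) TM_add[OF vw(1,3)] tensor_map_cls[OF A_hom_id t]
      by (subst TM_add) (auto intro!: ext_Z A_hom_id t vw)
  qed
  have hat\<tau>: "hat \<beta> (?\<tau> (p \<oplus>\<^bsub>TM\<^esub> q)) = hat \<beta> (?\<tau> p) + hat \<beta> (?\<tau> q)"
    if pq: "p \<in> carrier TM" "q \<in> carrier TM" for p q
    unfolding \<tau>a[OF pq] by (rule hat_add[OF \<beta> \<tau>c[OF pq(1)] \<tau>c[OF pq(2)]])
  have eq: "hat (pull t \<beta>) q = hat \<beta> (?\<tau> q)" if q: "q \<in> carrier TM" for q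
  proof (rule additive_eqI[OF hat_add[OF pull_Bal[OF t \<beta>]] hat\<tau> _ q])
    fix x m assume "x \<in> carrier A" "m \<in> carrier M"
    then show "hat (pull t \<beta>) (pure x m) = hat \<beta> (?\<tau> (pure x m))"
      using hat_pure[OF pull_Bal[OF t \<beta>]]
      by (simp add: pure_def tensor_map_cls[OF A_hom_id t] hat_cls[OF \<beta>] hat_cls[OF pull_Bal[OF t \<beta>]])
         (simp add: ext_def pull_def Sp_def)
  qed
  show ?thesis
  proof (rule eq_vecI)
    fix i assume "i < dim_vec (transpose_mat (map_mat j (endo_mat TM ?\<tau>)) *\<^sub>v kap \<beta>)"
    then have i: "i < length ?bs" by (simp add: TMv.endo_mat_eq)
    have "hat \<beta> (?\<tau> (?bs ! i)) = hat \<beta> (lin_comb TM (coords TM ?bs (?\<tau> (?bs ! i))) ?bs)"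
      using TMv.coords(2)[OF TM_basis \<tau>c[OF some_basis_carrier[OF i]]] by simp
    also have "\<dots> = (\<Sum>k<length ?bs. j (coords TM ?bs (?\<tau> (?bs ! i)) ! k) * hat \<beta> (?bs ! k))"
      by (rule TMv.functional_lin_comb[of "hat \<beta>" j, OF hat_add[OF \<beta>] hat_smult[OF j \<beta>] s])
    finally show "kap (pull t \<beta>) $ i = (transpose_mat (map_mat j (endo_mat TM ?\<tau>)) *\<^sub>v kap \<beta>) $ i"
      using i eq[OF some_basis_carrier[OF i]]
      by (simp add: kap_def TMv.endo_mat_eq scalar_prod_def lessThan_atLeast0)
  qed (simp add: kap_def TMv.endo_mat_eq)
qed

end

section \<open>Subrings and ideals inside a ring type\<close>

text \<open>Subsets of a ring type instead of ring records, so that the arithmetic of the type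
  applies directly; \<open>ideal_int_ring_iff\<close> translates between the two views.\<close>

definition subrng :: "'a::comm_ring_1 set => bool" where
  "subrng S \<longleftrightarrow> 0 \<in> S \<and> 1 \<in> S \<and> (\<forall>x\<in>S. \<forall>y\<in>S. x + y \<in> S \<and> x * y \<in> S) \<and> (\<forall>x\<in>S. - x \<in> S)"

definition idl :: "'a::comm_ring_1 set => 'a set => bool" where
  "idl I S \<longleftrightarrow> I \<subseteq> S \<and> 0 \<in> I \<and> (\<forall>x\<in>I. \<forall>y\<in>I. x + y \<in> I) \<and> (\<forall>x\<in>S. \<forall>y\<in>I. x * y \<in> I)"

lemma subrngD:
  assumes "subrng S"
  shows "0 \<in> S" "1 \<in> S" "x \<in> S ==> y \<in> S ==> x + y \<in> S" "x \<in> S ==> y \<in> S ==> x * y \<in> S"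
    "x \<in> S ==> - x \<in> S" "x \<in> S ==> y \<in> S ==> x - y \<in> S"
proof -
  show "x \<in> S ==> y \<in> S ==> x - y \<in> S"
    using assms unfolding subrng_def by (metis diff_conv_add_uminus)
qed (use assms in \<open>simp_all add: subrng_def\<close>)

lemma subrng_power: "subrng S ==> x \<in> S ==> x ^ n \<in> S"
  by (induction n) (simp_all add: subrngD)

lemma subrng_sum: "subrng S ==> (!!i. i \<in> A ==> f i \<in> S) ==> (\<Sum>i\<in>A. f i) \<in> S"
  by (induction A rule: infinite_finite_induct) (simp_all add: subrngD)

lemma subrng_prod: "subrng S ==> (!!i. i \<in> A ==> f i \<in> S) ==> (\<Prod>i\<in>A. f i) \<in> S"
  by (induction A rule: infinite_finite_induct) (simp_all add: subrngD)

lemma idlD: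
  assumes "idl I S" "subrng S"
  shows "0 \<in> I" "x \<in> I ==> x \<in> S" "x \<in> I ==> y \<in> I ==> x + y \<in> I" "x \<in> S ==> y \<in> I ==> x * y \<in> I"
    "x \<in> I ==> y \<in> S ==> x * y \<in> I" "x \<in> I ==> - x \<in> I" "x \<in> I ==> y \<in> I ==> x - y \<in> I"
proof -
  have neg: "- x \<in> I" if "x \<in> I" for x
  proof -
    have "(- 1) * x \<in> I" using assms that subrngD(2,5)[OF assms(2)] unfolding idl_def by blast
    then show ?thesis by simp
  qed
  show "x \<in> I ==> - x \<in> I" by (rule neg)
  show "x \<in> I ==> y \<in> I ==> x - y \<in> I"
    using neg[of y] assms(1) unfolding idl_def diff_conv_add_uminus by blast
  show "x \<in> I ==> y \<in> S ==> x * y \<in> I" using assms(1) unfolding idl_def by (metis mult.commute)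
qed (use assms(1) in \<open>auto simp: idl_def\<close>)

lemma idl_sum: "idl I S ==> (!!i. i \<in> A ==> f i \<in> I) ==> (\<Sum>i\<in>A. f i) \<in> I"
  by (induction A rule: infinite_finite_induct) (simp_all add: idl_def)

section \<open>Integral elements\<close>

text \<open>The determinant trick: \<open>v\<close>, nonzero because of its entry at 0, is an
  eigenvector with eigenvalue \<open>x\<close> of a matrix over the base ring, so \<open>x\<close>
  is a root of the monic characteristic polynomial.\<close>

lemma integral_over_lattice:
  fixes h :: "'a::comm_ring_1 => 'b::field" and m :: nat
  assumes h: "comm_ring_hom h" and m: "0 < m" "v 0 ~= 0"
    and ex: "!!k. k < m ==> \<exists>c. x * v k = (\<Sum>l<m. h (c l) * v l)"
  shows "integral_over h x"
proof -
  interpret h: comm_ring_hom h by (rule h)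
  obtain c where c: "!!k. k < m ==> x * v k = (\<Sum>l<m. h (c k l) * v l)" using ex by metis
  define A where "A = mat m m (%(k, l). c k l)"
  have A: "A \<in> carrier_mat m m" by (simp add: A_def)
  have "eigenvector (map_mat h A) (vec m v) x"
    unfolding eigenvector_def
  proof (intro conjI)
    show "vec m v ~= 0\<^sub>v (dim_row (map_mat h A))"
    proof
      assume e: "vec m v = 0\<^sub>v (dim_row (map_mat h A))"
      have "vec m v $ 0 = 0" unfolding e using m A by simp
      then show False using m by simp
    qed
    show "map_mat h A *\<^sub>v vec m v = x \<cdot>\<^sub>v vec m v"
      by (rule eq_vecI) (simp_all add: A_def c scalar_prod_def lessThan_atLeast0)
  qed (simp add: A_def)
  then have "eigenvalue (map_mat h A) x" unfolding eigenvalue_def by blast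
  then have "poly (char_poly (map_mat h A)) x = 0"
    using eigenvalue_root_char_poly[of "map_mat h A" m x] A by simp
  then have "poly (map_poly h (char_poly A)) x = 0" using h.char_poly_hom[OF A] by simp
  moreover have "lead_coeff (char_poly A) = 1" using degree_monic_char_poly[OF A] by simp
  ultimately show ?thesis unfolding integral_over_def by blast
qed

lemma integral_over_relation:
  fixes h :: "'a::comm_ring_1 => 'b::field"
  assumes h: "comm_ring_hom h" and x: "integral_over h x"
  obtains r c where "0 < r" "x ^ r = (\<Sum>i<r. h (c i) * x ^ i)"
proof -
  interpret h: comm_ring_hom h by (rule h)
  obtain p where p: "lead_coeff p = 1" "poly (map_poly h p) x = 0" using x unfolding integral_over_def by blast
  have d: "degree (map_poly h p) = degree p"
    by (rule map_poly_degree_eq) (simp add: p(1))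
  have "0 = (\<Sum>i\<le>degree p. h (coeff p i) * x ^ i)"
    using p(2) by (simp add: poly_altdef d)
  also have "\<dots> = (\<Sum>i<degree p. h (coeff p i) * x ^ i) + x ^ degree p"
    using p(1) by (simp add: lessThan_Suc_atMost[symmetric])
  finally have e: "x ^ degree p = (\<Sum>i<degree p. h (- coeff p i) * x ^ i)"
    by (simp add: h.hom_uminus sum_negf eq_neg_iff_add_eq_0 add.commute)
  have "0 < degree p"
  proof (rule ccontr)
    assume "\<not> 0 < degree p"
    then show False using e by simp
  qed
  then show ?thesis by (rule that[OF _ e])
qed

text \<open>The products of powers of \<open>x\<close> below \<open>r\<close> and of
  \<open>y\<close> below \<open>s\<close> span a lattice that is stable under multiplication by
  \<open>x\<close> and by \<open>y\<close>, hence by their sum and product.\<close>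

lemma integral_over_add_mult:
  fixes h :: "'a::comm_ring_1 => 'b::field"
  assumes h: "comm_ring_hom h" and x: "integral_over h x" and y: "integral_over h y"
  shows "integral_over h (x + y)" and "integral_over h (x * y)"
proof -
  interpret h: comm_ring_hom h by (rule h)
  obtain r c where r: "0 < r" "x ^ r = (\<Sum>i<r. h (c i) * x ^ i)" using integral_over_relation[OF h x] .
  obtain s d where s: "0 < s" "y ^ s = (\<Sum>i<s. h (d i) * y ^ i)" using integral_over_relation[OF h y] .
  \<comment> \<open>The monomials are numbered by k = i s + j. Number 0 is the monomial 1, which
    supplies the nonzero entry required by \<open>integral_over_lattice\<close>.\<close>
  define v where "v = (%k. x ^ (k div s) * y ^ (k mod s))"
  define Sp where "Sp = {u. \<exists>c. u = (\<Sum>l<r * s. h (c l) * v l)}"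
  have rs: "0 < r * s" using r s by simp
  have v0: "v 0 ~= 0" by (simp add: v_def)
  have Sp0: "0 \<in> Sp" unfolding Sp_def by (auto intro!: exI[of _ "%_. 0"])
  have Spa: "a + b \<in> Sp" if ab: "a \<in> Sp" "b \<in> Sp" for a b
  proof -
    obtain e f where "a = (\<Sum>l<r * s. h (e l) * v l)" "b = (\<Sum>l<r * s. h (f l) * v l)" using ab unfolding Sp_def by blast
    then have "a + b = (\<Sum>l<r * s. h (e l + f l) * v l)" by (simp add: h.hom_add algebra_simps sum.distrib)
    then show ?thesis unfolding Sp_def mem_Collect_eq by (intro exI[of _ "%l. e l + f l"])
  qed
  have Sph: "h e * a \<in> Sp" if a: "a \<in> Sp" for a e
  proof -
    obtain f where "a = (\<Sum>l<r * s. h (f l) * v l)" using a unfolding Sp_def by blast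
    then have "h e * a = (\<Sum>l<r * s. h (e * f l) * v l)" by (simp add: h.hom_mult algebra_simps sum_distrib_left)
    then show ?thesis unfolding Sp_def mem_Collect_eq by (intro exI[of _ "%l. e * f l"])
  qed
  have Sps: "(\<Sum>i\<in>A. f i) \<in> Sp" if "!!i. i \<in> A ==> f i \<in> Sp" for A :: "nat set" and f
    using that by (induction A rule: infinite_finite_induct) (simp_all add: Sp0 Spa)
  have Spv: "v k \<in> Sp" if "k < r * s" for k
  proof -
    have "v k = (\<Sum>l<r * s. if l = k then v l else 0)" using that by simp
    also have "\<dots> = (\<Sum>l<r * s. h (if l = k then 1 else 0) * v l)" by (rule sum.cong) simp_all
    finally show ?thesis unfolding Sp_def mem_Collect_eq by (intro exI[of _ "%l. if l = k then 1 else 0"])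
  qed
  have mon: "x ^ i * y ^ j \<in> Sp" if "i < r" "j < s" for i j
  proof -
    have "i * s + j < Suc i * s" using that by simp
    also have "\<dots> \<le> r * s" using that by (intro mult_le_mono1) simp
    finally have "i * s + j < r * s" .
    moreover have "v (i * s + j) = x ^ i * y ^ j" using that by (simp add: v_def)
    ultimately show ?thesis using Spv by metis
  qed
  have xs: "x ^ i * y ^ j \<in> Sp" if "i \<le> r" "j < s" for i j
  proof (cases "i = r")
    case True
    have "x ^ r * y ^ j = (\<Sum>k<r. h (c k) * (x ^ k * y ^ j))"
      unfolding r(2) sum_distrib_right by (simp add: algebra_simps)
    then show ?thesis unfolding True using that by (simp only:, intro Sps Sph mon) simp_all
  qed (use that mon in auto)
  have ys: "x ^ i * y ^ j \<in> Sp" if "i < r" "j \<le> s" for i j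
  proof (cases "j = s")
    case True
    have "x ^ i * y ^ s = (\<Sum>k<s. h (d k) * (x ^ i * y ^ k))"
      unfolding s(2) sum_distrib_left by (simp add: algebra_simps)
    then show ?thesis unfolding True using that by (simp only:, intro Sps Sph mon) simp_all
  qed (use that mon in auto)
  have dm: "k div s < r" "k mod s < s" if "k < r * s" for k
    using that s(1) by (auto simp: less_mult_imp_div_less)
  have xv: "x * v k \<in> Sp" if "k < r * s" for k
    using xs[of "Suc (k div s)" "k mod s"] dm[OF that] by (simp add: v_def algebra_simps)
  have yv: "y * v k \<in> Sp" if "k < r * s" for k
    using ys[of "k div s" "Suc (k mod s)"] dm[OF that] by (simp add: v_def algebra_simps)
  have mulS: "z * a \<in> Sp" if z: "!!k. k < r * s ==> z * v k \<in> Sp" and a: "a \<in> Sp" for z a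
  proof -
    obtain f where "a = (\<Sum>l<r * s. h (f l) * v l)" using a unfolding Sp_def by blast
    then have "z * a = (\<Sum>l<r * s. h (f l) * (z * v l))" by (simp add: sum_distrib_left algebra_simps)
    then show ?thesis using z by (simp only:, intro Sps Sph) simp_all
  qed
  have *: "integral_over h z" if z: "!!k. k < r * s ==> z * v k \<in> Sp" for z
  proof (rule integral_over_lattice[where v = v and m = "r * s", OF h rs v0])
    fix k assume "k < r * s"
    from z[OF this] show "\<exists>c. z * v k = (\<Sum>l<r * s. h (c l) * v l)" unfolding Sp_def by simp
  qed
  show "integral_over h (x + y)" by (rule *) (simp add: distrib_right xv yv Spa)
  show "integral_over h (x * y)" by (rule *) (simp add: mult.assoc mulS[of x] xv yv)
qed

lemma integral_over_const:
  assumes "comm_ring_hom h" shows "integral_over h (h c)"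
proof -
  interpret h: comm_ring_hom h by (rule assms)
  have "poly (map_poly h [:- c, 1:]) (h c) = 0"
    by (subst map_poly_pCons) (simp_all add: h.hom_uminus)
  then show ?thesis unfolding integral_over_def by (intro exI[of _ "[:- c, 1:]"]) simp
qed

lemma subrng_integral:
  fixes h :: "'a::comm_ring_1 => 'b::field"
  assumes h: "comm_ring_hom h" shows "subrng {x. integral_over h x}"
proof -
  interpret h: comm_ring_hom h by (rule h)
  have "integral_over h (- x)" if "integral_over h x" for x
    using integral_over_add_mult(2)[OF h integral_over_const[OF h, of "- 1"] that] by (simp add: h.hom_uminus)
  then show ?thesis
    using integral_over_const[OF h, of 0] integral_over_const[OF h, of 1] integral_over_add_mult[OF h]
    by (simp add: subrng_def)
qed

lemma poly_emb_hom:
  fixes h :: "'k::field poly fract => 'b::field"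
  assumes "field_hom h" shows "comm_ring_hom (poly_emb h)"
proof -
  interpret h: field_hom h by (rule assms)
  show ?thesis unfolding poly_emb_def
    by unfold_locales (simp_all add: Zero_fract_def[symmetric] One_fract_def[symmetric]
       flip: h.hom_add h.hom_mult)
qed

lemma poly_emb_eq_0:
  fixes h :: "'k::field poly fract => 'b::field"
  assumes "field_hom h" shows "poly_emb h p = 0 \<longleftrightarrow> p = 0"
proof -
  interpret h: field_hom h by (rule assms)
  have "poly_emb h p = 0 \<longleftrightarrow> Fraction_Field.Fract p 1 = 0" by (simp add: poly_emb_def)
  then show ?thesis by (simp add: Zero_fract_def eq_fract)
qed

abbreviation int_set :: "('k::field poly fract => 'b::field) => 'b set" where
  "int_set h \<equiv> {x. integral_over (poly_emb h) x}"

lemma subrng_int_set: "field_hom h ==> subrng (int_set h)"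
  by (intro subrng_integral poly_emb_hom)

lemma poly_emb_int_set: "field_hom h ==> poly_emb h p \<in> int_set h"
  using integral_over_const[OF poly_emb_hom] by simp

text \<open>Clearing denominators in an integral equation for 1/z would express 1 as a polynomial in
  t without constant term. This is what prevents the zero ideal from being maximal.\<close>

lemma inverse_t_not_integral:
  fixes h :: "'k::field poly fract => 'b::field"
  assumes h: "field_hom h"
  shows "inverse (poly_emb h [:0, 1:]) \<notin> int_set h"
proof
  interpret e: comm_ring_hom "poly_emb h" by (rule poly_emb_hom[OF h])
  define z where "z = poly_emb h [:0, 1:]"
  have z: "z ~= 0" using poly_emb_eq_0[OF h] by (simp add: z_def)
  assume "inverse (poly_emb h [:0, 1:]) \<in> int_set h"
  then obtain r c where r: "0 < r" "inverse z ^ r = (\<Sum>i<r. poly_emb h (c i) * inverse z ^ i)"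
    using integral_over_relation[OF poly_emb_hom[OF h]] unfolding z_def by blast
  have pw: "z ^ r * inverse z ^ i = z ^ (r - i)" if "i \<le> r" for i
    using z that by (simp add: power_inverse power_diff field_simps)
  have "1 = z ^ r * inverse z ^ r" using z by (simp add: power_inverse)
  also have "\<dots> = (\<Sum>i<r. poly_emb h (c i) * (z ^ r * inverse z ^ i))"
    unfolding r(2) by (simp add: sum_distrib_left algebra_simps)
  also have "\<dots> = (\<Sum>i<r. poly_emb h (c i) * z ^ (r - i))"
    using pw by (intro sum.cong) simp_all
  also have "\<dots> = poly_emb h (\<Sum>i<r. c i * [:0, 1:] ^ (r - i))"
    by (simp add: z_def e.hom_sum e.hom_mult e.hom_power)
  finally have "poly_emb h (1 - (\<Sum>i<r. c i * [:0, 1:] ^ (r - i))) = 0" by (simp add: e.hom_minus)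
  then have "1 = (\<Sum>i<r. c i * [:0, 1:] ^ (r - i))" using poly_emb_eq_0[OF h] by simp
  then have "poly 1 0 = poly (\<Sum>i<r. c i * [:0, 1:] ^ (r - i)) 0" by simp
  also have "\<dots> = 0" unfolding poly_sum by (intro sum.neutral) (simp add: power_0_left)
  finally show False by simp
qed

section \<open>Linear dependence over the rational function field\<close>

text \<open>Relations are indexed by positions, so a repeated entry is itself a relation; an
  injective family longer than a finite spanning set is dependent.\<close>

lemma finite_ext_dependent:
  fixes h :: "'a::field => 'b::field"
  assumes "finite_ext h"
  shows "\<exists>N. \<forall>m>N. \<forall>x :: nat => 'b. \<exists>c. (\<exists>i<m. c i ~= 0) \<and> (\<Sum>i<m. h (c i) * x i) = 0"
proof -
  interpret h: field_hom h using assms by (simp add: finite_ext_def)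
  interpret v: vector_space "%c x. h c * x"
    by unfold_locales (simp_all add: algebra_simps h.hom_add h.hom_mult)
  obtain B where B: "finite B" "v.span B = UNIV" using assms by (auto simp: finite_ext_def)
  have "\<exists>c. (\<exists>i<m. c i ~= 0) \<and> (\<Sum>i<m. h (c i) * x i) = 0" if m: "m > card B" for m and x :: "nat => 'b"
  proof (cases "inj_on x {..<m}")
    case False
    then obtain i j where ij: "i < m" "j < m" "i ~= j" "x i = x j" unfolding inj_on_def by blast
    define c where "c = (%k. if k = i then 1 else if k = j then - 1 else 0 :: 'a)"
    have "(\<Sum>k<m. h (c k) * x k) = (\<Sum>k\<in>{i, j}. h (c k) * x k)"
      using ij by (intro sum.mono_neutral_right) (auto simp: c_def)
    also have "\<dots> = 0" using ij by (simp add: c_def h.hom_uminus)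
    finally show ?thesis using ij by (intro exI[of _ c]) (auto simp: c_def)
  next
    case True
    have "v.dependent (x ` {..<m})"
    proof (rule ccontr)
      assume "v.independent (x ` {..<m})"
      from v.independent_span_bound[OF B(1) this] B(2) True m show False by (simp add: card_image)
    qed
    then obtain u where u: "\<exists>v\<in>x ` {..<m}. u v ~= 0" "(\<Sum>v\<in>x ` {..<m}. h (u v) * v) = 0"
      using v.dependent_finite[of "x ` {..<m}"] by auto
    have "(\<Sum>i<m. h (u (x i)) * x i) = 0" using u(2) True by (simp add: sum.reindex)
    then show ?thesis using u(1) by (intro exI[of _ "%i. u (x i)"]) auto
  qed
  then show ?thesis by blast
qed

lemma poly_dependent:
  fixes h :: "'k::field poly fract => 'b::field" and m :: nat
  assumes h: "field_hom h" and c: "\<exists>i<m. c i ~= 0" "(\<Sum>i<m. h (c i) * x i) = 0"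
  shows "\<exists>d. (\<exists>i<m. d i ~= 0) \<and> (\<Sum>i<m. poly_emb h (d i) * x i) = 0"
proof -
  interpret h: field_hom h by (rule h)
  have "\<exists>p r. r ~= 0 \<and> c i = Fraction_Field.Fract p r" for i
    by (cases "c i") auto
  then obtain p r where pr: "!!i. r i ~= 0" "!!i. c i = Fraction_Field.Fract (p i) (r i)" by metis
  define D where "D = (\<Prod>i<m. r i)"
  define d where "d = (%i. p i * (\<Prod>j\<in>{..<m} - {i}. r j))"
  have D: "D ~= 0" by (simp add: D_def pr(1))
  have e: "Fraction_Field.Fract D 1 * c i = Fraction_Field.Fract (d i) 1" if "i < m" for i
  proof -
    have "D = r i * (\<Prod>j\<in>{..<m} - {i}. r j)" unfolding D_def using that by (intro prod.remove) auto
    then show ?thesis using pr by (simp add: pr(2)[of i] eq_fract d_def algebra_simps)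
  qed
  have "(\<Sum>i<m. poly_emb h (d i) * x i) = h (Fraction_Field.Fract D 1) * (\<Sum>i<m. h (c i) * x i)"
    unfolding sum_distrib_left poly_emb_def
    by (intro sum.cong refl) (simp add: e[symmetric] h.hom_mult mult.assoc)
  moreover have "d i ~= 0" if "i < m" "c i ~= 0" for i
  proof
    assume "d i = 0"
    then have "Fraction_Field.Fract D 1 * c i = 0" using e[OF that(1)] by (simp add: Zero_fract_def)
    moreover have "Fraction_Field.Fract D 1 ~= 0" using D by (simp add: Zero_fract_def eq_fract)
    ultimately show False using that(2) by simp
  qed
  ultimately show ?thesis using c by (intro exI[of _ d]) auto
qed

text \<open>A nonzero combination \<open>d * c + e * p\<close> of least degree divides both
  \<open>c\<close> and \<open>p\<close>. It is then a unit, because \<open>p\<close> is irreducible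
  and does not divide \<open>c\<close>.\<close>

lemma irreducible_poly_bezout:
  fixes p c :: "'k::field poly"
  assumes p: "irreducible p" and c: "\<not> p dvd c"
  shows "\<exists>d. p dvd d * c - 1"
proof -
  define P where "P = (%g. g ~= 0 \<and> (\<exists>d e. g = d * c + e * p))"
  have "c ~= 0" using c by auto
  then have "P c" unfolding P_def by (intro conjI exI[of _ 1] exI[of _ 0]) simp_all
  then obtain g where g: "P g" "!!f. P f ==> degree g \<le> degree f" using ex_has_least_nat[of P c degree] by blast
  then obtain d e where de: "g ~= 0" "g = d * c + e * p" unfolding P_def by blast
  have dv: "g dvd f" if "f = d' * c + e' * p" for f d' e'
  proof (rule ccontr)
    assume "\<not> g dvd f"
    then have ne: "f mod g ~= 0" by (simp add: mod_eq_0_iff_dvd)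
    have "f mod g = (d' - f div g * d) * c + (e' - f div g * e) * p"
      unfolding minus_div_mult_eq_mod[symmetric] using that de(2) by (simp add: algebra_simps)
    then have "P (f mod g)" unfolding P_def using ne by blast
    then have "degree g \<le> degree (f mod g)" by (rule g(2))
    moreover have "degree (f mod g) < degree g \<or> f mod g = 0" using degree_mod_less[OF de(1), of f] by blast
    ultimately show False using ne by simp
  qed
  have gc: "g dvd c" by (rule dv[of _ 1 0]) simp
  have gp: "g dvd p" by (rule dv[of _ 0 1]) simp
  have "g dvd 1"
  proof (rule ccontr)
    assume ng: "\<not> g dvd 1"
    obtain k where k: "p = g * k" using gp by blast
    then have "k dvd 1" using p ng irreducibleD by blast
    then have "p dvd g" using k by (simp add: mult_unit_dvd_iff)
    then show False using gc c dvd_trans by blast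
  qed
  then obtain k where k: "1 = g * k" by blast
  have "(k * d) * c - 1 = - (k * e) * p" using k de(2) by (simp add: algebra_simps)
  then show ?thesis by (intro exI[of _ "k * d"]) simp
qed

text \<open>Finiteness of S/I, expressed by finitely many representatives in \<open>S\<close>, which
  may be congruent to each other.\<close>

definition fin_quot :: "'b::comm_ring_1 set => 'b set => bool" where
  "fin_quot S I \<longleftrightarrow> (\<exists>Y. finite Y \<and> Y \<subseteq> S \<and> (\<forall>x\<in>S. \<exists>y\<in>Y. x - y \<in> I))"

lemma finite_polys_degree_less: "finite {p :: 'k::{field,finite} poly. degree p < n \<or> p = 0}"
proof -
  have "{p :: 'k poly. degree p < n \<or> p = 0} \<subseteq> Poly ` {xs. set xs \<subseteq> UNIV \<and> length xs \<le> n}"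
  proof
    fix p :: "'k poly" assume "p \<in> {p. degree p < n \<or> p = 0}"
    then have "length (coeffs p) \<le> n" by (cases "p = 0") (simp_all add: length_coeffs_degree)
    then show "p \<in> Poly ` {xs. set xs \<subseteq> UNIV \<and> length xs \<le> n}"
      by (intro image_eqI[of _ _ "coeffs p"]) simp_all
  qed
  then show ?thesis
    by (rule finite_subset[OF _ finite_imageI[OF finite_lists_length_le[OF finite]]])
qed

text \<open>A family in the integral closure that is independent modulo \<open>p\<close> is independent over \<open>k(t)\<close>:
  a minimal relation with polynomial coefficients could be divided by \<open>p\<close>.\<close>

lemma fin_quot_irreducible:
  fixes h :: "'k::{field,finite} poly fract => 'b::field"
  assumes fe: "finite_ext h" and p: "irreducible p"
  shows "fin_quot (int_set h) {poly_emb h p * y | y. y \<in> int_set h}"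
proof -
  have h: "field_hom h" using fe by (simp add: finite_ext_def)
  interpret e: comm_ring_hom "poly_emb h" by (rule poly_emb_hom[OF h])
  define S where "S = int_set h"
  have S: "subrng S" unfolding S_def by (rule subrng_int_set[OF h])
  have eS: "poly_emb h f \<in> S" for f unfolding S_def by (rule poly_emb_int_set[OF h])
  define I where "I = {poly_emb h p * y | y. y \<in> S}"
  have p0: "p ~= 0" using p by auto
  have ep0: "poly_emb h p ~= 0" using p0 poly_emb_eq_0[OF h] by simp
  have I: "idl I S"
    unfolding idl_def
  proof (intro conjI ballI)
    show "0 \<in> I" unfolding I_def using subrngD(1)[OF S] by (intro CollectI exI[of _ 0]) simp
    fix x y assume "y \<in> I"
    then obtain u where u: "y = poly_emb h p * u" "u \<in> S" unfolding I_def by blast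
    { assume "x \<in> I"
      then obtain w where w: "x = poly_emb h p * w" "w \<in> S" unfolding I_def by blast
      have "x + y = poly_emb h p * (w + u)" by (simp add: u w algebra_simps)
      then show "x + y \<in> I" unfolding I_def using subrngD(3)[OF S] u w by blast }
    { assume "x \<in> S"
      have "x * y = poly_emb h p * (x * u)" by (simp add: u algebra_simps)
      then show "x * y \<in> I" unfolding I_def using subrngD(4)[OF S \<open>x \<in> S\<close> u(2)] by blast }
  next
    show "I \<subseteq> S" unfolding I_def using subrngD(4)[OF S eS] by blast
  qed
  define ind where "ind = (%m (x :: nat => 'b). (\<forall>i<m. x i \<in> S) \<and>
      (\<forall>c. (\<Sum>i<m. poly_emb h (c i) * x i) \<in> I \<longrightarrow> (\<forall>i<m. p dvd c i)))"
  obtain N where N: "!!m (x :: nat => 'b). m > N ==> \<exists>c. (\<exists>i<m. c i ~= 0) \<and> (\<Sum>i<m. h (c i) * x i) = 0"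
    using finite_ext_dependent[OF fe] by blast
  have bound: "m \<le> N" if ind: "ind m x" for m x
  proof (rule ccontr)
    assume "\<not> m \<le> N"
    then have mN: "m > N" by simp
    obtain c where "\<exists>i<m. c i ~= 0" "(\<Sum>i<m. h (c i) * x i) = 0" using N[OF mN, of x] by blast
    from poly_dependent[OF h this] obtain d i where d: "i < m" "d i ~= 0" "(\<Sum>i<m. poly_emb h (d i) * x i) = 0"
      by blast
    then show False
    proof (induction "degree (d i)" arbitrary: d rule: less_induct)
      case less
      have "(\<Sum>i<m. poly_emb h (d i) * x i) \<in> I" using less.prems(3) idlD(1)[OF I S] by simp
      then have dv: "\<forall>i<m. p dvd d i" using ind unfolding ind_def by blast
      define f where "f = (%i. d i div p)"
      have f: "d i = p * f i" if "i < m" for i using dv that by (simp add: f_def)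
      have "poly_emb h p * (\<Sum>i<m. poly_emb h (f i) * x i) = (\<Sum>i<m. poly_emb h (d i) * x i)"
        unfolding sum_distrib_left by (intro sum.cong refl) (simp add: f e.hom_mult)
      then have s0: "(\<Sum>i<m. poly_emb h (f i) * x i) = 0" using less.prems(3) ep0 by simp
      have f0: "f i ~= 0" using f[OF d(1)] less.prems(2) by auto
      have "degree p > 0"
      proof (rule ccontr)
        assume "\<not> degree p > 0"
        then have "p dvd 1" using p0 by (simp add: is_unit_iff_degree)
        then show False using irreducible_not_unit[OF p] by blast
      qed
      then have "degree (f i) < degree (d i)" using f[OF d(1)] f0 p0 by (simp add: degree_mult_eq)
      from less.hyps[OF this d(1) f0 s0] show False .
    qed
  qed
  define Q where "Q = (%m. \<exists>x. ind m x)"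
  have "Q 0" unfolding Q_def ind_def by simp
  have Qb: "\<forall>y. Q y \<longrightarrow> y \<le> N" unfolding Q_def using bound by blast
  from GreatestI_nat[of Q 0 N, OF \<open>Q 0\<close>] Qb have "Q (GREATEST m. Q m)" by blast
  then obtain m x where m: "m = (GREATEST m. Q m)" and ix: "ind m x" unfolding Q_def by blast
  have max: "\<not> Q (Suc m)" using Greatest_le_nat[of Q "Suc m" N] Qb m by auto
  \<comment> \<open>Candidate representatives: combinations of a maximal independent family with
    coefficients reduced modulo \<open>p\<close>. There are finitely many, the field of constants
    being finite.\<close>
  define Y where "Y = (%c. \<Sum>i<m. poly_emb h (c i) * x i) ` ({..<m} \<rightarrow>\<^sub>E {f. degree f < degree p \<or> f = 0})"
  have xS: "x i \<in> S" if "i < m" for i using ix that unfolding ind_def by blast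
  have "finite Y" unfolding Y_def by (intro finite_imageI finite_PiE finite_polys_degree_less) simp
  moreover have "Y \<subseteq> S" unfolding Y_def using xS by (auto intro!: subrng_sum[OF S] subrngD(4)[OF S] eS)
  moreover have "\<exists>r\<in>Y. y - r \<in> I" if y: "y \<in> S" for y
  proof -
    define x' where "x' = x(m := y)"
    have "\<not> ind (Suc m) x'" using max unfolding Q_def by blast
    moreover have "\<forall>i<Suc m. x' i \<in> S" using xS y by (auto simp: x'_def less_Suc_eq)
    ultimately obtain c i where c: "(\<Sum>i<Suc m. poly_emb h (c i) * x' i) \<in> I" "i < Suc m" "\<not> p dvd c i"
      unfolding ind_def by blast
    have sum: "(\<Sum>i<m. poly_emb h (c i) * x i) + poly_emb h (c m) * y \<in> I"
    proof -
      have "(\<Sum>i<m. poly_emb h (c i) * x' i) = (\<Sum>i<m. poly_emb h (c i) * x i)"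
        by (intro sum.cong) (auto simp: x'_def)
      then show ?thesis using c(1) by (simp add: x'_def)
    qed
    have "\<not> p dvd c m"
    proof
      assume pc: "p dvd c m"
      then obtain k where k: "c m = p * k" by blast
      have "poly_emb h (c m) * y = poly_emb h p * (poly_emb h k * y)" by (simp add: k e.hom_mult)
      then have "poly_emb h (c m) * y \<in> I" unfolding I_def using subrngD(4)[OF S eS y] by blast
      from idlD(7)[OF I S sum this] have "(\<Sum>i<m. poly_emb h (c i) * x i) \<in> I" by simp
      then have "\<forall>i<m. p dvd c i" using ix unfolding ind_def by blast
      then show False using c(2,3) pc by (auto simp: less_Suc_eq)
    qed
    from irreducible_poly_bezout[OF p this] obtain d k where dk: "d * c m - 1 = p * k" by (auto simp: dvd_def)
    \<comment> \<open>With \<open>d\<close> inverse to \<open>c m\<close> modulo \<open>p\<close>,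
      multiplying the new relation by \<open>d\<close> solves it for \<open>y\<close>; these are the
      resulting coefficients, reduced modulo \<open>p\<close>.\<close>
    define g where "g = (\<lambda>i\<in>{..<m}. (- d * c i) mod p)"
    define r where "r = (\<Sum>i<m. poly_emb h (g i) * x i)"
    have "r \<in> Y"
    proof -
      have "g \<in> {..<m} \<rightarrow>\<^sub>E {f. degree f < degree p \<or> f = 0}"
        unfolding g_def restrict_PiE_iff using degree_mod_less[OF p0] by blast
      then show ?thesis unfolding r_def Y_def by (rule imageI)
    qed
    moreover have "y - r \<in> I"
    proof -
      have 1: "poly_emb h d * ((\<Sum>i<m. poly_emb h (c i) * x i) + poly_emb h (c m) * y) \<in> I"
        by (rule idlD(4)[OF I S eS sum])
      have pI: "poly_emb h p * u \<in> I" if "u \<in> S" for u unfolding I_def using that by blast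
      have 2: "(\<Sum>i<m. poly_emb h p * (poly_emb h ((- d * c i) div p) * x i)) \<in> I"
        using xS by (intro idl_sum[OF I] pI subrngD(4)[OF S eS]) simp
      have gi: "poly_emb h (g i) = - poly_emb h d * poly_emb h (c i) - poly_emb h p * poly_emb h ((- d * c i) div p)"
        if "i < m" for i
      proof -
        have "g i = - d * c i - p * ((- d * c i) div p)" using that by (simp only: g_def restrict_apply lessThan_iff if_True minus_mult_div_eq_mod)
        then show ?thesis by (simp add: e.hom_minus e.hom_mult e.hom_uminus)
      qed
      have 3: "r = - poly_emb h d * (\<Sum>i<m. poly_emb h (c i) * x i) - (\<Sum>i<m. poly_emb h p * (poly_emb h ((- d * c i) div p) * x i))"
        unfolding r_def sum_distrib_left sum_subtractf[symmetric]
        by (intro sum.cong refl) (simp add: gi algebra_simps)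
      have 4: "poly_emb h d * poly_emb h (c m) = 1 + poly_emb h p * poly_emb h k"
      proof -
        have "poly_emb h (d * c m) = poly_emb h (1 + p * k)" using dk by (simp add: algebra_simps)
        then show ?thesis by (simp add: e.hom_mult e.hom_add)
      qed
      have "poly_emb h d * ((\<Sum>i<m. poly_emb h (c i) * x i) + poly_emb h (c m) * y) =
          poly_emb h d * (\<Sum>i<m. poly_emb h (c i) * x i) + (poly_emb h d * poly_emb h (c m)) * y"
        by (simp add: algebra_simps)
      then have "y - r = poly_emb h d * ((\<Sum>i<m. poly_emb h (c i) * x i) + poly_emb h (c m) * y)
          + (\<Sum>i<m. poly_emb h p * (poly_emb h ((- d * c i) div p) * x i)) - poly_emb h p * (poly_emb h k * y)"
        unfolding 3 4 by (simp add: algebra_simps)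
      then show ?thesis using idlD(7)[OF I S idlD(3)[OF I S 1 2] pI[OF subrngD(4)[OF S eS y]]] by simp
    qed
    ultimately show ?thesis by blast
  qed
  ultimately show ?thesis unfolding fin_quot_def S_def[symmetric] I_def[symmetric] by blast
qed

section \<open>Maximal ideals of the integral closure\<close>

lemma int_ring_simps [simp]:
  "carrier (int_ring h) = int_set h" "x \<otimes>\<^bsub>int_ring h\<^esub> y = x * y" "\<one>\<^bsub>int_ring h\<^esub> = 1"
  "\<zero>\<^bsub>int_ring h\<^esub> = 0" "x \<oplus>\<^bsub>int_ring h\<^esub> y = x + y"
  by (simp_all add: int_ring_def)

lemma cring_int_ring:
  assumes h: "field_hom h" shows "cring (int_ring h)"
proof -
  note S = subrngD[OF subrng_int_set[OF h]]
  show ?thesis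
  proof (rule cringI)
    show "abelian_group (int_ring h)"
    proof (rule abelian_groupI)
      fix x assume "x \<in> carrier (int_ring h)"
      then show "\<exists>y\<in>carrier (int_ring h). y \<oplus>\<^bsub>int_ring h\<^esub> x = \<zero>\<^bsub>int_ring h\<^esub>"
        using S(5)[of x] by (intro bexI[of _ "- x"]) simp_all
    qed (use S in \<open>simp_all add: algebra_simps\<close>)
    show "Group.comm_monoid (int_ring h)"
      by (rule comm_monoidI) (use S in \<open>simp_all add: algebra_simps\<close>)
  qed (simp add: algebra_simps)
qed

lemma ideal_int_ring_iff:
  assumes h: "field_hom h" shows "ideal I (int_ring h) \<longleftrightarrow> idl I (int_set h)"
proof
  assume I: "ideal I (int_ring h)"
  interpret I: ideal I "int_ring h" by (rule I)
  note ad = I.is_additive_subgroup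
  show "idl I (int_set h)"
    unfolding idl_def
  proof (intro conjI ballI)
    show "I \<subseteq> int_set h" using I.a_subset by simp
    show "0 \<in> I" using additive_subgroup.zero_closed[OF ad] by simp
    show "x + y \<in> I" if "x \<in> I" "y \<in> I" for x y using additive_subgroup.a_closed[OF ad that] by simp
    show "x * y \<in> I" if "x \<in> int_set h" "y \<in> I" for x y using I.I_l_closed[of y x] that by simp
  qed
next
  assume I: "idl I (int_set h)"
  note S = subrng_int_set[OF h] and d = idlD[OF I subrng_int_set[OF h]]
  interpret R: cring "int_ring h" by (rule cring_int_ring[OF h])
  show "ideal I (int_ring h)"
  proof (rule idealI)
    show "Ring.ring (int_ring h)" by unfold_locales
    show "subgroup I (add_monoid (int_ring h))"
    proof (rule R.add.subgroupI)
      show "I \<subseteq> carrier (int_ring h)" using I by (simp add: idl_def)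
      show "I ~= {}" using d(1) by blast
      fix x y assume x: "x \<in> I" and y: "y \<in> I"
      show "x \<oplus>\<^bsub>int_ring h\<^esub> y \<in> I" using d(3)[OF x y] by simp
      have "\<ominus>\<^bsub>int_ring h\<^esub> x = - x"
        by (rule R.minus_equality) (use d(2)[OF x] subrngD(5)[OF S] in simp_all)
      then show "\<ominus>\<^bsub>int_ring h\<^esub> x \<in> I" using d(6)[OF x] by simp
    qed
  qed (use d(4,5) in simp_all)
qed

section \<open>Cosets, quotient rings and prime ideals\<close>

definition coset :: "'b::ab_group_add set => 'b => 'b set" where
  "coset I x = (%i. i + x) ` I"

lemma in_coset: "y \<in> coset I x \<longleftrightarrow> y - x \<in> I"
proof
  assume "y - x \<in> I"
  then show "y \<in> coset I x" unfolding coset_def by (intro image_eqI[of _ _ "y - x"]) simp_all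
qed (auto simp: coset_def)

lemma coset_eq_iff:
  assumes I: "idl I S" "subrng S"
  shows "coset I x = coset I y \<longleftrightarrow> x - y \<in> I"
proof
  assume e: "coset I x = coset I y"
  have "x \<in> coset I x" by (simp add: in_coset idlD(1)[OF I])
  then show "x - y \<in> I" unfolding e by (simp add: in_coset)
next
  assume xy: "x - y \<in> I"
  have "u - x \<in> I \<longleftrightarrow> u - y \<in> I" for u
  proof
    assume "u - x \<in> I" from idlD(3)[OF I this xy] show "u - y \<in> I" by simp
  next
    assume "u - y \<in> I" from idlD(7)[OF I this xy] show "u - x \<in> I" by simp
  qed
  then show "coset I x = coset I y" by (simp add: set_eq_iff in_coset)
qed

context
  fixes h :: "'k::field poly fract => 'b::field" and I
  assumes h: "field_hom h" and I: "idl I (int_set h)"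
begin

lemma a_r_coset_int_ring: "I +>\<^bsub>int_ring h\<^esub> x = coset I x"
  by (auto simp: coset_def a_r_coset_def' int_ring_simps)

lemma Quot_carrier: "carrier (int_ring h Quot I) = coset I ` int_set h"
  by (auto simp: FactRing_def A_RCOSETS_def' a_r_coset_int_ring[unfolded a_r_coset_def'] a_r_coset_int_ring)

lemma Quot_zero: "\<zero>\<^bsub>int_ring h Quot I\<^esub> = coset I 0"
  by (simp add: FactRing_def coset_def)

lemma Quot_one: "\<one>\<^bsub>int_ring h Quot I\<^esub> = coset I 1"
  by (simp add: FactRing_def a_r_coset_int_ring)

lemma Quot_add:
  assumes "x \<in> int_set h" "y \<in> int_set h"
  shows "coset I x \<oplus>\<^bsub>int_ring h Quot I\<^esub> coset I y = coset I (x + y)"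
proof -
  interpret R: cring "int_ring h" by (rule cring_int_ring[OF h])
  interpret J: ideal I "int_ring h" using I by (simp add: ideal_int_ring_iff[OF h])
  show ?thesis
    using J.a_rcos_sum[of x y] assms by (simp add: FactRing_def a_r_coset_int_ring)
qed

lemma Quot_mult:
  assumes "x \<in> int_set h" "y \<in> int_set h"
  shows "coset I x \<otimes>\<^bsub>int_ring h Quot I\<^esub> coset I y = coset I (x * y)"
proof -
  interpret J: ideal I "int_ring h" using I by (simp add: ideal_int_ring_iff[OF h])
  show ?thesis
    using J.rcoset_mult_add[of x y] assms by (simp add: FactRing_def a_r_coset_int_ring)
qed

lemma Quot_pow:
  assumes "x \<in> int_set h"
  shows "coset I x [^]\<^bsub>int_ring h Quot I\<^esub> (n :: nat) = coset I (x ^ n)"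
proof (induction n)
  case 0
  show ?case by (simp add: nat_pow_def Quot_one)
next
  case (Suc n)
  have "coset I x [^]\<^bsub>int_ring h Quot I\<^esub> Suc n = coset I x [^]\<^bsub>int_ring h Quot I\<^esub> n \<otimes>\<^bsub>int_ring h Quot I\<^esub> coset I x"
    by (simp add: nat_pow_def)
  then show ?case
    using Suc Quot_mult[OF subrng_power[OF subrng_int_set[OF h] assms] assms, of n] by (simp add: mult.commute)
qed

lemma quot_emb_coset: "quot_emb h I p = coset I (poly_emb h p)"
  by (simp add: quot_emb_def a_r_coset_int_ring)

lemma Quot_finite:
  assumes "fin_quot (int_set h) I"
  shows "finite (carrier (int_ring h Quot I))"
proof -
  obtain Y where Y: "finite Y" "!!x. x \<in> int_set h ==> \<exists>y\<in>Y. x - y \<in> I"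
    using assms unfolding fin_quot_def by blast
  have "coset I ` int_set h \<subseteq> coset I ` Y"
  proof (rule image_subsetI)
    fix x assume "x \<in> int_set h"
    from Y(2)[OF this] obtain y where "y \<in> Y" "x - y \<in> I" by blast
    then show "coset I x \<in> coset I ` Y" using coset_eq_iff[OF I subrng_int_set[OF h]] by blast
  qed
  then show ?thesis unfolding Quot_carrier using Y(1) by (rule finite_subset[OF _ finite_imageI])
qed

end

lemma fin_quot_mono: "fin_quot S I ==> I \<subseteq> J ==> fin_quot S J"
  unfolding fin_quot_def by (meson subsetD)

definition prime_idl :: "'b::comm_ring_1 set => 'b set => bool" where
  "prime_idl P S \<longleftrightarrow> idl P S \<and> 1 \<notin> P \<and> (\<forall>x\<in>S. \<forall>y\<in>S. x * y \<in> P \<longrightarrow> x \<in> P \<or> y \<in> P)"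

lemma idl_one: "idl I S ==> 1 \<in> I ==> I = S"
  unfolding idl_def by (metis mult.right_neutral subsetI subset_antisym)

lemma primeideal_int_ring:
  assumes h: "field_hom h" and P: "primeideal P (int_ring h)"
  shows "prime_idl P (int_set h)"
proof -
  interpret P: primeideal P "int_ring h" by (rule P)
  have i: "idl P (int_set h)" using ideal_int_ring_iff[OF h] P.ideal_axioms by blast
  have "1 \<notin> P" using idl_one[OF i] P.I_notcarr by auto
  then show ?thesis unfolding prime_idl_def using i P.I_prime by simp
qed

lemma maximalideal_prime_idl:
  assumes h: "field_hom h" and P: "maximalideal P (int_ring h)"
  shows "prime_idl P (int_set h)"
proof -
  interpret R: cring "int_ring h" by (rule cring_int_ring[OF h])
  show ?thesis by (rule primeideal_int_ring[OF h R.maximalideal_prime[OF P]])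
qed

lemma maximalideal_max:
  assumes h: "field_hom h" and P: "maximalideal P (int_ring h)" and J: "idl J (int_set h)" "P \<subseteq> J"
  shows "J = P \<or> 1 \<in> J"
proof -
  interpret P: maximalideal P "int_ring h" by (rule P)
  have "J = P \<or> J = carrier (int_ring h)"
    using J ideal_int_ring_iff[OF h] by (intro P.I_maximal) (auto simp: idl_def)
  then show ?thesis using subrngD(2)[OF subrng_int_set[OF h]] by auto
qed

text \<open>If the ideal were zero, maximality would force the principal ideal of z to be zero or
  everything; but z is nonzero and 1/z is not integral.\<close>

lemma maximalideal_nonzero:
  fixes h :: "'k::field poly fract => 'b::field"
  assumes h: "field_hom h" and P: "maximalideal P (int_ring h)"
  shows "\<exists>x\<in>P. x ~= 0"
proof (rule ccontr)
  assume no: "\<not> (\<exists>x\<in>P. x ~= 0)"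
  note S = subrng_int_set[OF h]
  define z where "z = poly_emb h [:0, 1:]"
  have z: "z \<in> int_set h" "z ~= 0" using poly_emb_int_set[OF h] poly_emb_eq_0[OF h] by (simp_all add: z_def)
  define J where "J = (%u. z * u) ` int_set h"
  have J: "idl J (int_set h)"
    unfolding idl_def
  proof (intro conjI ballI)
    show "J \<subseteq> int_set h" unfolding J_def by (rule image_subsetI) (rule subrngD(4)[OF S z(1)])
    show "0 \<in> J" unfolding J_def using subrngD(1)[OF S] by (intro image_eqI[of _ _ 0]) simp_all
    fix x y assume "y \<in> J"
    then obtain u where u: "y = z * u" "u \<in> int_set h" unfolding J_def by (rule imageE)
    { assume "x \<in> J"
      then obtain w where w: "x = z * w" "w \<in> int_set h" unfolding J_def by (rule imageE)
      show "x + y \<in> J" unfolding J_def u w distrib_left[symmetric]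
        by (rule imageI) (rule subrngD(3)[OF S w(2) u(2)]) }
    { assume x: "x \<in> int_set h"
      have "x * y = z * (x * u)" by (simp add: u)
      then show "x * y \<in> J" unfolding J_def using subrngD(4)[OF S x u(2)] by (rule image_eqI) }
  qed
  have "P \<subseteq> J" using no idlD(1)[OF J S] by auto
  from maximalideal_max[OF h P J this] show False
  proof
    assume "J = P"
    moreover have "z * 1 \<in> J" unfolding J_def by (rule imageI) (rule subrngD(2)[OF S])
    ultimately show False using no z(2) by simp
  next
    assume "1 \<in> J"
    then obtain u where "1 = z * u" "u \<in> int_set h" unfolding J_def by (rule imageE)
    then have "inverse z = u" using z(2) by (simp add: field_simps)
    then show False using inverse_t_not_integral[OF h] \<open>u \<in> int_set h\<close> by (simp add: z_def)
  qed
qed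

text \<open>The constant term of an integral equation for \<open>x\<close> is a multiple of
  \<open>x\<close>, hence lies in \<open>I\<close>. In an equation of least degree it is nonzero,
  since otherwise \<open>x\<close> could be cancelled.\<close>

lemma idl_contains_poly:
  fixes h :: "'k::field poly fract => 'b::field"
  assumes h: "field_hom h" and I: "idl I (int_set h)" and x: "x \<in> I" "x ~= 0"
  shows "\<exists>f. f ~= 0 \<and> poly_emb h f \<in> I"
proof -
  note S = subrng_int_set[OF h]
  interpret e: comm_ring_hom "poly_emb h" by (rule poly_emb_hom[OF h])
  define Q where "Q = (%r. 0 < r \<and> (\<exists>c. x ^ r = (\<Sum>i<r. poly_emb h (c i) * x ^ i)))"
  have "\<exists>r. Q r" unfolding Q_def
    using integral_over_relation[OF poly_emb_hom[OF h], of x] idlD(2)[OF I S x(1)] by blast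
  then obtain r where r: "Q r" "!!s. Q s ==> r \<le> s" using exists_least_iff[of Q] by (meson not_less)
  then obtain c where c: "0 < r" "x ^ r = (\<Sum>i<r. poly_emb h (c i) * x ^ i)" unfolding Q_def by blast
  obtain s where s: "r = Suc s" using c(1) gr0_conv_Suc by blast
  have exp: "x * x ^ s = poly_emb h (c 0) + x * (\<Sum>i<s. poly_emb h (c (Suc i)) * x ^ i)"
    using c(2) unfolding s sum.lessThan_Suc_shift by (simp add: sum_distrib_left algebra_simps)
  have xS: "x \<in> int_set h" using idlD(2)[OF I S x(1)] .
  have "c 0 ~= 0"
  proof
    assume "c 0 = 0"
    then have "x * x ^ s = x * (\<Sum>i<s. poly_emb h (c (Suc i)) * x ^ i)" using exp by simp
    then have e: "x ^ s = (\<Sum>i<s. poly_emb h (c (Suc i)) * x ^ i)" using x(2) by simp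
    have "s ~= 0"
    proof
      assume "s = 0"
      then show False using e by simp
    qed
    then have "Q s" unfolding Q_def using e by (intro conjI exI[of _ "%i. c (Suc i)"]) simp_all
    then show False using r(2)[of s] s by simp
  qed
  moreover have "poly_emb h (c 0) \<in> I"
  proof -
    have "poly_emb h (c 0) = x * (x ^ s - (\<Sum>i<s. poly_emb h (c (Suc i)) * x ^ i))"
      using exp by (simp add: algebra_simps)
    also have "\<dots> \<in> I"
      by (intro idlD(5)[OF I S x(1)] subrngD(6)[OF S] subrng_power[OF S xS] subrng_sum[OF S]
          subrngD(4)[OF S poly_emb_int_set[OF h]])
    finally show ?thesis .
  qed
  ultimately show ?thesis by blast
qed

text \<open>A nonzero polynomial of least degree in the contraction of \<open>P\<close> to k[t] is
  irreducible: as \<open>P\<close> is prime, one factor of a factorization lies in \<open>P\<close>,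
  and by minimality the other is constant.\<close>

lemma prime_idl_min_poly:
  fixes h :: "'k::field poly fract => 'b::field"
  assumes h: "field_hom h" and P: "prime_idl P (int_set h)" and f: "f ~= 0" "poly_emb h f \<in> P"
  obtains p where "irreducible p" "poly_emb h p \<in> P"
    "!!f. f ~= 0 ==> poly_emb h f \<in> P ==> degree p \<le> degree f"
proof -
  note S = subrng_int_set[OF h] and eS = poly_emb_int_set[OF h]
  interpret e: comm_ring_hom "poly_emb h" by (rule poly_emb_hom[OF h])
  have I: "idl P (int_set h)" using P by (simp add: prime_idl_def)
  obtain p where p: "p ~= 0 \<and> poly_emb h p \<in> P" "!!f. f ~= 0 \<and> poly_emb h f \<in> P ==> degree p \<le> degree f"
    using ex_has_least_nat[of "%f. f ~= 0 \<and> poly_emb h f \<in> P" f degree] f by blast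
  have nu: "\<not> u dvd 1" if u: "poly_emb h u \<in> P" for u
  proof
    assume "u dvd 1"
    then obtain v where "1 = u * v" by (rule dvdE)
    then have "1 = poly_emb h u * poly_emb h v" by (metis e.hom_mult e.hom_one)
    then have "1 \<in> P" using idlD(5)[OF I S u eS, of v] by simp
    then show False using P by (simp add: prime_idl_def)
  qed
  have "irreducible p"
  proof (rule Factorial_Ring.irreducibleI)
    fix u v assume uv: "p = u * v"
    have uv0: "u ~= 0" "v ~= 0" using p(1) uv by auto
    have "poly_emb h u * poly_emb h v \<in> P" using p(1) uv by (simp add: e.hom_mult)
    then have "poly_emb h u \<in> P \<or> poly_emb h v \<in> P" using P eS unfolding prime_idl_def by blast
    then show "u dvd 1 \<or> v dvd 1"
    proof
      assume "poly_emb h u \<in> P"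
      then have "degree p \<le> degree u" using p(2) uv0 by blast
      then have "degree v = 0" using uv uv0 by (simp add: degree_mult_eq)
      then show ?thesis using uv0 by (simp add: is_unit_iff_degree)
    next
      assume "poly_emb h v \<in> P"
      then have "degree p \<le> degree v" using p(2) uv0 by blast
      then have "degree u = 0" using uv uv0 by (simp add: degree_mult_eq)
      then show ?thesis using uv0 by (simp add: is_unit_iff_degree)
    qed
  next
    show "p ~= 0" using p(1) by blast
    show "\<not> p dvd 1" using nu p(1) by blast
  qed
  moreover have "poly_emb h p \<in> P" using p(1) by blast
  moreover have "degree p \<le> degree f" if "f ~= 0" "poly_emb h f \<in> P" for f using p(2) that by blast
  ultimately show ?thesis by (rule that)
qed

lemma idl_multiples_subset:
  assumes "idl I S" "x \<in> I"
  shows "{x * y | y. y \<in> S} \<subseteq> I"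
  using assms unfolding idl_def by (auto simp: mult.commute)

lemma fin_quot_idl:
  fixes h :: "'k::{field,finite} poly fract => 'b::field"
  assumes fe: "finite_ext h" and I: "idl I (int_set h)" and p: "irreducible p" "poly_emb h p \<in> I"
  shows "fin_quot (int_set h) I"
  by (rule fin_quot_mono[OF fin_quot_irreducible[OF fe p(1)] idl_multiples_subset[OF I p(2)]])

text \<open>The powers of \<open>t\<close> of exponent less than \<open>degree p\<close> are incongruent modulo the maximal ideal.\<close>

lemma finite_maximal_bounded:
  fixes h :: "'k::{field,finite} poly fract => 'b::field"
  assumes fe: "finite_ext h"
  shows "finite {P \<in> Max_ideals (int_ring h). card (carrier (int_ring h Quot P)) \<le> m}"
proof -
  have h: "field_hom h" using fe by (simp add: finite_ext_def)
  note S = subrng_int_set[OF h]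
  interpret e: comm_ring_hom "poly_emb h" by (rule poly_emb_hom[OF h])
  define D where "D = {p :: 'k poly. degree p < Suc m \<or> p = 0} \<inter> {p. irreducible p}"
  have "finite D" unfolding D_def using finite_polys_degree_less by blast
  define A where "A = (%p. {P \<in> Max_ideals (int_ring h). poly_emb h p \<in> P})"
  \<comment> \<open>An ideal containing \<open>p\<close> is a union of cosets of the principal ideal
    of \<open>p\<close>, so it is determined by the representatives in the finite set
    \<open>Y\<close> that belong to it.\<close>
  have fA: "finite (A p)" if p: "p \<in> D" for p
  proof -
    have irr: "irreducible p" using p by (simp add: D_def)
    obtain Y where Y: "finite Y" "Y \<subseteq> int_set h" "!!x. x \<in> int_set h ==> \<exists>y\<in>Y. x - y \<in> {poly_emb h p * y | y. y \<in> int_set h}"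
      using fin_quot_irreducible[OF fe irr] unfolding fin_quot_def by blast
    have sub: "P \<subseteq> P'" if P: "P \<in> A p" "P' \<in> A p" "P \<inter> Y = P' \<inter> Y" for P P'
    proof
      fix x assume x: "x \<in> P"
      have I: "idl P (int_set h)" "idl P' (int_set h)"
        using P maximalideal_prime_idl[OF h] by (auto simp: A_def Max_ideals_def prime_idl_def)
      obtain y where y: "y \<in> Y" "x - y \<in> {poly_emb h p * y | y. y \<in> int_set h}" using Y(3) idlD(2)[OF I(1) S x] by blast
      have "poly_emb h p \<in> P" "poly_emb h p \<in> P'" using P by (simp_all add: A_def)
      then have xy: "x - y \<in> P" "x - y \<in> P'" using y(2) idl_multiples_subset[OF I(1)] idl_multiples_subset[OF I(2)] by blast+
      have "y \<in> P" using idlD(7)[OF I(1) S x xy(1)] by simp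
      then have "y \<in> P'" using P(3) y(1) by blast
      then show "x \<in> P'" using idlD(3)[OF I(2) S xy(2)] by fastforce
    qed
    have "inj_on (%P. P \<inter> Y) (A p)"
    proof (rule inj_onI)
      fix P P' assume PP: "P \<in> A p" "P' \<in> A p" "P \<inter> Y = P' \<inter> Y"
      show "P = P'" using sub[OF PP] sub[OF PP(2,1) PP(3)[symmetric]] by (rule subset_antisym)
    qed
    moreover have "(%P. P \<inter> Y) ` A p \<subseteq> Pow Y" by blast
    ultimately show ?thesis using Y(1) by (meson finite_Pow_iff inj_on_finite)
  qed
  have "{P \<in> Max_ideals (int_ring h). card (carrier (int_ring h Quot P)) \<le> m} \<subseteq> (\<Union>p\<in>D. A p)"
  proof
    fix P assume "P \<in> {P \<in> Max_ideals (int_ring h). card (carrier (int_ring h Quot P)) \<le> m}"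
    then have PM: "P \<in> Max_ideals (int_ring h)" and P: "maximalideal P (int_ring h)" and c: "card (carrier (int_ring h Quot P)) \<le> m"
      by (simp_all add: Max_ideals_def)
    have pr: "prime_idl P (int_set h)" by (rule maximalideal_prime_idl[OF h P])
    then have I: "idl P (int_set h)" by (simp add: prime_idl_def)
    obtain x where "x \<in> P" "x ~= 0" using maximalideal_nonzero[OF h P] by blast
    then obtain f where "f ~= 0" "poly_emb h f \<in> P" using idl_contains_poly[OF h I] by blast
    from prime_idl_min_poly[OF h pr this]
    obtain p where p: "irreducible p" "poly_emb h p \<in> P" "!!f. f ~= 0 ==> poly_emb h f \<in> P ==> degree p \<le> degree f"
      by blast
    have fin: "finite (carrier (int_ring h Quot P))" by (rule Quot_finite[OF h I fin_quot_idl[OF fe I p(1,2)]])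
    define w where "w = (%i. coset P (poly_emb h (Polynomial.monom 1 i)))"
    have "inj_on w {..<degree p}"
    proof (rule inj_onI)
      fix i j assume ij: "i \<in> {..<degree p}" "j \<in> {..<degree p}" "w i = w j"
      define f :: "'k poly" where "f = Polynomial.monom 1 i - Polynomial.monom 1 j"
      have "poly_emb h f \<in> P" using ij(3) coset_eq_iff[OF I S] by (simp add: w_def f_def e.hom_minus)
      moreover have "degree f < degree p" unfolding f_def using ij by (intro degree_diff_less) (auto simp: degree_monom_eq)
      ultimately have "f = 0" using p(3)[of f] by (meson not_less)
      then show "i = j" by (simp add: f_def monom_eq_iff')
    qed
    moreover have "w ` {..<degree p} \<subseteq> carrier (int_ring h Quot P)"
      unfolding Quot_carrier[OF h I] w_def using poly_emb_int_set[OF h] by auto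
    ultimately have "card {..<degree p} \<le> card (carrier (int_ring h Quot P))"
      using fin by (rule card_inj_on_le)
    then have "p \<in> D" using c p(1) by (simp add: D_def)
    then show "P \<in> (\<Union>p\<in>D. A p)" using PM p(2) by (auto simp: A_def)
  qed
  then show ?thesis using \<open>finite D\<close> fA by (meson finite_UN_I finite_subset)
qed

section \<open>The Galois group\<close>

lemma finite_ext_comp:
  assumes "finite_ext a" "finite_ext b" shows "finite_ext (b \<circ> a)"
proof -
  interpret a: field_hom a using assms by (simp add: finite_ext_def)
  interpret b: field_hom b using assms by (simp add: finite_ext_def)
  interpret va: vector_space "%c x. a c * x"
    by unfold_locales (simp_all add: algebra_simps a.hom_add a.hom_mult)
  interpret vb: vector_space "%c x. b c * x"
    by unfold_locales (simp_all add: algebra_simps b.hom_add b.hom_mult)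
  have hom: "field_hom (b \<circ> a)"
    by unfold_locales (simp_all add: a.hom_add a.hom_mult b.hom_add b.hom_mult)
  interpret vc: vector_space "%c x. (b \<circ> a) c * x"
    by unfold_locales (simp_all add: algebra_simps a.hom_add a.hom_mult b.hom_add b.hom_mult)
  obtain A where A: "finite A" "va.span A = UNIV" using assms by (auto simp: finite_ext_def)
  obtain B where B: "finite B" "vb.span B = UNIV" using assms by (auto simp: finite_ext_def)
  define C where "C = (%(x, y). b x * y) ` (A \<times> B)"
  have "x \<in> vc.span C" for x
  proof -
    have "x \<in> vb.span B" using B by simp
    then show ?thesis
    proof (induction rule: vb.span_induct_alt)
      case base
      show ?case by (rule vc.span_zero)
    next
      case (step c y z)
      have "c \<in> va.span A" using A by simp
      then have "b c * y \<in> vc.span C"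
      proof (induction rule: va.span_induct_alt)
        case base
        show ?case by (simp only: b.hom_zero mult_zero_left vc.span_zero)
      next
        case (step d u w)
        have "b u * y \<in> C" unfolding C_def using step(1) \<open>y \<in> B\<close> by (intro image_eqI[of _ _ "(u, y)"]) simp_all
        then have "(b \<circ> a) d * (b u * y) \<in> vc.span C" by (intro vc.span_scale vc.span_base)
        then have "(b \<circ> a) d * (b u * y) + b w * y \<in> vc.span C" using step(2) by (rule vc.span_add)
        then show ?case by (simp add: b.hom_add b.hom_mult algebra_simps)
      qed
      then show ?case using step(2) by (rule vc.span_add)
    qed
  qed
  then have "vc.span C = UNIV" by blast
  moreover have "finite C" unfolding C_def using A B by simp
  ultimately show ?thesis unfolding finite_ext_def using hom by blast
qed

lemma Gal_iff: "g \<in> carrier (Gal b) \<longleftrightarrow> field_hom g \<and> bij g \<and> (\<forall>x. g (b x) = b x)"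
  by (simp add: Gal_def)

lemma Gal_mult [simp]: "g \<otimes>\<^bsub>Gal b\<^esub> g' = g \<circ> g'" and Gal_one [simp]: "\<one>\<^bsub>Gal b\<^esub> = id"
  by (simp_all add: Gal_def)

lemma Gal_id: "id \<in> carrier (Gal b)"
  unfolding Gal_iff by (intro conjI) (unfold_locales, simp_all)

lemma Gal_comp: "g \<in> carrier (Gal b) ==> g' \<in> carrier (Gal b) ==> g \<circ> g' \<in> carrier (Gal b)"
  unfolding Gal_iff
proof (intro conjI allI)
  assume g: "field_hom g \<and> bij g \<and> (\<forall>x. g (b x) = b x)" and g': "field_hom g' \<and> bij g' \<and> (\<forall>x. g' (b x) = b x)"
  interpret g: field_hom g using g by simp
  interpret g': field_hom g' using g' by simp
  show "field_hom (g \<circ> g')" by unfold_locales (simp_all add: g.hom_add g.hom_mult g'.hom_add g'.hom_mult)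
  show "bij (g \<circ> g')" using g g' by (simp add: bij_comp)
qed simp

lemma Gal_inv: "g \<in> carrier (Gal b) ==> inv_into UNIV g \<in> carrier (Gal b)"
  unfolding Gal_iff
proof (intro conjI allI)
  assume g: "field_hom g \<and> bij g \<and> (\<forall>x. g (b x) = b x)"
  interpret g: field_hom g using g by simp
  have inj: "inj g" and surj: "surj g" using g by (simp_all add: bij_def)
  have eqI: "inv_into UNIV g x = y" if "x = g y" for x y using that inj by (simp add: inv_f_f)
  note gi = surj_f_inv_f[OF surj]
  show "field_hom (inv_into UNIV g)"
    by unfold_locales (rule eqI, simp add: g.hom_add g.hom_mult gi)+
  show "bij (inv_into UNIV g)" using g by (simp add: bij_imp_bij_inv)
  show "inv_into UNIV g (b x) = b x" for x by (rule eqI) (use g in simp)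
qed

text \<open>An automorphism is determined by its values on a finite spanning set, and each value is
  a root of a nonzero polynomial over K that kills the argument.\<close>

lemma finite_Gal:
  assumes "finite_ext b"
  shows "finite (carrier (Gal b))"
proof -
  interpret b: field_hom b using assms by (simp add: finite_ext_def)
  interpret vb: vector_space "%c x. b c * x"
    by unfold_locales (simp_all add: algebra_simps b.hom_add b.hom_mult)
  obtain B where B: "finite B" "vb.span B = UNIV" using assms by (auto simp: finite_ext_def)
  have "\<exists>p. p ~= 0 \<and> poly (map_poly b p) x = 0" for x
  proof -
    obtain N where "!!m (x :: nat => _). m > N ==> \<exists>c. (\<exists>i<m. c i ~= 0) \<and> (\<Sum>i<m. b (c i) * x i) = 0"
      using finite_ext_dependent[OF assms] by blast
    from this[of "Suc N" "%i. x ^ i"]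
    obtain c where c: "\<exists>i<Suc N. c i ~= 0" "(\<Sum>i<Suc N. b (c i) * x ^ i) = 0" by blast
    define p where "p = (\<Sum>i<Suc N. Polynomial.monom (c i) i)"
    have "coeff p i = c i" if "i < Suc N" for i
      using that unfolding p_def coeff_sum coeff_monom by (simp del: sum.lessThan_Suc)
    then have "p ~= 0" using c(1) by (metis coeff_0)
    moreover have "poly (map_poly b p) x = 0"
    proof -
      interpret mb: map_poly_comm_ring_hom b ..
      have "map_poly b p = (\<Sum>i<Suc N. Polynomial.monom (b (c i)) i)"
        unfolding p_def mb.hom_sum by (simp add: map_poly_monom)
      then show ?thesis using c(2) by (simp add: poly_sum poly_monom del: sum.lessThan_Suc)
    qed
    ultimately show ?thesis by blast
  qed
  then obtain p where p: "!!x. p x ~= 0" "!!x. poly (map_poly b (p x)) x = 0" by metis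
  define T where "T = (\<Pi>\<^sub>E x\<in>B. {y. poly (map_poly b (p x)) y = 0})"
  have "finite T" unfolding T_def
    by (intro finite_PiE B(1) poly_roots_finite) (use p(1) in simp)
  moreover have "(%g. restrict g B) ` carrier (Gal b) \<subseteq> T"
  proof (rule image_subsetI)
    fix g assume "g \<in> carrier (Gal b)"
    then have g: "field_hom g" "!!x. g (b x) = b x" by (simp_all add: Gal_iff)
    interpret g: field_hom g by (rule g(1))
    have "poly (map_poly b (p x)) (g x) = 0" for x
    proof -
      have "map_poly g (map_poly b (p x)) = map_poly b (p x)"
        by (simp add: map_poly_map_poly comp_def g(2))
      then have "poly (map_poly b (p x)) (g x) = g (poly (map_poly b (p x)) x)"
        by (metis g.poly_map_poly)
      then show ?thesis by (simp add: p(2))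
    qed
    then show "restrict g B \<in> T" unfolding T_def restrict_PiE_iff by simp
  qed
  moreover have "inj_on (%g. restrict g B) (carrier (Gal b))"
  proof (rule inj_onI)
    fix g g' assume gg: "g \<in> carrier (Gal b)" "g' \<in> carrier (Gal b)" "restrict g B = restrict g' B"
    interpret g: field_hom g using gg by (simp add: Gal_iff)
    interpret g': field_hom g' using gg by (simp add: Gal_iff)
    have eqB: "g x = g' x" if "x \<in> B" for x using gg(3) that by (metis restrict_apply')
    have "g x = g' x" for x
    proof -
      have "x \<in> vb.span B" using B by simp
      then show ?thesis
      proof (induction rule: vb.span_induct_alt)
        case (step c y z)
        then show ?case using gg(1,2) eqB[of y] by (simp add: g.hom_add g.hom_mult g'.hom_add g'.hom_mult Gal_iff)
      qed simp
    qed
    then show "g = g'" by blast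
  qed
  ultimately show ?thesis by (meson finite_subset finite_imageD)
qed

lemma Gal_int_set:
  assumes h: "field_hom (b \<circ> a)" and g: "g \<in> carrier (Gal b)" and x: "x \<in> int_set (b \<circ> a)"
  shows "g x \<in> int_set (b \<circ> a)"
proof -
  interpret g: field_hom g using g by (simp add: Gal_iff)
  obtain p where p: "lead_coeff p = 1" "poly (map_poly (poly_emb (b \<circ> a)) p) x = 0"
    using x unfolding mem_Collect_eq integral_over_def by blast
  have "g (poly_emb (b \<circ> a) c) = poly_emb (b \<circ> a) c" for c using g by (simp add: poly_emb_def Gal_iff)
  moreover have "poly_emb (b \<circ> a) 0 = 0" using poly_emb_eq_0[OF h] by simp
  ultimately have "map_poly g (map_poly (poly_emb (b \<circ> a)) p) = map_poly (poly_emb (b \<circ> a)) p"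
    by (intro poly_eqI) (simp add: coeff_map_poly)
  then have "poly (map_poly (poly_emb (b \<circ> a)) p) (g x) = 0"
    using p(2) g.poly_map_poly[of "map_poly (poly_emb (b \<circ> a)) p" x] by simp
  then show ?thesis using p(1) unfolding mem_Collect_eq integral_over_def by blast
qed

lemma field_hom_comp:
  assumes "field_hom a" "field_hom b" shows "field_hom (b \<circ> a)"
proof -
  interpret a: field_hom a by (rule assms)
  interpret b: field_hom b by (rule assms)
  show ?thesis by unfold_locales (simp_all add: a.hom_add a.hom_mult b.hom_add b.hom_mult)
qed

lemma int_set_comp_iff:
  assumes "field_hom a" "field_hom b"
  shows "b y \<in> int_set (b \<circ> a) \<longleftrightarrow> y \<in> int_set a"
proof -
  interpret b: field_hom b by (rule assms)
  interpret e: comm_ring_hom "poly_emb a" by (rule poly_emb_hom[OF assms(1)])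
  have "map_poly (poly_emb (b \<circ> a)) p = map_poly b (map_poly (poly_emb a) p)" for p
    using poly_emb_eq_0[OF field_hom_comp[OF assms], of 0]
    by (intro poly_eqI) (simp add: coeff_map_poly, simp add: poly_emb_def)
  then have "poly (map_poly (poly_emb (b \<circ> a)) p) (b y) = b (poly (map_poly (poly_emb a) p) y)" for p
    by (simp add: b.poly_map_poly)
  then show ?thesis unfolding mem_Collect_eq integral_over_def by (simp only: b.hom_0_iff)
qed

lemma Gal_fixed_int_set:
  assumes "finite_ext a" "finite_galois_ext b" and x: "x \<in> int_set (b \<circ> a)"
    and fixed: "!!g. g \<in> carrier (Gal b) ==> g x = x"
  shows "x \<in> b ` int_set a"
proof -
  have "x \<in> range b" using assms(2) fixed unfolding finite_galois_ext_def by blast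
  then obtain y where "x = b y" by blast
  then show ?thesis using x int_set_comp_iff[of a b y] assms(1,2)
    by (auto simp: finite_ext_def finite_galois_ext_def)
qed

section \<open>The Frobenius map over a finite field\<close>

lemma card_UNIV_finite_field: "1 < card (UNIV :: 'k::{field,finite} set)"
proof -
  have "card {0 :: 'k, 1} \<le> card (UNIV :: 'k set)" by (intro card_mono) simp_all
  then show ?thesis by simp
qed

text \<open>Multiplication by a nonzero \<open>c\<close> permutes the nonzero elements, so comparing
  their products shows that \<open>c\<close> to the number of these elements is 1.\<close>

lemma power_card_field: "(c :: 'k::{field,finite}) ^ card (UNIV :: 'k set) = c"
proof (cases "c = 0")
  case True
  have "0 < card (UNIV :: 'k set)" using card_UNIV_finite_field[where ?'k = 'k] by simp
  then show ?thesis unfolding True by (rule zero_power)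
next
  case False
  let ?U = "UNIV - {0 :: 'k}"
  have "(\<Prod>y\<in>?U. c * y) = (\<Prod>y\<in>?U. y)"
    by (rule prod.reindex_bij_witness[of _ "%y. y / c" "%y. c * y"]) (use False in auto)
  moreover have "(\<Prod>y\<in>?U. c * y) = c ^ card ?U * (\<Prod>y\<in>?U. y)" by (simp add: prod.distrib)
  moreover have "(\<Prod>y\<in>?U. y) ~= 0" by simp
  ultimately have "c ^ card ?U = 1" by simp
  moreover have "card (UNIV :: 'k set) = Suc (card ?U)" using card_UNIV_finite_field[where ?'k = 'k] by (simp add: card_Diff_singleton)
  ultimately show ?thesis by (simp only: power_Suc mult_1_right)
qed

text \<open>Translation by 1 permutes the field and adds the number of elements to the sum of all of
  them.\<close>

lemma of_nat_card_field: "of_nat (card (UNIV :: 'k set)) = (0 :: 'k::{field,finite})"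
proof -
  have "(\<Sum>c\<in>(UNIV :: 'k set). c + 1) = (\<Sum>c\<in>UNIV. c)"
    by (rule sum.reindex_bij_witness[of _ "%c. c - 1" "%c. c + 1"]) auto
  then show ?thesis by (simp add: sum.distrib)
qed

lemma field_hom_inj: "field_hom j ==> j x = j y \<longleftrightarrow> x = y"
proof -
  assume "field_hom j"
  then interpret j: field_hom j .
  show ?thesis by simp
qed

text \<open>Both polynomials are monic of degree q and vanish at the q elements of the image of
  \<open>j\<close>.\<close>

lemma prod_linear_finite_field:
  fixes j :: "'k::{field,finite} => 'o::field"
  assumes j: "field_hom j"
  shows "(\<Prod>c\<in>(UNIV :: 'k set). [:- j c, 1:]) = Polynomial.monom 1 (card (UNIV :: 'k set)) - Polynomial.monom 1 1"
    (is "?P = ?R")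
proof (rule poly_eqI_degree_lead_coeff[where n = "card (UNIV :: 'k set)" and A = "range j"])
  interpret j: field_hom j by (rule j)
  have q: "1 < card (UNIV :: 'k set)" by (rule card_UNIV_finite_field)
  have inj: "inj j" using field_hom_inj[OF j] by (simp add: inj_on_def)
  show "degree ?P \<le> card (UNIV :: 'k set)" by (subst degree_prod_eq_sum_degree) simp_all
  have dP: "degree ?P = card (UNIV :: 'k set)" by (subst degree_prod_eq_sum_degree) simp_all
  have "lead_coeff ?P = 1" by (subst lead_coeff_prod) simp
  then show "coeff ?P (card (UNIV :: 'k set)) = coeff ?R (card (UNIV :: 'k set))" using dP q by simp
  show "degree ?R \<le> card (UNIV :: 'k set)" using q by (intro degree_diff_le degree_monom_le[THEN order_trans]) simp_all
  show "card (UNIV :: 'k set) \<le> card (range j)" using inj by (simp add: card_image)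
  fix x assume "x \<in> range j"
  then obtain c where c: "x = j c" by blast
  have "poly ?P x = 0" unfolding poly_prod by (rule prod_zero) (auto simp: c)
  moreover have "poly ?R x = 0" using power_card_field[of c] by (simp add: poly_monom c flip: j.hom_power)
  ultimately show "poly ?P x = poly ?R x" by simp
qed

text \<open>\<open>y^q - y\<close> is the product of all \<open>y - c\<close>, hence invariant under translation by elements of the finite
  field; so the two sides agree for \<open>x\<close> in the finite field, and differ by a polynomial in \<open>x\<close> of
  degree less than \<open>q\<close>.\<close>

lemma add_power_card:
  fixes j :: "'k::{field,finite} => 'o::field"
  assumes j: "field_hom j"
  shows "(x + y) ^ card (UNIV :: 'k set) = x ^ card (UNIV :: 'k set) + (y :: 'o) ^ card (UNIV :: 'k set)"
proof -
  interpret j: field_hom j by (rule j)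
  let ?q = "card (UNIV :: 'k set)"
  have ev: "(\<Prod>c\<in>(UNIV :: 'k set). u - j c) = u ^ ?q - u" for u
  proof -
    have "poly (\<Prod>c\<in>(UNIV :: 'k set). [:- j c, 1:]) u = u ^ ?q - u"
      unfolding prod_linear_finite_field[OF j] by (simp add: poly_monom)
    then show ?thesis by (simp add: poly_prod)
  qed
  have tr: "(j d + y) ^ ?q = j d ^ ?q + y ^ ?q" for d
  proof -
    have "(\<Prod>c\<in>(UNIV :: 'k set). (j d + y) - j c) = (\<Prod>c\<in>(UNIV :: 'k set). y - j c)"
      by (rule prod.reindex_bij_witness[of _ "%c. c + d" "%c. c - d"]) (auto simp: j.hom_minus j.hom_add)
    then have "(j d + y) ^ ?q - (j d + y) = y ^ ?q - y" by (simp only: ev)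
    moreover have "j d ^ ?q = j d" by (simp only: j.hom_power[symmetric] power_card_field)
    ultimately show ?thesis by (simp add: algebra_simps)
  qed
  have inj: "inj j" using field_hom_inj[OF j] by (simp add: inj_on_def)
  have "[:y, 1:] ^ ?q = Polynomial.monom 1 ?q + [:y ^ ?q:]" (is "?P = ?R")
  proof (rule poly_eqI_degree_lead_coeff[where n = ?q and A = "range j"])
    have q: "1 < ?q" by (rule card_UNIV_finite_field)
    have dP: "degree ?P = ?q" by (simp add: degree_power_eq)
    then show "degree ?P \<le> ?q" by simp
    have "lead_coeff ?P = 1" by (simp add: lead_coeff_power)
    then have "coeff ?P ?q = 1" using dP by simp
    moreover have "coeff ?R ?q = 1" using q by (cases ?q) simp_all
    ultimately show "coeff ?P ?q = coeff ?R ?q" by simp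
    show "degree ?R \<le> ?q" by (intro degree_add_le degree_monom_le) simp
    show "?q \<le> card (range j)" using inj by (simp add: card_image)
    fix u assume "u \<in> range j"
    then obtain d where "u = j d" by blast
    then show "poly ?P u = poly ?R u" using tr[of d] by (simp add: poly_monom add.commute)
  qed
  then have "poly ([:y, 1:] ^ ?q) x = poly (Polynomial.monom 1 ?q + [:y ^ ?q:]) x" by simp
  then show ?thesis by (simp add: poly_monom add.commute)
qed

lemma add_power_card_power:
  fixes j :: "'k::{field,finite} => 'o::field"
  assumes j: "field_hom j"
  shows "(x + y) ^ (card (UNIV :: 'k set) ^ n) = x ^ (card (UNIV :: 'k set) ^ n) + (y :: 'o) ^ (card (UNIV :: 'k set) ^ n)"
  by (induction n arbitrary: x y) (simp_all add: power_mult add_power_card[OF j])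

lemma power_card_power:
  fixes j :: "'k::{field,finite} => 'o::field"
  assumes j: "field_hom j"
  shows "j c ^ (card (UNIV :: 'k set) ^ n) = j c"
proof -
  interpret j: field_hom j by (rule j)
  have "j c ^ card (UNIV :: 'k set) = j c" by (simp only: j.hom_power[symmetric] power_card_field)
  then show ?thesis by (induction n) (simp_all add: power_mult)
qed

lemma diff_power_card_power:
  fixes j :: "'k::{field,finite} => 'o::field"
  assumes j: "field_hom j"
  shows "(x - y) ^ (card (UNIV :: 'k set) ^ n) = x ^ (card (UNIV :: 'k set) ^ n) - (y :: 'o) ^ (card (UNIV :: 'k set) ^ n)"
  using add_power_card_power[OF j, of "x - y" y n] by (simp add: algebra_simps)

lemma power_card_power_inj:
  fixes j :: "'k::{field,finite} => 'o::field"
  assumes j: "field_hom j" and eq: "x ^ (card (UNIV :: 'k set) ^ n) = (y :: 'o) ^ (card (UNIV :: 'k set) ^ n)"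
  shows "x = y"
  using diff_power_card_power[OF j, of x y n] eq by simp

text \<open>The polynomial splits because the field is algebraically closed, and its roots are
  distinct because its derivative is -1 in a field where q is zero.\<close>

lemma split_frobenius_poly:
  fixes j :: "'k::{field,finite} => 'o::alg_closed_field"
  assumes j: "field_hom j" and n: "0 < n"
  shows "\<exists>A. finite A \<and> (\<Prod>\<alpha>\<in>A. [:- \<alpha>, 1:]) = Polynomial.monom 1 (card (UNIV :: 'k set) ^ n) - Polynomial.monom (1 :: 'o) 1"
proof -
  interpret j: field_hom j by (rule j)
  let ?M = "card (UNIV :: 'k set) ^ n"
  define p where "p = Polynomial.monom 1 ?M - Polynomial.monom (1 :: 'o) 1"
  have M: "1 < ?M" using card_UNIV_finite_field n by (rule one_less_power)
  have dp: "degree p = ?M"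
  proof (rule antisym)
    show "degree p \<le> ?M" unfolding p_def using M by (intro degree_diff_le degree_monom_le[THEN order_trans]) simp_all
    have "coeff p ?M = 1" unfolding p_def using M by simp
    then show "?M \<le> degree p" by (intro le_degree) simp
  qed
  have lc: "lead_coeff p = 1" unfolding dp unfolding p_def using M by simp
  then have p0: "p ~= 0" by auto
  obtain A where A: "p = Polynomial.smult (lead_coeff p) (\<Prod>x\<in>#A. [:- x, 1:])"
    using alg_closed_imp_factorization[OF p0] by blast
  then have A: "p = (\<Prod>x\<in>#A. [:- x, 1:])" using lc by simp
  have q0: "of_nat ?M = (0 :: 'o)"
  proof -
    have "of_nat (card (UNIV :: 'k set)) = (0 :: 'o)" using of_nat_card_field[where ?'k = 'k] by (metis j.hom_of_nat j.hom_zero)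
    then show ?thesis using n by (simp add: of_nat_power)
  qed
  have "count A \<alpha> \<le> 1" for \<alpha>
  proof (rule ccontr)
    assume "\<not> count A \<alpha> \<le> 1"
    then have "{#\<alpha>, \<alpha>#} \<subseteq># A" by (simp add: subseteq_mset_def)
    then obtain B where "A = {#\<alpha>, \<alpha>#} + B" by (metis subset_mset.le_iff_add)
    then have e: "p = [:- \<alpha>, 1:] * ([:- \<alpha>, 1:] * (\<Prod>x\<in>#B. [:- x, 1:]))" using A by (simp add: mult.assoc)
    define r where "r = [:- \<alpha>, 1:]"
    have r: "poly r \<alpha> = 0" by (simp add: r_def)
    have "poly (pderiv p) \<alpha> = 0" unfolding e r_def[symmetric] by (simp add: pderiv_mult r)
    moreover have "pderiv p = - 1"
      unfolding p_def pderiv_diff pderiv_monom q0 by (simp add: monom_0 one_pCons)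
    ultimately show False by simp
  qed
  then have "A = mset_set (set_mset A)"
    by (intro multiset_eqI) (metis count_mset_set(1,3) count_greater_eq_one_iff count_eq_zero_iff finite_set_mset le_antisym)
  then have "p = (\<Prod>x\<in>set_mset A. [:- x, 1:])" using A by (metis prod_unfold_prod_mset)
  then show ?thesis unfolding p_def by (intro exI[of _ "set_mset A"]) simp
qed

section \<open>Characters of a finite quotient\<close>

definition rhom :: "'a::comm_ring_1 set => ('a => 'b::comm_ring_1) => bool" where
  "rhom S \<chi> \<longleftrightarrow> \<chi> 0 = 0 \<and> \<chi> 1 = 1 \<and> (\<forall>x\<in>S. \<forall>y\<in>S. \<chi> (x + y) = \<chi> x + \<chi> y \<and> \<chi> (x * y) = \<chi> x * \<chi> y)"

lemma rhomD:
  assumes "rhom S \<chi>"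
  shows "\<chi> 0 = 0" "\<chi> 1 = 1" "x \<in> S ==> y \<in> S ==> \<chi> (x + y) = \<chi> x + \<chi> y"
    "x \<in> S ==> y \<in> S ==> \<chi> (x * y) = \<chi> x * \<chi> y"
  using assms by (simp_all add: rhom_def)

lemma rhom_uminus: "rhom S \<chi> ==> subrng S ==> x \<in> S ==> \<chi> (- x) = - \<chi> x"
  using rhomD(1)[of S \<chi>] rhomD(3)[of S \<chi> x "- x"] subrngD(5)[of S x] by (simp add: eq_neg_iff_add_eq_0 add.commute)

lemma rhom_diff: "rhom S \<chi> ==> subrng S ==> x \<in> S ==> y \<in> S ==> \<chi> (x - y) = \<chi> x - \<chi> y"
  using rhomD(3)[of S \<chi> x "- y"] subrngD(5)[of S y] rhom_uminus[of S \<chi> y] by simp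

lemma rhom_power: "rhom S \<chi> ==> subrng S ==> x \<in> S ==> \<chi> (x ^ n) = \<chi> x ^ n"
  by (induction n) (simp_all add: rhomD subrng_power)

lemma rhom_sum: "rhom S \<chi> ==> subrng S ==> (!!i. i \<in> A ==> f i \<in> S) ==> \<chi> (\<Sum>i\<in>A. f i) = (\<Sum>i\<in>A. \<chi> (f i))"
  by (induction A rule: infinite_finite_induct) (simp_all add: rhomD subrng_sum)

lemma rhom_prod: "rhom S \<chi> ==> subrng S ==> (!!i. i \<in> A ==> f i \<in> S) ==> \<chi> (\<Prod>i\<in>A. f i) = (\<Prod>i\<in>A. \<chi> (f i))"
  by (induction A rule: infinite_finite_induct) (simp_all add: rhomD subrng_prod)

definition polys_over :: "'a::comm_ring_1 set => 'a poly set" where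
  "polys_over S = {p. \<forall>i. coeff p i \<in> S}"

lemma subrng_polys_over:
  assumes S: "subrng S" shows "subrng (polys_over S)"
proof -
  have "coeff (p * q) i \<in> S" if "p \<in> polys_over S" "q \<in> polys_over S" for p q i
    unfolding coeff_mult using that by (intro subrng_sum[OF S] subrngD(4)[OF S]) (simp_all add: polys_over_def)
  moreover have "coeff 1 i \<in> S" for i using subrngD(1,2)[OF S] by (cases i) simp_all
  ultimately show ?thesis
    unfolding subrng_def using subrngD[OF S] by (simp add: polys_over_def)
qed

lemma rhom_map_poly:
  assumes S: "subrng S" and \<chi>: "rhom S \<chi>"
  shows "rhom (polys_over S) (map_poly \<chi>)"
proof -
  have c: "coeff (map_poly \<chi> p) i = \<chi> (coeff p i)" for p i by (simp add: coeff_map_poly rhomD(1)[OF \<chi>])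
  have "map_poly \<chi> (p * q) = map_poly \<chi> p * map_poly \<chi> q" if "p \<in> polys_over S" "q \<in> polys_over S" for p q
  proof (rule poly_eqI)
    fix i
    have "\<chi> (coeff p j * coeff q l) = \<chi> (coeff p j) * \<chi> (coeff q l)" for j l
      using that by (intro rhomD(4)[OF \<chi>]) (simp_all add: polys_over_def)
    moreover have "coeff p j * coeff q l \<in> S" for j l
      using that by (intro subrngD(4)[OF S]) (simp_all add: polys_over_def)
    ultimately show "coeff (map_poly \<chi> (p * q)) i = coeff (map_poly \<chi> p * map_poly \<chi> q) i"
      unfolding c coeff_mult by (subst rhom_sum[OF \<chi> S]) simp_all
  qed
  moreover have "map_poly \<chi> (p + q) = map_poly \<chi> p + map_poly \<chi> q" if "p \<in> polys_over S" "q \<in> polys_over S" for p q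
    by (rule poly_eqI) (use that in \<open>simp add: c polys_over_def rhomD(3)[OF \<chi>]\<close>)
  moreover have "map_poly \<chi> 1 = 1"
  proof (rule poly_eqI)
    fix i show "coeff (map_poly \<chi> 1) i = coeff 1 i" unfolding c by (cases i) (simp_all add: rhomD(1,2)[OF \<chi>])
  qed
  ultimately show ?thesis unfolding rhom_def by simp
qed

text \<open>The elements of \<open>S[Y]\<close> whose coefficients represent the finite quotient play the role of a single
  generic element: its characteristic polynomial under \<open>G\<close> has invariant coefficients.\<close>

lemma char_transitive:
  fixes \<chi> \<psi> :: "'l::comm_ring_1 => 'o::idom"
  assumes S: "subrng S" and G: "finite G" "id \<in> G" and Gh: "!!g. g \<in> G ==> rhom S g" "!!g x. g \<in> G ==> x \<in> S ==> g x \<in> S"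
    and perm: "!!h. h \<in> G ==> bij_betw (%g. h \<circ> g) G G"
    and Y: "finite Y" "Y \<subseteq> S" "!!x. x \<in> S ==> \<exists>y\<in>Y. x - y \<in> Q" and QS: "Q \<subseteq> S"
    and \<chi>: "rhom S \<chi>" and \<psi>: "rhom S \<psi>"
    and kill: "!!x. x \<in> Q ==> \<psi> x = 0" "!!g x. g \<in> G ==> x \<in> Q ==> \<chi> (g x) = 0"
    and agree: "!!x. x \<in> S ==> (!!g. g \<in> G ==> g x = x) ==> \<chi> x = \<psi> x"
  shows "\<exists>g\<in>G. \<forall>x\<in>S. \<psi> x = \<chi> (g x)"
proof -
  obtain ys where ys: "set ys = Y" using finite_list[OF Y(1)] by blast
  \<comment> \<open>The coefficients of \<open>xp\<close> run through the representatives of the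
    quotient, so one equality of polynomials compares two homomorphisms on all of them.\<close>
  define xp where "xp = Poly ys"
  let ?S1 = "polys_over S" let ?S2 = "polys_over ?S1"
  note S1 = subrng_polys_over[OF S] note S2 = subrng_polys_over[OF S1]
  have xp: "xp \<in> ?S1"
  proof -
    have "nth_default 0 ys i \<in> S" for i
      using ys Y(2) subrngD(1)[OF S] by (auto simp: nth_default_def)
    then show ?thesis by (simp add: polys_over_def xp_def coeff_Poly_eq)
  qed
  have gxp: "map_poly g p \<in> ?S1" if "g \<in> G" "p \<in> ?S1" for g p
    using that Gh(2) by (simp add: polys_over_def coeff_map_poly rhomD(1)[OF Gh(1)])
  define L where "L = (%p :: 'l poly. [:- p, 1:])"
  have L: "L p \<in> ?S2" if "p \<in> ?S1" for p
  proof -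
    have "coeff (L p) i \<in> ?S1" for i
      using subrngD(1,2)[OF S1] subrngD(5)[OF S1 that] unfolding L_def by (cases i rule: nat.exhaust; simp add: coeff_pCons split: nat.split)
    then show ?thesis by (simp add: polys_over_def[of ?S1])
  qed
  have mapL: "map_poly (map_poly f) (L p) = [:- map_poly f p, 1:]" if f: "rhom S f" and p: "p \<in> ?S1" for f :: "'l => 'c::comm_ring_1" and p
    unfolding L_def using rhomD(1,2)[OF rhom_map_poly[OF S f]] rhom_uminus[OF rhom_map_poly[OF S f] S1 p]
    by (simp add: map_poly_pCons)
  \<comment> \<open>The product of T - g(\<open>xp\<close>) over the group. Left translation by an
    element of \<open>G\<close> permutes the factors, so the coefficients are fixed by
    \<open>G\<close> and \<open>\<chi>\<close>, \<open>\<psi>\<close> agree on them.\<close>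
  define E where "E = (\<Prod>g\<in>G. L (map_poly g xp))"
  have E: "E \<in> ?S2" unfolding E_def by (intro subrng_prod[OF S2] L gxp xp)
  have mapE: "map_poly (map_poly f) E = (\<Prod>g\<in>G. [:- map_poly f (map_poly g xp), 1:])" if f: "rhom S f" for f :: "'l => 'c::comm_ring_1"
    unfolding E_def using rhom_prod[OF rhom_map_poly[OF S1 rhom_map_poly[OF S f]] S2, of G "%g. L (map_poly g xp)"]
    by (simp add: L gxp xp mapL[OF f])
  have fixed: "map_poly (map_poly h) E = E" if h: "h \<in> G" for h
  proof -
    have "map_poly h (map_poly g xp) = map_poly (h \<circ> g) xp" if "g \<in> G" for g
      by (rule map_poly_map_poly) (rule rhomD(1)[OF Gh(1)[OF h]])
    then have "map_poly (map_poly h) E = (\<Prod>g\<in>G. L (map_poly (h \<circ> g) xp))"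
      unfolding mapE[OF Gh(1)[OF h]] L_def by simp
    also have "\<dots> = E" unfolding E_def by (rule prod.reindex_bij_betw[OF perm[OF h]])
    finally show ?thesis .
  qed
  have coeffs: "\<chi> (coeff (coeff E i) l) = \<psi> (coeff (coeff E i) l)" for i l
  proof (rule agree)
    show "coeff (coeff E i) l \<in> S" using E by (simp add: polys_over_def)
    fix h assume h: "h \<in> G"
    have "coeff (coeff (map_poly (map_poly h) E) i) l = h (coeff (coeff E i) l)"
      by (simp add: coeff_map_poly rhomD(1)[OF Gh(1)[OF h]])
    then show "h (coeff (coeff E i) l) = coeff (coeff E i) l" using fixed[OF h] by simp
  qed
  have "map_poly (map_poly \<chi>) E = map_poly (map_poly \<psi>) E"
    by (intro poly_eqI) (simp add: coeff_map_poly rhomD(1)[OF \<chi>] rhomD(1)[OF \<psi>] coeffs)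
  then have "poly (map_poly (map_poly \<chi>) E) (map_poly \<psi> xp) = poly (map_poly (map_poly \<psi>) E) (map_poly \<psi> xp)" by simp
  also have "\<dots> = 0"
    unfolding mapE[OF \<psi>] poly_prod
  proof (rule prod_zero[OF G(1)])
    have "map_poly id xp = xp" by (simp add: poly_eq_iff coeff_map_poly)
    then have "map_poly \<psi> (map_poly id xp) = map_poly \<psi> xp" by simp
    then show "\<exists>g\<in>G. poly [:- map_poly \<psi> (map_poly g xp), 1:] (map_poly \<psi> xp) = 0" using G(2) by (intro bexI[of _ id]) simp_all
  qed
  \<comment> \<open>The image under \<open>\<psi>\<close> vanishes at
    \<open>map_poly \<psi> xp\<close> through the factor of the identity. So does the equal image
    under \<open>\<chi>\<close>, and over a domain one of its linear factors must vanish.\<close>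
  finally obtain g where g: "g \<in> G" "map_poly \<psi> xp = map_poly \<chi> (map_poly g xp)"
    unfolding mapE[OF \<chi>] poly_prod using G(1) by (auto simp: prod_zero_iff)
  have onY: "\<psi> y = \<chi> (g y)" if y: "y \<in> Y" for y
  proof -
    obtain i where i: "i < length ys" "ys ! i = y" using y ys by (auto simp: in_set_conv_nth)
    have "coeff xp i = y" using i by (simp add: xp_def coeff_Poly_eq nth_default_def)
    then show ?thesis using arg_cong[OF g(2), of "%p. coeff p i"]
      by (simp add: coeff_map_poly rhomD(1)[OF \<chi>] rhomD(1)[OF \<psi>] rhomD(1)[OF Gh(1)[OF g(1)]])
  qed
  have "\<psi> x = \<chi> (g x)" if x: "x \<in> S" for x
  proof -
    obtain y where y: "y \<in> Y" "x - y \<in> Q" using Y(3)[OF x] by blast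
    have yS: "y \<in> S" using y Y(2) by blast
    have "\<psi> x - \<psi> y = 0" using kill(1)[OF y(2)] rhom_diff[OF \<psi> S x yS] by simp
    moreover have "\<chi> (g x) - \<chi> (g y) = 0"
      using kill(2)[OF g(1) y(2)] rhom_diff[OF Gh(1)[OF g(1)] S x yS]
        rhom_diff[OF \<chi> S Gh(2)[OF g(1) x] Gh(2)[OF g(1) yS]] by simp
    ultimately show ?thesis using onY[OF y(1)] by simp
  qed
  then show ?thesis using g(1) by blast
qed

text \<open>The argument of Dedekind and Artin: a relation evaluated at y x, minus
  \<open>\<psi> y\<close> times the relation at x, no longer involves \<open>\<psi>\<close>. The
  default value 0 outside \<open>S\<close> ensures that distinct homomorphisms already differ at
  some element of \<open>S\<close>.\<close>

lemma dedekind_independence: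
  fixes F :: "('l::comm_ring_1 => 'o::idom) set"
  assumes S: "subrng S" and "finite F"
    and F: "!!\<chi>. \<chi> \<in> F ==> rhom S \<chi>" "!!\<chi> x. \<chi> \<in> F ==> x \<notin> S ==> \<chi> x = 0"
    and z: "!!x. x \<in> S ==> (\<Sum>\<chi>\<in>F. c \<chi> * \<chi> x) = 0" and "\<chi> \<in> F"
  shows "c \<chi> = 0"
  using assms(2-)
proof (induction F arbitrary: c \<chi> rule: finite_induct)
  case (insert \<psi> F)
  have IH: "c \<chi> * (\<chi> y - \<psi> y) = 0" if \<chi>: "\<chi> \<in> F" and y: "y \<in> S" for \<chi> y
  proof (rule insert.IH[where c = "%\<chi>. c \<chi> * (\<chi> y - \<psi> y)"])
    fix x assume x: "x \<in> S"
    have 1: "c \<psi> * \<psi> x + (\<Sum>\<chi>\<in>F. c \<chi> * \<chi> x) = 0" using insert.prems(3)[OF x] insert.hyps by simp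
    have 2: "c \<psi> * (\<psi> y * \<psi> x) + (\<Sum>\<chi>\<in>F. c \<chi> * (\<chi> y * \<chi> x)) = 0"
    proof -
      have "\<chi> (y * x) = \<chi> y * \<chi> x" if "\<chi> \<in> insert \<psi> F" for \<chi> using rhomD(4)[OF insert.prems(1)[OF that] y x] .
      then show ?thesis using insert.prems(3)[OF subrngD(4)[OF S y x]] insert.hyps by simp
    qed
    have "(\<Sum>\<chi>\<in>F. c \<chi> * (\<chi> y - \<psi> y) * \<chi> x) = (\<Sum>\<chi>\<in>F. c \<chi> * (\<chi> y * \<chi> x)) - \<psi> y * (\<Sum>\<chi>\<in>F. c \<chi> * \<chi> x)"
      unfolding sum_distrib_left sum_subtractf[symmetric] by (simp add: algebra_simps)
    also have "\<dots> = (c \<psi> * (\<psi> y * \<psi> x) + (\<Sum>\<chi>\<in>F. c \<chi> * (\<chi> y * \<chi> x))) - \<psi> y * (c \<psi> * \<psi> x + (\<Sum>\<chi>\<in>F. c \<chi> * \<chi> x))"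
      by (simp add: algebra_simps)
    finally show "(\<Sum>\<chi>\<in>F. c \<chi> * (\<chi> y - \<psi> y) * \<chi> x) = 0" unfolding 1 2 by simp
  qed (use insert.prems(1,2) \<chi> in auto)
  have cF: "c \<chi> = 0" if \<chi>: "\<chi> \<in> F" for \<chi>
  proof -
    have "\<chi> ~= \<psi>" using \<chi> insert.hyps by blast
    then obtain y where y: "\<chi> y ~= \<psi> y" by blast
    then have "y \<in> S" using insert.prems(2)[of \<chi> y] insert.prems(2)[of \<psi> y] \<chi> by (metis insertCI)
    from IH[OF \<chi> this] y show ?thesis by simp
  qed
  show ?case
  proof (cases "\<chi> = \<psi>")
    case True
    have "c \<psi> * \<psi> 1 + (\<Sum>\<chi>\<in>F. c \<chi> * \<chi> 1) = 0" using insert.prems(3)[OF subrngD(2)[OF S]] insert.hyps by simp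
    moreover have "(\<Sum>\<chi>\<in>F. c \<chi> * \<chi> 1) = 0" by (rule sum.neutral) (simp add: cF)
    moreover have "\<psi> 1 = 1" using rhomD(2)[OF insert.prems(1)] by simp
    ultimately show ?thesis using True by simp
  next
    case False
    then show ?thesis using cF insert.prems(4) by blast
  qed
qed simp

text \<open>The finite k-algebra S/Q, represented by subsets of a field. \<open>Q\<close> is an
  arbitrary ideal, so nilpotents are allowed, as ramification demands.\<close>

locale fin_char =
  fixes S Q :: "'l::field set" and kp :: "'k::{field,finite} => 'l" and j :: "'k => 'o::alg_closed_field" and q :: nat
  assumes q_def: "q = card (UNIV :: 'k set)" and S: "subrng S" and Q: "idl Q S" and kp: "field_hom kp" and kpS: "!!c. kp c \<in> S"
    and j: "field_hom j" and fq: "fin_quot S Q"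
begin

lemmas add_power_L = add_power_card_power[OF kp, folded q_def]
  and add_power_O = add_power_card_power[OF j, folded q_def]
  and power_L = power_card_power[OF kp, folded q_def]
  and power_O = power_card_power[OF j, folded q_def]
  and power_inj_O = power_card_power_inj[OF j, folded q_def]
  and split_O = split_frobenius_poly[OF j, folded q_def]

lemma q1: "1 < q" "0 < q"
  using card_UNIV_finite_field[where ?'k = 'k] by (simp_all add: q_def)

lemmas SD = subrngD[OF S] and QD = idlD[OF Q S]

lemma S_power: "x \<in> S ==> x ^ n \<in> S" by (rule subrng_power[OF S])

text \<open>Functionals on S/Q, viewed as functions on \<open>S\<close> that kill \<open>Q\<close>.
  The default 0 outside \<open>S\<close> makes equality of functionals the same as equality of
  functions.\<close>

definition lin :: "('l => 'o) set" where
  "lin = {f. (\<forall>x\<in>S. \<forall>y\<in>S. f (x + y) = f x + f y) \<and> (\<forall>c. \<forall>x\<in>S. f (kp c * x) = j c * f x) \<and>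
     (\<forall>x\<in>Q. f x = 0) \<and> (\<forall>x. x \<notin> S \<longrightarrow> f x = 0)}"

definition chars :: "('l => 'o) set" where
  "chars = {\<chi>. rhom S \<chi> \<and> (\<forall>c. \<chi> (kp c) = j c) \<and> (\<forall>x\<in>Q. \<chi> x = 0) \<and> (\<forall>x. x \<notin> S \<longrightarrow> \<chi> x = 0)}"

lemma linD:
  assumes "f \<in> lin"
  shows "x \<in> S ==> y \<in> S ==> f (x + y) = f x + f y" "x \<in> S ==> f (kp c * x) = j c * f x"
    "x \<in> Q ==> f x = 0" "x \<notin> S ==> f x = 0"
  using assms by (simp_all add: lin_def)

lemma charsD:
  assumes "\<chi> \<in> chars"
  shows "rhom S \<chi>" "\<chi> (kp c) = j c" "x \<in> Q ==> \<chi> x = 0" "x \<notin> S ==> \<chi> x = 0"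
  using assms by (simp_all add: chars_def)

lemma chars_lin: "\<chi> \<in> chars ==> \<chi> \<in> lin"
proof -
  assume \<chi>: "\<chi> \<in> chars"
  show "\<chi> \<in> lin"
    unfolding lin_def
  proof (intro CollectI conjI ballI allI impI)
    fix x y assume "x \<in> S" "y \<in> S"
    then show "\<chi> (x + y) = \<chi> x + \<chi> y" by (rule rhomD(3)[OF charsD(1)[OF \<chi>]])
  next
    fix c x assume "x \<in> S"
    then show "\<chi> (kp c * x) = j c * \<chi> x" using rhomD(4)[OF charsD(1)[OF \<chi>] kpS] charsD(2)[OF \<chi>] by simp
  qed (use charsD(3,4)[OF \<chi>] in blast)+
qed

lemma lin_zero: "(%x. 0) \<in> lin" by (simp add: lin_def)

lemma lin_add: "f \<in> lin ==> g \<in> lin ==> (%x. f x + g x) \<in> lin"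
  by (simp add: lin_def algebra_simps)

lemma lin_scale: "f \<in> lin ==> (%x. c * f x) \<in> lin"
  by (simp add: lin_def algebra_simps)

lemma lin_sum: "(!!i. i \<in> A ==> f i \<in> lin) ==> (%x. \<Sum>i\<in>A. f i x) \<in> lin"
  by (induction A rule: infinite_finite_induct) (simp_all add: lin_zero lin_add)

definition mul :: "'l => ('l => 'o) => 'l => 'o" where
  "mul z f = (%x. if x \<in> S then f (z * x) else 0)"

lemma mul_lin:
  assumes z: "z \<in> S" and f: "f \<in> lin" shows "mul z f \<in> lin"
proof -
  have zS: "z * x \<in> S" if "x \<in> S" for x using that SD(4) z by simp
  show ?thesis
    unfolding lin_def mul_def
  proof (intro CollectI conjI ballI allI impI)
    fix x y assume xy: "x \<in> S" "y \<in> S"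
    show "(if x + y \<in> S then f (z * (x + y)) else 0) =
        (if x \<in> S then f (z * x) else 0) + (if y \<in> S then f (z * y) else 0)"
      using xy SD(3)[OF xy] linD(1)[OF f zS zS] by (simp add: distrib_left)
  next
    fix c x assume x: "x \<in> S"
    have e: "z * (kp c * x) = kp c * (z * x)" by (simp add: algebra_simps)
    show "(if kp c * x \<in> S then f (z * (kp c * x)) else 0) = j c * (if x \<in> S then f (z * x) else 0)"
      using x SD(4)[OF kpS x] linD(2)[OF f zS[OF x], of c] unfolding e by simp
  next
    fix x assume x: "x \<in> Q"
    show "(if x \<in> S then f (z * x) else 0) = 0" using linD(3)[OF f QD(4)[OF z x]] by simp
  qed simp
qed

text \<open>Composition with the power map of exponent q^n. It stays linear over k because elements
  of k are fixed by that power; on characters it raises the values to the power q^n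
  (\<open>frob_char\<close>).\<close>

definition frob :: "nat => ('l => 'o) => 'l => 'o" where
  "frob n f = (%x. if x \<in> S then f (x ^ (q ^ n)) else 0)"

lemma frob_lin:
  assumes f: "f \<in> lin" shows "frob n f \<in> lin"
proof -
  have "f ((x + y) ^ (q ^ n)) = f (x ^ (q ^ n)) + f (y ^ (q ^ n))" if "x \<in> S" "y \<in> S" for x y
    unfolding add_power_L using that by (intro linD[OF f] S_power)
  moreover have "f ((kp c * x) ^ (q ^ n)) = j c * f (x ^ (q ^ n))" if "x \<in> S" for c x
    unfolding power_mult_distrib power_L using that by (intro linD[OF f] S_power)
  moreover have "x \<in> S" "f (x ^ (q ^ n)) = 0" if "x \<in> Q" for x
  proof -
    show xS: "x \<in> S" using QD(2)[OF that] .
    have "q ^ n > 0" by (simp add: q1)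
    then obtain m where "q ^ n = Suc m" using gr0_conv_Suc by blast
    then have "x ^ (q ^ n) \<in> Q" using QD(5)[OF that S_power[OF xS]] by simp
    then show "f (x ^ (q ^ n)) = 0" by (rule linD(3)[OF f])
  qed
  ultimately show ?thesis
    unfolding lin_def frob_def using SD(3) SD(4)[OF kpS] by simp
qed

lemma frob_frob: "frob m (frob n f) = frob (n + m) f"
  by (rule HOL.ext) (simp add: frob_def S_power power_add power_mult[symmetric] mult.commute)

lemma frob_char: "\<chi> \<in> chars ==> frob n \<chi> x = \<chi> x ^ (q ^ n)"
proof (cases "x \<in> S")
  case False
  have "(0 :: 'o) ^ (q ^ n) = 0" by (simp add: q1)
  moreover assume "\<chi> \<in> chars"
  ultimately show ?thesis using False by (simp add: frob_def charsD(4))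
qed (simp add: frob_def rhom_power[OF charsD(1) S])

lemma frob_chars:
  assumes \<chi>: "\<chi> \<in> chars" shows "frob n \<chi> \<in> chars"
proof -
  have "rhom S (frob n \<chi>)"
    unfolding rhom_def frob_char[OF \<chi>]
    using rhomD[OF charsD(1)[OF \<chi>]] add_power_O
    by (simp add: power_mult_distrib q1)
  then show ?thesis unfolding chars_def using \<chi> linD(3,4)[OF frob_lin[OF chars_lin[OF \<chi>]]]
    by (simp add: frob_char[OF \<chi>] charsD(2) power_O)
qed

lemma frob_char_inj: "\<chi> \<in> chars ==> \<psi> \<in> chars ==> frob n \<chi> = frob n \<psi> ==> \<chi> = \<psi>"
proof (rule HOL.ext)
  fix x assume "\<chi> \<in> chars" "\<psi> \<in> chars" "frob n \<chi> = frob n \<psi>"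
  then have "\<chi> x ^ (q ^ n) = \<psi> x ^ (q ^ n)" by (metis frob_char)
  then show "\<chi> x = \<psi> x" by (rule power_inj_O)
qed

text \<open>Some iterate of the Frobenius map of the finite ring is idempotent.\<close>

lemma exists_idempotent_frobenius: "\<exists>N>0. \<forall>x\<in>S. x ^ (q ^ (N + N)) - x ^ (q ^ N) \<in> Q"
proof -
  obtain Y where Y: "finite Y" "Y \<subseteq> S" "!!x. x \<in> S ==> \<exists>y\<in>Y. x - y \<in> Q" using fq unfolding fin_quot_def by blast
  define r where "r = (%x. SOME y. y \<in> Y \<and> x - y \<in> Q)"
  have r: "r x \<in> Y" "x - r x \<in> Q" if "x \<in> S" for x
    using someI_ex[of "%y. y \<in> Y \<and> x - y \<in> Q"] Y(3)[OF that] unfolding r_def by blast+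
  \<comment> \<open>The action of the power maps on representatives. There are only finitely many
    selfmaps of \<open>Y\<close>, so two exponents give the same one.\<close>
  define F where "F = (%n :: nat. \<lambda>y\<in>Y. r (y ^ (q ^ n)))"
  have "range F \<subseteq> Y \<rightarrow>\<^sub>E Y"
    unfolding F_def using r(1) S_power Y(2) by (intro image_subsetI) (simp add: restrict_PiE_iff subset_iff)
  then have "finite (range F)" by (rule finite_subset) (intro finite_PiE Y(1))
  then have "\<not> inj F" using finite_imageD infinite_UNIV_nat by blast
  then obtain a b where ab: "a < b" "F a = F b" unfolding inj_on_def by (metis nat_neq_iff)
  have cong: "x ^ m - y ^ m \<in> Q" if "x \<in> S" "y \<in> S" "x - y \<in> Q" for x y m
  proof (induction m)
    case (Suc m)
    have "x ^ Suc m - y ^ Suc m = x ^ m * (x - y) + (x ^ m - y ^ m) * y" by (simp add: algebra_simps)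
    then show ?case using QD(3)[OF QD(4)[OF S_power[OF that(1)] that(3)] QD(5)[OF Suc that(2)]] by simp
  qed (simp add: QD(1))
  have tr: "x - z \<in> Q" if "x - y \<in> Q" "y - z \<in> Q" for x y z using QD(3)[OF that] by simp
  have sy: "y - x \<in> Q" if "x - y \<in> Q" for x y using QD(6)[OF that] by simp
  have eqab: "x ^ (q ^ b) - x ^ (q ^ a) \<in> Q" if x: "x \<in> S" for x
  proof -
    obtain y where y: "y \<in> Y" "x - y \<in> Q" using Y(3)[OF x] by blast
    have yS: "y \<in> S" using y Y(2) by blast
    have "r (y ^ (q ^ a)) = r (y ^ (q ^ b))" using fun_cong[OF ab(2), of y] y(1) by (simp add: F_def)
    then have "y ^ (q ^ b) - r (y ^ (q ^ a)) \<in> Q" using r(2)[OF S_power[OF yS, of "q ^ b"]] by simp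
    from tr[OF this sy[OF r(2)[OF S_power[OF yS]]]] have "y ^ (q ^ b) - y ^ (q ^ a) \<in> Q" .
    from tr[OF tr[OF cong[OF x yS y(2)] this] sy[OF cong[OF x yS y(2)]]] show ?thesis .
  qed
  define d where "d = b - a"
  have per: "x ^ (q ^ (n + d)) - x ^ (q ^ n) \<in> Q" if x: "x \<in> S" and n: "a \<le> n" for x n
  proof -
    have e: "x ^ (q ^ (m + (n - a))) = (x ^ (q ^ (n - a))) ^ (q ^ m)" for m
      by (simp add: power_add power_mult[symmetric] mult.commute)
    have "b + (n - a) = n + d" "a + (n - a) = n" using n ab(1) by (simp_all add: d_def)
    then show ?thesis using eqab[OF S_power[OF x, of "q ^ (n - a)"]] e[of a] e[of b] by simp
  qed
  have per2: "x ^ (q ^ (n + k * d)) - x ^ (q ^ n) \<in> Q" if x: "x \<in> S" and n: "a \<le> n" for x n k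
  proof (induction k)
    case (Suc k)
    have "x ^ (q ^ (n + k * d + d)) - x ^ (q ^ (n + k * d)) \<in> Q" using n by (intro per[OF x]) simp
    from tr[OF this Suc] show ?case by (simp add: algebra_simps)
  qed (simp add: QD(1))
  \<comment> \<open>A multiple of the period \<open>d\<close> that has passed the preperiod
    \<open>a\<close>; hence the exponents N and N + N act alike.\<close>
  define N where "N = Suc a * d"
  have d: "0 < d" using ab by (simp add: d_def)
  then have "a \<le> N" by (cases d) (simp_all add: N_def)
  then have "\<forall>x\<in>S. x ^ (q ^ (N + N)) - x ^ (q ^ N) \<in> Q" using per2[of _ N "Suc a"] by (simp add: N_def)
  then show ?thesis using d by (intro exI[of _ N]) (simp add: N_def)
qed

definition "N = (SOME N. 0 < N \<and> (\<forall>x\<in>S. x ^ (q ^ (N + N)) - x ^ (q ^ N) \<in> Q))"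

lemma N: "0 < N" "x \<in> S ==> x ^ (q ^ (N + N)) - x ^ (q ^ N) \<in> Q"
  using someI_ex[OF exists_idempotent_frobenius] unfolding N_def by simp_all

lemma lin_diff: "f \<in> lin ==> x \<in> S ==> y \<in> S ==> f (x - y) = f x - f y"
  using linD(1)[of f "x - y" y] SD(6)[of x y] by simp

lemma lin_cong: "f \<in> lin ==> x \<in> S ==> y \<in> S ==> x - y \<in> Q ==> f x = f y"
  using lin_diff[of f x y] linD(3)[of f "x - y"] by simp

lemma frob_idem: "f \<in> lin ==> frob N (frob N f) = frob N f"
  unfolding frob_frob by (rule HOL.ext) (simp add: frob_def lin_cong[OF _ _ _ N(2)] S_power)

lemma frob_N_char: "\<chi> \<in> chars ==> frob N \<chi> = \<chi>"
  using frob_idem[OF chars_lin, of \<chi>] frob_char_inj[OF frob_chars, of \<chi> \<chi> N N] by simp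

text \<open>A character is determined by its values on finitely many representatives, and these
  values are roots of T^(q^N) - T.\<close>

lemma finite_chars: "finite chars"
proof -
  obtain Y where Y: "finite Y" "Y \<subseteq> S" "!!x. x \<in> S ==> \<exists>y\<in>Y. x - y \<in> Q" using fq unfolding fin_quot_def by blast
  obtain A where A: "finite A" "(\<Prod>\<alpha>\<in>A. [:- \<alpha>, 1:]) = Polynomial.monom 1 (q ^ N) - Polynomial.monom (1 :: 'o) 1"
    using split_O[OF N(1)] by blast
  have "(%\<chi>. restrict \<chi> Y) ` chars \<subseteq> Y \<rightarrow>\<^sub>E A"
  proof (rule image_subsetI)
    fix \<chi> assume \<chi>: "\<chi> \<in> chars"
    have "\<chi> y \<in> A" for y
    proof -
      have "poly (\<Prod>\<alpha>\<in>A. [:- \<alpha>, 1:]) (\<chi> y) = 0"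
        unfolding A(2) using fun_cong[OF frob_N_char[OF \<chi>], of y] by (simp add: poly_monom frob_char[OF \<chi>])
      then show ?thesis unfolding poly_prod using A(1) by (auto simp: prod_zero_iff)
    qed
    then show "restrict \<chi> Y \<in> Y \<rightarrow>\<^sub>E A" by (simp add: restrict_PiE_iff)
  qed
  then have "finite ((%\<chi>. restrict \<chi> Y) ` chars)" by (rule finite_subset) (intro finite_PiE Y(1) A(1))
  moreover have "inj_on (%\<chi>. restrict \<chi> Y) chars"
  proof (rule inj_onI)
    fix \<chi> \<psi> assume e: "\<chi> \<in> chars" "\<psi> \<in> chars" "restrict \<chi> Y = restrict \<psi> Y"
    show "\<chi> = \<psi>"
    proof
      fix x show "\<chi> x = \<psi> x"
      proof (cases "x \<in> S")
        case True
        obtain y where y: "y \<in> Y" "x - y \<in> Q" using Y(3)[OF True] by blast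
        have yS: "y \<in> S" using y Y(2) by blast
        have "\<chi> y = \<psi> y" using fun_cong[OF e(3), of y] y(1) by simp
        then show ?thesis using lin_cong[OF chars_lin[OF e(1)] True yS y(2)] lin_cong[OF chars_lin[OF e(2)] True yS y(2)] by simp
      qed (use charsD(4)[OF e(1)] charsD(4)[OF e(2)] in simp)
    qed
  qed
  ultimately show ?thesis by (rule finite_imageD)
qed

lemma chars_independent:
  assumes "!!x. x \<in> S ==> (\<Sum>\<chi>\<in>chars. c \<chi> * \<chi> x) = 0" "\<chi> \<in> chars" shows "c \<chi> = 0"
  by (rule dedekind_independence[OF S finite_chars _ _ assms]) (simp_all add: charsD)

section \<open>Functionals fixed by the idempotent Frobenius are combinations of characters\<close>

text \<open>The polynomial \<open>p\<close>, evaluated at the operator that multiplies the argument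
  by \<open>z\<close>, applied to \<open>f\<close>.\<close>

definition pact :: "'l => 'o poly => ('l => 'o) => 'l => 'o" where
  "pact z p f = (%x. \<Sum>i\<le>degree p. coeff p i * f (z ^ i * x))"

lemma pact_bound: "degree p \<le> n ==> pact z p f x = (\<Sum>i\<le>n. coeff p i * f (z ^ i * x))"
  unfolding pact_def by (intro sum.mono_neutral_left) (auto simp: coeff_eq_0)

lemma pact_linear_factor:
  assumes z: "z \<in> S" and x: "x \<in> S"
  shows "pact z ([:- \<alpha>, 1:] * p) f x = pact z p (%w. f (z * w) - \<alpha> * f w) x"
proof -
  let ?n = "degree p"
  have e: "[:- \<alpha>, 1:] * p = pCons 0 p - Polynomial.smult \<alpha> p" by simp
  have "pact z ([:- \<alpha>, 1:] * p) f x = (\<Sum>i\<le>Suc ?n. coeff (pCons 0 p - Polynomial.smult \<alpha> p) i * f (z ^ i * x))"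
    unfolding e by (intro pact_bound degree_diff_le) (simp_all add: degree_pCons_le degree_smult_le[THEN order_trans])
  also have "\<dots> = (\<Sum>i\<le>Suc ?n. coeff (pCons 0 p) i * f (z ^ i * x)) - (\<Sum>i\<le>Suc ?n. \<alpha> * coeff p i * f (z ^ i * x))"
    by (simp add: algebra_simps sum_subtractf del: sum.atMost_Suc)
  also have "(\<Sum>i\<le>Suc ?n. coeff (pCons 0 p) i * f (z ^ i * x)) = (\<Sum>i\<le>?n. coeff p i * f (z ^ i * (z * x)))"
    unfolding sum.atMost_Suc_shift by (simp add: algebra_simps)
  also have "(\<Sum>i\<le>Suc ?n. \<alpha> * coeff p i * f (z ^ i * x)) = (\<Sum>i\<le>?n. \<alpha> * coeff p i * f (z ^ i * x))"
    by (simp add: coeff_eq_0)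
  finally show ?thesis
    unfolding pact_def by (simp add: algebra_simps sum_subtractf)
qed

text \<open>An operator killed by a product of distinct linear factors is diagonalizable. The set
  \<open>E\<close> stands for any stable subspace, so that the splitting can be repeated for
  commuting operators without leaving a common eigenspace.\<close>

lemma eigen_split:
  fixes E :: "('l => 'o) set"
  assumes z: "z \<in> S" and fin: "finite A"
    and E: "E \<subseteq> lin" "!!f g. f \<in> E ==> g \<in> E ==> (%x. f x + g x) \<in> E" "!!f c. f \<in> E ==> (%x. c * f x) \<in> E"
      "!!f. f \<in> E ==> mul z f \<in> E" "(%x. 0) \<in> E"
    and f: "f \<in> E" "!!x. x \<in> S ==> pact z (\<Prod>\<alpha>\<in>A. [:- \<alpha>, 1:]) f x = 0"
  shows "\<exists>g. (\<forall>\<alpha>\<in>A. g \<alpha> \<in> E \<and> mul z (g \<alpha>) = (%x. \<alpha> * g \<alpha> x)) \<and> f = (%x. \<Sum>\<alpha>\<in>A. g \<alpha> x)"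
  using fin f
proof (induction A arbitrary: f rule: finite_induct)
  case empty
  have "f x = 0" for x
  proof (cases "x \<in> S")
    case True
    then show ?thesis using empty.prems(2)[OF True] by (simp add: pact_def)
  qed (use empty.prems(1) E(1) linD(4) in blast)
  then show ?case by auto
next
  case (insert \<beta> A)
  define u where "u = (%x. mul z f x + (- \<beta>) * f x)"
  have u: "u \<in> E" unfolding u_def by (intro E(2) E(3) E(4) insert.prems(1))
  have "pact z (\<Prod>\<alpha>\<in>A. [:- \<alpha>, 1:]) u x = 0" if x: "x \<in> S" for x
  proof -
    have "pact z (\<Prod>\<alpha>\<in>A. [:- \<alpha>, 1:]) u x = pact z (\<Prod>\<alpha>\<in>A. [:- \<alpha>, 1:]) (%w. f (z * w) - \<beta> * f w) x"
      unfolding pact_def u_def mul_def using SD(4)[OF S_power[OF z] x] by simp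
    also have "\<dots> = 0"
      using pact_linear_factor[OF z x, of \<beta> "\<Prod>\<alpha>\<in>A. [:- \<alpha>, 1:]" f] insert.prems(2)[OF x] insert.hyps by simp
    finally show ?thesis .
  qed
  from insert.IH[OF u this] obtain g where
    g: "\<forall>\<alpha>\<in>A. g \<alpha> \<in> E \<and> mul z (g \<alpha>) = (%x. \<alpha> * g \<alpha> x)" "u = (%x. \<Sum>\<alpha>\<in>A. g \<alpha> x)" by blast
  \<comment> \<open>On each eigenvector in the decomposition of \<open>u\<close> this inverts the
    operator \<open>mul z\<close> minus \<beta>, so subtracting all \<open>h \<alpha>\<close> from
    \<open>f\<close> leaves a vector of the eigenspace for \<beta>.\<close>
  define h where "h = (%\<alpha> x. inverse (\<alpha> - \<beta>) * g \<alpha> x)"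
  have hE: "h \<alpha> \<in> E" if "\<alpha> \<in> A" for \<alpha> unfolding h_def using g(1) that by (intro E(3)) blast
  have hsum: "(%x. \<Sum>\<alpha>\<in>B. h \<alpha> x) \<in> E" if "B \<subseteq> A" for B
    using that by (induction B rule: infinite_finite_induct) (simp_all add: E(2,5) hE)
  define f' where "f' = (%x. f x + (- 1) * (\<Sum>\<alpha>\<in>A. h \<alpha> x))"
  have f'E: "f' \<in> E" unfolding f'_def by (intro E(2) E(3) insert.prems(1) hsum subset_refl)
  have ev: "mul z (h \<alpha>) x = \<alpha> * h \<alpha> x" if "\<alpha> \<in> A" for \<alpha> x
  proof -
    have "mul z (h \<alpha>) x = inverse (\<alpha> - \<beta>) * mul z (g \<alpha>) x" by (simp add: mul_def h_def)
    then show ?thesis using g(1) that by (simp add: h_def)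
  qed
  have "mul z f' x = \<beta> * f' x" for x
  proof -
    have "mul z f' x = mul z f x - (\<Sum>\<alpha>\<in>A. mul z (h \<alpha>) x)" by (simp add: mul_def f'_def sum_negf)
    also have "\<dots> = u x + \<beta> * f x - (\<Sum>\<alpha>\<in>A. \<alpha> * h \<alpha> x)" by (simp add: u_def ev)
    also have "u x = (\<Sum>\<alpha>\<in>A. (\<alpha> - \<beta>) * h \<alpha> x)"
      unfolding g(2)
    proof (rule sum.cong[OF refl])
      fix \<alpha> assume "\<alpha> \<in> A"
      then have "\<alpha> - \<beta> ~= 0" using insert.hyps(2) by auto
      then show "g \<alpha> x = (\<alpha> - \<beta>) * h \<alpha> x" by (simp add: h_def mult.assoc[symmetric])
    qed
    finally have m: "mul z f' x = (\<Sum>\<alpha>\<in>A. (\<alpha> - \<beta>) * h \<alpha> x) + \<beta> * f x - (\<Sum>\<alpha>\<in>A. \<alpha> * h \<alpha> x)" .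
    have f'x: "f' x = f x - (\<Sum>\<alpha>\<in>A. h \<alpha> x)" by (simp add: f'_def sum_negf)
    show ?thesis unfolding m f'x by (simp add: algebra_simps sum_subtractf sum_distrib_left)
  qed
  then have f'e: "mul z f' = (%x. \<beta> * f' x)" by blast
  define g' where "g' = h(\<beta> := f')"
  have "\<forall>\<alpha>\<in>insert \<beta> A. g' \<alpha> \<in> E \<and> mul z (g' \<alpha>) = (%x. \<alpha> * g' \<alpha> x)"
    using f'E f'e hE ev by (auto simp: g'_def)
  moreover have "f = (%x. \<Sum>\<alpha>\<in>insert \<beta> A. g' \<alpha> x)"
  proof
    fix x
    have "(\<Sum>\<alpha>\<in>A. g' \<alpha> x) = (\<Sum>\<alpha>\<in>A. h \<alpha> x)" using insert.hyps by (intro sum.cong refl) (auto simp: g'_def)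
    then show "f x = (\<Sum>\<alpha>\<in>insert \<beta> A. g' \<alpha> x)" using insert.hyps by (simp add: g'_def f'_def)
  qed
  ultimately show ?case by blast
qed

definition spanc :: "('l => 'o) set" where
  "spanc = {f. \<exists>c. f = (%x. \<Sum>\<chi>\<in>chars. c \<chi> * \<chi> x)}"

lemma spanc_zero: "(%x. 0) \<in> spanc"
  unfolding spanc_def by (intro CollectI exI[of _ "%_. 0"]) simp

lemma spanc_add:
  assumes "f \<in> spanc" "g \<in> spanc" shows "(%x. f x + g x) \<in> spanc"
proof -
  obtain c d where "f = (%x. \<Sum>\<chi>\<in>chars. c \<chi> * \<chi> x)" "g = (%x. \<Sum>\<chi>\<in>chars. d \<chi> * \<chi> x)"
    using assms unfolding spanc_def by blast
  then have "(%x. f x + g x) = (%x. \<Sum>\<chi>\<in>chars. (c \<chi> + d \<chi>) * \<chi> x)" by (simp add: algebra_simps sum.distrib)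
  then show ?thesis unfolding spanc_def mem_Collect_eq by (intro exI[of _ "%\<chi>. c \<chi> + d \<chi>"])
qed

lemma spanc_sum: "(!!i. i \<in> A ==> f i \<in> spanc) ==> (%x. \<Sum>i\<in>A. f i x) \<in> spanc"
  by (induction A rule: infinite_finite_induct) (simp_all add: spanc_zero spanc_add)

lemma spanc_scaled_char: "\<chi> \<in> chars ==> (%x. a * \<chi> x) \<in> spanc"
proof -
  assume \<chi>: "\<chi> \<in> chars"
  have "(%x. a * \<chi> x) = (%x. \<Sum>\<psi>\<in>chars. (if \<psi> = \<chi> then a else 0) * \<psi> x)"
  proof
    fix x
    have "(\<Sum>\<psi>\<in>chars. (if \<psi> = \<chi> then a else 0) * \<psi> x) = (\<Sum>\<psi>\<in>chars. if \<psi> = \<chi> then a * \<psi> x else 0)"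
      by (intro sum.cong) auto
    then show "a * \<chi> x = (\<Sum>\<psi>\<in>chars. (if \<psi> = \<chi> then a else 0) * \<psi> x)" using \<chi> finite_chars by simp
  qed
  then show ?thesis unfolding spanc_def mem_Collect_eq by (intro exI[of _ "%\<psi>. if \<psi> = \<chi> then a else 0"])
qed

text \<open>A common eigenvector of all multiplications is \<open>f 1\<close> times the map sending
  x to its eigenvalue, and that map is multiplicative. If \<open>f 1\<close> is zero, then so is
  \<open>f\<close>.\<close>

lemma eigen_spanc:
  assumes f: "f \<in> lin" and ev: "!!x. x \<in> S ==> \<exists>\<alpha>. \<forall>w\<in>S. f (x * w) = \<alpha> * f w"
  shows "f \<in> spanc"
proof (cases "f 1 = 0")
  case True
  have "f x = 0" for x
  proof (cases "x \<in> S")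
    case xS: True
    then obtain \<alpha> where "\<forall>w\<in>S. f (x * w) = \<alpha> * f w" using ev by blast
    then have "f (x * 1) = \<alpha> * f 1" using SD(2) by blast
    then show ?thesis using True by simp
  qed (rule linD(4)[OF f])
  then have "f = (%x. 0)" by blast
  then show ?thesis using spanc_zero by simp
next
  case False
  define \<chi> where "\<chi> = (%x. inverse (f 1) * f x)"
  have fx: "f x = f 1 * \<chi> x" for x using False by (simp add: \<chi>_def)
  have mult: "f (x * w) = \<chi> x * f w" if x: "x \<in> S" and w: "w \<in> S" for x w
  proof -
    obtain \<alpha> where \<alpha>: "\<forall>w\<in>S. f (x * w) = \<alpha> * f w" using ev[OF x] by blast
    then have "f (x * 1) = \<alpha> * f 1" using SD(2) by blast
    then have "\<chi> x = \<alpha>" using False by (simp add: \<chi>_def)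
    then show ?thesis using \<alpha> w by simp
  qed
  have "\<chi> \<in> lin" unfolding \<chi>_def by (rule lin_scale[OF f])
  have "rhom S \<chi>"
    unfolding rhom_def
  proof (intro conjI ballI)
    show "\<chi> 0 = 0" using linD(3)[OF \<open>\<chi> \<in> lin\<close> QD(1)] .
    show "\<chi> 1 = 1" using False by (simp add: \<chi>_def)
    fix x y assume xy: "x \<in> S" "y \<in> S"
    show "\<chi> (x + y) = \<chi> x + \<chi> y" by (rule linD(1)[OF \<open>\<chi> \<in> lin\<close> xy])
    show "\<chi> (x * y) = \<chi> x * \<chi> y" unfolding \<chi>_def[THEN fun_cong, of "x * y"] mult[OF xy] by (simp add: \<chi>_def)
  qed
  moreover have "\<chi> (kp c) = j c" for c
    using linD(2)[OF \<open>\<chi> \<in> lin\<close> SD(2), of c] \<open>rhom S \<chi>\<close> by (simp add: rhom_def)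
  ultimately have "\<chi> \<in> chars" using linD(3,4)[OF \<open>\<chi> \<in> lin\<close>] by (simp add: chars_def)
  then have "(%x. f 1 * \<chi> x) \<in> spanc" by (rule spanc_scaled_char)
  moreover have "f = (%x. f 1 * \<chi> x)" using fx by blast
  ultimately show ?thesis by simp
qed

text \<open>The hypothesis says that every multiplication operator, applied to \<open>f\<close>,
  satisfies T^(q^N) - T, whose roots are distinct. Simultaneous diagonalization over the
  representatives of the quotient then writes \<open>f\<close> as a sum of common
  eigenvectors.\<close>

lemma frobenius_stable_spanc:
  assumes f: "f \<in> lin" and st: "!!x y. x \<in> S ==> y \<in> S ==> f (x ^ (q ^ N) * y) = f (x * y)"
  shows "f \<in> spanc"
proof -
  obtain Y where Y: "finite Y" "Y \<subseteq> S" "!!x. x \<in> S ==> \<exists>y\<in>Y. x - y \<in> Q" using fq unfolding fin_quot_def by blast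
  obtain A where A: "finite A" "(\<Prod>\<alpha>\<in>A. [:- \<alpha>, 1:]) = Polynomial.monom 1 (q ^ N) - Polynomial.monom (1 :: 'o) 1"
    using split_O[OF N(1)] by blast
  define st where "st = {f \<in> lin. \<forall>x\<in>S. \<forall>y\<in>S. f (x ^ (q ^ N) * y) = f (x * y)}"
  \<comment> \<open>The stable functionals on which each \<open>y\<close> in \<open>Y0\<close> acts
    by the scalar \<open>\<sigma> y\<close>. The induction enlarges \<open>Y0\<close> one
    representative at a time.\<close>
  define E where "E = (%Y0 \<sigma>. {f \<in> st. \<forall>y\<in>Y0. mul y f = (%x. \<sigma> y * f x)})"
  have fE: "f \<in> E {} \<sigma>" for \<sigma> using f assms(2) by (simp add: E_def st_def)
  have all: "f \<in> E Y \<sigma> ==> f \<in> spanc" for f \<sigma>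
  proof -
    assume fE: "f \<in> E Y \<sigma>"
    then have fl: "f \<in> lin" by (simp add: E_def st_def)
    show "f \<in> spanc"
    proof (rule eigen_spanc[OF fl])
      fix x assume x: "x \<in> S"
      obtain y where y: "y \<in> Y" "x - y \<in> Q" using Y(3)[OF x] by blast
      have yS: "y \<in> S" using y(1) Y(2) by blast
      have "f (x * w) = \<sigma> y * f w" if w: "w \<in> S" for w
      proof -
        have "x * w - y * w \<in> Q" using QD(5)[OF y(2) w] by (simp add: algebra_simps)
        then have "f (x * w) = f (y * w)" by (intro lin_cong[OF fl] SD(4) x yS w)
        also have "\<dots> = mul y f w" using w by (simp add: mul_def)
        also have "\<dots> = \<sigma> y * f w" using fE y(1) by (simp add: E_def)
        finally show ?thesis .
      qed
      then show "\<exists>\<alpha>. \<forall>w\<in>S. f (x * w) = \<alpha> * f w" by blast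
    qed
  qed
  have "f \<in> E Y0 \<sigma> ==> f \<in> spanc" if "Y0 \<subseteq> Y" for f Y0 \<sigma>
    using that
  proof (induction "card (Y - Y0)" arbitrary: Y0 f \<sigma>)
    case 0
    then have "Y0 = Y" using Y(1) by auto
    then show ?case using all 0 by blast
  next
    case (Suc n)
    then obtain z where z: "z \<in> Y" "z \<notin> Y0" by (metis Diff_iff card_eq_0_iff equals0I nat.distinct(1))
    have zS: "z \<in> S" using z(1) Y(2) by blast
    have mm: "mul y (mul z g) = mul z (mul y g)" if "y \<in> Y0" for y g
      using that Suc.prems(2) Y(2) zS SD(4) by (auto simp: mul_def fun_eq_iff algebra_simps)
    have Y0S: "y \<in> S" if "y \<in> Y0" for y using that Suc.prems(2) Y(2) by blast
    have ml: "mul y (%x. f x + g x) = (%x. mul y f x + mul y g x)" "mul y (%x. c * f x) = (%x. c * mul y f x)" for y c and f g :: "'l => 'o"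
      by (simp_all add: mul_def fun_eq_iff)
    have "\<exists>g. (\<forall>\<alpha>\<in>A. g \<alpha> \<in> E Y0 \<sigma> \<and> mul z (g \<alpha>) = (%x. \<alpha> * g \<alpha> x)) \<and> f = (%x. \<Sum>\<alpha>\<in>A. g \<alpha> x)"
    proof (rule eigen_split[OF zS A(1)])
      show "E Y0 \<sigma> \<subseteq> lin" by (auto simp: E_def st_def)
      show "(%x. f x + g x) \<in> E Y0 \<sigma>" if "f \<in> E Y0 \<sigma>" "g \<in> E Y0 \<sigma>" for f g
        using that by (simp add: E_def st_def lin_add ml distrib_left)
      show "(%x. c * f x) \<in> E Y0 \<sigma>" if "f \<in> E Y0 \<sigma>" for f c
        using that by (simp add: E_def st_def lin_scale ml mult.left_commute)
      show "(%x. 0) \<in> E Y0 \<sigma>" by (simp add: E_def st_def lin_zero mul_def)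
      show "f \<in> E Y0 \<sigma>" by (rule Suc.prems(1))
      show "mul z f \<in> E Y0 \<sigma>" if f: "f \<in> E Y0 \<sigma>" for f
      proof -
        have "mul z f \<in> lin" using f zS by (intro mul_lin) (simp_all add: E_def st_def)
        moreover have "mul z f (x ^ (q ^ N) * y) = mul z f (x * y)" if "x \<in> S" "y \<in> S" for x y
        proof -
          have "f (x ^ (q ^ N) * (z * y)) = f (x * (z * y))" using f that SD(4)[OF zS] by (simp add: E_def st_def)
          then show ?thesis using that by (simp add: mul_def SD(4) S_power algebra_simps)
        qed
        moreover have "mul y (mul z f) = (%x. \<sigma> y * mul z f x)" if "y \<in> Y0" for y
        proof -
          have "mul y f = (%x. \<sigma> y * f x)" using f that by (simp add: E_def)
          then show ?thesis unfolding mm[OF that] by (simp add: ml)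
        qed
        ultimately show ?thesis by (simp add: E_def st_def)
      qed
      fix x assume x: "x \<in> S"
      let ?p = "Polynomial.monom 1 (q ^ N) - Polynomial.monom (1 :: 'o) 1"
      have M: "1 < q ^ N" using q1(1) N(1) by (rule one_less_power)
      have "pact z ?p f x = (\<Sum>i\<le>q ^ N. coeff ?p i * f (z ^ i * x))"
        using M by (intro pact_bound degree_diff_le degree_monom_le[THEN order_trans]) simp_all
      also have "\<dots> = (\<Sum>i\<in>{q ^ N, 1}. coeff ?p i * f (z ^ i * x))"
        using M by (intro sum.mono_neutral_right) auto
      also have "\<dots> = f (z ^ (q ^ N) * x) - f (z * x)" using M N(1) by (subst sum.insert) auto
      also have "\<dots> = 0" using Suc.prems(1) zS x by (simp add: E_def st_def)
      finally show "pact z (\<Prod>\<alpha>\<in>A. [:- \<alpha>, 1:]) f x = 0" unfolding A(2) .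
    qed
    then obtain g where g: "!!\<alpha>. \<alpha> \<in> A ==> g \<alpha> \<in> E Y0 \<sigma>" "!!\<alpha>. \<alpha> \<in> A ==> mul z (g \<alpha>) = (%x. \<alpha> * g \<alpha> x)"
      "f = (%x. \<Sum>\<alpha>\<in>A. g \<alpha> x)" by blast
    have "g \<alpha> \<in> spanc" if \<alpha>: "\<alpha> \<in> A" for \<alpha>
    proof (rule Suc.hyps(1))
      show "n = card (Y - insert z Y0)"
        using Suc.hyps(2) z Y(1) by (metis Diff_insert card_Diff_singleton diff_Suc_1 DiffI)
      show "g \<alpha> \<in> E (insert z Y0) (\<sigma>(z := \<alpha>))" using g(1,2)[OF \<alpha>] z(2) by (auto simp: E_def)
      show "insert z Y0 \<subseteq> Y" using z Suc.prems(2) by blast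
    qed
    then show ?case unfolding g(3) by (rule spanc_sum)
  qed
  then show ?thesis using fE[of "%_. 0"] by blast
qed

text \<open>Idempotence modulo \<open>Q\<close> gives exactly the stability hypothesis of
  \<open>frobenius_stable_spanc\<close>.\<close>

lemma frob_N_spanc:
  assumes f: "f \<in> lin" shows "frob N f \<in> spanc"
proof (rule frobenius_stable_spanc[OF frob_lin[OF f]])
  fix x y assume xy: "x \<in> S" "y \<in> S"
  have "(x ^ (q ^ N) * y) ^ (q ^ N) - (x * y) ^ (q ^ N) = (x ^ (q ^ (N + N)) - x ^ (q ^ N)) * y ^ (q ^ N)"
    by (simp add: power_mult_distrib power_add power_mult[symmetric] algebra_simps)
  then have "(x ^ (q ^ N) * y) ^ (q ^ N) - (x * y) ^ (q ^ N) \<in> Q" using QD(5)[OF N(2)[OF xy(1)] S_power[OF xy(2)]] by simp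
  then show "frob N f (x ^ (q ^ N) * y) = frob N f (x * y)"
    using xy by (simp add: frob_def SD(4) S_power lin_cong[OF f])
qed

text \<open>Coefficients of \<open>frob N f\<close> and not of \<open>f\<close> itself, which need
  not be a combination of characters. When \<open>f\<close> kills the nilpotents, the two expansions
  agree (\<open>Kj_N_stable\<close>).\<close>

definition coef :: "('l => 'o) => ('l => 'o) => 'o" where
  "coef f = (SOME c. frob N f = (%x. \<Sum>\<chi>\<in>chars. c \<chi> * \<chi> x))"

lemma coef: "f \<in> lin ==> frob N f = (%x. \<Sum>\<chi>\<in>chars. coef f \<chi> * \<chi> x)"
  using frob_N_spanc[of f] unfolding spanc_def coef_def mem_Collect_eq by (rule someI_ex)

lemma coef_unique:
  assumes f: "f \<in> lin" and c: "!!x. x \<in> S ==> frob N f x = (\<Sum>\<chi>\<in>chars. c \<chi> * \<chi> x)" and \<chi>: "\<chi> \<in> chars"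
  shows "coef f \<chi> = c \<chi>"
proof -
  have "coef f \<chi> - c \<chi> = 0"
  proof (rule chars_independent[OF _ \<chi>, of "%\<chi>. coef f \<chi> - c \<chi>"])
    fix x assume "x \<in> S"
    from c[OF this] fun_cong[OF coef[OF f], of x]
    show "(\<Sum>\<chi>\<in>chars. (coef f \<chi> - c \<chi>) * \<chi> x) = 0" by (simp add: algebra_simps sum_subtractf)
  qed
  then show ?thesis by simp
qed

lemma coef_comb:
  assumes "\<chi> \<in> chars" shows "coef (%x. \<Sum>\<chi>\<in>chars. c \<chi> * \<chi> x) \<chi> = c \<chi>"
proof (rule coef_unique[OF _ _ assms])
  show "(%x. \<Sum>\<chi>\<in>chars. c \<chi> * \<chi> x) \<in> lin" by (intro lin_sum lin_scale chars_lin)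
  fix x assume x: "x \<in> S"
  have "\<chi> (x ^ (q ^ N)) = \<chi> x" if "\<chi> \<in> chars" for \<chi> using fun_cong[OF frob_N_char[OF that], of x] x by (simp add: frob_def)
  then have "(\<Sum>\<chi>\<in>chars. c \<chi> * \<chi> (x ^ (q ^ N))) = (\<Sum>\<chi>\<in>chars. c \<chi> * \<chi> x)" by (intro sum.cong) simp_all
  then show "frob N (%x. \<Sum>\<chi>\<in>chars. c \<chi> * \<chi> x) x = (\<Sum>\<chi>\<in>chars. c \<chi> * \<chi> x)" using x by (simp add: frob_def)
qed

lemma coef_eval: "f \<in> lin ==> x \<in> S ==> f (x ^ (q ^ N)) = (\<Sum>\<chi>\<in>chars. coef f \<chi> * \<chi> x)"
  using fun_cong[OF coef, of f x] by (simp add: frob_def)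

lemma coef_add:
  assumes "f \<in> lin" "g \<in> lin" "\<chi> \<in> chars" shows "coef (%x. f x + g x) \<chi> = coef f \<chi> + coef g \<chi>"
  by (rule coef_unique[OF lin_add[OF assms(1,2)] _ assms(3)])
     (simp add: frob_def coef_eval[OF assms(1)] coef_eval[OF assms(2)] distrib_right sum.distrib)

lemma coef_scale:
  assumes "f \<in> lin" "\<chi> \<in> chars" shows "coef (%x. a * f x) \<chi> = a * coef f \<chi>"
  by (rule coef_unique[OF lin_scale[OF assms(1)] _ assms(2)])
     (simp add: frob_def coef_eval[OF assms(1)] mult.assoc sum_distrib_left)

end

section \<open>The determinant at one prime\<close>

text \<open>The conjugates of \<open>\<chi>0\<close> under G and Frobenius exhaust all characters;
  \<open>\<gamma>\<close> lifts the d-th power of the Frobenius, and by \<open>disjoint\<close> no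
  smaller positive power returns to the G-orbit of \<open>\<chi>0\<close>. The exponents in
  \<open>orbit\<close> run from 1 to d instead of 0 to d - 1: they match the filtration
  \<open>Ti\<close>, whose last layer is that G-orbit. \<open>D\<close> models the dual of V with
  its right action \<open>ra\<close>.\<close>

locale local_prime = fin_char S Q kp j q
  for S Q :: "'l::field set" and kp :: "'k::{field,finite} => 'l" and j :: "'k => 'o::alg_closed_field" and q :: nat +
  fixes G :: "('l => 'l) set" and z :: 'l and n d :: nat and \<chi>0 :: "'l => 'o" and \<gamma> :: "'l => 'l"
    and D :: "'x set" and ad :: "'x => 'x => 'x" and sm :: "'f::field => 'x => 'x" and ra :: "'x => ('l => 'l) => 'x"
    and jf :: "'f => 'o"
  assumes G_fin: "finite G" and G_id: "id \<in> G" and G_comp: "!!g h. g \<in> G ==> h \<in> G ==> g \<circ> h \<in> G"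
    and G_bij: "!!g. g \<in> G ==> bij g" and G_inv: "!!g. g \<in> G ==> inv_into UNIV g \<in> G"
    and G_rhom: "!!g. g \<in> G ==> rhom S g" and G_S: "!!g x. g \<in> G ==> x \<in> S ==> g x \<in> S"
    and G_kp: "!!g c. g \<in> G ==> g (kp c) = kp c" and G_Q: "!!g x. g \<in> G ==> x \<in> Q ==> g x \<in> Q"
    and zS: "z \<in> S" and G_z: "!!g. g \<in> G ==> g z = z" and n: "0 < n" and d: "0 < d"
    and \<chi>0: "\<chi>0 \<in> chars" and \<gamma>: "\<gamma> \<in> G" and frob_d: "!!x. x \<in> S ==> \<chi>0 x ^ (q ^ d) = \<chi>0 (\<gamma> x)"
    and orbit: "!!\<chi>. \<chi> \<in> chars ==> \<exists>i g. 0 < i \<and> i \<le> d \<and> g \<in> G \<and> (\<forall>x\<in>S. \<chi> x = \<chi>0 (g x) ^ (q ^ i))"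
    and disjoint: "!!i g. 0 < i ==> i < d ==> g \<in> G ==> \<exists>x\<in>S. \<chi>0 x ^ (q ^ i) ~= \<chi>0 (g x)"
    and ad_D: "!!\<phi> \<psi>. \<phi> \<in> D ==> \<psi> \<in> D ==> ad \<phi> \<psi> \<in> D" and sm_D: "!!c \<phi>. \<phi> \<in> D ==> sm c \<phi> \<in> D"
    and ra_D: "!!\<phi> g. \<phi> \<in> D ==> g \<in> G ==> ra \<phi> g \<in> D"
    and ra_comp: "!!\<phi> g h. \<phi> \<in> D ==> g \<in> G ==> h \<in> G ==> ra (ra \<phi> g) h = ra \<phi> (g \<circ> h)"
    and ra_id: "!!\<phi>. \<phi> \<in> D ==> ra \<phi> id = \<phi>"
    and ra_ad: "!!\<phi> \<psi> g. \<phi> \<in> D ==> \<psi> \<in> D ==> g \<in> G ==> ra (ad \<phi> \<psi>) g = ad (ra \<phi> g) (ra \<psi> g)"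
    and ra_sm: "!!c \<phi> g. \<phi> \<in> D ==> g \<in> G ==> ra (sm c \<phi>) g = sm c (ra \<phi> g)"
begin

text \<open>When \<open>D\<close> is the dual of V, this is a copy of V with scalars extended to
  \<Omega>, presented as a double dual.\<close>

definition VO :: "('x => 'o) set" where
  "VO = {w. (\<forall>\<phi>\<in>D. \<forall>\<psi>\<in>D. w (ad \<phi> \<psi>) = w \<phi> + w \<psi>) \<and> (\<forall>c. \<forall>\<phi>\<in>D. w (sm c \<phi>) = jf c * w \<phi>) \<and>
     (\<forall>\<phi>. \<phi> \<notin> D \<longrightarrow> w \<phi> = 0)}"

text \<open>If \<open>ra\<close> is the right action on the dual of V, this is the original left
  action, extended to \<open>VO\<close>.\<close>

definition lact :: "('l => 'l) => ('x => 'o) => 'x => 'o" where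
  "lact g w = (%\<phi>. if \<phi> \<in> D then w (ra \<phi> g) else 0)"

text \<open>\<open>u (\<phi>, i, x)\<close> stands for the value at the tensor of
  \<open>\<phi>\<close> with the vector having x in coordinate i and 0 elsewhere. Compatibility with
  \<open>ra\<close> is the balancing over the group; the zero clauses make the representing function
  unique.\<close>

definition U :: "('x \<times> nat \<times> 'l => 'o) set" where
  "U = {u. (\<forall>\<phi>\<in>D. \<forall>i<n. (%x. u (\<phi>, i, x)) \<in> lin) \<and> (\<forall>i<n. \<forall>x\<in>S. (%\<phi>. u (\<phi>, i, x)) \<in> VO) \<and>
     (\<forall>\<phi>\<in>D. \<forall>i<n. \<forall>x\<in>S. \<forall>g\<in>G. u (ra \<phi> g, i, x) = u (\<phi>, i, g x)) \<and>
     (\<forall>\<phi> i x. \<phi> \<notin> D \<or> n \<le> i \<longrightarrow> u (\<phi>, i, x) = 0)}"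

text \<open>The transpose of the Lie action: an x in coordinate i contributes z x to coordinate i
  and x to coordinate i - 1, hence the downward shift of the index.\<close>

definition Lop :: "('x \<times> nat \<times> 'l => 'o) => 'x \<times> nat \<times> 'l => 'o" where
  "Lop u = (%(\<phi>, i, x). if i < n then mul z (%x. u (\<phi>, i, x)) x + (if 0 < i then u (\<phi>, i - 1, x) else 0) else 0)"

text \<open>The transpose of the extra Carlitz term: the q-th power of coordinate 0 is added to the
  last coordinate. So only the last component of \<open>u\<close> is read and only coordinate 0 is
  written.\<close>

definition sig :: "('x \<times> nat \<times> 'l => 'o) => 'x \<times> nat \<times> 'l => 'o" where
  "sig u = (%(\<phi>, i, x). if i = 0 then frob 1 (%x. u (\<phi>, n - 1, x)) x else 0)"

text \<open>The stabilizer of \<open>\<chi>0\<close>; it is identified with the inertia group in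
  \<open>Inert_eq\<close>.\<close>

definition Inert :: "('l => 'l) set" where
  "Inert = {g \<in> G. \<forall>x\<in>S. \<chi>0 (g x) = \<chi>0 x}"

definition W :: "('x => 'o) set" where
  "W = {w \<in> VO. \<forall>g\<in>Inert. lact g w = w}"

lemma U_lin: "u \<in> U ==> \<phi> \<in> D ==> i < n ==> (%x. u (\<phi>, i, x)) \<in> lin"
  and U_VO: "u \<in> U ==> i < n ==> x \<in> S ==> (%\<phi>. u (\<phi>, i, x)) \<in> VO"
  and U_equiv: "u \<in> U ==> \<phi> \<in> D ==> i < n ==> x \<in> S ==> g \<in> G ==> u (ra \<phi> g, i, x) = u (\<phi>, i, g x)"
  and U_zero: "u \<in> U ==> \<phi> \<notin> D \<or> n \<le> i ==> u (\<phi>, i, x) = 0"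
  by (simp_all add: U_def)

lemma VOD:
  assumes "w \<in> VO"
  shows "\<phi> \<in> D ==> \<psi> \<in> D ==> w (ad \<phi> \<psi>) = w \<phi> + w \<psi>" "\<phi> \<in> D ==> w (sm c \<phi>) = jf c * w \<phi>" "\<phi> \<notin> D ==> w \<phi> = 0"
  using assms by (simp_all add: VO_def)

lemma VO_zero: "(%_. 0) \<in> VO" by (simp add: VO_def)

lemma VO_add: "v \<in> VO ==> w \<in> VO ==> (%\<phi>. v \<phi> + w \<phi>) \<in> VO"
  by (simp add: VO_def algebra_simps)

lemma VO_scale: "w \<in> VO ==> (%\<phi>. c * w \<phi>) \<in> VO"
  by (simp add: VO_def algebra_simps)

lemma VO_sum: "(!!i. i \<in> A ==> f i \<in> VO) ==> (%x. \<Sum>i\<in>A. f i x) \<in> VO"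
  by (induction A rule: infinite_finite_induct) (simp_all add: VO_zero VO_add)

lemma lact_VO: "w \<in> VO ==> g \<in> G ==> lact g w \<in> VO"
  using ad_D sm_D by (simp add: VO_def lact_def ra_ad ra_sm ra_D)

lemma lact_comp: "w \<in> VO ==> g \<in> G ==> h \<in> G ==> lact g (lact h w) = lact (g \<circ> h) w"
  by (rule HOL.ext) (simp add: lact_def ra_D ra_comp)

lemma inv_comp: "g \<in> G ==> inv_into UNIV g \<circ> g = id" "g \<in> G ==> g \<circ> inv_into UNIV g = id"
  using G_bij[of g] by (simp_all add: bij_is_inj bij_is_surj surj_iff[symmetric])

lemma inv_apply: "g \<in> G ==> inv_into UNIV g (g x) = x" "g \<in> G ==> g (inv_into UNIV g x) = x"
  using inv_comp by (metis comp_apply id_apply)+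

definition tw :: "('l => 'l) => ('l => 'o) => 'l => 'o" where
  "tw g f = (%x. if x \<in> S then f (g x) else 0)"

lemma tw_lin:
  assumes g: "g \<in> G" and f: "f \<in> lin" shows "tw g f \<in> lin"
  unfolding lin_def tw_def
proof (intro CollectI conjI ballI allI impI)
  note gr = rhomD[OF G_rhom[OF g]] note gS = G_S[OF g]
  fix x y assume x: "x \<in> S" and y: "y \<in> S"
  show "(if x + y \<in> S then f (g (x + y)) else 0) = (if x \<in> S then f (g x) else 0) + (if y \<in> S then f (g y) else 0)"
    using x y SD(3)[OF x y] gr(3)[OF x y] linD(1)[OF f gS[OF x] gS[OF y]] by simp
next
  fix c x assume x: "x \<in> S"
  show "(if kp c * x \<in> S then f (g (kp c * x)) else 0) = j c * (if x \<in> S then f (g x) else 0)"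
    using x SD(4)[OF kpS x] rhomD(4)[OF G_rhom[OF g] kpS x] linD(2)[OF f G_S[OF g x]] G_kp[OF g] by simp
next
  fix x assume x: "x \<in> Q"
  show "(if x \<in> S then f (g x) else 0) = 0" using linD(3)[OF f G_Q[OF g x]] by simp
qed simp

lemma tw_chars:
  assumes g: "g \<in> G" and \<chi>: "\<chi> \<in> chars" shows "tw g \<chi> \<in> chars"
proof -
  have "rhom S (tw g \<chi>)"
    unfolding rhom_def tw_def
    using rhomD[OF G_rhom[OF g]] rhomD[OF charsD(1)[OF \<chi>]] SD G_S[OF g] by simp
  moreover have "tw g \<chi> (kp c) = j c" for c using kpS G_kp[OF g] charsD(2)[OF \<chi>] by (simp add: tw_def)
  ultimately show ?thesis
    unfolding chars_def using linD(3,4)[OF tw_lin[OF g chars_lin[OF \<chi>]]] by simp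
qed

lemma tw_tw: "g \<in> G ==> tw g (tw h f) = tw (h \<circ> g) f"
  by (rule HOL.ext) (simp add: tw_def G_S)

lemma tw_id: "f \<in> lin ==> tw id f = f"
  by (rule HOL.ext) (simp add: tw_def linD(4))

lemma tw_inj: "g \<in> G ==> f \<in> lin ==> f' \<in> lin ==> tw g f = tw g f' ==> f = f'"
  using tw_tw[OF G_inv, of g g] by (metis inv_comp(2) tw_id)

lemma frob_tw: "g \<in> G ==> frob i (tw g f) = tw g (frob i f)"
  by (rule HOL.ext) (simp add: frob_def tw_def S_power G_S rhom_power[OF G_rhom S])

lemma frob_d': "frob d \<chi>0 = tw \<gamma> \<chi>0"
proof
  fix x show "frob d \<chi>0 x = tw \<gamma> \<chi>0 x"
    by (cases "x \<in> S") (simp_all add: frob_def tw_def rhom_power[OF charsD(1)[OF \<chi>0] S] frob_d)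
qed

text \<open>All members take the same value at z (\<open>O0_z\<close>), because z is fixed by
  \<open>G\<close>. Therefore the scalar picked up at each Frobenius step is common to the whole
  orbit.\<close>

definition O0 :: "('l => 'o) set" where "O0 = (%g. tw g \<chi>0) ` G"

lemma O0_chars: "O0 \<subseteq> chars" unfolding O0_def using tw_chars[OF _ \<chi>0] by blast

lemma O0_fin: "finite O0" unfolding O0_def using G_fin by simp

lemma O0_z:
  assumes "\<chi> \<in> O0" shows "\<chi> z = \<chi>0 z"
proof -
  obtain g where "g \<in> G" "\<chi> = tw g \<chi>0" using assms unfolding O0_def by (rule imageE)
  then show ?thesis using zS by (simp add: tw_def G_z)
qed

lemma tw_O0:
  assumes g: "g \<in> G" shows "bij_betw (tw g) O0 O0"
proof -
  have "tw g ` O0 \<subseteq> O0"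
  proof (rule image_subsetI)
    fix \<chi> assume "\<chi> \<in> O0"
    then obtain h where h: "h \<in> G" "\<chi> = tw h \<chi>0" unfolding O0_def by (rule imageE)
    then show "tw g \<chi> \<in> O0" using tw_tw[OF g] G_comp[OF h(1) g] unfolding O0_def by simp
  qed
  moreover have "inj_on (tw g) O0"
    by (rule inj_onI) (rule tw_inj[OF g chars_lin[OF subsetD[OF O0_chars]] chars_lin[OF subsetD[OF O0_chars]]])
  ultimately show ?thesis using O0_fin by (simp add: bij_betw_def endo_inj_surj)
qed

lemma frob_d_O0: "bij_betw (frob d) O0 O0"
proof -
  have "frob d ` O0 \<subseteq> O0"
  proof (rule image_subsetI)
    fix \<chi> assume "\<chi> \<in> O0"
    then obtain h where h: "h \<in> G" "\<chi> = tw h \<chi>0" unfolding O0_def by (rule imageE)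
    then show "frob d \<chi> \<in> O0" using G_comp[OF \<gamma> h(1)] unfolding O0_def by (simp add: frob_tw frob_d' tw_tw)
  qed
  moreover have "inj_on (frob d) O0"
    by (rule inj_onI) (rule frob_char_inj[OF subsetD[OF O0_chars] subsetD[OF O0_chars]])
  ultimately show ?thesis using O0_fin by (simp add: bij_betw_def endo_inj_surj)
qed

text \<open>The equivariant extension to the orbit \<open>O0\<close> of the value \<open>w\<close>
  at \<open>\<chi>0\<close>. The choice of the group element is harmless for \<open>w\<close> in
  \<open>W\<close>, since two choices differ by an element of \<open>Inert\<close>
  (\<open>vv_tw\<close>).\<close>

definition vv :: "('x => 'o) => ('l => 'o) => 'x => 'o" where
  "vv w \<chi> = lact (inv_into UNIV (SOME g. g \<in> G \<and> \<chi> = tw g \<chi>0)) w"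

lemma W_VO: "w \<in> W ==> w \<in> VO" by (simp add: W_def)

lemma vv_tw:
  assumes w: "w \<in> W" and g: "g \<in> G" shows "vv w (tw g \<chi>0) = lact (inv_into UNIV g) w"
proof -
  define h where "h = (SOME h. h \<in> G \<and> tw g \<chi>0 = tw h \<chi>0)"
  have h: "h \<in> G" "tw g \<chi>0 = tw h \<chi>0" using someI[of "%h. h \<in> G \<and> tw g \<chi>0 = tw h \<chi>0" g] g by (simp_all add: h_def)
  have "h \<circ> inv_into UNIV g \<in> Inert"
    unfolding Inert_def
  proof (intro CollectI conjI ballI)
    show "h \<circ> inv_into UNIV g \<in> G" by (intro G_comp h G_inv g)
    fix x assume x: "x \<in> S"
    then have "inv_into UNIV g x \<in> S" using G_S[OF G_inv[OF g]] by blast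
    then show "\<chi>0 ((h \<circ> inv_into UNIV g) x) = \<chi>0 x"
      using fun_cong[OF h(2), of "inv_into UNIV g x"] inv_apply(2)[OF g] by (simp add: tw_def)
  qed
  then have "lact (h \<circ> inv_into UNIV g) w = w" using w by (simp add: W_def)
  then have "lact (inv_into UNIV h) w = lact (inv_into UNIV h) (lact (h \<circ> inv_into UNIV g) w)" by simp
  also have "\<dots> = lact (inv_into UNIV h \<circ> (h \<circ> inv_into UNIV g)) w" by (intro lact_comp W_VO w G_inv G_comp h g)
  also have "inv_into UNIV h \<circ> (h \<circ> inv_into UNIV g) = inv_into UNIV g" using inv_comp(1)[OF h(1)] by (simp add: comp_assoc[symmetric])
  finally show ?thesis unfolding vv_def h_def[symmetric] .
qed

lemma vv_VO: "w \<in> W ==> \<chi> \<in> O0 ==> vv w \<chi> \<in> VO"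
proof -
  assume w: "w \<in> W" and "\<chi> \<in> O0"
  then obtain g where "g \<in> G" "\<chi> = tw g \<chi>0" unfolding O0_def by blast
  then show ?thesis using vv_tw[OF w] lact_VO[OF W_VO[OF w] G_inv] by simp
qed

lemma inv_comp_dist: "g \<in> G ==> h \<in> G ==> inv_into UNIV (g \<circ> h) = inv_into UNIV h \<circ> inv_into UNIV g"
  using G_bij by (simp add: o_inv_distrib)

lemma inv_inv_G: "g \<in> G ==> inv_into UNIV (inv_into UNIV g) = g" using G_bij by (simp add: inv_inv_eq)

lemma vv_equiv:
  assumes w: "w \<in> W" and g: "g \<in> G" and \<chi>: "\<chi> \<in> O0"
  shows "lact g (vv w (tw g \<chi>)) = vv w \<chi>"
proof -
  obtain h where h: "h \<in> G" "\<chi> = tw h \<chi>0" using \<chi> unfolding O0_def by blast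
  have "vv w (tw g \<chi>) = lact (inv_into UNIV (h \<circ> g)) w" using h vv_tw[OF w G_comp[OF h(1) g]] tw_tw[OF g] by simp
  then have "lact g (vv w (tw g \<chi>)) = lact (g \<circ> inv_into UNIV (h \<circ> g)) w"
    using lact_comp[OF W_VO[OF w] g G_inv[OF G_comp[OF h(1) g]]] by simp
  also have "g \<circ> inv_into UNIV (h \<circ> g) = inv_into UNIV h"
    using inv_comp(2)[OF g] by (simp add: inv_comp_dist[OF h(1) g] comp_assoc[symmetric])
  finally show ?thesis using h vv_tw[OF w h(1)] by simp
qed

text \<open>Induction from the inertia group: an invariant vector becomes an equivariant combination
  of the characters in its orbit. It sits in the last coordinate because \<open>sig\<close> reads no
  other.\<close>

definition emb :: "('x => 'o) => 'x \<times> nat \<times> 'l => 'o" where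
  "emb w = (%(\<phi>, i, x). if i = n - 1 \<and> \<phi> \<in> D then (\<Sum>\<chi>\<in>O0. vv w \<chi> \<phi> * \<chi> x) else 0)"

lemma emb_U:
  assumes w: "w \<in> W" shows "emb w \<in> U"
  unfolding U_def
proof (intro CollectI conjI ballI allI impI)
  fix \<phi> i assume \<phi>: "\<phi> \<in> D" and i: "i < n"
  show "(%x. emb w (\<phi>, i, x)) \<in> lin"
    using \<phi> lin_zero lin_sum[of O0 "%\<chi> x. vv w \<chi> \<phi> * \<chi> x", OF lin_scale[OF chars_lin[OF subsetD[OF O0_chars]]]]
    by (cases "i = n - 1") (simp_all add: emb_def)
next
  fix i x assume i: "i < n" and x: "x \<in> S"
  have "(%\<phi>. \<Sum>\<chi>\<in>O0. \<chi> x * vv w \<chi> \<phi>) \<in> VO" by (intro VO_sum VO_scale vv_VO w)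
  moreover have "(%\<phi>. \<Sum>\<chi>\<in>O0. \<chi> x * vv w \<chi> \<phi>) = (%\<phi>. if \<phi> \<in> D then (\<Sum>\<chi>\<in>O0. vv w \<chi> \<phi> * \<chi> x) else 0)"
  proof
    fix \<phi>
    have "(\<Sum>\<chi>\<in>O0. \<chi> x * vv w \<chi> \<phi>) = 0" if "\<phi> \<notin> D" by (rule sum.neutral) (simp add: VOD(3)[OF vv_VO[OF w] that])
    then show "(\<Sum>\<chi>\<in>O0. \<chi> x * vv w \<chi> \<phi>) = (if \<phi> \<in> D then (\<Sum>\<chi>\<in>O0. vv w \<chi> \<phi> * \<chi> x) else 0)" by (simp add: mult.commute)
  qed
  ultimately show "(%\<phi>. emb w (\<phi>, i, x)) \<in> VO" using VO_zero by (cases "i = n - 1") (simp_all add: emb_def)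
next
  fix \<phi> i x g assume \<phi>: "\<phi> \<in> D" and i: "i < n" and x: "x \<in> S" and g: "g \<in> G"
  have "(\<Sum>\<chi>\<in>O0. vv w \<chi> (ra \<phi> g) * \<chi> x) = (\<Sum>\<chi>\<in>O0. lact g (vv w \<chi>) \<phi> * \<chi> x)" using \<phi> by (simp add: lact_def)
  also have "\<dots> = (\<Sum>\<chi>\<in>O0. lact g (vv w (tw g \<chi>)) \<phi> * tw g \<chi> x)"
    by (rule sum.reindex_bij_betw[OF tw_O0[OF g], symmetric])
  also have "\<dots> = (\<Sum>\<chi>\<in>O0. vv w \<chi> \<phi> * \<chi> (g x))"
  proof (rule sum.cong[OF refl])
    fix \<chi> assume "\<chi> \<in> O0"
    moreover have "tw g \<chi> x = \<chi> (g x)" using x by (simp add: tw_def)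
    ultimately show "lact g (vv w (tw g \<chi>)) \<phi> * tw g \<chi> x = vv w \<chi> \<phi> * \<chi> (g x)"
      by (simp only: vv_equiv[OF w g])
  qed
  finally have e: "(\<Sum>\<chi>\<in>O0. vv w \<chi> (ra \<phi> g) * \<chi> x) = (\<Sum>\<chi>\<in>O0. vv w \<chi> \<phi> * \<chi> (g x))" .
  show "emb w (ra \<phi> g, i, x) = emb w (\<phi>, i, g x)"
    unfolding emb_def prod.case e using \<phi> ra_D[OF \<phi> g] by (simp only: simp_thms)
next
  fix \<phi> i x assume "\<phi> \<notin> D \<or> n \<le> i"
  then have "\<not> (i = n - 1 \<and> \<phi> \<in> D)" using n by linarith
  then show "emb w (\<phi>, i, x) = 0" unfolding emb_def prod.case by (rule if_not_P)
qed

lemma n1: "n - 1 < n" using n by simp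

lemma coef_tw:
  assumes f: "f \<in> lin" and g: "g \<in> G" and \<chi>: "\<chi> \<in> chars"
  shows "coef (tw g f) (tw g \<chi>) = coef f \<chi>"
proof -
  have "coef (tw g f) (tw g \<chi>) = coef f (tw (inv_into UNIV g) (tw g \<chi>))"
  proof (rule coef_unique[OF tw_lin[OF g f] _ tw_chars[OF g \<chi>], where c = "%\<psi>. coef f (tw (inv_into UNIV g) \<psi>)"])
    fix x assume x: "x \<in> S"
    have bij: "bij_betw (tw g) chars chars"
    proof -
      have "inj_on (tw g) chars" by (rule inj_onI) (rule tw_inj[OF g chars_lin chars_lin])
      moreover have "tw g ` chars \<subseteq> chars" using tw_chars[OF g] by blast
      ultimately show ?thesis using finite_chars by (simp add: bij_betw_def endo_inj_surj)
    qed
    have bk: "tw (inv_into UNIV g) (tw g \<psi>) = \<psi>" if "\<psi> \<in> chars" for \<psi>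
      using tw_tw[OF G_inv[OF g], of g \<psi>] tw_id[OF chars_lin[OF that]] inv_comp(2)[OF g] by simp
    have "frob N (tw g f) x = f (g x ^ (q ^ N))" using x by (simp add: frob_def tw_def S_power rhom_power[OF G_rhom[OF g] S])
    also have "\<dots> = (\<Sum>\<psi>\<in>chars. coef f \<psi> * \<psi> (g x))" by (rule coef_eval[OF f G_S[OF g x]])
    also have "\<dots> = (\<Sum>\<psi>\<in>chars. coef f (tw (inv_into UNIV g) (tw g \<psi>)) * tw g \<psi> x)"
      using x by (intro sum.cong refl) (simp only: bk, simp add: tw_def)
    also have "\<dots> = (\<Sum>\<psi>\<in>chars. coef f (tw (inv_into UNIV g) \<psi>) * \<psi> x)" by (rule sum.reindex_bij_betw[OF bij])
    finally show "frob N (tw g f) x = (\<Sum>\<psi>\<in>chars. coef f (tw (inv_into UNIV g) \<psi>) * \<psi> x)" .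
  qed
  also have "tw (inv_into UNIV g) (tw g \<chi>) = \<chi>"
    using tw_tw[OF G_inv[OF g], of g \<chi>] tw_id[OF chars_lin[OF \<chi>]] inv_comp(2)[OF g] by simp
  finally show ?thesis .
qed

text \<open>The coefficient at \<open>\<chi>0\<close> of the last component, as a function of
  \<open>\<phi>\<close>. By equivariance it determines the coefficients on all of \<open>O0\<close>,
  see \<open>coef_O0\<close>.\<close>

definition Pop :: "('x \<times> nat \<times> 'l => 'o) => 'x => 'o" where
  "Pop u = (%\<phi>. if \<phi> \<in> D then coef (%x. u (\<phi>, n - 1, x)) \<chi>0 else 0)"

abbreviation last_comp :: "('x \<times> nat \<times> 'l => 'o) => 'x => 'l => 'o" where
  "last_comp u \<phi> \<equiv> %x. u (\<phi>, n - 1, x)"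

lemma last_lin: "u \<in> U ==> \<phi> \<in> D ==> last_comp u \<phi> \<in> lin" by (rule U_lin[OF _ _ n1])

lemma last_tw: "u \<in> U ==> \<phi> \<in> D ==> g \<in> G ==> last_comp u (ra \<phi> g) = tw g (last_comp u \<phi>)"
proof
  fix x assume u: "u \<in> U" and \<phi>: "\<phi> \<in> D" and g: "g \<in> G"
  show "u (ra \<phi> g, n - 1, x) = tw g (last_comp u \<phi>) x"
    using U_equiv[OF u \<phi> n1 _ g, of x] linD(4)[OF last_lin[OF u ra_D[OF \<phi> g]], of x]
    by (cases "x \<in> S") (simp_all add: tw_def)
qed

lemma Pop_W:
  assumes u: "u \<in> U" shows "Pop u \<in> W"
proof -
  have "Pop u \<in> VO"
    unfolding VO_def
  proof (intro CollectI conjI ballI allI impI)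
    fix \<phi> \<psi> assume \<phi>: "\<phi> \<in> D" and \<psi>: "\<psi> \<in> D"
    have "last_comp u (ad \<phi> \<psi>) = (%x. last_comp u \<phi> x + last_comp u \<psi> x)"
    proof
      fix x show "u (ad \<phi> \<psi>, n - 1, x) = u (\<phi>, n - 1, x) + u (\<psi>, n - 1, x)"
        using VOD(1)[OF U_VO[OF u n1] \<phi> \<psi>, of x] linD(4)[OF last_lin[OF u], of _ x] ad_D[OF \<phi> \<psi>] \<phi> \<psi>
        by (cases "x \<in> S") simp_all
    qed
    then show "Pop u (ad \<phi> \<psi>) = Pop u \<phi> + Pop u \<psi>"
      using \<phi> \<psi> ad_D coef_add[OF last_lin[OF u \<phi>] last_lin[OF u \<psi>] \<chi>0] by (simp add: Pop_def)
  next
    fix c \<phi> assume \<phi>: "\<phi> \<in> D"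
    have "last_comp u (sm c \<phi>) = (%x. jf c * last_comp u \<phi> x)"
    proof
      fix x show "u (sm c \<phi>, n - 1, x) = jf c * u (\<phi>, n - 1, x)"
        using VOD(2)[OF U_VO[OF u n1] \<phi>, of x] linD(4)[OF last_lin[OF u], of _ x] sm_D[OF \<phi>] \<phi>
        by (cases "x \<in> S") simp_all
    qed
    then show "Pop u (sm c \<phi>) = jf c * Pop u \<phi>"
      using \<phi> sm_D coef_scale[OF last_lin[OF u \<phi>] \<chi>0] by (simp add: Pop_def)
  qed (simp add: Pop_def)
  moreover have "lact g (Pop u) = Pop u" if "g \<in> Inert" for g
  proof
    fix \<phi>
    have g: "g \<in> G" using that by (simp add: Inert_def)
    have "tw g \<chi>0 = \<chi>0"
    proof
      fix x show "tw g \<chi>0 x = \<chi>0 x" using that charsD(4)[OF \<chi>0, of x] by (cases "x \<in> S") (simp_all add: tw_def Inert_def)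
    qed
    then show "lact g (Pop u) \<phi> = Pop u \<phi>"
      using coef_tw[OF last_lin[OF u] g \<chi>0, of \<phi>] last_tw[OF u _ g, of \<phi>] ra_D[OF _ g, of \<phi>]
      by (cases "\<phi> \<in> D") (simp_all add: lact_def Pop_def)
  qed
  ultimately show ?thesis by (simp add: W_def)
qed

text \<open>A twist by a group element moves any member of the orbit to \<open>\<chi>0\<close>, and
  equivariance of \<open>u\<close> moves it over to the argument \<open>\<phi>\<close>.\<close>

lemma coef_O0:
  assumes u: "u \<in> U" and \<phi>: "\<phi> \<in> D" and \<chi>: "\<chi> \<in> O0"
  shows "coef (last_comp u \<phi>) \<chi> = vv (Pop u) \<chi> \<phi>"
proof -
  obtain g where g: "g \<in> G" "\<chi> = tw g \<chi>0" using \<chi> unfolding O0_def by blast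
  have \<phi>': "ra \<phi> (inv_into UNIV g) \<in> D" by (rule ra_D[OF \<phi> G_inv[OF g(1)]])
  have "ra (ra \<phi> (inv_into UNIV g)) g = \<phi>" using ra_comp[OF \<phi> G_inv[OF g(1)] g(1)] ra_id[OF \<phi>] inv_comp(1)[OF g(1)] by simp
  then have "last_comp u \<phi> = tw g (last_comp u (ra \<phi> (inv_into UNIV g)))" using last_tw[OF u \<phi>' g(1)] by simp
  then have "coef (last_comp u \<phi>) \<chi> = coef (last_comp u (ra \<phi> (inv_into UNIV g))) \<chi>0"
    using coef_tw[OF last_lin[OF u \<phi>'] g(1) \<chi>0] g(2) by simp
  also have "\<dots> = lact (inv_into UNIV g) (Pop u) \<phi>" using \<phi> \<phi>' by (simp add: lact_def Pop_def)
  finally show ?thesis using vv_tw[OF Pop_W[OF u] g(1)] g(2) by simp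
qed

text \<open>A filtration of the nilpotent elements modulo \<open>Q\<close>, by the number of
  Frobenius steps that kill them.\<close>

definition Kj :: "nat => 'l set" where "Kj i = {x \<in> S. x ^ (q ^ i) \<in> Q}"

lemma Kj_S: "Kj i \<subseteq> S" by (auto simp: Kj_def)

lemma Kj_mult: "x \<in> S ==> y \<in> Kj i ==> x * y \<in> Kj i"
  using QD(4) SD(4) S_power by (simp add: Kj_def power_mult_distrib)

lemma Kj_Suc: "x \<in> Kj (Suc i) ==> x ^ q \<in> Kj i"
  using S_power by (simp add: Kj_def power_mult[symmetric] mult.commute)

lemma char_Kj: "\<chi> \<in> chars ==> x \<in> Kj i ==> \<chi> x = 0"
proof -
  assume \<chi>: "\<chi> \<in> chars" and x: "x \<in> Kj i"
  have "\<chi> x ^ (q ^ i) = 0" using x charsD(3)[OF \<chi>] rhom_power[OF charsD(1)[OF \<chi>] S, of x "q ^ i"] by (simp add: Kj_def)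
  then show ?thesis by simp
qed

text \<open>Idempotence of the N-th Frobenius power puts x - x^(q^N) into \<open>Kj N\<close>, so
  \<open>f\<close> cannot distinguish x from x^(q^N), and on such powers it is a combination of
  characters.\<close>

lemma Kj_N_stable:
  assumes f: "f \<in> lin" and v: "!!x. x \<in> Kj N ==> f x = 0" shows "f = (%x. \<Sum>\<chi>\<in>chars. coef f \<chi> * \<chi> x)"
proof
  fix x show "f x = (\<Sum>\<chi>\<in>chars. coef f \<chi> * \<chi> x)"
  proof (cases "x \<in> S")
    case True
    have "(x - x ^ (q ^ N)) ^ (q ^ N) = - (x ^ (q ^ (N + N)) - x ^ (q ^ N))"
      unfolding diff_power_card_power[OF kp, folded q_def] by (simp add: power_add power_mult[symmetric])
    then have "x - x ^ (q ^ N) \<in> Kj N" unfolding Kj_def using QD(6)[OF N(2)[OF True]] SD(6)[OF True S_power[OF True]] by simp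
    then have "f x = f (x ^ (q ^ N))" using v lin_diff[OF f True S_power[OF True]] by fastforce
    then show ?thesis using coef_eval[OF f True] by simp
  qed (simp add: linD(4)[OF f] charsD(4))
qed

text \<open>A decreasing filtration of the characters by position on the Frobenius cycle: everything
  at 0, nothing at d. A Frobenius step raises the index by one once the members of
  \<open>O0\<close>, where the cycle closes, have been removed (\<open>frob_1_Ti\<close>).\<close>

definition Ti :: "nat => ('l => 'o) set" where
  "Ti i = {\<chi>. \<exists>l g. i < l \<and> l \<le> d \<and> g \<in> G \<and> \<chi> = frob l (tw g \<chi>0)}"

lemma Ti_chars: "Ti i \<subseteq> chars" unfolding Ti_def using frob_chars tw_chars \<chi>0 by blast

lemma Ti_fin: "finite (Ti i)" by (rule finite_subset[OF Ti_chars finite_chars])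

lemma Ti_0: "chars \<subseteq> Ti 0"
proof
  fix \<chi> assume \<chi>: "\<chi> \<in> chars"
  obtain i g where ig: "0 < i" "i \<le> d" "g \<in> G" "\<forall>x\<in>S. \<chi> x = \<chi>0 (g x) ^ (q ^ i)" using orbit[OF \<chi>] by blast
  have "\<chi> = frob i (tw g \<chi>0)"
  proof
    fix x
    have "frob i (tw g \<chi>0) x = tw g \<chi>0 x ^ (q ^ i)" by (rule frob_char[OF tw_chars[OF ig(3) \<chi>0]])
    then show "\<chi> x = frob i (tw g \<chi>0) x"
      using ig(4) charsD(4)[OF \<chi>, of x] q1(2) by (cases "x \<in> S") (simp_all add: tw_def)
  qed
  then show "\<chi> \<in> Ti 0" unfolding Ti_def using ig by blast
qed

lemma Ti_d: "Ti d = {}" by (auto simp: Ti_def)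

lemma frob_1_Ti: "\<chi> \<in> Ti i - O0 ==> frob 1 \<chi> \<in> Ti (Suc i)"
proof -
  assume \<chi>: "\<chi> \<in> Ti i - O0"
  then obtain l g where lg: "i < l" "l \<le> d" "g \<in> G" "\<chi> = frob l (tw g \<chi>0)" unfolding Ti_def by blast
  have "l ~= d"
  proof
    assume "l = d"
    then have "\<chi> = tw (\<gamma> \<circ> g) \<chi>0" using lg by (simp add: frob_tw frob_d' tw_tw)
    then show False using \<chi> G_comp[OF \<gamma> lg(3)] unfolding O0_def by blast
  qed
  then have "frob 1 \<chi> = frob (Suc l) (tw g \<chi>0)" "Suc i < Suc l" "Suc l \<le> d" using lg by (simp_all add: frob_frob)
  then show ?thesis unfolding Ti_def using lg(3) by blast
qed

text \<open>The family may repeat characters; the coefficients of coinciding members add up.\<close>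

lemma coef_family:
  assumes fin: "finite J" and \<chi>: "!!i. i \<in> J ==> f i \<in> chars" and \<psi>: "\<psi> \<in> chars"
  shows "coef (%x. \<Sum>i\<in>J. c i * f i x) \<psi> = (\<Sum>i\<in>{i \<in> J. f i = \<psi>}. c i)"
proof -
  have "(\<Sum>i\<in>J. c i * f i x) = (\<Sum>\<chi>\<in>chars. (\<Sum>i\<in>{i \<in> J. f i = \<chi>}. c i) * \<chi> x)" for x
  proof -
    have "(\<Sum>\<chi>\<in>chars. (\<Sum>i\<in>{i \<in> J. f i = \<chi>}. c i) * \<chi> x) = (\<Sum>\<chi>\<in>chars. \<Sum>i\<in>{i \<in> J. f i = \<chi>}. c i * f i x)"
      by (simp add: sum_distrib_right)
    also have "\<dots> = (\<Sum>i\<in>J. c i * f i x)" using \<chi> by (intro sum.group fin finite_chars) blast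
    finally show ?thesis by simp
  qed
  then have "(%x. \<Sum>i\<in>J. c i * f i x) = (%x. \<Sum>\<chi>\<in>chars. (\<Sum>i\<in>{i \<in> J. f i = \<chi>}. c i) * \<chi> x)" by blast
  then show ?thesis using coef_comb[OF \<psi>, of "%\<chi>. \<Sum>i\<in>{i \<in> J. f i = \<chi>}. c i"] by simp
qed

end

context local_prime
begin

lemma UI:
  assumes "!!\<phi> i. \<phi> \<in> D ==> i < n ==> (%x. u (\<phi>, i, x)) \<in> lin"
    and "!!i x. i < n ==> x \<in> S ==> (%\<phi>. u (\<phi>, i, x)) \<in> VO"
    and "!!\<phi> i x g. \<phi> \<in> D ==> i < n ==> x \<in> S ==> g \<in> G ==> u (ra \<phi> g, i, x) = u (\<phi>, i, g x)"
    and "!!\<phi> i x. \<phi> \<notin> D \<or> n \<le> i ==> u (\<phi>, i, x) = 0"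
  shows "u \<in> U"
  unfolding U_def using assms by simp

lemma zero_U: "(%_. 0) \<in> U"
  by (simp add: U_def lin_zero VO_zero)

lemma add_U: "u \<in> U ==> v \<in> U ==> (%y. u y + v y) \<in> U"
  by (simp add: U_def lin_add VO_add)

lemma scale_U: "u \<in> U ==> (%y. c * u y) \<in> U"
  by (simp add: U_def lin_scale VO_scale)

lemma Lop_U: assumes u: "u \<in> U" shows "Lop u \<in> U"
proof (rule UI)
  fix \<phi> i assume \<phi>: "\<phi> \<in> D" and i: "i < n"
  have "(%x. if 0 < i then u (\<phi>, i - 1, x) else 0) \<in> lin"
    using U_lin[OF u \<phi>, of "i - 1"] i lin_zero by (cases "0 < i") simp_all
  from lin_add[OF mul_lin[OF zS U_lin[OF u \<phi> i]] this] show "(%x. Lop u (\<phi>, i, x)) \<in> lin" using i by (simp add: Lop_def)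
next
  fix i x assume i: "i < n" and x: "x \<in> S"
  have "(%\<phi>. if 0 < i then u (\<phi>, i - 1, x) else 0) \<in> VO"
    using U_VO[OF u _ x, of "i - 1"] i VO_zero by (cases "0 < i") simp_all
  from VO_add[OF U_VO[OF u i SD(4)[OF zS x]] this] show "(%\<phi>. Lop u (\<phi>, i, x)) \<in> VO" using i x by (simp add: Lop_def mul_def)
next
  fix \<phi> i x g assume \<phi>: "\<phi> \<in> D" and i: "i < n" and x: "x \<in> S" and g: "g \<in> G"
  have "g (z * x) = z * g x" using rhomD(4)[OF G_rhom[OF g] zS x] G_z[OF g] by simp
  then have "u (ra \<phi> g, i, z * x) = u (\<phi>, i, z * g x)" using U_equiv[OF u \<phi> i SD(4)[OF zS x] g] by simp
  moreover have "0 < i ==> u (ra \<phi> g, i - 1, x) = u (\<phi>, i - 1, g x)" using U_equiv[OF u \<phi> _ x g, of "i - 1"] i by simp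
  ultimately show "Lop u (ra \<phi> g, i, x) = Lop u (\<phi>, i, g x)" using i x G_S[OF g x] by (simp add: Lop_def mul_def)
next
  fix \<phi> i x assume a: "\<phi> \<notin> D \<or> n \<le> i"
  show "Lop u (\<phi>, i, x) = 0"
  proof (cases "i < n")
    case True
    then have "u (\<phi>, i', x') = 0" for i' x' using a by (intro U_zero[OF u]) simp
    then show ?thesis by (simp add: Lop_def mul_def)
  qed (simp add: Lop_def)
qed

lemma sig_U: assumes u: "u \<in> U" shows "sig u \<in> U"
proof (rule UI)
  fix \<phi> i assume \<phi>: "\<phi> \<in> D" and i: "i < n"
  show "(%x. sig u (\<phi>, i, x)) \<in> lin"
    using frob_lin[OF last_lin[OF u \<phi>], of 1] lin_zero by (cases "i = 0") (simp_all add: sig_def)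
next
  fix i x assume i: "i < n" and x: "x \<in> S"
  show "(%\<phi>. sig u (\<phi>, i, x)) \<in> VO"
    using U_VO[OF u n1 S_power[OF x], of "q ^ 1"] x VO_zero by (cases "i = 0") (simp_all add: sig_def frob_def)
next
  fix \<phi> i x g assume \<phi>: "\<phi> \<in> D" and i: "i < n" and x: "x \<in> S" and g: "g \<in> G"
  have "g (x ^ q) = g x ^ q" by (rule rhom_power[OF G_rhom[OF g] S x])
  then have "u (ra \<phi> g, n - 1, x ^ q) = u (\<phi>, n - 1, g x ^ q)" using U_equiv[OF u \<phi> n1 S_power[OF x] g, of q] by simp
  then show "sig u (ra \<phi> g, i, x) = sig u (\<phi>, i, g x)" using x G_S[OF g x] by (simp add: sig_def frob_def)
next
  fix \<phi> i x assume a: "\<phi> \<notin> D \<or> n \<le> i"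
  show "sig u (\<phi>, i, x) = 0"
  proof (cases "i = 0")
    case True
    then have "u (\<phi>, i', x') = 0" for i' x' using a n by (intro U_zero[OF u]) simp
    then show ?thesis by (simp add: sig_def frob_def)
  qed (simp add: sig_def)
qed

lemma poly_S: "poly (map_poly kp p) z \<in> S"
proof (induction p)
  case (pCons c p)
  interpret kp: field_hom kp by (rule kp)
  have "poly (map_poly kp (pCons c p)) z = kp c + z * poly (map_poly kp p) z" by (simp add: kp.map_poly_pCons_hom)
  then show ?case using SD(3)[OF kpS SD(4)[OF zS pCons.IH]] by simp
qed (simp add: SD)

lemma eigen_poly:
  assumes f: "f \<in> lin" and K: "K \<subseteq> S" "!!x. x \<in> K ==> z * x \<in> K" and ev: "!!x. x \<in> K ==> f (z * x) = s * f x"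
  shows "x \<in> K ==> f (poly (map_poly kp p) z * x) = poly (map_poly j p) s * f x"
proof (induction p arbitrary: x)
  case 0
  then show ?case using linD(3)[OF f QD(1)] by simp
next
  case (pCons c p)
  interpret kp: field_hom kp by (rule kp)
  interpret j: field_hom j by (rule j)
  have x: "x \<in> S" "z * x \<in> S" using pCons.prems K by blast+
  have "poly (map_poly kp (pCons c p)) z * x = kp c * x + poly (map_poly kp p) z * (z * x)"
    by (simp add: kp.map_poly_pCons_hom algebra_simps)
  then have "f (poly (map_poly kp (pCons c p)) z * x) = f (kp c * x) + f (poly (map_poly kp p) z * (z * x))"
    using linD(1)[OF f SD(4)[OF kpS x(1)] SD(4)[OF poly_S x(2)]] by simp
  also have "\<dots> = j c * f x + poly (map_poly j p) s * (s * f x)"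
    using linD(2)[OF f x(1)] pCons.IH[OF K(2)[OF pCons.prems]] ev[OF pCons.prems] by simp
  also have "\<dots> = poly (map_poly j (pCons c p)) s * f x" by (simp add: j.map_poly_pCons_hom algebra_simps)
  finally show ?case .
qed

lemma lin_on_comp: "lin_on A B f ==> lin_on B C g ==> lin_on A C (%x. g (f x))"
  by (simp add: lin_on_def)

lemma lact_add: "lact g (%\<phi>. v \<phi> + w \<phi>) = (%\<phi>. lact g v \<phi> + lact g w \<phi>)"
  and lact_scale: "lact g (%\<phi>. c * w \<phi>) = (%\<phi>. c * lact g w \<phi>)"
  by (simp_all add: lact_def fun_eq_iff)

lemma emb_lin: "lin_on W U emb"
  unfolding lin_on_def
proof (intro conjI ballI allI)
  show "emb w \<in> U" if "w \<in> W" for w by (rule emb_U[OF that])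
  fix v w
  have "(\<Sum>\<chi>\<in>O0. vv (%y. v y + w y) \<chi> \<phi> * \<chi> x) = (\<Sum>\<chi>\<in>O0. vv v \<chi> \<phi> * \<chi> x) + (\<Sum>\<chi>\<in>O0. vv w \<chi> \<phi> * \<chi> x)" for \<phi> x
    unfolding vv_def lact_add by (simp add: algebra_simps sum.distrib)
  then show "emb (%y. v y + w y) = (%x. emb v x + emb w x)" unfolding emb_def by (auto simp: fun_eq_iff)
next
  fix c w
  have "(\<Sum>\<chi>\<in>O0. vv (%y. c * w y) \<chi> \<phi> * \<chi> x) = c * (\<Sum>\<chi>\<in>O0. vv w \<chi> \<phi> * \<chi> x)" for \<phi> x
    unfolding vv_def lact_scale by (simp add: algebra_simps sum_distrib_left)
  then show "emb (%y. c * w y) = (%x. c * emb w x)" unfolding emb_def by (auto simp: fun_eq_iff)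
qed

lemma Pop_lin: "lin_on U W Pop"
  unfolding lin_on_def
proof (intro conjI ballI allI)
  show "Pop u \<in> W" if "u \<in> U" for u by (rule Pop_W[OF that])
  fix u v assume u: "u \<in> U" and v: "v \<in> U"
  show "Pop (%y. u y + v y) = (%x. Pop u x + Pop v x)"
    using coef_add[OF last_lin[OF u] last_lin[OF v] \<chi>0] by (simp add: Pop_def fun_eq_iff)
next
  fix c u assume u: "u \<in> U"
  show "Pop (%y. c * u y) = (%x. c * Pop u x)"
    using coef_scale[OF last_lin[OF u] \<chi>0] by (simp add: Pop_def fun_eq_iff)
qed

text \<open>Within one turn the orbit meets \<open>\<chi>0\<close> exactly once, at step d and at
  the twist by the inverse of \<open>\<gamma>\<close>. This isolates the surviving term in
  \<open>Pop_Yop\<close>.\<close>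

lemma frob_O0_eq_\<chi>0:
  assumes i: "0 < i" "i \<le> d" and \<chi>: "\<chi> \<in> O0" and eq: "frob i \<chi> = \<chi>0"
  shows "i = d \<and> \<chi> = tw (inv_into UNIV \<gamma>) \<chi>0"
proof -
  obtain g where g: "g \<in> G" "\<chi> = tw g \<chi>0" using \<chi> unfolding O0_def by blast
  have "i = d"
  proof (rule ccontr)
    assume "i ~= d"
    then obtain x where x: "x \<in> S" "\<chi>0 x ^ (q ^ i) ~= \<chi>0 (inv_into UNIV g x)"
      using disjoint[of i "inv_into UNIV g"] i G_inv[OF g(1)] by auto
    have y: "inv_into UNIV g x \<in> S" by (rule G_S[OF G_inv[OF g(1)] x(1)])
    have "frob i \<chi> (inv_into UNIV g x) = \<chi>0 x ^ (q ^ i)"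
      using frob_char[OF tw_chars[OF g(1) \<chi>0], of i] y inv_apply(2)[OF g(1)] unfolding g(2) by (simp add: tw_def)
    then show False using x(2) eq by simp
  qed
  moreover have "frob d (tw (inv_into UNIV \<gamma>) \<chi>0) = \<chi>0"
    unfolding frob_tw[OF G_inv[OF \<gamma>]] frob_d' tw_tw[OF G_inv[OF \<gamma>]] inv_comp(2)[OF \<gamma>] by (rule tw_id[OF chars_lin[OF \<chi>0]])
  ultimately show ?thesis
    using frob_char_inj[OF subsetD[OF O0_chars \<chi>] tw_chars[OF G_inv[OF \<gamma>] \<chi>0], of d] eq by simp
qed

lemma frob_d_tw_inv: "frob d (tw (inv_into UNIV \<gamma>) \<chi>0) = \<chi>0"
  unfolding frob_tw[OF G_inv[OF \<gamma>]] frob_d' tw_tw[OF G_inv[OF \<gamma>]] inv_comp(2)[OF \<gamma>] by (rule tw_id[OF chars_lin[OF \<chi>0]])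

end

section \<open>The resolvent at a generic point\<close>

text \<open>\<open>det_s\<close> makes s - L invertible. The polynomial \<open>e\<close> kills S/Q
  when evaluated at z but is nonzero at \<open>s\<close>, so \<open>s\<close> is no eigenvalue of
  multiplication by z on functionals; every vanishing or uniqueness claim about solutions rests on
  this.\<close>

locale local_det = local_prime +
  fixes kpU m LM SM kpW r \<Phi> s e
  assumes U_iso: "coord_iso U kpU m" and LM: "LM \<in> carrier_mat m m" and SM: "SM \<in> carrier_mat m m"
    and LM_eq: "!!u. u \<in> U ==> kpU (Lop u) = LM *\<^sub>v kpU u" and SM_eq: "!!u. u \<in> U ==> kpU (sig u) = SM *\<^sub>v kpU u"
    and W_iso: "coord_iso W kpW r" and \<Phi>: "\<Phi> \<in> carrier_mat r r"
    and \<Phi>_eq: "!!w. w \<in> W ==> kpW (lact \<gamma> w) = \<Phi> *\<^sub>v kpW w"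
    and det_s: "det (s \<cdot>\<^sub>m 1\<^sub>m m - LM) ~= 0"
    and e_Q: "poly (map_poly kp e) z \<in> Q" and e_s: "poly (map_poly j e) s ~= 0"
begin

text \<open>Evaluating \<open>f\<close> at e(z) x gives 0, because e(z) lies in \<open>Q\<close>,
  and also e(s) f(x), because \<open>f\<close> is an eigenfunctional on \<open>K\<close>.\<close>

lemma eigen_zero:
  assumes "f \<in> lin" "K \<subseteq> S" "!!x. x \<in> K ==> z * x \<in> K" "!!x. x \<in> K ==> f (z * x) = s * f x" "x \<in> K"
  shows "f x = 0"
proof -
  have "f (poly (map_poly kp e) z * x) = 0" using linD(3)[OF assms(1) QD(5)[OF e_Q]] assms(2,5) by blast
  then show ?thesis using eigen_poly[OF assms, of e] e_s by simp
qed

lemma s_neq_char: "\<chi> \<in> chars ==> s - \<chi> z ~= 0"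
proof
  assume \<chi>: "\<chi> \<in> chars" and "s - \<chi> z = 0"
  then have "\<chi> (z * x) = s * \<chi> x" if "x \<in> S" for x using rhomD(4)[OF charsD(1)[OF \<chi>] zS that] by simp
  then have "\<chi> 1 = 0" by (intro eigen_zero[OF chars_lin[OF \<chi>], of S]) (simp_all add: SD(4) zS SD(2))
  then show False using rhomD(2)[OF charsD(1)[OF \<chi>]] by simp
qed

definition AM where "AM = s \<cdot>\<^sub>m 1\<^sub>m m - LM"
definition BM where "BM = inverse (det AM) \<cdot>\<^sub>m adj_mat AM"
definition EM where "EM = BM * SM"

lemma AM: "AM \<in> carrier_mat m m" unfolding AM_def by (intro minus_carrier_mat LM)
lemma BM: "BM \<in> carrier_mat m m" using adj_mat(1)[OF AM] by (simp add: BM_def)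
lemma EM: "EM \<in> carrier_mat m m" using BM SM by (simp add: EM_def)

lemma AM_BM: "AM * BM = 1\<^sub>m m"
  unfolding BM_def mult_smult_distrib[OF AM adj_mat(1)[OF AM]] adj_mat(2)[OF AM]
  using det_s unfolding AM_def[symmetric] by (intro eq_matI) auto

lemma det_factor: "det (s \<cdot>\<^sub>m 1\<^sub>m m - (LM + SM)) = det (s \<cdot>\<^sub>m 1\<^sub>m m - LM) * det (1\<^sub>m m - EM)"
proof -
  have "AM * (1\<^sub>m m - EM) = AM * 1\<^sub>m m - AM * EM" by (rule mult_minus_distrib_mat[OF AM one_carrier_mat EM])
  also have "AM * EM = SM" unfolding EM_def assoc_mult_mat[OF AM BM SM, symmetric] AM_BM using SM by simp
  also have "AM * 1\<^sub>m m = AM" using AM by simp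
  also have "AM - SM = s \<cdot>\<^sub>m 1\<^sub>m m - (LM + SM)" unfolding AM_def using LM SM by (intro eq_matI) auto
  finally show ?thesis
    using det_mult[OF AM minus_carrier_mat[OF EM, of "1\<^sub>m m"]] unfolding AM_def[symmetric] by simp
qed

definition Eop where "Eop u = (SOME v. v \<in> U \<and> kpU v = EM *\<^sub>v kpU u)"

lemma Eop: assumes u: "u \<in> U" shows "Eop u \<in> U" "kpU (Eop u) = EM *\<^sub>v kpU u"
proof -
  have "EM *\<^sub>v kpU u \<in> carrier_vec m" using EM coord_iso_carrier[OF U_iso u] by simp
  then have "\<exists>v. v \<in> U \<and> kpU v = EM *\<^sub>v kpU u" using coord_iso_ex[OF U_iso] by blast
  from someI_ex[OF this] show "Eop u \<in> U" "kpU (Eop u) = EM *\<^sub>v kpU u" unfolding Eop_def by blast+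
qed

lemma Eop_lin: "lin_on U U Eop"
  unfolding lin_on_def
proof (intro conjI ballI allI)
  fix u v assume u: "u \<in> U" and v: "v \<in> U"
  note c = coord_iso_carrier[OF U_iso]
  have uv: "(%y. u y + v y) \<in> U" by (rule add_U[OF u v])
  show "Eop (%y. u y + v y) = (%y. Eop u y + Eop v y)"
  proof (rule coord_iso_inj[OF U_iso Eop(1)[OF uv] add_U[OF Eop(1)[OF u] Eop(1)[OF v]]])
    show "kpU (Eop (%y. u y + v y)) = kpU (%y. Eop u y + Eop v y)"
      unfolding Eop(2)[OF uv] coord_iso_add(2)[OF U_iso u v] coord_iso_add(2)[OF U_iso Eop(1)[OF u] Eop(1)[OF v]] Eop(2)[OF u] Eop(2)[OF v]
      by (rule mult_add_distrib_mat_vec[OF EM c[OF u] c[OF v]])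
  qed
next
  fix c u assume u: "u \<in> U"
  have cu: "(%y. c * u y) \<in> U" by (rule scale_U[OF u])
  show "Eop (%y. c * u y) = (%y. c * Eop u y)"
  proof (rule coord_iso_inj[OF U_iso Eop(1)[OF cu] scale_U[OF Eop(1)[OF u]]])
    show "kpU (Eop (%y. c * u y)) = kpU (%y. c * Eop u y)"
      unfolding Eop(2)[OF cu] coord_iso_scale(2)[OF U_iso u] coord_iso_scale(2)[OF U_iso Eop(1)[OF u]] Eop(2)[OF u]
      by (rule mult_mat_vec[OF EM coord_iso_carrier[OF U_iso u]])
  qed
qed (rule Eop(1))

lemma Eop_resolvent:
  assumes u: "u \<in> U" shows "s * Eop u y - Lop (Eop u) y = sig u y"
proof -
  note E = Eop(1)[OF u]
  have cE: "kpU (Eop u) \<in> carrier_vec m" and cu: "kpU u \<in> carrier_vec m" using coord_iso_carrier[OF U_iso] E u by blast+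
  have sE: "(%y. s * Eop u y) \<in> U" by (rule scale_U[OF E])
  have "kpU (%y. s * Eop u y - Lop (Eop u) y) = s \<cdot>\<^sub>v kpU (Eop u) - LM *\<^sub>v kpU (Eop u)"
    unfolding coord_iso_diff(2)[OF U_iso sE Lop_U[OF E]] coord_iso_scale(2)[OF U_iso E] LM_eq[OF E] ..
  also have "\<dots> = AM *\<^sub>v kpU (Eop u)"
  proof -
    have "AM *\<^sub>v kpU (Eop u) = (s \<cdot>\<^sub>m 1\<^sub>m m) *\<^sub>v kpU (Eop u) - LM *\<^sub>v kpU (Eop u)"
      unfolding AM_def by (rule minus_mult_distrib_mat_vec[OF _ LM cE]) simp
    also have "(s \<cdot>\<^sub>m 1\<^sub>m m) *\<^sub>v kpU (Eop u) = s \<cdot>\<^sub>v kpU (Eop u)"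
      using cE by (intro eq_vecI) (simp_all add: scalar_prod_def mult_delta_left mult_delta_right)
    finally show ?thesis by simp
  qed
  also have "\<dots> = (AM * BM) *\<^sub>v (SM *\<^sub>v kpU u)"
    unfolding Eop(2)[OF u] EM_def using AM BM SM cu by (simp add: assoc_mult_mat_vec[of _ m m])
  also have "\<dots> = kpU (sig u)" unfolding AM_BM SM_eq[OF u] using SM cu by simp
  finally have "(%y. s * Eop u y - Lop (Eop u) y) = sig u"
    by (intro coord_iso_inj[OF U_iso coord_iso_diff(1)[OF U_iso sE Lop_U[OF E]] sig_U[OF u]])
  then show ?thesis by (rule fun_cong)
qed

text \<open>The resolvent equation read coordinate by coordinate: coordinate 0 is driven by the
  Frobenius of the last component of \<open>u\<close>, every later coordinate by its
  predecessor.\<close>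

lemma Eop_comp:
  assumes u: "u \<in> U" and \<phi>: "\<phi> \<in> D" and x: "x \<in> S"
  shows "Eop u (\<phi>, 0, z * x) = s * Eop u (\<phi>, 0, x) - u (\<phi>, n - 1, x ^ q)"
    and "Suc i < n ==> Eop u (\<phi>, Suc i, z * x) = s * Eop u (\<phi>, Suc i, x) - Eop u (\<phi>, i, x)"
  using Eop_resolvent[OF u, of "(\<phi>, 0, x)"] Eop_resolvent[OF u, of "(\<phi>, Suc i, x)"] n x
  by (simp_all add: Lop_def sig_def mul_def frob_def algebra_simps)

text \<open>The q-th power maps \<open>Kj (Suc k)\<close> into \<open>Kj k\<close>, so the driving
  term vanishes there and each coordinate in turn is an eigenfunctional for \<open>s\<close>, hence
  zero.\<close>

lemma Eop_vanish:
  assumes u: "u \<in> U" and \<phi>: "\<phi> \<in> D" and v: "!!x. x \<in> Kj k ==> u (\<phi>, n - 1, x) = 0"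
  shows "i < n ==> x \<in> Kj (Suc k) ==> Eop u (\<phi>, i, x) = 0"
proof (induction i arbitrary: x)
  case 0
  show ?case
  proof (rule eigen_zero[OF U_lin[OF Eop(1)[OF u] \<phi> 0(1)] Kj_S Kj_mult[OF zS] _ 0(2)])
    fix x assume x: "x \<in> Kj (Suc k)"
    then have "u (\<phi>, n - 1, x ^ q) = 0" by (intro v Kj_Suc)
    then show "Eop u (\<phi>, 0, z * x) = s * Eop u (\<phi>, 0, x)" using Eop_comp(1)[OF u \<phi>, of x] x Kj_S by fastforce
  qed
next
  case (Suc i)
  show ?case
  proof (rule eigen_zero[OF U_lin[OF Eop(1)[OF u] \<phi> Suc.prems(1)] Kj_S Kj_mult[OF zS] _ Suc.prems(2)])
    fix x assume x: "x \<in> Kj (Suc k)"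
    have "Eop u (\<phi>, i, x) = 0" using Suc.IH[OF _ x] Suc.prems(1) by simp
    then show "Eop u (\<phi>, Suc i, z * x) = s * Eop u (\<phi>, Suc i, x)"
      using Eop_comp(2)[OF u \<phi> _ Suc.prems(1), of x] x Kj_S by fastforce
  qed
qed

text \<open>The explicit sum \<open>h\<close> satisfies the recursion of \<open>Eop_comp\<close>,
  since \<open>frob 1\<close> of a character has eigenvalue \<open>f i z ^ q\<close>; the difference
  is an eigenfunctional for \<open>s\<close> and vanishes. In the last coordinate the exponent is n,
  the origin of the n-th power of |kappa_p|.\<close>

lemma Eop_chars:
  assumes u: "u \<in> U" and \<phi>: "\<phi> \<in> D" and J: "finite J" "!!i. i \<in> J ==> f i \<in> chars"
    and last: "!!x. x \<in> S ==> u (\<phi>, n - 1, x) = (\<Sum>i\<in>J. c i * f i x)"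
  shows "k < n ==> x \<in> S ==> Eop u (\<phi>, k, x) = (\<Sum>i\<in>J. c i * inverse (s - f i z ^ q) ^ Suc k * frob 1 (f i) x)"
proof -
  define h where "h = (%k x. \<Sum>i\<in>J. c i * inverse (s - f i z ^ q) ^ Suc k * frob 1 (f i) x)"
  have hl: "h k \<in> lin" for k unfolding h_def by (intro lin_sum lin_scale chars_lin frob_chars J(2))
  have fz: "frob 1 (f i) x = f i x ^ q" if "i \<in> J" for i x using frob_char[OF J(2)[OF that], of 1] by simp
  have nz: "s - f i z ^ q ~= 0" if "i \<in> J" for i using s_neq_char[OF frob_chars[OF J(2)[OF that]], of 1] fz[OF that] by simp
  have hz: "h k (z * x) = s * h k x - (\<Sum>i\<in>J. c i * inverse (s - f i z ^ q) ^ k * frob 1 (f i) x)" if x: "x \<in> S" for k x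
  proof -
    have "c i * inverse (s - f i z ^ q) ^ Suc k * frob 1 (f i) (z * x) =
        s * (c i * inverse (s - f i z ^ q) ^ Suc k * frob 1 (f i) x) - c i * inverse (s - f i z ^ q) ^ k * frob 1 (f i) x"
      if i: "i \<in> J" for i
    proof -
      have "inverse (s - f i z ^ q) * (s - f i z ^ q) = 1" using nz[OF i] by simp
      then have e: "inverse (s - f i z ^ q) * f i z ^ q = s * inverse (s - f i z ^ q) - 1" by (simp add: algebra_simps)
      have "c i * inverse (s - f i z ^ q) ^ Suc k * frob 1 (f i) (z * x) =
          c i * inverse (s - f i z ^ q) ^ k * (inverse (s - f i z ^ q) * f i z ^ q) * frob 1 (f i) x"
        unfolding fz[OF i] rhomD(4)[OF charsD(1)[OF J(2)[OF i]] zS x] by (simp add: power_mult_distrib algebra_simps)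
      then show ?thesis unfolding e by (simp add: algebra_simps)
    qed
    then show ?thesis unfolding h_def by (simp only: sum_distrib_left sum_subtractf[symmetric] cong: sum.cong)
  qed
  have main: "k < n ==> x \<in> S ==> Eop u (\<phi>, k, x) - h k x = 0" for k x
  proof (induction k arbitrary: x)
    case 0
    have l: "(%x. Eop u (\<phi>, 0, x) + (-1) * h 0 x) \<in> lin" by (intro lin_add U_lin[OF Eop(1)[OF u] \<phi>] lin_scale hl 0(1))
    have "Eop u (\<phi>, 0, x) + (-1) * h 0 x = 0"
    proof (rule eigen_zero[OF l subset_refl SD(4)[OF zS] _ 0(2)])
      fix x assume x: "x \<in> S"
      have "u (\<phi>, n - 1, x ^ q) = (\<Sum>i\<in>J. c i * inverse (s - f i z ^ q) ^ 0 * frob 1 (f i) x)"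
        unfolding last[OF S_power[OF x]] using x by (simp add: frob_def)
      then show "Eop u (\<phi>, 0, z * x) + (-1) * h 0 (z * x) = s * (Eop u (\<phi>, 0, x) + (-1) * h 0 x)"
        unfolding Eop_comp(1)[OF u \<phi> x] hz[OF x] by (simp add: algebra_simps)
    qed
    then show ?case by simp
  next
    case (Suc k)
    have l: "(%x. Eop u (\<phi>, Suc k, x) + (-1) * h (Suc k) x) \<in> lin" by (intro lin_add U_lin[OF Eop(1)[OF u] \<phi>] lin_scale hl Suc.prems(1))
    have "Eop u (\<phi>, Suc k, x) + (-1) * h (Suc k) x = 0"
    proof (rule eigen_zero[OF l subset_refl SD(4)[OF zS] _ Suc.prems(2)])
      fix x assume x: "x \<in> S"
      have "Eop u (\<phi>, k, x) = h k x" using Suc.IH[OF _ x] Suc.prems(1) by simp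
      then show "Eop u (\<phi>, Suc k, z * x) + (-1) * h (Suc k) (z * x) = s * (Eop u (\<phi>, Suc k, x) + (-1) * h (Suc k) x)"
        unfolding Eop_comp(2)[OF u \<phi> x Suc.prems(1)] hz[OF x] \<open>Eop u (\<phi>, k, x) = h k x\<close> by (simp add: h_def algebra_simps)
    qed
    then show ?case by simp
  qed
  show "k < n ==> x \<in> S ==> Eop u (\<phi>, k, x) = (\<Sum>i\<in>J. c i * inverse (s - f i z ^ q) ^ Suc k * frob 1 (f i) x)"
    using main unfolding h_def by (metis (no_types, lifting) right_minus_eq)
qed

lemma Eop_last_zero:
  assumes u: "u \<in> U" and v: "!!\<phi> x. \<phi> \<in> D ==> x \<in> S ==> u (\<phi>, n - 1, x) = 0"
  shows "Eop u = (%_. 0)"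
proof
  fix y show "Eop u y = 0"
  proof (cases y)
    case (fields \<phi> i x)
    show ?thesis
    proof (cases "\<phi> \<in> D \<and> i < n \<and> x \<in> S")
      case True
      \<comment> \<open>The empty family of characters: \<open>Eop\<close> sees only the last
        component of its argument.\<close>
      then show ?thesis using Eop_chars[OF u, of \<phi> "{}" "%_. undefined" "%_. 0" i x] v fields by simp
    next
      case False
      then show ?thesis using U_zero[OF Eop(1)[OF u], of \<phi> i x] linD(4)[OF U_lin[OF Eop(1)[OF u], of \<phi> i], of x] fields by fastforce
    qed
  qed
qed

end

section \<open>Nilpotent part and one turn of the Frobenius cycle\<close>

context local_det
begin

text \<open>The operator E' of \<open>det_one_minus_reduce\<close>: \<open>Eop\<close> after the
  part on \<open>O0\<close> has been taken out of the last component.\<close>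

definition Epr where "Epr u = Eop (%y. u y - emb (Pop u) y)"

lemma diff_U: "u \<in> U ==> v \<in> U ==> (%y. u y - v y) \<in> U"
  by (rule coord_iso_diff(1)[OF U_iso])

lemma Epr_arg_U: "u \<in> U ==> (%y. u y - emb (Pop u) y) \<in> U"
  by (intro diff_U emb_U Pop_W)

lemma emb_last: "\<phi> \<in> D ==> emb w (\<phi>, n - 1, x) = (\<Sum>\<chi>\<in>O0. vv w \<chi> \<phi> * \<chi> x)"
  by (simp add: emb_def)

lemma Epr_U: "u \<in> U ==> Epr u \<in> U"
  unfolding Epr_def by (intro Eop Epr_arg_U)

text \<open>Progress under \<open>Epr\<close> is measured twice. \<open>vanish\<close> climbs the
  filtration of the nilpotents until the last component is a combination of characters; after that
  \<open>chars_from\<close> tracks how far these characters have moved along the cycle.\<close>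

definition vanish where "vanish k u \<longleftrightarrow> (\<forall>\<phi>\<in>D. \<forall>x\<in>Kj k. u (\<phi>, n - 1, x) = 0)"

definition chars_from where
  "chars_from k u \<longleftrightarrow> (\<exists>f. \<forall>\<phi>\<in>D. \<forall>x\<in>S. u (\<phi>, n - 1, x) = (\<Sum>\<chi>\<in>Ti k. f \<phi> \<chi> * \<chi> x))"

lemma vanish_0: "u \<in> U ==> vanish 0 u"
  unfolding vanish_def Kj_def using linD(3)[OF last_lin] by simp

lemma vanish_Suc:
  assumes u: "u \<in> U" and v: "vanish k u" shows "vanish (Suc k) (Epr u)"
  unfolding vanish_def Epr_def
proof (intro ballI)
  fix \<phi> x assume \<phi>: "\<phi> \<in> D" and x: "x \<in> Kj (Suc k)"
  show "Eop (%y. u y - emb (Pop u) y) (\<phi>, n - 1, x) = 0"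
  proof (rule Eop_vanish[OF Epr_arg_U[OF u] \<phi> _ n1 x])
    fix y assume y: "y \<in> Kj k"
    have "emb (Pop u) (\<phi>, n - 1, y) = 0"
      unfolding emb_last[OF \<phi>] by (rule sum.neutral) (simp add: char_Kj[OF subsetD[OF O0_chars] y])
    then show "u (\<phi>, n - 1, y) - emb (Pop u) (\<phi>, n - 1, y) = 0" using v \<phi> y by (simp add: vanish_def)
  qed
qed

lemma chars_from_0:
  assumes u: "u \<in> U" and v: "vanish N u" shows "chars_from 0 u"
proof -
  have "u (\<phi>, n - 1, x) = (\<Sum>\<chi>\<in>Ti 0. coef (last_comp u \<phi>) \<chi> * \<chi> x)" if "\<phi> \<in> D" for \<phi> x
  proof -
    have lc: "last_comp u \<phi> = (%x. \<Sum>\<chi>\<in>chars. coef (last_comp u \<phi>) \<chi> * \<chi> x)"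
      by (rule Kj_N_stable[OF last_lin[OF u that]]) (use v that in \<open>simp add: vanish_def\<close>)
    have c: "chars = Ti 0" using Ti_0 Ti_chars[of 0] by (rule subset_antisym)
    show ?thesis unfolding c[symmetric] by (rule fun_cong[OF lc])
  qed
  then show ?thesis unfolding chars_from_def by (intro exI[of _ "%\<phi>. coef (last_comp u \<phi>)"]) blast
qed

text \<open>By \<open>coef_O0\<close>, \<open>emb (Pop u)\<close> reproduces exactly those terms of
  the last component that belong to characters in \<open>O0\<close>, so the subtraction deletes them
  and leaves the others untouched.\<close>

lemma Epr_arg_last:
  assumes u: "u \<in> U" and f: "!!\<phi> x. \<phi> \<in> D ==> x \<in> S ==> u (\<phi>, n - 1, x) = (\<Sum>\<chi>\<in>Ti k. f \<phi> \<chi> * \<chi> x)"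
    and \<phi>: "\<phi> \<in> D" and x: "x \<in> S"
  shows "u (\<phi>, n - 1, x) - emb (Pop u) (\<phi>, n - 1, x) = (\<Sum>\<chi>\<in>Ti k - O0. f \<phi> \<chi> * \<chi> x)"
proof -
  have lc: "last_comp u \<phi> = (%x. \<Sum>\<chi>\<in>Ti k. f \<phi> \<chi> * \<chi> x)"
  proof
    fix x show "u (\<phi>, n - 1, x) = (\<Sum>\<chi>\<in>Ti k. f \<phi> \<chi> * \<chi> x)"
    proof (cases "x \<in> S")
      case False
      then have "\<chi> x = 0" if "\<chi> \<in> Ti k" for \<chi> using charsD(4)[OF subsetD[OF Ti_chars that]] by simp
      then have "(\<Sum>\<chi>\<in>Ti k. f \<phi> \<chi> * \<chi> x) = 0" by (intro sum.neutral ballI) simp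
      then show ?thesis using linD(4)[OF last_lin[OF u \<phi>] False] by simp
    qed (rule f[OF \<phi>])
  qed
  have "vv (Pop u) \<chi> \<phi> = (if \<chi> \<in> Ti k then f \<phi> \<chi> else 0)" if \<chi>: "\<chi> \<in> O0" for \<chi>
  proof -
    have "vv (Pop u) \<chi> \<phi> = coef (last_comp u \<phi>) \<chi>" by (rule coef_O0[OF u \<phi> \<chi>, symmetric])
    also have "\<dots> = (\<Sum>\<psi>\<in>{\<psi> \<in> Ti k. \<psi> = \<chi>}. f \<phi> \<psi>)"
      unfolding lc by (rule coef_family[OF Ti_fin, of k "%\<psi>. \<psi>"]) (use Ti_chars O0_chars \<chi> in blast)+
    also have "{\<psi> \<in> Ti k. \<psi> = \<chi>} = (if \<chi> \<in> Ti k then {\<chi>} else {})" by auto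
    finally show ?thesis by simp
  qed
  then have "emb (Pop u) (\<phi>, n - 1, x) = (\<Sum>\<chi>\<in>O0. (if \<chi> \<in> Ti k then f \<phi> \<chi> else 0) * \<chi> x)"
    unfolding emb_last[OF \<phi>] by (intro sum.cong refl) simp
  also have "\<dots> = (\<Sum>\<chi>\<in>O0. if \<chi> \<in> Ti k then f \<phi> \<chi> * \<chi> x else 0)" by (intro sum.cong refl) simp
  also have "\<dots> = (\<Sum>\<chi>\<in>O0 \<inter> Ti k. f \<phi> \<chi> * \<chi> x)" by (rule sum.inter_restrict[OF O0_fin, symmetric])
  finally have "emb (Pop u) (\<phi>, n - 1, x) = (\<Sum>\<chi>\<in>Ti k \<inter> O0. f \<phi> \<chi> * \<chi> x)" by (simp add: Int_commute)
  moreover have "(\<Sum>\<chi>\<in>Ti k. f \<phi> \<chi> * \<chi> x) = (\<Sum>\<chi>\<in>Ti k \<inter> O0. f \<phi> \<chi> * \<chi> x) + (\<Sum>\<chi>\<in>Ti k - O0. f \<phi> \<chi> * \<chi> x)"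
    by (rule sum.Int_Diff[OF Ti_fin])
  ultimately show ?thesis unfolding f[OF \<phi> x] by simp
qed

text \<open>With the members of \<open>O0\<close> gone, the Frobenius step carries each remaining
  character from \<open>Ti k\<close> into \<open>Ti (Suc k)\<close>; several may land on the same
  one, hence the grouping of the sum.\<close>

lemma chars_from_Suc:
  assumes u: "u \<in> U" and c: "chars_from k u" shows "chars_from (Suc k) (Epr u)"
proof -
  obtain f where f: "!!\<phi> x. \<phi> \<in> D ==> x \<in> S ==> u (\<phi>, n - 1, x) = (\<Sum>\<chi>\<in>Ti k. f \<phi> \<chi> * \<chi> x)"
    using c unfolding chars_from_def by blast
  let ?J = "Ti k - O0"
  have J: "finite ?J" "!!\<chi>. \<chi> \<in> ?J ==> \<chi> \<in> chars" using Ti_fin Ti_chars by blast+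
  let ?c = "%\<phi> \<chi>. f \<phi> \<chi> * inverse (s - \<chi> z ^ q) ^ Suc (n - 1)"
  have "Epr u (\<phi>, n - 1, x) = (\<Sum>\<psi>\<in>Ti (Suc k). (\<Sum>\<chi>\<in>{\<chi> \<in> ?J. frob 1 \<chi> = \<psi>}. ?c \<phi> \<chi>) * \<psi> x)"
    if \<phi>: "\<phi> \<in> D" and x: "x \<in> S" for \<phi> x
  proof -
    have "Epr u (\<phi>, n - 1, x) = (\<Sum>\<chi>\<in>?J. ?c \<phi> \<chi> * frob 1 \<chi> x)"
      unfolding Epr_def
      by (rule Eop_chars[OF Epr_arg_U[OF u] \<phi> J Epr_arg_last[OF u f \<phi>] n1 x])
    also have "\<dots> = (\<Sum>\<psi>\<in>Ti (Suc k). \<Sum>\<chi>\<in>{\<chi> \<in> ?J. frob 1 \<chi> = \<psi>}. ?c \<phi> \<chi> * frob 1 \<chi> x)"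
      by (rule sum.group[OF J(1) Ti_fin, symmetric]) (use frob_1_Ti in blast)
    also have "\<dots> = (\<Sum>\<psi>\<in>Ti (Suc k). (\<Sum>\<chi>\<in>{\<chi> \<in> ?J. frob 1 \<chi> = \<psi>}. ?c \<phi> \<chi>) * \<psi> x)"
      by (intro sum.cong refl) (simp add: sum_distrib_right)
    finally show ?thesis .
  qed
  then show ?thesis unfolding chars_from_def
    by (intro exI[of _ "%\<phi> \<psi>. \<Sum>\<chi>\<in>{\<chi> \<in> ?J. frob 1 \<chi> = \<psi>}. ?c \<phi> \<chi>"]) blast
qed

lemma Epr_iter_U: "u \<in> U ==> (Epr ^^ k) u \<in> U"
  by (induction k) (simp_all add: Epr_U)

text \<open>N steps make the last component vanish on \<open>Kj N\<close>, d more push its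
  characters into the empty set \<open>Ti d\<close>, and one further step kills everything, because
  \<open>Eop\<close> depends only on the last component.\<close>

lemma Epr_nilpotent:
  assumes u: "u \<in> U" shows "(Epr ^^ Suc (d + N)) u = (%_. 0)"
proof -
  have 1: "vanish k ((Epr ^^ k) u)" for k
    by (induction k) (simp_all add: vanish_0[OF u] vanish_Suc[OF Epr_iter_U[OF u]])
  have 2: "chars_from k ((Epr ^^ (k + N)) u)" for k
    by (induction k) (simp_all add: chars_from_0[OF Epr_iter_U[OF u] 1] chars_from_Suc[OF Epr_iter_U[OF u]])
  let ?v = "(Epr ^^ (d + N)) u"
  obtain f where f: "!!\<phi> x. \<phi> \<in> D ==> x \<in> S ==> ?v (\<phi>, n - 1, x) = (\<Sum>\<chi>\<in>Ti d. f \<phi> \<chi> * \<chi> x)"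
    using 2[of d] unfolding chars_from_def by blast
  have "Eop (%y. ?v y - emb (Pop ?v) y) = (%_. 0)"
    by (rule Eop_last_zero[OF Epr_arg_U[OF Epr_iter_U[OF u]]]) (simp only: Epr_arg_last[OF Epr_iter_U[OF u] f] Ti_d empty_Diff sum.empty)
  with Epr_def[of ?v] have "Epr ?v = (%_. 0)" by (rule trans)
  then show ?thesis by simp
qed

lemma Eop_add: "u \<in> U ==> v \<in> U ==> Eop (%y. u y + v y) = (%y. Eop u y + Eop v y)"
  using Eop_lin unfolding lin_on_def by blast

definition yy where "yy k w = (Eop ^^ k) (emb w)"
text \<open>The scalar collected in the first k Frobenius steps from \<open>O0\<close>. For k = d it
  is the inverse n-th power of |kappa_p| at \<open>s\<close>.\<close>

definition cc where "cc k = (\<Prod>i\<in>{1..k}. inverse (s - \<chi>0 z ^ (q ^ i)) ^ n)"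

lemma yy_U: "w \<in> W ==> yy k w \<in> U"
  unfolding yy_def by (induction k) (simp_all add: emb_U Eop)

lemma yy_lin: "lin_on W U (yy k)"
proof (induction k)
  case (Suc k)
  have "yy (Suc k) = (%w. Eop (yy k w))" by (simp add: yy_def fun_eq_iff)
  then show ?case using lin_on_comp[OF Suc Eop_lin] by simp
qed (use emb_lin in \<open>simp add: yy_def[abs_def]\<close>)

lemma yy_last:
  assumes w: "w \<in> W" and \<phi>: "\<phi> \<in> D"
  shows "x \<in> S ==> yy k w (\<phi>, n - 1, x) = (\<Sum>\<chi>\<in>O0. cc k * vv w \<chi> \<phi> * frob k \<chi> x)"
proof (induction k arbitrary: x)
  case 0
  then show ?case by (simp add: yy_def cc_def emb_last[OF \<phi>, simplified] frob_def)
next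
  case (Suc k)
  have ch: "frob k \<chi> \<in> chars" if "\<chi> \<in> O0" for \<chi> using frob_chars O0_chars that by blast
  have "yy (Suc k) w (\<phi>, n - 1, x) = Eop (yy k w) (\<phi>, n - 1, x)" by (simp add: yy_def)
  also have "\<dots> = (\<Sum>\<chi>\<in>O0. cc k * vv w \<chi> \<phi> * inverse (s - frob k \<chi> z ^ q) ^ Suc (n - 1) * frob 1 (frob k \<chi>) x)"
    by (rule Eop_chars[OF yy_U[OF w] \<phi> O0_fin ch Suc.IH n1 Suc.prems])
  also have "\<dots> = (\<Sum>\<chi>\<in>O0. cc (Suc k) * vv w \<chi> \<phi> * frob (Suc k) \<chi> x)"
  proof (rule sum.cong[OF refl])
    fix \<chi> assume \<chi>: "\<chi> \<in> O0"
    have "frob k \<chi> z ^ q = \<chi>0 z ^ (q ^ Suc k)"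
      using frob_char[OF subsetD[OF O0_chars \<chi>], of k z] O0_z[OF \<chi>] by (simp add: power_mult[symmetric] mult.commute)
    then show "cc k * vv w \<chi> \<phi> * inverse (s - frob k \<chi> z ^ q) ^ Suc (n - 1) * frob 1 (frob k \<chi>) x =
        cc (Suc k) * vv w \<chi> \<phi> * frob (Suc k) \<chi> x"
      using n by (simp add: cc_def frob_frob)
  qed
  finally show ?case .
qed

text \<open>One full turn, without the starting term. It is the solution Y of Y = E' Y + E emb
  required by \<open>det_one_minus_reduce\<close>, a truncated geometric series in
  \<open>Eop\<close>.\<close>

definition Yop where "Yop w = (%y. \<Sum>k\<in>{1..d}. yy k w y)"

lemma Yop_lin: "lin_on W U Yop"
proof -
  have "lin_on W U (%w y. \<Sum>k\<in>{1..l}. yy k w y)" for l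
  proof (induction l)
    case 0
    then show ?case using zero_U by (simp add: lin_on_def)
  next
    case (Suc l)
    then show ?case using yy_lin[of "Suc l"] by (simp add: lin_on_def add_U fun_eq_iff algebra_simps)
  qed
  then show ?thesis unfolding Yop_def[abs_def] .
qed

text \<open>Among all characters occurring in the sum only one equals \<open>\<chi>0\<close>, the
  d-th Frobenius iterate of its twist by the inverse of \<open>\<gamma>\<close>; its coefficient is
  the Frobenius action times the collected scalar.\<close>

lemma Pop_Yop:
  assumes w: "w \<in> W" shows "Pop (Yop w) = (%\<phi>. cc d * lact \<gamma> w \<phi>)"
proof
  fix \<phi>
  show "Pop (Yop w) \<phi> = cc d * lact \<gamma> w \<phi>"
  proof (cases "\<phi> \<in> D")
    case \<phi>: True
    let ?J = "{1..d} \<times> O0" and ?f = "%(k, \<chi>). frob k \<chi>" and ?c = "%(k, \<chi>). cc k * vv w \<chi> \<phi>"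
    have f: "?f i \<in> chars" if "i \<in> ?J" for i using that frob_chars O0_chars by auto
    have Yl: "last_comp (Yop w) \<phi> = (%x. \<Sum>i\<in>?J. ?c i * ?f i x)"
    proof
      fix x
      show "Yop w (\<phi>, n - 1, x) = (\<Sum>i\<in>?J. ?c i * ?f i x)"
      proof (cases "x \<in> S")
        case True
        have "Yop w (\<phi>, n - 1, x) = (\<Sum>k\<in>{1..d}. \<Sum>\<chi>\<in>O0. cc k * vv w \<chi> \<phi> * frob k \<chi> x)"
          unfolding Yop_def yy_last[OF w \<phi> True] ..
        then show ?thesis by (simp add: sum.cartesian_product case_prod_beta)
      next
        case False
        have "(\<Sum>i\<in>?J. ?c i * ?f i x) = 0"
          by (rule sum.neutral) (use charsD(4)[OF f False] in \<open>simp add: case_prod_beta\<close>)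
        then show ?thesis
          using linD(4)[OF last_lin[of "Yop w", OF _ \<phi>] False] Yop_lin w unfolding lin_on_def by simp
      qed
    qed
    \<comment> \<open>The pair with exponent d survives alone; starting the range of exponents at 1
      excludes \<open>\<chi>0\<close> itself.\<close>
    have set: "{i \<in> ?J. ?f i = \<chi>0} = {(d, tw (inv_into UNIV \<gamma>) \<chi>0)}"
    proof (intro subset_antisym subsetI)
      fix i assume "i \<in> {i \<in> ?J. ?f i = \<chi>0}"
      then obtain k \<chi> where "i = (k, \<chi>)" "0 < k" "k \<le> d" "\<chi> \<in> O0" "frob k \<chi> = \<chi>0" by (cases i) auto
      then show "i \<in> {(d, tw (inv_into UNIV \<gamma>) \<chi>0)}" using frob_O0_eq_\<chi>0[of k \<chi>] by simp
    next
      fix i assume "i \<in> {(d, tw (inv_into UNIV \<gamma>) \<chi>0)}"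
      moreover have "tw (inv_into UNIV \<gamma>) \<chi>0 \<in> O0" unfolding O0_def using G_inv[OF \<gamma>] by blast
      ultimately show "i \<in> {i \<in> ?J. ?f i = \<chi>0}" using frob_d_tw_inv d by simp
    qed
    have "Pop (Yop w) \<phi> = coef (%x. \<Sum>i\<in>?J. ?c i * ?f i x) \<chi>0" unfolding Pop_def Yl using \<phi> by simp
    also have "\<dots> = (\<Sum>i\<in>{i \<in> ?J. ?f i = \<chi>0}. ?c i)"
      by (rule coef_family[OF _ f \<chi>0]) (simp add: O0_fin)
    also have "\<dots> = cc d * vv w (tw (inv_into UNIV \<gamma>) \<chi>0) \<phi>" unfolding set by simp
    also have "vv w (tw (inv_into UNIV \<gamma>) \<chi>0) = lact \<gamma> w" unfolding vv_tw[OF w G_inv[OF \<gamma>]] inv_inv_G[OF \<gamma>] ..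
    finally show ?thesis .
  qed (simp add: Pop_def lact_def)
qed

text \<open>After d steps the characters are back in \<open>O0\<close>. Reindexing the orbit by
  \<open>frob d\<close> shows that the last component of \<open>yy d w\<close> is that of
  \<open>emb (Pop (Yop w))\<close>, and \<open>Eop\<close> sees nothing else.\<close>

lemma Eop_yy_d:
  assumes w: "w \<in> W" shows "Eop (yy d w) = Eop (emb (Pop (Yop w)))"
proof -
  let ?w = "Pop (Yop w)"
  have YU: "Yop w \<in> U" using Yop_lin w by (simp add: lin_on_def)
  have w': "?w \<in> W" by (rule Pop_W[OF YU])
  have v: "(%y. yy d w y - emb ?w y) \<in> U" by (intro diff_U yy_U emb_U w w')
  have "yy d w (\<phi>, n - 1, x) - emb ?w (\<phi>, n - 1, x) = 0" if \<phi>: "\<phi> \<in> D" and x: "x \<in> S" for \<phi> x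
  proof -
    have "vv ?w (frob d \<chi>) \<phi> = cc d * vv w \<chi> \<phi>" if \<chi>: "\<chi> \<in> O0" for \<chi>
    proof -
      obtain g where g: "g \<in> G" "\<chi> = tw g \<chi>0" using \<chi> unfolding O0_def by blast
      have \<gamma>g: "\<gamma> \<circ> g \<in> G" by (rule G_comp[OF \<gamma> g(1)])
      have "frob d \<chi> = tw (\<gamma> \<circ> g) \<chi>0" unfolding g(2) frob_tw[OF g(1)] frob_d' tw_tw[OF g(1)] ..
      then have "vv ?w (frob d \<chi>) = lact (inv_into UNIV (\<gamma> \<circ> g)) (%\<phi>. cc d * lact \<gamma> w \<phi>)"
        unfolding Pop_Yop[OF w, symmetric] using vv_tw[OF w' \<gamma>g] by simp
      also have "\<dots> = (%\<phi>. cc d * lact (inv_into UNIV (\<gamma> \<circ> g)) (lact \<gamma> w) \<phi>)" by (rule lact_scale)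
      also have "lact (inv_into UNIV (\<gamma> \<circ> g)) (lact \<gamma> w) = lact (inv_into UNIV (\<gamma> \<circ> g) \<circ> \<gamma>) w"
        by (intro lact_comp W_VO w G_inv \<gamma>g \<gamma>)
      also have "inv_into UNIV (\<gamma> \<circ> g) \<circ> \<gamma> = inv_into UNIV g"
        unfolding inv_comp_dist[OF \<gamma> g(1)] comp_assoc inv_comp(1)[OF \<gamma>] by simp
      also have "lact (inv_into UNIV g) w = vv w \<chi>" unfolding g(2) vv_tw[OF w g(1)] ..
      finally show ?thesis by simp
    qed
    then have "(\<Sum>\<chi>\<in>O0. cc d * vv w \<chi> \<phi> * frob d \<chi> x) = (\<Sum>\<chi>\<in>O0. vv ?w (frob d \<chi>) \<phi> * frob d \<chi> x)"
      by (intro sum.cong refl) simp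
    also have "\<dots> = (\<Sum>\<chi>\<in>O0. vv ?w \<chi> \<phi> * \<chi> x)" by (rule sum.reindex_bij_betw[OF frob_d_O0])
    finally show ?thesis unfolding yy_last[OF w \<phi> x] emb_last[OF \<phi>] by simp
  qed
  then have "Eop (%y. yy d w y - emb ?w y) = (%_. 0)" by (rule Eop_last_zero[OF v])
  moreover have "Eop (%y. (yy d w y - emb ?w y) + emb ?w y) = (%y. Eop (%y. yy d w y - emb ?w y) y + Eop (emb ?w) y)"
    by (rule Eop_add[OF v emb_U[OF w']])
  then have "Eop (yy d w) = (%y. Eop (%y. yy d w y - emb ?w y) y + Eop (emb ?w) y)" unfolding diff_add_cancel .
  ultimately show ?thesis by simp
qed

text \<open>Applying \<open>Eop\<close> shifts the sum by one step. The surplus term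
  \<open>yy (Suc d) w\<close> equals the image under \<open>Eop\<close> of
  \<open>emb (Pop (Yop w))\<close>, and the missing first term is the image of
  \<open>emb w\<close>.\<close>

lemma Yop_resolvent:
  assumes w: "w \<in> W"
  shows "Yop w = (%y. Eop (%y. Yop w y - emb (Pop (Yop w)) y) y + Eop (emb w) y)"
proof -
  let ?w = "Pop (Yop w)"
  have YU: "Yop w \<in> U" using Yop_lin w by (simp add: lin_on_def)
  have w': "?w \<in> W" by (rule Pop_W[OF YU])
  note add = Eop_add
  have E0: "Eop (%_. 0) = (%_. 0)" by (rule Eop_last_zero[OF zero_U]) simp
  have part: "(%y. \<Sum>k\<in>{1..l}. yy k w y) \<in> U \<and> Eop (%y. \<Sum>k\<in>{1..l}. yy k w y) = (%y. \<Sum>k\<in>{1..l}. yy (Suc k) w y)" for l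
  proof (induction l)
    case 0
    then show ?case using zero_U E0 by simp
  next
    case (Suc l)
    then show ?case using add[OF conjunct1[OF Suc] yy_U[OF w, of "Suc l"]] add_U[OF conjunct1[OF Suc] yy_U[OF w, of "Suc l"]]
      by (simp add: yy_def)
  qed
  have "Eop (Yop w) = (%y. Eop (%y. Yop w y - emb ?w y) y + Eop (emb ?w) y)"
    using add[OF diff_U[OF YU emb_U[OF w']] emb_U[OF w']] by simp
  then have "Eop (Yop w) y = Eop (%y. Yop w y - emb ?w y) y + Eop (emb ?w) y" for y by (rule fun_cong)
  moreover have "Eop (Yop w) y = (\<Sum>k\<in>{1..d}. yy (Suc k) w y)" for y using part[of d] unfolding Yop_def by (metis (no_types))
  moreover have "Eop (emb ?w) = yy (Suc d) w" using Eop_yy_d[OF w] by (simp add: yy_def)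
  moreover have "(\<Sum>k\<in>{1..d}. yy (Suc k) w y) + yy 1 w y = Yop w y + yy (Suc d) w y" for y
  proof -
    have "(\<Sum>k\<in>{1..d}. yy (Suc k) w y) = (\<Sum>k\<in>{Suc 1..Suc d}. yy k w y)" by (rule sum.shift_bounds_cl_Suc_ivl[symmetric])
    moreover have "(\<Sum>k\<in>{1..Suc d}. yy k w y) = yy 1 w y + (\<Sum>k\<in>{Suc 1..Suc d}. yy k w y)" by (rule sum.atLeast_Suc_atMost) simp
    ultimately show ?thesis by (simp add: Yop_def)
  qed
  moreover have "Eop (emb w) = yy 1 w" by (simp add: yy_def)
  ultimately show ?thesis by (simp add: fun_eq_iff)
qed

lemma prod_neq_zeroI: "(!!i. i \<in> A ==> f i ~= (0 :: 'z::field)) ==> prod f A ~= 0"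
  by (induction A rule: infinite_finite_induct) simp_all

lemma cc_neq_0: "cc k ~= 0"
proof -
  have "s - \<chi>0 z ^ (q ^ i) ~= 0" for i using s_neq_char[OF frob_chars[OF \<chi>0], of i] unfolding frob_char[OF \<chi>0] .
  then show ?thesis unfolding cc_def by (intro prod_neq_zeroI) simp
qed

lemma Pop_Yop_coords:
  assumes w: "w \<in> W" shows "kpW (Pop (Yop w)) = (cc d \<cdot>\<^sub>m \<Phi>) *\<^sub>v kpW w"
proof -
  have YU: "Yop w \<in> U" using Yop_lin w by (simp add: lin_on_def)
  \<comment> \<open>Membership of \<open>lact \<gamma> w\<close> in \<open>W\<close> comes from
    \<open>Pop_Yop\<close>: it is a scalar multiple of a value of \<open>Pop\<close>.\<close>
  have "(%\<phi>. inverse (cc d) * Pop (Yop w) \<phi>) \<in> W" by (rule coord_iso_scale(1)[OF W_iso Pop_W[OF YU]])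
  moreover have "(%\<phi>. inverse (cc d) * Pop (Yop w) \<phi>) = lact \<gamma> w"
    unfolding Pop_Yop[OF w] using cc_neq_0 by (simp add: mult.assoc[symmetric])
  ultimately have lW: "lact \<gamma> w \<in> W" by (simp only:)
  have "kpW (Pop (Yop w)) = cc d \<cdot>\<^sub>v (\<Phi> *\<^sub>v kpW w)"
    unfolding Pop_Yop[OF w] coord_iso_scale(2)[OF W_iso lW] \<Phi>_eq[OF w] ..
  also have "\<dots> = (cc d \<cdot>\<^sub>m \<Phi>) *\<^sub>v kpW w"
    using \<Phi> coord_iso_carrier[OF W_iso w] by (intro eq_vecI) (simp_all add: scalar_prod_def sum_distrib_left mult.assoc)
  finally show ?thesis .
qed

lemma det_local:
  "det (s \<cdot>\<^sub>m 1\<^sub>m m - (LM + SM)) = det (s \<cdot>\<^sub>m 1\<^sub>m m - LM) * det (1\<^sub>m r - cc d \<cdot>\<^sub>m \<Phi>)"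
proof -
  have \<Phi>c: "cc d \<cdot>\<^sub>m \<Phi> \<in> carrier_mat r r" using \<Phi> by simp
  have E: "Epr = (%u. Eop (%y. u y - emb (Pop u) y))" by (rule HOL.ext) (rule Epr_def)
  have "det (1\<^sub>m m - EM) = det (1\<^sub>m r - cc d \<cdot>\<^sub>m \<Phi>)"
    by (rule det_one_minus_reduce[where U = U and W = W and E = Eop and emb = emb and P = Pop and Y = Yop and EM = EM
        and \<Phi> = "cc d \<cdot>\<^sub>m \<Phi>" and kp = kpU and kp' = kpW and m = m and r = r and k = "Suc (d + N)", OF U_iso W_iso Eop_lin emb_lin Pop_lin Yop_lin EM Eop(2) \<Phi>c Pop_Yop_coords Epr_nilpotent[unfolded E] Yop_resolvent])
  then show ?thesis unfolding det_factor by simp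
qed

end

section \<open>Characters of a residue field and its size\<close>

lemma field_hom_const_emb:
  fixes h :: "'k::field poly fract => 'b::field"
  assumes h: "field_hom h" shows "field_hom (%c. poly_emb h [:c:])"
proof -
  interpret e: comm_ring_hom "poly_emb h" by (rule poly_emb_hom[OF h])
  show ?thesis
  proof unfold_locales
    show "poly_emb h [:x + y:] = poly_emb h [:x:] + poly_emb h [:y:]" for x y unfolding e.hom_add[symmetric] by simp
    show "poly_emb h [:x * y:] = poly_emb h [:x:] * poly_emb h [:y:]" for x y unfolding e.hom_mult[symmetric] by (simp add: mult.commute)
    show "poly_emb h [:1:] = 1" using e.hom_one by (simp add: one_pCons)
    show "poly_emb h [:0:] = 0" using e.hom_zero by simp
  qed
qed

lemma poly_const_emb:
  fixes h :: "'k::field poly fract => 'b::field"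
  assumes h: "field_hom h" shows "poly (map_poly (%c. poly_emb h [:c:]) p) (poly_emb h [:0, 1:]) = poly_emb h p"
proof (induction p)
  case 0
  interpret e: comm_ring_hom "poly_emb h" by (rule poly_emb_hom[OF h])
  show ?case by simp
next
  case (pCons c p)
  interpret e: comm_ring_hom "poly_emb h" by (rule poly_emb_hom[OF h])
  interpret c: field_hom "%c. poly_emb h [:c:]" by (rule field_hom_const_emb[OF h])
  have "pCons c p = [:c:] + [:0, 1:] * p" by simp
  then have "poly_emb h (pCons c p) = poly_emb h [:c:] + poly_emb h [:0, 1:] * poly_emb h p"
    unfolding e.hom_add[symmetric] e.hom_mult[symmetric] by simp
  then show ?case using pCons by (simp add: c.map_poly_pCons_hom)
qed

lemma (in vector_record) card_carrier:
  assumes bs: "ordered_basis M bs" and fin: "finite (UNIV :: 'c set)"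
  shows "card (carrier M) = card (UNIV :: 'c set) ^ length bs"
proof -
  have s: "set bs \<subseteq> carrier M" using bs by (simp add: ordered_basis_def)
  have "bij_betw (%cs. lin_comb M cs bs) {cs. set cs \<subseteq> (UNIV :: 'c set) \<and> length cs = length bs} (carrier M)"
    unfolding bij_betw_def
  proof (intro conjI subset_antisym subsetI inj_onI)
    fix cs ds assume "cs \<in> {cs. set cs \<subseteq> (UNIV :: 'c set) \<and> length cs = length bs}" "ds \<in> {cs. set cs \<subseteq> (UNIV :: 'c set) \<and> length cs = length bs}"
      "lin_comb M cs bs = lin_comb M ds bs"
    then show "cs = ds" using bs lin_comb_closed[OF s, of ds] unfolding ordered_basis_def by blast
  next
    fix x assume "x \<in> (%cs. lin_comb M cs bs) ` {cs. set cs \<subseteq> (UNIV :: 'c set) \<and> length cs = length bs}"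
    then show "x \<in> carrier M" using lin_comb_closed[OF s] by blast
  next
    fix x assume "x \<in> carrier M"
    then show "x \<in> (%cs. lin_comb M cs bs) ` {cs. set cs \<subseteq> (UNIV :: 'c set) \<and> length cs = length bs}"
      using coords[OF bs, of x] by (intro image_eqI[of _ _ "coords M bs x"]) simp_all
  qed
  then have "card (carrier M) = card {cs. set cs \<subseteq> (UNIV :: 'c set) \<and> length cs = length bs}" by (rule bij_betw_same_card[symmetric])
  then show ?thesis using card_lists_length_eq[OF fin] by simp
qed

text \<open>Used twice: at P it supplies the character \<open>\<chi>0\<close>, and at p the length
  of the Frobenius cycle and the size of kappa_p.\<close>

locale residue_field =
  fixes h :: "'k::{field,finite} poly fract => 'l::field" and I :: "'l set" and j :: "'k => 'o::alg_closed_field" and q :: nat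
  assumes q_card: "q = card (UNIV :: 'k set)" and h: "field_hom h" and prime: "prime_idl I (int_set h)" and fqI: "fin_quot (int_set h) I" and jh: "field_hom j"
begin

abbreviation "kp \<equiv> %c. poly_emb h [:c:]"

lemma idlI: "idl I (int_set h)" using prime by (simp add: prime_idl_def)

sublocale fin_char "int_set h" I "%c. poly_emb h [:c:]" j q
  by (rule fin_char.intro[OF q_card subrng_int_set[OF h] idlI field_hom_const_emb[OF h] poly_emb_int_set[OF h] jh fqI])

lemma primeD: "x \<in> int_set h ==> y \<in> int_set h ==> x * y \<in> I ==> x \<in> I \<or> y \<in> I" and one_notin: "1 \<notin> I"
  using prime unfolding prime_idl_def by blast+

lemma power_in_I: "x \<in> int_set h ==> x ^ m \<in> I ==> x \<in> I"
proof (induction m)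
  case (Suc m)
  then show ?case using primeD[OF Suc.prems(1) S_power[OF Suc.prems(1)], of m] by auto
qed (use one_notin in simp)

text \<open>\<open>I\<close> is a k-subspace not containing 1, so a basis of it remains independent
  when 1 is added; the functional is prescribed there.\<close>

lemma exists_functional: "\<exists>f\<in>lin. f 1 ~= 0"
proof -
  interpret kp: field_hom kp by (rule field_hom_const_emb[OF h])
  interpret j: field_hom j by (rule jh)
  interpret v1: vector_space "%c x. kp c * (x :: 'l)" by unfold_locales (simp_all add: algebra_simps kp.hom_add kp.hom_mult)
  interpret v2: vector_space "%c x. j c * (x :: 'o)" by unfold_locales (simp_all add: algebra_simps j.hom_add j.hom_mult)
  interpret vp: vector_space_pair "%c x. kp c * (x :: 'l)" "%c x. j c * (x :: 'o)" by unfold_locales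
  have "v1.subspace I" unfolding v1.subspace_def using QD(1,3) QD(4)[OF kpS] by simp
  then have sp: "v1.span I = I" by (simp add: v1.span_eq_iff)
  obtain B where B: "B \<subseteq> I" "v1.independent B" "I \<subseteq> v1.span B" using v1.maximal_independent_subset[of I] by blast
  have "v1.span B \<subseteq> I" using v1.span_mono[OF B(1)] sp by simp
  then have "1 \<notin> v1.span B" using one_notin by blast
  then have ind: "v1.independent (insert 1 B)" using B(2) by (rule v1.independent_insertI)
  from vp.linear_independent_extend[OF this, of "%x. if x = 1 then 1 else 0"]
  obtain F where F: "Vector_Spaces.linear (%c x. kp c * (x :: 'l)) (%c x. j c * (x :: 'o)) F"
    "!!x. x \<in> insert 1 B ==> F x = (if x = 1 then 1 else 0)" by blast
  interpret F: Vector_Spaces.linear "%c x. kp c * (x :: 'l)" "%c x. j c * (x :: 'o)" F by (rule F(1))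
  have "F x = 0" if "x \<in> I" for x
  proof (rule vp.linear_eq_0_on_span[OF F(1)])
    show "F y = 0" if "y \<in> B" for y using F(2)[of y] that B(1) one_notin by auto
    show "x \<in> v1.span B" using that B(3) by blast
  qed
  then have "(%x. if x \<in> int_set h then F x else 0) \<in> lin"
    unfolding lin_def using SD(3) SD(4)[OF kpS] QD(2) F.add F.scale by simp
  moreover have "F 1 = 1" using F(2)[of 1] by simp
  ultimately show ?thesis using SD(2) by (intro bexI[of _ "%x. if x \<in> int_set h then F x else 0"]) simp_all
qed

text \<open>Without characters \<open>frob N f\<close> would be the empty combination for every
  functional, yet its value at 1 is \<open>f 1\<close>.\<close>

lemma exists_char: "\<exists>\<chi>. \<chi> \<in> chars"
proof (rule ccontr)
  assume no: "\<not> (\<exists>\<chi>. \<chi> \<in> chars)"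
  obtain f where f: "f \<in> lin" "f 1 ~= 0" using exists_functional by blast
  have "f (1 ^ (q ^ N)) = 0" using coef_eval[OF f(1) SD(2)] no by (simp add: sum.neutral)
  then show False using f(2) by simp
qed

text \<open>Idempotence of Frobenius gives x^(q^N) (x^(M+1) - 1) in the prime ideal
  \<open>I\<close>. Either x itself lies in \<open>I\<close>, or x is a root of unity modulo
  \<open>I\<close>, and then no character vanishes at it.\<close>

lemma char_eq_0:
  assumes \<chi>: "\<chi> \<in> chars" and x: "x \<in> int_set h" shows "\<chi> x = 0 \<longleftrightarrow> x \<in> I"
proof
  assume \<chi>x: "\<chi> x = 0"
  have lt: "q ^ N < q ^ (N + N)" using N(1) q1 by simp
  then obtain M where M: "q ^ (N + N) = q ^ N + Suc M" using less_imp_Suc_add by fastforce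
  have "x ^ (q ^ (N + N)) - x ^ (q ^ N) = x ^ (q ^ N) * (x ^ Suc M - 1)" unfolding M by (simp only: power_add right_diff_distrib mult_1_right)
  then have "x ^ (q ^ N) * (x ^ Suc M - 1) \<in> I" using N(2)[OF x] by simp
  then have "x ^ (q ^ N) \<in> I \<or> x ^ Suc M - 1 \<in> I" by (rule primeD[OF S_power[OF x] SD(6)[OF S_power[OF x] SD(2)]])
  moreover have "x ^ Suc M - 1 \<notin> I"
  proof
    assume "x ^ Suc M - 1 \<in> I"
    then have "\<chi> (x ^ Suc M) = \<chi> 1" by (rule lin_cong[OF chars_lin[OF \<chi>] S_power[OF x] SD(2)])
    then show False using rhom_power[OF charsD(1)[OF \<chi>] S x, of "Suc M"] rhomD(2)[OF charsD(1)[OF \<chi>]] \<chi>x by simp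
  qed
  ultimately show "x \<in> I" using power_in_I[OF x] by blast
qed (rule charsD(3)[OF \<chi>])

lemma char_eq_iff: "\<chi> \<in> chars ==> x \<in> int_set h ==> y \<in> int_set h ==> \<chi> x = \<chi> y \<longleftrightarrow> x - y \<in> I"
  using char_eq_0[of \<chi> "x - y"] lin_diff[OF chars_lin, of \<chi> x y] SD(6)[of x y] by simp

definition "RM = (let B = int_ring h Quot I; \<eta> = quot_emb h I in
   mk_module (carrier B) \<zero>\<^bsub>B\<^esub> (\<oplus>\<^bsub>B\<^esub>) (%c x. \<eta> [:c:] \<otimes>\<^bsub>B\<^esub> x))"

lemma RM_simps:
  "carrier RM = coset I ` int_set h" "\<zero>\<^bsub>RM\<^esub> = coset I 0"
  "x \<in> int_set h ==> y \<in> int_set h ==> coset I x \<oplus>\<^bsub>RM\<^esub> coset I y = coset I (x + y)"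
  "x \<in> int_set h ==> c \<odot>\<^bsub>RM\<^esub> coset I x = coset I (kp c * x)"
  using kpS[of c]
  by (simp_all add: RM_def mk_module_def Let_def Quot_carrier[OF h idlI] Quot_zero[OF h idlI]
      Quot_add[OF h idlI] quot_emb_coset[OF h idlI] Quot_mult[OF h idlI] del: mem_Collect_eq)

sublocale RM: vector_record RM
proof (rule vector_record.intro)
  interpret kp: field_hom kp by (rule field_hom_const_emb[OF h])
  have ex: "\<exists>a\<in>int_set h. x = coset I a" if "x \<in> carrier RM" for x using that unfolding RM_simps by blast
  note add = RM_simps(3)
  show "abelian_group RM"
  proof (rule abelian_groupI)
    fix x y assume "x \<in> carrier RM" "y \<in> carrier RM"
    then obtain a b where a: "a \<in> int_set h" "x = coset I a" and b: "b \<in> int_set h" "y = coset I b" using ex by blast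
    show "x \<oplus>\<^bsub>RM\<^esub> y \<in> carrier RM" unfolding a(2) b(2) add[OF a(1) b(1)] RM_simps(1) by (rule imageI[OF SD(3)[OF a(1) b(1)]])
    show "x \<oplus>\<^bsub>RM\<^esub> y = y \<oplus>\<^bsub>RM\<^esub> x" unfolding a(2) b(2) add[OF a(1) b(1)] add[OF b(1) a(1)] by (simp add: add.commute)
    fix z assume "z \<in> carrier RM"
    then obtain c where c: "c \<in> int_set h" "z = coset I c" using ex by blast
    show "x \<oplus>\<^bsub>RM\<^esub> y \<oplus>\<^bsub>RM\<^esub> z = x \<oplus>\<^bsub>RM\<^esub> (y \<oplus>\<^bsub>RM\<^esub> z)"
      unfolding a(2) b(2) c(2) add[OF a(1) b(1)] add[OF b(1) c(1)] add[OF SD(3)[OF a(1) b(1)] c(1)] add[OF a(1) SD(3)[OF b(1) c(1)]]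
      by (simp add: add.assoc)
  next
    show "\<zero>\<^bsub>RM\<^esub> \<in> carrier RM" unfolding RM_simps by (rule imageI[OF SD(1)])
  next
    fix x assume "x \<in> carrier RM"
    then obtain a where a: "a \<in> int_set h" "x = coset I a" using ex by blast
    show "\<zero>\<^bsub>RM\<^esub> \<oplus>\<^bsub>RM\<^esub> x = x" unfolding a(2) RM_simps(2) add[OF SD(1) a(1)] by simp
    show "\<exists>y\<in>carrier RM. y \<oplus>\<^bsub>RM\<^esub> x = \<zero>\<^bsub>RM\<^esub>"
    proof
      show "coset I (- a) \<oplus>\<^bsub>RM\<^esub> x = \<zero>\<^bsub>RM\<^esub>" unfolding a(2) RM_simps(2) add[OF SD(5)[OF a(1)] a(1)] by simp
      show "coset I (- a) \<in> carrier RM" unfolding RM_simps by (rule imageI[OF SD(5)[OF a(1)]])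
    qed
  qed
  fix c d x y
  {
    assume "x \<in> carrier RM"
    then obtain a where a: "x = coset I a" "a \<in> int_set h" unfolding RM_simps by blast
    note ac = SD(4)[OF kpS a(2)]
    show "c \<odot>\<^bsub>RM\<^esub> x \<in> carrier RM" unfolding a(1) RM_simps(4)[OF a(2)] RM_simps(1) by (intro imageI ac)
    show "(c + d) \<odot>\<^bsub>RM\<^esub> x = c \<odot>\<^bsub>RM\<^esub> x \<oplus>\<^bsub>RM\<^esub> d \<odot>\<^bsub>RM\<^esub> x"
      unfolding a(1) RM_simps(4)[OF a(2)] RM_simps(3)[OF ac ac] by (simp only: kp.hom_add distrib_right)
    show "c \<odot>\<^bsub>RM\<^esub> (d \<odot>\<^bsub>RM\<^esub> x) = (c * d) \<odot>\<^bsub>RM\<^esub> x"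
      unfolding a(1) RM_simps(4)[OF a(2)] RM_simps(4)[OF ac] by (simp only: kp.hom_mult mult.assoc)
    show "1 \<odot>\<^bsub>RM\<^esub> x = x" unfolding a(1) RM_simps(4)[OF a(2)] by (simp only: kp.hom_one mult_1)
    assume "y \<in> carrier RM"
    then obtain b where b: "y = coset I b" "b \<in> int_set h" unfolding RM_simps by blast
    show "c \<odot>\<^bsub>RM\<^esub> (x \<oplus>\<^bsub>RM\<^esub> y) = c \<odot>\<^bsub>RM\<^esub> x \<oplus>\<^bsub>RM\<^esub> c \<odot>\<^bsub>RM\<^esub> y"
      unfolding a(1) b(1) RM_simps(3)[OF a(2) b(2)] RM_simps(4)[OF a(2)] RM_simps(4)[OF b(2)] RM_simps(4)[OF SD(3)[OF a(2) b(2)]]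
        RM_simps(3)[OF ac SD(4)[OF kpS b(2)]] by (simp only: distrib_left)
  }
qed

lemma RM_carrier: "carrier RM = carrier (int_ring h Quot I)"
  unfolding RM_simps Quot_carrier[OF h idlI] ..

lemma RM_basis: "ordered_basis RM RM.some_basis"
proof -
  have "finite (carrier RM)" unfolding RM_carrier by (rule Quot_finite[OF h idlI fqI])
  then have "\<exists>bs. ordered_basis RM bs" using RM.finite_spanning RM.ordered_basis_exists by blast
  then show ?thesis unfolding RM.some_basis_def by (rule someI_ex)
qed

definition "D = length RM.some_basis"
definition "bl i = (SOME x. x \<in> int_set h \<and> coset I x = RM.some_basis ! i)"

lemma bl: "i < D ==> bl i \<in> int_set h" "i < D ==> coset I (bl i) = RM.some_basis ! i"
proof -
  assume i: "i < D"
  then have "RM.some_basis ! i \<in> carrier RM" using RM_basis unfolding ordered_basis_def D_def by (auto simp del: RM_simps)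
  then have "\<exists>x. x \<in> int_set h \<and> coset I x = RM.some_basis ! i" unfolding RM_simps by blast
  from someI_ex[OF this] show "bl i \<in> int_set h" "coset I (bl i) = RM.some_basis ! i" unfolding bl_def by blast+
qed

lemma card_residue: "card (carrier (int_ring h Quot I)) = q ^ D"
  using RM.card_carrier[OF RM_basis] unfolding RM_carrier D_def q_card by simp

lemma coset_rep: "x \<in> int_set h ==> (SOME y. y \<in> coset I x) \<in> int_set h \<and> (SOME y. y \<in> coset I x) - x \<in> I"
proof -
  assume x: "x \<in> int_set h"
  have "x \<in> coset I x" using QD(1) by (simp add: in_coset)
  then have "(SOME y. y \<in> coset I x) \<in> coset I x" by (rule someI)
  then have e: "(SOME y. y \<in> coset I x) - x \<in> I" by (simp add: in_coset)
  then have "(SOME y. y \<in> coset I x) - x + x \<in> int_set h" using SD(3)[OF QD(2)[OF e] x] by blast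
  then show ?thesis using e by simp
qed

lemma functional_expand:
  assumes f: "f \<in> lin" and x: "x \<in> int_set h"
  shows "f x = (\<Sum>i<D. j (coords RM RM.some_basis (coset I x) ! i) * f (bl i))"
proof -
  define u where "u = (%A. f (SOME y. y \<in> A))"
  have u: "u (coset I x) = f x" if "x \<in> int_set h" for x
    unfolding u_def using coset_rep[OF that] that by (intro lin_cong[OF f]) blast+
  have ua: "u (A \<oplus>\<^bsub>RM\<^esub> B) = u A + u B" if AB: "A \<in> carrier RM" "B \<in> carrier RM" for A B
  proof -
    obtain a b where ab: "A = coset I a" "a \<in> int_set h" "B = coset I b" "b \<in> int_set h" using AB unfolding RM_simps by blast
    show ?thesis unfolding ab(1,3) RM_simps(3)[OF ab(2,4)] u[OF ab(2)] u[OF ab(4)] u[OF SD(3)[OF ab(2,4)]] by (rule linD(1)[OF f ab(2,4)])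
  qed
  have us: "u (c \<odot>\<^bsub>RM\<^esub> A) = j c * u A" if A: "A \<in> carrier RM" for A c
  proof -
    obtain a where a: "A = coset I a" "a \<in> int_set h" using A unfolding RM_simps by blast
    show ?thesis unfolding a(1) RM_simps(4)[OF a(2)] u[OF a(2)] u[OF SD(4)[OF kpS a(2)]] by (rule linD(2)[OF f a(2)])
  qed
  have xc: "coset I x \<in> carrier RM" unfolding RM_simps by (rule imageI[OF x])
  have s: "set RM.some_basis \<subseteq> carrier RM" using RM_basis by (simp add: ordered_basis_def)
  have "f x = u (lin_comb RM (coords RM RM.some_basis (coset I x)) RM.some_basis)"
    unfolding RM.coords(2)[OF RM_basis xc] u[OF x] ..
  also have "\<dots> = (\<Sum>i<D. j (coords RM RM.some_basis (coset I x) ! i) * u (RM.some_basis ! i))"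
    unfolding D_def by (rule RM.functional_lin_comb[OF ua us s])
  also have "\<dots> = (\<Sum>i<D. j (coords RM RM.some_basis (coset I x) ! i) * f (bl i))"
    by (rule sum.cong[OF refl]) (use u[OF bl(1)] bl(2) in simp)
  finally show ?thesis .
qed

text \<open>A vector in the left kernel is a relation between characters on a basis, hence
  everywhere, against their independence. The columns from \<open>D\<close> on are padded with
  zeros: for m = D the matrix of values is invertible, and for m > D the conclusion is absurd, which
  bounds the number of characters.\<close>

lemma char_matrix_det:
  assumes \<psi>: "!!i. i < m ==> \<psi> i \<in> chars" "inj_on \<psi> {..<m}" and m: "D \<le> m"
  shows "det (mat m m (%(i, l). if l < D then \<psi> i (bl l) else 0)) ~= 0"
proof
  let ?A = "mat m m (%(i, l). if l < D then \<psi> i (bl l) else 0)"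
  assume "det ?A = 0"
  then have "det (transpose_mat ?A) = 0" by (simp add: det_transpose[of _ m])
  then obtain v where v: "v \<in> carrier_vec m" "v ~= 0\<^sub>v m" "transpose_mat ?A *\<^sub>v v = 0\<^sub>v m"
    using det_0_iff_vec_prod_zero[of "transpose_mat ?A" m] by auto
  have z: "(\<Sum>i<m. v $ i * \<psi> i (bl l)) = 0" if l: "l < D" for l
  proof -
    have "(transpose_mat ?A *\<^sub>v v) $ l = 0" using v(3) l m by simp
    then show ?thesis using v(1) l m by (simp add: scalar_prod_def lessThan_atLeast0 mult.commute)
  qed
  define c where "c = (%\<chi>. if \<chi> \<in> \<psi> ` {..<m} then v $ (inv_into {..<m} \<psi> \<chi>) else 0)"
  have csum: "(\<Sum>\<chi>\<in>chars. c \<chi> * \<chi> x) = (\<Sum>i<m. v $ i * \<psi> i x)" for x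
  proof -
    have "(\<Sum>\<chi>\<in>chars. c \<chi> * \<chi> x) = (\<Sum>\<chi>\<in>\<psi> ` {..<m}. c \<chi> * \<chi> x)"
      using \<psi>(1) by (intro sum.mono_neutral_right finite_chars) (auto simp: c_def)
    also have "\<dots> = (\<Sum>i<m. c (\<psi> i) * \<psi> i x)" by (simp add: sum.reindex[OF \<psi>(2)])
    also have "\<dots> = (\<Sum>i<m. v $ i * \<psi> i x)" by (intro sum.cong refl) (simp add: c_def inv_into_f_f[OF \<psi>(2)])
    finally show ?thesis .
  qed
  have "(\<Sum>\<chi>\<in>chars. c \<chi> * \<chi> x) = 0" if x: "x \<in> int_set h" for x
  proof -
    have "(%x. \<Sum>i<m. v $ i * \<psi> i x) \<in> lin" by (intro lin_sum lin_scale chars_lin \<psi>(1)) simp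
    from functional_expand[OF this x] show ?thesis unfolding csum by (simp add: z)
  qed
  then have "c (\<psi> i) = 0" if "i < m" for i using chars_independent[OF _ \<psi>(1)[OF that]] by blast
  then have "v $ i = 0" if "i < m" for i using that by (auto simp: c_def inv_into_f_f[OF \<psi>(2)])
  then show False using v(1,2) by (auto simp: vec_eq_iff)
qed

lemma card_chars_le: "card chars \<le> D"
proof (rule ccontr)
  assume "\<not> card chars \<le> D"
  then have m: "D < card chars" by simp
  obtain \<psi> where \<psi>: "bij_betw \<psi> {..<card chars} chars"
    using ex_bij_betw_nat_finite[OF finite_chars] by (auto simp: lessThan_atLeast0)
  let ?m = "card chars"
  let ?A = "mat ?m ?m (%(i, l). if l < D then \<psi> i (bl l) else 0)"
  have "det ?A ~= 0" using \<psi> m by (intro char_matrix_det) (auto simp: bij_betw_def)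
  moreover have "?A *\<^sub>v unit_vec ?m D = 0\<^sub>v ?m"
    using m by (intro eq_vecI) (simp_all add: scalar_prod_right_unit)
  then have "det ?A = 0"
    unfolding det_0_iff_vec_prod_zero[OF mat_carrier] using unit_vec_nonzero[OF m] by (intro exI[of _ "unit_vec ?m D"]) simp
  ultimately show False by blast
qed

text \<open>A character is injective on the residue field, whose image consists of roots of \<open>T^q^d - T\<close>.\<close>

lemma D_le:
  assumes \<chi>: "\<chi> \<in> chars" and d: "0 < d" "frob d \<chi> = \<chi>" shows "D \<le> d"
proof -
  obtain A where A: "finite A" "(\<Prod>\<alpha>\<in>A. [:- \<alpha>, 1:]) = Polynomial.monom 1 (q ^ d) - Polynomial.monom (1 :: 'o) 1"
    using split_O[OF d(1)] by blast
  have "card A = degree (\<Prod>\<alpha>\<in>A. [:- \<alpha>, 1:])" by (subst degree_prod_sum_eq) simp_all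
  also have "\<dots> \<le> q ^ d"
    unfolding A(2) using q1 by (intro degree_diff_le degree_monom_le[THEN order_trans]) simp_all
  finally have cA: "card A \<le> q ^ d" .
  have "inj_on (%B. \<chi> (SOME y. y \<in> B)) (coset I ` int_set h)"
  proof (rule inj_onI)
    fix B C assume "B \<in> coset I ` int_set h" "C \<in> coset I ` int_set h" and e: "\<chi> (SOME y. y \<in> B) = \<chi> (SOME y. y \<in> C)"
    then obtain x y where xy: "B = coset I x" "x \<in> int_set h" "C = coset I y" "y \<in> int_set h" by blast
    have "\<chi> x = \<chi> y"
      using e[unfolded xy] coset_rep[OF xy(2)] coset_rep[OF xy(4)]
        lin_cong[OF chars_lin[OF \<chi>] _ xy(2), of "SOME z. z \<in> coset I x"] lin_cong[OF chars_lin[OF \<chi>] _ xy(4), of "SOME z. z \<in> coset I y"]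
      by (simp only: simp_thms)
    then show "B = C" unfolding xy coset_eq_iff[OF idlI S] using char_eq_iff[OF \<chi> xy(2,4)] by simp
  qed
  moreover have "(%B. \<chi> (SOME y. y \<in> B)) ` (coset I ` int_set h) \<subseteq> A"
  proof (rule image_subsetI)
    fix B :: "'l set"
    let ?x = "SOME y. y \<in> B"
    have "poly (\<Prod>\<alpha>\<in>A. [:- \<alpha>, 1:]) (\<chi> ?x) = 0"
      unfolding A(2) using frob_char[OF \<chi>, of d ?x] d(2) by (simp add: poly_monom)
    then show "\<chi> ?x \<in> A" unfolding poly_prod using A(1) by (auto simp: prod_zero_iff)
  qed
  ultimately have "card (coset I ` int_set h) \<le> card A" using A(1) by (rule card_inj_on_le)
  then have "q ^ D \<le> q ^ d" using cA card_residue unfolding Quot_carrier[OF h idlI] by simp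
  then show ?thesis using q1(1) power_increasing_iff by blast
qed

text \<open>Let d be the period of \<open>\<chi>\<close>. Its distinct iterates give d \<le>
  \<open>card chars\<close>, independence gives \<open>card chars\<close> \<le> D, and
  \<open>D_le\<close> gives D \<le> d; so all three agree and the iterates exhaust the
  characters.\<close>

lemma frob_period:
  assumes \<chi>: "\<chi> \<in> chars"
  shows "inj_on (%i. frob i \<chi>) {..<D}" "chars = (%i. frob i \<chi>) ` {..<D}" "frob D \<chi> = \<chi>" "0 < D"
proof -
  define d where "d = (LEAST d. 0 < d \<and> frob d \<chi> = \<chi>)"
  have d: "0 < d" "frob d \<chi> = \<chi>" using LeastI[of "%d. 0 < d \<and> frob d \<chi> = \<chi>" N] N(1) frob_N_char[OF \<chi>] unfolding d_def by blast+
  have inj: "inj_on (%i. frob i \<chi>) {..<d}"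
  proof (rule linorder_inj_onI)
    fix x y assume xy: "x < y" "x \<in> {..<d}" "y \<in> {..<d}"
    show "frob x \<chi> ~= frob y \<chi>"
    proof
      assume "frob x \<chi> = frob y \<chi>"
      moreover have "frob y \<chi> = frob x (frob (y - x) \<chi>)" using xy by (simp add: frob_frob)
      ultimately have "frob (y - x) \<chi> = \<chi>" using frob_char_inj[OF \<chi> frob_chars[OF \<chi>], of x] by metis
      then have "d \<le> y - x" unfolding d_def using xy(1) by (intro Least_le) simp
      then show False using xy by simp
    qed
  qed auto
  have sub: "(%i. frob i \<chi>) ` {..<d} \<subseteq> chars" using frob_chars[OF \<chi>] by blast
  have "d \<le> card chars" using card_mono[OF finite_chars sub] card_image[OF inj] by simp
  then have dD: "d = D" "card chars = d" using card_chars_le D_le[OF \<chi> d] by simp_all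
  have "(%i. frob i \<chi>) ` {..<d} = chars"
    by (rule card_subset_eq[OF finite_chars sub]) (use card_image[OF inj] dD in simp)
  then show "inj_on (%i. frob i \<chi>) {..<D}" "chars = (%i. frob i \<chi>) ` {..<D}" "frob D \<chi> = \<chi>" "0 < D" using inj d dD by simp_all
qed

definition "RA = endo_mat RM (%x. quot_emb h I [:0, 1:] \<otimes>\<^bsub>int_ring h Quot I\<^esub> x)"

lemma residue_size_eq: "residue_size h I = char_poly RA"
  unfolding residue_size_def mod_size_def RA_def RM_def Let_def ..

lemma RA: "RA \<in> carrier_mat D D" by (simp add: RA_def RM.endo_mat_eq D_def)

lemma degree_residue_size: "degree (residue_size h I) = D" "lead_coeff (residue_size h I) = 1"
  using degree_monic_char_poly[OF RA] unfolding residue_size_eq by simp_all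

text \<open>The D conjugate characters, evaluated on a basis, form an invertible matrix
  \<open>B\<close> that diagonalizes multiplication by z over \<Omega>, with the conjugates of the
  image of z as eigenvalues.\<close>

lemma residue_size_eval:
  assumes \<chi>: "\<chi> \<in> chars"
  shows "poly (map_poly j (residue_size h I)) s = (\<Prod>i<D. s - \<chi> (poly_emb h [:0, 1:]) ^ (q ^ i))"
proof -
  interpret j: field_hom j by (rule jh)
  let ?z = "poly_emb h [:0, 1:]"
  have z: "?z \<in> int_set h" by (rule poly_emb_int_set[OF h])
  define B where "B = mat D D (%(i, l). frob i \<chi> (bl l))"
  have Bc: "B \<in> carrier_mat D D" by (simp add: B_def)
  have "B = mat D D (%(i, l). if l < D then frob i \<chi> (bl l) else 0)" unfolding B_def by (rule cong_mat) simp_all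
  then have dB: "det B ~= 0" using char_matrix_det[of D "%i. frob i \<chi>"] frob_period(1)[OF \<chi>] frob_chars[OF \<chi>] by simp
  let ?R = "map_mat j RA"
  define Dg where "Dg = mat D D (%(i, l). if i = l then s - \<chi> ?z ^ (q ^ i) else 0)"
  have Dgc: "Dg \<in> carrier_mat D D" by (simp add: Dg_def)
  have Rc: "s \<cdot>\<^sub>m 1\<^sub>m D - ?R \<in> carrier_mat D D" using RA by (intro minus_carrier_mat) simp
  have entry: "(\<Sum>k<D. frob i \<chi> (bl k) * j (RA $$ (k, l))) = \<chi> ?z ^ (q ^ i) * frob i \<chi> (bl l)" if il: "i < D" "l < D" for i l
  proof -
    have zb: "?z * bl l \<in> int_set h" using SD(4)[OF z bl(1)[OF il(2)]] .
    have "RA $$ (k, l) = coords RM RM.some_basis (coset I (?z * bl l)) ! k" if "k < D" for k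
      using that il(2) bl[OF il(2)] Quot_mult[OF h idlI z bl(1)[OF il(2)]]
      by (simp add: RA_def RM.endo_mat_eq D_def quot_emb_coset[OF h idlI])
    then have "(\<Sum>k<D. frob i \<chi> (bl k) * j (RA $$ (k, l))) = (\<Sum>k<D. j (coords RM RM.some_basis (coset I (?z * bl l)) ! k) * frob i \<chi> (bl k))"
      by (intro sum.cong refl) (simp add: mult.commute)
    also have "\<dots> = frob i \<chi> (?z * bl l)" by (rule functional_expand[OF chars_lin[OF frob_chars[OF \<chi>]] zb, symmetric])
    also have "\<dots> = frob i \<chi> ?z * frob i \<chi> (bl l)" by (rule rhomD(4)[OF charsD(1)[OF frob_chars[OF \<chi>]] z bl(1)[OF il(2)]])
    finally show ?thesis by (simp add: frob_char[OF \<chi>])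
  qed
  have "B * (s \<cdot>\<^sub>m 1\<^sub>m D - ?R) = Dg * B"
  proof (rule eq_matI)
    fix i l assume "i < dim_row (Dg * B)" "l < dim_col (Dg * B)"
    then have il: "i < D" "l < D" using Bc Dgc by auto
    have "(B * (s \<cdot>\<^sub>m 1\<^sub>m D - ?R)) $$ (i, l) = (\<Sum>k<D. frob i \<chi> (bl k) * ((if k = l then s else 0) - j (RA $$ (k, l))))"
      using il RA by (simp add: B_def scalar_prod_def lessThan_atLeast0 if_distrib[of "(*) s"] cong: if_cong)
    also have "\<dots> = (\<Sum>k<D. (if k = l then frob i \<chi> (bl k) * s else 0)) - (\<Sum>k<D. frob i \<chi> (bl k) * j (RA $$ (k, l)))"
      unfolding sum_subtractf[symmetric] by (intro sum.cong refl) (simp add: algebra_simps)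
    also have "\<dots> = (s - \<chi> ?z ^ (q ^ i)) * frob i \<chi> (bl l)" unfolding entry[OF il] using il by (simp add: algebra_simps)
    also have "\<dots> = (\<Sum>k<D. (if i = k then s - \<chi> ?z ^ (q ^ i) else 0) * frob k \<chi> (bl l))"
    proof -
      have "(\<Sum>k<D. (if i = k then s - \<chi> ?z ^ (q ^ i) else 0) * frob k \<chi> (bl l)) = (\<Sum>k<D. if i = k then (s - \<chi> ?z ^ (q ^ i)) * frob k \<chi> (bl l) else 0)"
        by (intro sum.cong refl) simp
      then show ?thesis using il by simp
    qed
    also have "\<dots> = (Dg * B) $$ (i, l)" using il by (simp add: B_def Dg_def scalar_prod_def lessThan_atLeast0)
    finally show "(B * (s \<cdot>\<^sub>m 1\<^sub>m D - ?R)) $$ (i, l) = (Dg * B) $$ (i, l)" .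
  qed (use Bc Dgc Rc in auto)
  then have "det B * det (s \<cdot>\<^sub>m 1\<^sub>m D - ?R) = det B * det Dg"
    using det_mult[OF Bc Rc] det_mult[OF Dgc Bc] by (metis mult.commute)
  then have dd: "det (s \<cdot>\<^sub>m 1\<^sub>m D - ?R) = det Dg" using mult_left_cancel[OF dB] by blast
  have "det Dg = prod_list (diag_mat Dg)"
    by (rule det_upper_triangular[OF _ Dgc]) (auto simp: Dg_def upper_triangular_def)
  also have "\<dots> = (\<Prod>i<D. s - \<chi> ?z ^ (q ^ i))"
    using Dgc by (simp add: diag_mat_def Dg_def prod.list_conv_set_nth lessThan_atLeast0)
  finally have dDg: "det Dg = (\<Prod>i<D. s - \<chi> ?z ^ (q ^ i))" .
  have "map_poly j (residue_size h I) = det (char_poly_matrix ?R)"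
    by (simp only: residue_size_eq char_poly_def[of ?R, symmetric] j.char_poly_hom[OF RA])
  also have "poly (det (char_poly_matrix ?R)) s = det (s \<cdot>\<^sub>m 1\<^sub>m D - ?R)"
    by (rule poly_det_cong[OF Rc]) (use RA in \<open>auto simp: char_poly_matrix_def\<close>)
  finally show ?thesis using dd dDg by simp
qed

end

section \<open>Decomposition data of a prime\<close>

locale prime_data =
  fixes \<iota> :: "'k::{field,finite} => 'f::field" and a :: "'k poly fract => 'K::field" and b :: "'K => 'L::field"
    and sc :: "'f => 'v::ab_group_add => 'v" and \<rho> :: "('L => 'L) => 'v => 'v" and n :: nat
    and p :: "'K set" and P :: "'L set" and jf :: "'f => 'o::alg_closed_field" and q :: nat
  assumes qc: "q = card (UNIV :: 'k set)" and fe\<iota>: "finite_ext \<iota>" and fea: "finite_ext a" and gal: "finite_galois_ext b"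
    and p: "p \<in> Max_ideals (int_ring a)" and above: "lies_above a b P p" and fd: "finite_dim_space sc"
    and \<rho>: "\<rho> \<in> hom (Gal b) (GL sc)" and n1: "n \<ge> 1" and jf: "field_hom jf"
begin

abbreviation "S \<equiv> int_set (b \<circ> a)"
abbreviation "Q \<equiv> ext_ideal a b p"
abbreviation "kp \<equiv> %c. poly_emb (b \<circ> a) [:c:]"
abbreviation "z \<equiv> poly_emb (b \<circ> a) [:0, 1:]"
abbreviation "G \<equiv> carrier (Gal b)"

lemma \<iota>: "field_hom \<iota>" using fe\<iota> by (simp add: finite_ext_def)
lemma feb: "finite_ext b" using gal by (simp add: finite_galois_ext_def)
lemma fha: "field_hom a" using fea by (simp add: finite_ext_def)
lemma fhb: "field_hom b" using feb by (simp add: finite_ext_def)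
lemma fhh: "field_hom (b \<circ> a)" by (rule field_hom_comp[OF fha fhb])
lemma feh: "finite_ext (b \<circ> a)" by (rule finite_ext_comp[OF fea feb])

sublocale b: field_hom b by (rule fhb)

lemma subS: "subrng S" by (rule subrng_int_set[OF fhh])
lemma bS: "b x \<in> S \<longleftrightarrow> x \<in> int_set a" by (rule int_set_comp_iff[OF fha fhb])
lemma poly_emb_comp: "poly_emb (b \<circ> a) f = b (poly_emb a f)" by (simp add: poly_emb_def)

lemma p_max: "maximalideal p (int_ring a)" using p by (simp add: Max_ideals_def)
lemma p_prime: "prime_idl p (int_set a)" by (rule maximalideal_prime_idl[OF fha p_max])
lemma p_idl: "idl p (int_set a)" using p_prime by (simp add: prime_idl_def)
lemma P_prime: "prime_idl P S" using above by (intro primeideal_int_ring[OF fhh]) (simp add: lies_above_def)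
lemma P_idl: "idl P S" using P_prime by (simp add: prime_idl_def)
lemma P_p: "x \<in> int_set a ==> b x \<in> P \<longleftrightarrow> x \<in> p" using above by (auto simp: lies_above_def)
lemma p_sub: "x \<in> p ==> x \<in> int_set a" using p_idl unfolding idl_def by blast

lemma irreducible_in_p: "\<exists>f. irreducible f \<and> poly_emb a f \<in> p"
proof -
  obtain x where "x \<in> p" "x ~= 0" using maximalideal_nonzero[OF fha p_max] by blast
  then obtain f where "f ~= 0" "poly_emb a f \<in> p" using idl_contains_poly[OF fha p_idl] by blast
  from prime_idl_min_poly[OF fha p_prime this] show ?thesis by metis
qed

lemma Q_idl: "idl Q S" and bp_Q: "x \<in> p ==> b x \<in> Q" and Q_min: "idl J S ==> b ` p \<subseteq> J ==> Q \<subseteq> J"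
proof -
  interpret R: cring "int_ring (b \<circ> a)" by (rule cring_int_ring[OF fhh])
  have c: "b ` p \<subseteq> carrier (int_ring (b \<circ> a))" unfolding int_ring_simps(1)[of "b \<circ> a"] using bS p_sub by blast
  show "idl Q S" unfolding ext_ideal_def using R.genideal_ideal[OF c] ideal_int_ring_iff[OF fhh] by blast
  show "b x \<in> Q" if "x \<in> p" using R.genideal_self[OF c] that unfolding ext_ideal_def by blast
  show "Q \<subseteq> J" if "idl J S" "b ` p \<subseteq> J"
    unfolding ext_ideal_def using that ideal_int_ring_iff[OF fhh] by (intro R.genideal_minimal) blast+
qed

lemma Q_P: "Q \<subseteq> P" using P_p p_sub by (intro Q_min[OF P_idl]) blast

lemma fq_Q: "fin_quot S Q"
proof -
  obtain f where f: "irreducible f" "poly_emb a f \<in> p" using irreducible_in_p by blast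
  then show ?thesis using bp_Q[OF f(2)] poly_emb_comp by (intro fin_quot_idl[OF feh Q_idl f(1)]) metis
qed

lemma fq_p: "fin_quot (int_set a) p"
  using irreducible_in_p fin_quot_idl[OF fea p_idl] by blast

sublocale \<iota>j: field_hom "jf \<circ> \<iota>" by (rule field_hom_comp[OF \<iota> jf])

sublocale fin_char S Q kp "jf \<circ> \<iota>" q
  by (rule fin_char.intro[OF qc subS Q_idl field_hom_const_emb[OF fhh] poly_emb_int_set[OF fhh] field_hom_comp[OF \<iota> jf] fq_Q])

sublocale RP: residue_field "b \<circ> a" P "jf \<circ> \<iota>" q
  by (rule residue_field.intro[OF qc fhh P_prime fin_quot_mono[OF fq_Q Q_P] field_hom_comp[OF \<iota> jf]])

sublocale RK: residue_field a p "jf \<circ> \<iota>" q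
  by (rule residue_field.intro[OF qc fha p_prime fq_p field_hom_comp[OF \<iota> jf]])

lemma z_S: "z \<in> S" by (rule poly_emb_int_set[OF fhh])

lemma Gal_rhom: "g \<in> G ==> rhom S g"
proof -
  assume "g \<in> G"
  then interpret g: field_hom g by (simp add: Gal_iff)
  show ?thesis by (simp add: rhom_def g.hom_add g.hom_mult)
qed

lemma Gal_S: "g \<in> G ==> x \<in> S ==> g x \<in> S" by (rule Gal_int_set[OF fhh])
lemma Gal_b: "g \<in> G ==> g (b x) = b x" by (simp add: Gal_iff)
lemma Gal_bij: "g \<in> G ==> bij g" by (simp add: Gal_iff)
lemma Gal_poly: "g \<in> G ==> g (poly_emb (b \<circ> a) f) = poly_emb (b \<circ> a) f" by (simp add: poly_emb_comp Gal_b)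
lemma Gal_inv_apply: "g \<in> G ==> inv_into UNIV g (g x) = x" "g \<in> G ==> g (inv_into UNIV g x) = x"
  using Gal_bij[of g] by (simp_all add: bij_is_inj bij_is_surj surj_f_inv_f)

text \<open>The elements sent into \<open>Q\<close> form an ideal, and it contains the generators of
  \<open>Q\<close>, which are fixed by \<open>g\<close>.\<close>

lemma Gal_Q:
  assumes g: "g \<in> G" and x: "x \<in> Q" shows "g x \<in> Q"
proof -
  note r = rhomD[OF Gal_rhom[OF g]]
  have "idl {x \<in> S. g x \<in> Q} S"
    unfolding idl_def
  proof (intro conjI ballI)
    show "0 \<in> {x \<in> S. g x \<in> Q}" using SD(1) QD(1) r(1) by simp
    show "x + y \<in> {x \<in> S. g x \<in> Q}" if "x \<in> {x \<in> S. g x \<in> Q}" "y \<in> {x \<in> S. g x \<in> Q}" for x y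
      using that SD(3)[of x y] r(3)[of x y] QD(3)[of "g x" "g y"] by simp
    show "x * y \<in> {x \<in> S. g x \<in> Q}" if "x \<in> S" "y \<in> {x \<in> S. g x \<in> Q}" for x y
      using that SD(4)[of x y] r(4)[of x y] QD(4)[of "g x" "g y"] Gal_S[OF g, of x] by simp
  qed blast
  moreover have "b ` p \<subseteq> {x \<in> S. g x \<in> Q}" using bp_Q Gal_b[OF g] bS p_sub by auto
  ultimately show ?thesis using Q_min x by blast
qed

text \<open>Integral elements fixed by the Galois group come from O_K, so agreement there is all
  that \<open>char_transitive\<close> requires.\<close>

lemma char_transitivity:
  assumes \<chi>: "\<chi> \<in> chars" and \<psi>: "\<psi> \<in> chars" and agree: "!!y. y \<in> int_set a ==> \<chi> (b y) = \<psi> (b y)"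
  shows "\<exists>g\<in>G. \<forall>x\<in>S. \<psi> x = \<chi> (g x)"
proof -
  obtain Y where Y: "finite Y" "Y \<subseteq> S" "!!x. x \<in> S ==> \<exists>y\<in>Y. x - y \<in> Q" using fq_Q unfolding fin_quot_def by blast
  show ?thesis
  proof (rule char_transitive[where S = S and G = G and Q = Q and Y = Y and \<chi> = \<chi> and \<psi> = \<psi>])
    show "subrng S" by (rule subS)
    show "finite G" by (rule finite_Gal[OF feb])
    show "id \<in> G" by (rule Gal_id)
    show "finite Y" "Y \<subseteq> S" by (rule Y)+
    show "rhom S \<chi>" "rhom S \<psi>" using charsD(1) \<chi> \<psi> by blast+
    show "rhom S g" if "g \<in> G" for g by (rule Gal_rhom[OF that])
    show "g x \<in> S" if "g \<in> G" "x \<in> S" for g x by (rule Gal_S[OF that])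
    show "\<exists>y\<in>Y. x - y \<in> Q" if "x \<in> S" for x by (rule Y(3)[OF that])
    show "bij_betw (%g. h \<circ> g) G G" if h: "h \<in> G" for h
    proof (rule bij_betwI[of _ _ _ "%g. inv_into UNIV h \<circ> g"])
      show "(%g. h \<circ> g) \<in> G \<rightarrow> G" "(%g. inv_into UNIV h \<circ> g) \<in> G \<rightarrow> G"
        using Gal_comp[OF h] Gal_comp[OF Gal_inv[OF h]] by blast+
      show "inv_into UNIV h \<circ> (h \<circ> g) = g" "h \<circ> (inv_into UNIV h \<circ> g) = g" for g
        using Gal_inv_apply[OF h] by (simp_all add: fun_eq_iff)
    qed
    show "Q \<subseteq> S" using QD(2) by blast
    show "\<psi> x = 0" if "x \<in> Q" for x by (rule charsD(3)[OF \<psi> that])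
    show "\<chi> (g x) = 0" if "g \<in> G" "x \<in> Q" for g x by (rule charsD(3)[OF \<chi> Gal_Q[OF that]])
    show "\<chi> x = \<psi> x" if x: "x \<in> S" "!!g. g \<in> G ==> g x = x" for x
    proof -
      have "x \<in> b ` int_set a" by (rule Gal_fixed_int_set[where a = a and b = b and x = x]) (rule fea, rule gal, rule x(1), rule x(2))
      then obtain y where "y \<in> int_set a" "x = b y" by blast
      then show ?thesis using agree by blast
    qed
  qed
qed

definition "\<chi>0 = (SOME \<chi>. \<chi> \<in> RP.chars)"
definition "rK \<chi> = (%x. if x \<in> int_set a then \<chi> (b x) else (0 :: 'o))"

lemma \<chi>0_RP: "\<chi>0 \<in> RP.chars" unfolding \<chi>0_def by (rule someI_ex[OF RP.exists_char])

lemma \<chi>0_chars: "\<chi>0 \<in> chars"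
  using \<chi>0_RP Q_P unfolding chars_def RP.chars_def by blast

lemma \<chi>0_eq_0: "x \<in> S ==> \<chi>0 x = 0 \<longleftrightarrow> x \<in> P" by (rule RP.char_eq_0[OF \<chi>0_RP])
lemma \<chi>0_eq_iff: "x \<in> S ==> y \<in> S ==> \<chi>0 x = \<chi>0 y \<longleftrightarrow> x - y \<in> P" by (rule RP.char_eq_iff[OF \<chi>0_RP])
lemma \<chi>0_power: "x \<in> S ==> \<chi>0 (x ^ m) = \<chi>0 x ^ m" by (rule rhom_power[OF charsD(1)[OF \<chi>0_chars] subS])

lemma rK_chars:
  assumes \<chi>: "\<chi> \<in> chars" shows "rK \<chi> \<in> RK.chars"
proof -
  note r = rhomD[OF charsD(1)[OF \<chi>]] note KD = subrngD[OF subrng_int_set[OF fha]]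
  have "rhom (int_set a) (rK \<chi>)"
    unfolding rhom_def
  proof (intro conjI ballI)
    show "rK \<chi> 0 = 0" "rK \<chi> 1 = 1" using KD(1,2) r(1,2) by (simp_all add: rK_def)
    fix x y assume xy: "x \<in> int_set a" "y \<in> int_set a"
    then have bxy: "b x \<in> S" "b y \<in> S" using bS by blast+
    show "rK \<chi> (x + y) = rK \<chi> x + rK \<chi> y" using KD(3)[OF xy] xy r(3)[OF bxy] by (simp add: rK_def b.hom_add)
    show "rK \<chi> (x * y) = rK \<chi> x * rK \<chi> y" using KD(4)[OF xy] xy r(4)[OF bxy] by (simp add: rK_def b.hom_mult)
  qed
  moreover have "rK \<chi> (poly_emb a [:c:]) = (jf \<circ> \<iota>) c" for c
    using charsD(2)[OF \<chi>, of c] poly_emb_int_set[OF fha, of "[:c:]"] by (simp add: rK_def poly_emb_comp)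
  moreover have "rK \<chi> x = 0" if "x \<in> p" for x using charsD(3)[OF \<chi> bp_Q[OF that]] by (simp add: rK_def)
  moreover have "rK \<chi> x = 0" if "x \<notin> int_set a" for x unfolding rK_def using that by (rule if_not_P)
  ultimately show ?thesis unfolding RK.chars_def by blast
qed

lemma rK_apply: "y \<in> int_set a ==> rK \<chi> y = \<chi> (b y)" unfolding rK_def by (rule if_P)

text \<open>The degree of kappa_p over k, and by \<open>RK.frob_period\<close> also the length of
  the Frobenius cycle on its characters.\<close>

abbreviation "d \<equiv> RK.D"

lemma d_pos: "0 < d" and \<chi>0_period: "y \<in> int_set a ==> \<chi>0 (b y) ^ (q ^ d) = \<chi>0 (b y)"
proof -
  note fp = RK.frob_period[OF rK_chars[OF \<chi>0_chars]]
  show "0 < d" by (rule fp(4))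
  show "\<chi>0 (b y) ^ (q ^ d) = \<chi>0 (b y)" if "y \<in> int_set a"
    using fun_cong[OF fp(3), of y] RK.frob_char[OF rK_chars[OF \<chi>0_chars], of d y] rK_apply[OF that] by simp
qed

text \<open>Restricted to O_K, every character is a Frobenius iterate of the restriction of
  \<open>\<chi>0\<close>; over that common restriction the Galois group acts transitively.\<close>

lemma char_orbit:
  assumes \<chi>: "\<chi> \<in> chars"
  shows "\<exists>i g. 0 < i \<and> i \<le> d \<and> g \<in> G \<and> (\<forall>x\<in>S. \<chi> x = \<chi>0 (g x) ^ (q ^ i))"
proof -
  note fp = RK.frob_period[OF rK_chars[OF \<chi>0_chars]]
  obtain i where i: "i < d" "rK \<chi> = RK.frob i (rK \<chi>0)" using rK_chars[OF \<chi>] unfolding fp(2) by blast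
  \<comment> \<open>Exponent 0 is traded for the full period d, which moves the range from 0 .. d -
    1 to 1 .. d.\<close>
  have "\<exists>i. 0 < i \<and> i \<le> d \<and> rK \<chi> = RK.frob i (rK \<chi>0)"
  proof (cases "i = 0")
    case True
    have "RK.frob 0 (rK \<chi>0) = rK \<chi>0" by (rule HOL.ext) (simp add: RK.frob_char[OF rK_chars[OF \<chi>0_chars]])
    then show ?thesis using i fp(3,4) True by (intro exI[of _ d]) simp
  qed (use i in auto)
  then obtain i where i: "0 < i" "i \<le> d" "rK \<chi> = RK.frob i (rK \<chi>0)" by blast
  have "frob i \<chi>0 (b y) = \<chi> (b y)" if y: "y \<in> int_set a" for y
  proof -
    have "frob i \<chi>0 (b y) = rK \<chi>0 y ^ (q ^ i)" unfolding frob_char[OF \<chi>0_chars] rK_apply[OF y] ..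
    also have "\<dots> = rK \<chi> y" unfolding i(3) by (rule RK.frob_char[OF rK_chars[OF \<chi>0_chars], symmetric])
    finally show ?thesis unfolding rK_apply[OF y] .
  qed
  from char_transitivity[OF frob_chars[OF \<chi>0_chars] \<chi> this]
  obtain g where "g \<in> G" "\<forall>x\<in>S. \<chi> x = frob i \<chi>0 (g x)" by blast
  then show ?thesis using i by (intro exI[of _ i] exI[of _ g]) (simp add: frob_char[OF \<chi>0_chars])
qed

text \<open>On O_K the element \<open>g\<close> acts trivially, so equality would give the
  restriction of \<open>\<chi>0\<close> a Frobenius period smaller than d.\<close>

lemma char_disjoint:
  assumes "0 < i" "i < d" "g \<in> G" shows "\<exists>x\<in>S. \<chi>0 x ^ (q ^ i) ~= \<chi>0 (g x)"
proof (rule ccontr)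
  assume no: "\<not> (\<exists>x\<in>S. \<chi>0 x ^ (q ^ i) ~= \<chi>0 (g x))"
  note fp = RK.frob_period[OF rK_chars[OF \<chi>0_chars]]
  have "RK.frob i (rK \<chi>0) = RK.frob 0 (rK \<chi>0)"
  proof
    fix y show "RK.frob i (rK \<chi>0) y = RK.frob 0 (rK \<chi>0) y"
    proof (cases "y \<in> int_set a")
      case True
      then have "\<chi>0 (b y) ^ (q ^ i) = \<chi>0 (g (b y))" using no bS by blast
      then show ?thesis unfolding RK.frob_char[OF rK_chars[OF \<chi>0_chars]] rK_apply[OF True] Gal_b[OF assms(3)] by simp
    next
      case False
      then have "rK \<chi>0 y = 0" unfolding rK_def by (rule if_not_P)
      then show ?thesis unfolding RK.frob_char[OF rK_chars[OF \<chi>0_chars]] using q1 by simp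
    qed
  qed
  then have "i = 0" using fp(1) assms(2) d_pos unfolding inj_on_def by blast
  then show False using assms(1) by simp
qed

text \<open>\<open>frob d \<chi>0\<close> and \<open>\<chi>0\<close> have the same restriction to
  O_K, so transitivity produces an element that induces the q^d-th power: a Frobenius element at
  P.\<close>

lemma exists_frob: "\<exists>g\<in>G. \<forall>x\<in>S. \<chi>0 x ^ (q ^ d) = \<chi>0 (g x)"
proof -
  have "\<chi>0 (b y) = frob d \<chi>0 (b y)" if "y \<in> int_set a" for y
    unfolding frob_char[OF \<chi>0_chars] \<chi>0_period[OF that] ..
  from char_transitivity[OF \<chi>0_chars frob_chars[OF \<chi>0_chars] this] show ?thesis
    unfolding frob_char[OF \<chi>0_chars] .
qed

text \<open>\<open>P\<close> is the kernel of \<open>\<chi>0\<close> in \<open>S\<close>, and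
  raising values to a positive power does not change a kernel.\<close>

lemma Gal_P:
  assumes g: "g \<in> G" and m: "0 < m" and eq: "!!x. x \<in> S ==> \<chi>0 x ^ m = \<chi>0 (g x)"
  shows "g ` P = P"
proof -
  have iff: "g x \<in> P \<longleftrightarrow> x \<in> P" if x: "x \<in> S" for x
    using eq[OF x] \<chi>0_eq_0[OF x] \<chi>0_eq_0[OF Gal_S[OF g x]] m by (metis power_eq_0_iff)
  have PS: "x \<in> S" if "x \<in> P" for x using P_idl that unfolding idl_def by blast
  show ?thesis
  proof (intro subset_antisym subsetI)
    fix y assume "y \<in> g ` P"
    then show "y \<in> P" using iff PS by blast
  next
    fix y assume y: "y \<in> P"
    have "inv_into UNIV g y \<in> S" by (rule Gal_S[OF Gal_inv[OF g] PS[OF y]])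
    from iff[OF this] have "inv_into UNIV g y \<in> P" unfolding Gal_inv_apply[OF g] using y by simp
    then show "y \<in> g ` P" using Gal_inv_apply(2)[OF g, of y] by (intro image_eqI[of _ _ "inv_into UNIV g y"]) simp_all
  qed
qed

lemma image_coset:
  assumes g: "g \<in> G" and J: "g ` J = J" shows "g ` coset J x = coset J (g x)"
proof -
  interpret g: field_hom g using g by (simp add: Gal_iff)
  have "g ` coset J x = (%i. i + g x) ` g ` J" unfolding coset_def image_image g.hom_add ..
  then show ?thesis unfolding J coset_def .
qed

lemma image_coset_Q: "g \<in> G ==> g ` coset Q x = coset Q (g x)"
proof (rule image_coset)
  assume g: "g \<in> G"
  show "g ` Q = Q"
  proof (intro subset_antisym subsetI)
    fix y assume "y \<in> Q"
    then show "y \<in> g ` Q" using Gal_Q[OF Gal_inv[OF g], of y] Gal_inv_apply(2)[OF g, of y] by (intro image_eqI[of _ _ "inv_into UNIV g y"]) simp_all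
  qed (use Gal_Q[OF g] in blast)
qed

text \<open>\<open>\<chi>0\<close> separates the cosets of \<open>P\<close>, so statements about the
  action on the residue field become equations between its values.\<close>

lemma residue_action:
  assumes g: "g \<in> G" and gP: "g ` P = P"
  shows "(\<forall>A\<in>carrier (int_ring (b \<circ> a) Quot P). g ` A = A [^]\<^bsub>int_ring (b \<circ> a) Quot P\<^esub> m) \<longleftrightarrow> (\<forall>x\<in>S. \<chi>0 x ^ m = \<chi>0 (g x))"
proof -
  have "g ` coset P x = coset P x [^]\<^bsub>int_ring (b \<circ> a) Quot P\<^esub> m \<longleftrightarrow> \<chi>0 x ^ m = \<chi>0 (g x)" if x: "x \<in> S" for x
    unfolding image_coset[OF g gP] Quot_pow[OF fhh P_idl x] coset_eq_iff[OF P_idl subS] \<chi>0_eq_iff[OF Gal_S[OF g x] S_power[OF x], symmetric] \<chi>0_power[OF x]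
    by (rule eq_commute)
  then show ?thesis unfolding Quot_carrier[OF fhh P_idl] ball_simps(9) by (intro ball_cong[OF refl])
qed

lemma inertia_iff: "g \<in> inertia a b P \<longleftrightarrow> g \<in> G \<and> (\<forall>x\<in>S. \<chi>0 (g x) = \<chi>0 x)"
proof -
  have dec: "g \<in> carrier (decomp_group a b P) \<longleftrightarrow> g \<in> G \<and> g ` P = P" by (simp add: decomp_group_def)
  have one: "A [^]\<^bsub>int_ring (b \<circ> a) Quot P\<^esub> (1 :: nat) = A" if A: "A \<in> carrier (int_ring (b \<circ> a) Quot P)" for A
  proof -
    obtain x where x: "x \<in> S" "A = coset P x" using A unfolding Quot_carrier[OF fhh P_idl] by blast
    show ?thesis unfolding x(2) Quot_pow[OF fhh P_idl x(1)] by simp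
  qed
  show ?thesis
  proof
    assume "g \<in> inertia a b P"
    then have gd: "g \<in> carrier (decomp_group a b P)" and A: "!!A. A \<in> carrier (int_ring (b \<circ> a) Quot P) ==> g ` A = A"
      unfolding inertia_def by blast+
    have g: "g \<in> G" "g ` P = P" using gd dec by blast+
    have "\<forall>A\<in>carrier (int_ring (b \<circ> a) Quot P). g ` A = A [^]\<^bsub>int_ring (b \<circ> a) Quot P\<^esub> (1 :: nat)"
    proof
      fix A assume A': "A \<in> carrier (int_ring (b \<circ> a) Quot P)"
      show "g ` A = A [^]\<^bsub>int_ring (b \<circ> a) Quot P\<^esub> (1 :: nat)" unfolding one[OF A'] by (rule A[OF A'])
    qed
    then have e: "\<forall>x\<in>S. \<chi>0 x ^ 1 = \<chi>0 (g x)" unfolding residue_action[OF g] .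
    have "\<chi>0 (g x) = \<chi>0 x" if "x \<in> S" for x using bspec[OF e that] by simp
    then show "g \<in> G \<and> (\<forall>x\<in>S. \<chi>0 (g x) = \<chi>0 x)" using g(1) by blast
  next
    assume g: "g \<in> G \<and> (\<forall>x\<in>S. \<chi>0 (g x) = \<chi>0 x)"
    have e: "\<chi>0 x ^ 1 = \<chi>0 (g x)" if "x \<in> S" for x using bspec[OF conjunct2[OF g] that] by simp
    have gP: "g ` P = P" by (rule Gal_P[OF conjunct1[OF g], of 1]) (simp, rule e)
    have A: "\<forall>A\<in>carrier (int_ring (b \<circ> a) Quot P). g ` A = A [^]\<^bsub>int_ring (b \<circ> a) Quot P\<^esub> (1 :: nat)"
      unfolding residue_action[OF conjunct1[OF g] gP] using e by (intro ballI)
    show "g \<in> inertia a b P"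
      unfolding inertia_def
    proof (intro CollectI conjI ballI)
      show "g \<in> carrier (decomp_group a b P)" using dec g gP by blast
      fix A assume A': "A \<in> carrier (int_ring (b \<circ> a) Quot P)"
      show "g ` A = A" using bspec[OF A A'] unfolding one[OF A'] .
    qed
  qed
qed

text \<open>Two elements of the right-hand set differ by one that fixes \<open>\<chi>0\<close>, that
  is, by an inertia element. So the set is a single coset, and any coset with the Frobenius property
  meets it.\<close>

lemma Frob_eq: "Frob a b p P = {g \<in> G. \<forall>x\<in>S. \<chi>0 x ^ (q ^ d) = \<chi>0 (g x)}" (is "_ = ?F")
  unfolding Frob_def
proof (rule the_equality)
  have crd: "card (carrier (int_ring a Quot p)) = q ^ d" by (rule RK.card_residue)
  have qd: "0 < q ^ d" using q1 by simp
  have dec: "g \<in> carrier (decomp_group a b P) \<longleftrightarrow> g \<in> G \<and> g ` P = P" for g by (simp add: decomp_group_def)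
  have md: "x \<otimes>\<^bsub>decomp_group a b P\<^esub> y = x \<circ> y" for x y by (simp add: decomp_group_def)
  have cm: "C \<in> carrier (decomp_group a b P Mod inertia a b P) \<longleftrightarrow>
      (\<exists>g\<in>carrier (decomp_group a b P). C = (%i. i \<circ> g) ` inertia a b P)" for C
    unfolding FactGroup_def RCOSETS_def r_coset_def partial_object.select_convs md by (simp add: image_def) blast
  have coset: "(%i. i \<circ> g) ` inertia a b P = ?F" if g: "g \<in> ?F" for g
  proof (intro subset_antisym subsetI)
    fix y assume "y \<in> (%i. i \<circ> g) ` inertia a b P"
    then obtain i where i0: "i \<in> inertia a b P" "y = i \<circ> g" by blast
    then have i: "i \<in> G" "!!x. x \<in> S ==> \<chi>0 (i x) = \<chi>0 x" "y = i \<circ> g" unfolding inertia_iff by blast+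
    have gG: "g \<in> G" using g by blast
    have "\<chi>0 x ^ (q ^ d) = \<chi>0 (y x)" if "x \<in> S" for x using g i(2)[OF Gal_S[OF gG that]] that unfolding i(3) by simp
    then show "y \<in> ?F" using Gal_comp[OF i(1) gG] unfolding i(3) by blast
  next
    fix y assume y: "y \<in> ?F"
    have G: "y \<in> G" "g \<in> G" using y g by blast+
    have "\<chi>0 ((y \<circ> inv_into UNIV g) x) = \<chi>0 x" if x: "x \<in> S" for x
    proof -
      have s: "inv_into UNIV g x \<in> S" by (rule Gal_S[OF Gal_inv[OF G(2)] x])
      have "\<chi>0 (y (inv_into UNIV g x)) = \<chi>0 (g (inv_into UNIV g x))" using y g s by (metis (mono_tags, lifting) mem_Collect_eq)
      then show ?thesis unfolding Gal_inv_apply(2)[OF G(2)] by simp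
    qed
    then have "y \<circ> inv_into UNIV g \<in> inertia a b P" unfolding inertia_iff using Gal_comp[OF G(1) Gal_inv[OF G(2)]] by blast
    moreover have "y = (y \<circ> inv_into UNIV g) \<circ> g" using Gal_inv_apply(1)[OF G(2)] by (simp add: fun_eq_iff)
    ultimately show "y \<in> (%i. i \<circ> g) ` inertia a b P" by (intro image_eqI[where x = "y \<circ> inv_into UNIV g"])
  qed
  have FP: "g ` P = P" if "g \<in> ?F" for g by (rule Gal_P[OF _ qd]) (use that in blast)+
  obtain g0 where g0: "g0 \<in> ?F" using exists_frob by blast
  show "?F \<in> carrier (decomp_group a b P Mod inertia a b P) \<and>
      (\<forall>g\<in>?F. \<forall>A\<in>carrier (int_ring (b \<circ> a) Quot P). g ` A = A [^]\<^bsub>int_ring (b \<circ> a) Quot P\<^esub> card (carrier (int_ring a Quot p)))"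
  proof
    show "?F \<in> carrier (decomp_group a b P Mod inertia a b P)"
      unfolding cm
    proof
      show "?F = (%i. i \<circ> g0) ` inertia a b P" by (rule coset[OF g0, symmetric])
      show "g0 \<in> carrier (decomp_group a b P)" unfolding dec using FP[OF g0] g0 by blast
    qed
    show "\<forall>g\<in>?F. \<forall>A\<in>carrier (int_ring (b \<circ> a) Quot P). g ` A = A [^]\<^bsub>int_ring (b \<circ> a) Quot P\<^esub> card (carrier (int_ring a Quot p))"
    proof
      fix g assume g: "g \<in> ?F"
      then have gG: "g \<in> G" by blast
      show "\<forall>A\<in>carrier (int_ring (b \<circ> a) Quot P). g ` A = A [^]\<^bsub>int_ring (b \<circ> a) Quot P\<^esub> card (carrier (int_ring a Quot p))"
        unfolding crd residue_action[OF gG FP[OF g]] using g by blast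
    qed
  qed
  fix C assume C: "C \<in> carrier (decomp_group a b P Mod inertia a b P) \<and>
      (\<forall>g\<in>C. \<forall>A\<in>carrier (int_ring (b \<circ> a) Quot P). g ` A = A [^]\<^bsub>int_ring (b \<circ> a) Quot P\<^esub> card (carrier (int_ring a Quot p)))"
  obtain g where gd: "g \<in> carrier (decomp_group a b P)" "C = (%i. i \<circ> g) ` inertia a b P"
    using conjunct1[OF C] unfolding cm by (rule bexE)
  then have g: "g \<in> G" "g ` P = P" "C = (%i. i \<circ> g) ` inertia a b P" unfolding dec by simp_all
  have "id \<in> inertia a b P" unfolding inertia_iff using Gal_id by simp
  moreover have "g = id \<circ> g" by simp
  ultimately have gC: "g \<in> C" unfolding g(3) by (intro image_eqI[where x = id])
  from bspec[OF conjunct2[OF C] gC] have "\<forall>x\<in>S. \<chi>0 x ^ (q ^ d) = \<chi>0 (g x)" unfolding crd residue_action[OF g(1,2)] .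
  then have "g \<in> ?F" using g(1) by (intro CollectI conjI)
  then show "C = ?F" using coset g(3) by simp
qed

text \<open>The same choice as in \<open>L_factor\<close>, so that the matrices of the Frobenius
  agree literally.\<close>

definition "\<gamma> = (SOME g. g \<in> Frob a b p P)"

lemma \<gamma>_Frob: "\<gamma> \<in> G" "x \<in> S ==> \<chi>0 x ^ (q ^ d) = \<chi>0 (\<gamma> x)"
proof -
  have "\<exists>g. g \<in> Frob a b p P" unfolding Frob_eq using exists_frob by blast
  from someI_ex[OF this] show "\<gamma> \<in> G" "x \<in> S ==> \<chi>0 x ^ (q ^ d) = \<chi>0 (\<gamma> x)" unfolding \<gamma>_def[symmetric] unfolding Frob_eq by blast+
qed

definition "D = {\<phi>. Vector_Spaces.linear sc (*) \<phi>}"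
abbreviation "ad \<equiv> %(\<phi> :: 'v => 'f) \<psi> v. \<phi> v + \<psi> v"
abbreviation "sm \<equiv> %c (\<phi> :: 'v => 'f) v. c * \<phi> v"
abbreviation "ra \<equiv> %(\<phi> :: 'v => 'f) g v. \<phi> (\<rho> g v)"

lemma vsc: "vector_space sc" using fd by (simp add: finite_dim_space_def)
lemma vsf: "vector_space ((*) :: 'f => 'f => 'f)" by unfold_locales (simp_all add: algebra_simps)

lemma D_iff: "\<phi> \<in> D \<longleftrightarrow> (\<forall>x y. \<phi> (x + y) = \<phi> x + \<phi> y) \<and> (\<forall>c x. \<phi> (sc c x) = c * \<phi> x)"
  unfolding D_def by (simp add: Vector_Spaces.linear_iff vsc vsf)

lemma \<rho>_lin: "g \<in> G ==> \<rho> g (x + y) = \<rho> g x + \<rho> g y" "g \<in> G ==> \<rho> g (sc c x) = sc c (\<rho> g x)" "g \<in> G ==> bij (\<rho> g)"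
proof -
  assume g: "g \<in> G"
  have "\<rho> g \<in> carrier (GL sc)" using \<rho> g by (rule hom_in_carrier)
  then have "Vector_Spaces.linear sc sc (\<rho> g)" "bij (\<rho> g)" by (simp_all add: GL_def)
  then show "\<rho> g (x + y) = \<rho> g x + \<rho> g y" "\<rho> g (sc c x) = sc c (\<rho> g x)" "bij (\<rho> g)" by (simp_all add: Vector_Spaces.linear_iff)
qed

lemma \<rho>_comp: "g \<in> G ==> g' \<in> G ==> \<rho> (g \<circ> g') v = \<rho> g (\<rho> g' v)"
  using hom_mult[OF \<rho>, of g g'] by (simp add: GL_def)

lemma \<rho>_id: "\<rho> id v = v"
  using \<rho>_comp[OF Gal_id Gal_id, of v] \<rho>_lin(3)[OF Gal_id] by (simp add: bij_is_inj inj_eq)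

sublocale local_prime S Q kp "jf \<circ> \<iota>" q G z n d \<chi>0 \<gamma> D ad sm ra jf
proof (rule local_prime.intro[OF fin_char_axioms], rule local_prime_axioms.intro)
  show "finite G" by (rule finite_Gal[OF feb])
  show "id \<in> G" by (rule Gal_id)
  show "0 < n" using n1 by simp
  show "z \<in> S" by (rule z_S)
  show "0 < d" by (rule d_pos)
  show "\<chi>0 \<in> chars" by (rule \<chi>0_chars)
  show "\<gamma> \<in> G" by (rule \<gamma>_Frob)
qed (simp_all only: Gal_comp Gal_bij Gal_inv Gal_rhom Gal_S Gal_poly Gal_Q \<gamma>_Frob(2) char_orbit char_disjoint \<rho>_comp \<rho>_id,
    simp_all add: D_iff \<rho>_lin algebra_simps)

lemma Inert_eq: "Inert = inertia a b P"
  unfolding Inert_def using inertia_iff by blast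

end

section \<open>Coordinates on the inertia invariants\<close>

lemma (in vector_space) finite_span_finite_field:
  assumes "finite (UNIV :: 'a set)" "finite B" shows "finite (span B)"
proof -
  have "span B \<subseteq> (%u. \<Sum>v\<in>B. scale (u v) v) ` (B \<rightarrow>\<^sub>E UNIV)"
  proof
    fix x assume "x \<in> span B"
    then obtain u where "x = (\<Sum>v\<in>B. scale (u v) v)" unfolding span_finite[OF assms(2)] by blast
    then have "x = (\<Sum>v\<in>B. scale (restrict u B v) v)" by simp
    moreover have "restrict u B \<in> B \<rightarrow>\<^sub>E UNIV" by simp
    ultimately show "x \<in> (%u. \<Sum>v\<in>B. scale (u v) v) ` (B \<rightarrow>\<^sub>E UNIV)" by blast
  qed
  then show ?thesis by (rule finite_subset) (intro finite_imageI finite_PiE assms)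
qed

context prime_data
begin

text \<open>F is finite-dimensional over a finite field; consequently V, its dual and the modules to
  be tensored are finite sets, which supplies all bases below.\<close>

lemma finite_F: "finite (UNIV :: 'f set)"
proof -
  interpret \<iota>: field_hom \<iota> by (rule \<iota>)
  interpret v: vector_space "%c x. \<iota> c * (x :: 'f)" by unfold_locales (simp_all add: algebra_simps \<iota>.hom_add \<iota>.hom_mult)
  obtain B where "finite B" "v.span B = UNIV" using fe\<iota> by (auto simp: finite_ext_def)
  then show ?thesis using v.finite_span_finite_field[of B] finite_class.finite_UNIV by simp
qed

lemma finite_V: "finite (UNIV :: 'v set)"
proof -
  interpret v: vector_space sc by (rule vsc)
  obtain B where "finite B" "v.span B = UNIV" using fd by (auto simp: finite_dim_space_def)
  then show ?thesis using v.finite_span_finite_field[OF finite_F, of B] by simp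
qed

lemma finite_D: "finite D"
proof -
  have "finite {f :: 'v => 'f. \<forall>x. (x \<in> UNIV \<longrightarrow> f x \<in> UNIV) \<and> (x \<notin> UNIV \<longrightarrow> f x = 0)}"
    by (rule finite_set_of_finite_funs[OF finite_V finite_F])
  then show ?thesis by (rule rev_finite_subset) simp
qed

definition "VI H = {v. \<forall>g\<in>H. \<rho> g v = v}"

lemma inv_simps: "carrier (invariants sc \<rho> H) = VI H" "\<zero>\<^bsub>invariants sc \<rho> H\<^esub> = 0"
  "x \<oplus>\<^bsub>invariants sc \<rho> H\<^esub> y = x + y" "c \<odot>\<^bsub>invariants sc \<rho> H\<^esub> x = sc c x"
  by (simp_all add: invariants_def mk_module_def VI_def)

sublocale V: vector_space sc by (rule vsc)

lemma \<rho>_zero: "g \<in> G ==> \<rho> g 0 = 0" using \<rho>_lin(1)[of g 0 0] by simp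

lemma VI_closed:
  assumes H: "H \<subseteq> G"
  shows "0 \<in> VI H" "x \<in> VI H ==> y \<in> VI H ==> x + y \<in> VI H" "x \<in> VI H ==> sc c x \<in> VI H"
  using H \<rho>_lin \<rho>_zero unfolding VI_def subset_iff by simp_all

lemma inv_record:
  assumes H: "H \<subseteq> G" shows "vector_record (invariants sc \<rho> H)"
proof (rule vector_record.intro)
  note cl = VI_closed[OF H]
  have neg: "\<exists>y\<in>VI H. y + x = 0" if "x \<in> VI H" for x using cl(3)[OF that, of "- 1"] by (intro bexI[of _ "sc (- 1) x"]) simp_all
  have neg': "\<exists>y\<in>VI H. x + y = 0" if "x \<in> VI H" for x using cl(3)[OF that, of "- 1"] by (intro bexI[of _ "sc (- 1) x"]) simp_all
  show "abelian_group (invariants sc \<rho> H)"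
    by (rule abelian_groupI) (simp_all add: inv_simps cl neg neg' add.assoc add.commute)
qed (simp_all add: inv_simps VI_closed[OF H] V.scale_left_distrib V.scale_right_distrib)

abbreviation "bas H \<equiv> vector_record.some_basis (invariants sc \<rho> H)"
abbreviation "crd H \<equiv> coords (invariants sc \<rho> H) (bas H)"

lemma bas:
  assumes H: "H \<subseteq> G" shows "ordered_basis (invariants sc \<rho> H) (bas H)"
proof -
  interpret I: vector_record "invariants sc \<rho> H" by (rule inv_record[OF H])
  have "finite (carrier (invariants sc \<rho> H))" by (rule finite_subset[OF _ finite_V]) simp
  then have "\<exists>bs. ordered_basis (invariants sc \<rho> H) bs" using I.finite_spanning I.ordered_basis_exists by blast
  then show ?thesis unfolding I.some_basis_def by (rule someI_ex)
qed

lemma bas_VI: "H \<subseteq> G ==> i < length (bas H) ==> bas H ! i \<in> VI H"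
  using bas[of H] nth_mem[of i "bas H"] unfolding ordered_basis_def inv_simps by blast

lemma functional_bas:
  assumes H: "H \<subseteq> G" and \<phi>: "\<phi> \<in> D" and v: "v \<in> VI H"
  shows "\<phi> v = (\<Sum>i<length (bas H). \<phi> (bas H ! i) * crd H v ! i)"
proof -
  interpret I: vector_record "invariants sc \<rho> H" by (rule inv_record[OF H])
  have s: "set (bas H) \<subseteq> carrier (invariants sc \<rho> H)" using bas[OF H] by (simp add: ordered_basis_def)
  have "\<phi> v = \<phi> (lin_comb (invariants sc \<rho> H) (crd H v) (bas H))"
    using I.coords(2)[OF bas[OF H], of v] v by (simp add: inv_simps)
  also have "\<dots> = (\<Sum>i<length (bas H). (%c. c) (crd H v ! i) * \<phi> (bas H ! i))"
    by (rule I.functional_lin_comb[where j = "%c. c" and u = \<phi>, OF _ _ s]) (use \<phi> in \<open>simp_all add: inv_simps D_iff\<close>)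
  finally show ?thesis by (simp add: mult.commute)
qed

lemma crd_lin:
  assumes H: "H \<subseteq> G" and i: "i < length (bas H)" and v: "v \<in> VI H"
  shows "w \<in> VI H ==> crd H (v + w) ! i = crd H v ! i + crd H w ! i" "crd H (sc c v) ! i = c * crd H v ! i"
proof -
  interpret I: vector_record "invariants sc \<rho> H" by (rule inv_record[OF H])
  show "w \<in> VI H ==> crd H (v + w) ! i = crd H v ! i + crd H w ! i" "crd H (sc c v) ! i = c * crd H v ! i"
    using I.coords_add[OF bas[OF H], of v w i] I.coords_smult[OF bas[OF H], of v i c] v i by (simp_all add: inv_simps)
qed

lemma functional_extends:
  assumes H: "H \<subseteq> G" and i: "i < length (bas H)"
  shows "\<exists>\<phi>\<in>D. \<forall>v\<in>VI H. \<phi> v = crd H v ! i"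
proof -
  interpret vp: vector_space_pair sc "(*) :: 'f => 'f => 'f" using vsc vsf by (rule vector_space_pair.intro)
  obtain B where B: "B \<subseteq> VI H" "V.independent B" "VI H \<subseteq> V.span B" using V.maximal_independent_subset[of "VI H"] by blast
  from vp.linear_independent_extend[OF B(2), of "%v. crd H v ! i"]
  obtain \<phi> where \<phi>: "Vector_Spaces.linear sc (*) \<phi>" "!!v. v \<in> B ==> \<phi> v = crd H v ! i" by blast
  have \<phi>D: "\<phi> \<in> D" using \<phi>(1) by (simp add: D_def)
  have c0: "crd H 0 ! i = 0" using crd_lin(2)[OF H i VI_closed(1)[OF H], of 0] by simp
  have \<phi>0: "\<phi> 0 = 0" using \<phi>D unfolding D_iff by (metis V.scale_zero_left mult_zero_left)
  have "V.subspace {v \<in> VI H. \<phi> v = crd H v ! i}"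
    unfolding V.subspace_def using VI_closed[OF H] crd_lin[OF H i] \<phi>D \<phi>0 c0 unfolding D_iff by simp
  then have "V.span B \<subseteq> {v \<in> VI H. \<phi> v = crd H v ! i}" using B(1) \<phi>(2) by (intro V.span_minimal) blast+
  then show ?thesis using B(3) \<phi>D by blast
qed

definition "dualf H i = (SOME \<phi>. \<phi> \<in> D \<and> (\<forall>v\<in>VI H. \<phi> v = crd H v ! i))"

lemma dualf:
  assumes "H \<subseteq> G" "i < length (bas H)" shows "dualf H i \<in> D" "v \<in> VI H ==> dualf H i v = crd H v ! i"
  using someI_ex[of "%\<phi>. \<phi> \<in> D \<and> (\<forall>v\<in>VI H. \<phi> v = crd H v ! i)"] functional_extends[OF assms] unfolding dualf_def by blast+

lemma dualf_bas:
  assumes H: "H \<subseteq> G" and i: "i < length (bas H)" "k < length (bas H)" shows "dualf H i (bas H ! k) = (if i = k then 1 else 0)"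
proof -
  interpret I: vector_record "invariants sc \<rho> H" by (rule inv_record[OF H])
  show ?thesis using dualf(2)[OF H i(1) bas_VI[OF H i(2)]] I.coords_basis[OF bas[OF H] i(2,1)] by simp
qed

lemma D_sum: "\<phi> \<in> D ==> (!!i. i < m ==> \<psi> i \<in> D) ==> (%v. \<phi> v + (\<Sum>i<m. c i * \<psi> i v)) \<in> D"
  unfolding D_iff by (simp add: algebra_simps sum.distrib sum_distrib_left)

lemma functional_sum:
  fixes u :: "('v => 'f) => 'z::comm_ring_1" and m :: nat
  assumes u: "!!\<phi> \<psi>. \<phi> \<in> D ==> \<psi> \<in> D ==> u (ad \<phi> \<psi>) = u \<phi> + u \<psi>" "!!c \<phi>. \<phi> \<in> D ==> u (sm c \<phi>) = J c * u \<phi>"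
    and \<phi>: "\<phi> \<in> D"
  shows "(!!i. i < m ==> \<psi> i \<in> D) ==> u (%v. \<phi> v + (\<Sum>i<m. c i * \<psi> i v)) = u \<phi> + (\<Sum>i<m. J (c i) * u (\<psi> i))"
proof (induction m)
  case (Suc m)
  have 1: "(%v. \<phi> v + (\<Sum>i<m. c i * \<psi> i v)) \<in> D" by (rule D_sum[OF \<phi>]) (simp add: Suc.prems)
  have 2: "sm (c m) (\<psi> m) \<in> D" using Suc.prems[of m] unfolding D_iff by (simp add: algebra_simps)
  have "(%v. \<phi> v + (\<Sum>i<Suc m. c i * \<psi> i v)) = ad (%v. \<phi> v + (\<Sum>i<m. c i * \<psi> i v)) (sm (c m) (\<psi> m))"
    by (simp add: fun_eq_iff add.assoc)
  then have "u (%v. \<phi> v + (\<Sum>i<Suc m. c i * \<psi> i v)) = u (%v. \<phi> v + (\<Sum>i<m. c i * \<psi> i v)) + u (sm (c m) (\<psi> m))"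
    using u(1)[OF 1 2] by simp
  then show ?case using Suc.IH Suc.prems u(2)[of "\<psi> m" "c m"] by (simp add: add.assoc)
qed simp

lemma D_separates: "(!!\<phi>. \<phi> \<in> D ==> \<phi> v = \<phi> w) ==> v = w"
proof -
  assume eq: "!!\<phi>. \<phi> \<in> D ==> \<phi> v = \<phi> w"
  \<comment> \<open>With no group element imposed, \<open>VI {}\<close> is all of V, so the
    coordinates on invariants serve for V itself.\<close>
  have H: "{} \<subseteq> G" by simp
  have U: "v \<in> VI {}" "w \<in> VI {}" by (simp_all add: VI_def)
  interpret I: vector_record "invariants sc \<rho> {}" by (rule inv_record[OF H])
  have e: "crd {} v ! i = crd {} w ! i" if i: "i < length (bas {})" for i
    using dualf(2)[OF H i U(1)] dualf(2)[OF H i U(2)] eq[OF dualf(1)[OF H i]] by simp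
  have vw: "v \<in> carrier (invariants sc \<rho> {})" "w \<in> carrier (invariants sc \<rho> {})" using U by (simp_all add: inv_simps)
  note l = I.coords(1)[OF bas[OF H] vw(1)] I.coords(1)[OF bas[OF H] vw(2)]
  have c: "crd {} v = crd {} w" by (rule nth_equalityI) (simp_all only: l e)
  show ?thesis using I.coords(2)[OF bas[OF H] vw(1)] unfolding c I.coords(2)[OF bas[OF H] vw(2)] by (rule sym)
qed

text \<open>Expanding a functional in the dual basis of V shows that \<open>\<mu>\<close> is
  evaluation at the vector whose coordinates are the values of \<open>\<mu>\<close> on that
  basis.\<close>

lemma double_dual:
  assumes \<mu>: "!!\<phi> \<psi>. \<phi> \<in> D ==> \<psi> \<in> D ==> \<mu> (ad \<phi> \<psi>) = \<mu> \<phi> + \<mu> \<psi>" "!!c \<phi>. \<phi> \<in> D ==> \<mu> (sm c \<phi>) = c * \<mu> \<phi>"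
  shows "\<exists>v. \<forall>\<phi>\<in>D. \<mu> \<phi> = \<phi> v"
proof -
  have H: "{} \<subseteq> G" by simp
  let ?m = "length (bas {})"
  define v where "v = (\<Sum>i<?m. sc (\<mu> (dualf {} i)) (bas {} ! i))"
  have "\<mu> \<phi> = \<phi> v" if \<phi>: "\<phi> \<in> D" for \<phi>
  proof -
    have z: "(%_. 0) \<in> D" by (simp add: D_iff)
    have "\<phi> x = 0 + (\<Sum>i<?m. \<phi> (bas {} ! i) * dualf {} i x)" for x
      using functional_bas[OF H \<phi>, of x] dualf(2)[OF H, of _ x] by (simp add: VI_def)
    then have "\<phi> = (%x. (%_. 0) x + (\<Sum>i<?m. \<phi> (bas {} ! i) * dualf {} i x))" by (rule HOL.ext)
    then have "\<mu> \<phi> = \<mu> (%x. (%_. 0) x + (\<Sum>i<?m. \<phi> (bas {} ! i) * dualf {} i x))" by (rule arg_cong)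
    also have "\<dots> = \<mu> (%_. 0) + (\<Sum>i<?m. (%c. c) (\<phi> (bas {} ! i)) * \<mu> (dualf {} i))"
      by (rule functional_sum[where u = \<mu> and J = "%c. c" and \<phi> = "%_. 0" and \<psi> = "dualf {}"
            and m = "length (bas {})" and c = "%i. \<phi> (bas {} ! i)"]) (simp_all add: \<mu> z dualf(1)[OF H])
    also have "\<mu> (%_. 0) = 0" using \<mu>(2)[OF z, of 0] by simp
    also have "0 + (\<Sum>i<?m. \<phi> (bas {} ! i) * \<mu> (dualf {} i)) = \<phi> v"
    proof -
      have "\<phi> (\<Sum>i<k. sc (c i) (f i)) = (\<Sum>i<k. c i * \<phi> (f i))" for k :: nat and c f
        using \<phi> unfolding D_iff by (induction k) (simp_all, metis V.scale_zero_left mult_zero_left)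
      then show ?thesis unfolding v_def by (simp add: mult.commute)
    qed
    finally show ?thesis .
  qed
  then show ?thesis by blast
qed

abbreviation "II \<equiv> inertia a b P"

lemma II_G: "II \<subseteq> G" using inertia_iff by blast

text \<open>Inertia invariants commute with extension of scalars to \<Omega>. If
  \<open>w \<phi>\<close> were nonzero, an F-linear map \<open>lam\<close> from \<Omega> to F with
  \<open>lam 1 = 1\<close>, applied to \<open>w\<close> divided by \<open>w \<phi>\<close>, would
  give a functional on the dual of V. It is evaluation at an inertia-invariant vector, where
  \<open>\<phi>\<close> is zero, although its value at \<open>\<phi>\<close> is 1.\<close>

lemma W_vanish:
  assumes w: "w \<in> W" and \<phi>: "\<phi> \<in> D" and v: "!!v. v \<in> VI II ==> \<phi> v = 0" shows "w \<phi> = 0"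
proof (rule ccontr)
  assume nz: "w \<phi> ~= 0"
  interpret jf: field_hom jf by (rule jf)
  interpret v1: vector_space "%c x. jf c * (x :: 'o)" by unfold_locales (simp_all add: algebra_simps jf.hom_add jf.hom_mult)
  interpret vp: vector_space_pair "%c x. jf c * (x :: 'o)" "(*) :: 'f => 'f => 'f" using v1.vector_space_axioms vsf by (rule vector_space_pair.intro)
  have "v1.independent {1}" by simp
  from vp.linear_independent_extend[OF this, of "%_. 1"]
  obtain lam where lam: "Vector_Spaces.linear (%c x. jf c * (x :: 'o)) (*) lam" "lam 1 = 1" by blast
  then have la: "lam (x + y) = lam x + lam y" and ls: "lam (jf c * x) = c * lam x" for x y c by (simp_all add: Vector_Spaces.linear_iff)
  define \<mu> where "\<mu> = (%\<psi>. lam (inverse (w \<phi>) * w \<psi>))"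
  note wV = VOD[OF W_VO[OF w]]
  have "\<exists>v. \<forall>\<psi>\<in>D. \<mu> \<psi> = \<psi> v"
  proof (rule double_dual)
    show "\<mu> (ad \<psi> \<psi>') = \<mu> \<psi> + \<mu> \<psi>'" if "\<psi> \<in> D" "\<psi>' \<in> D" for \<psi> \<psi>'
      unfolding \<mu>_def wV(1)[OF that] distrib_left la ..
    show "\<mu> (sm c \<psi>) = c * \<mu> \<psi>" if "\<psi> \<in> D" for c \<psi>
      unfolding \<mu>_def wV(2)[OF that] mult.left_commute[of _ "jf c"] ls ..
  qed
  then obtain v where ev: "!!\<psi>. \<psi> \<in> D ==> \<mu> \<psi> = \<psi> v" by blast
  have "v \<in> VI II"
    unfolding VI_def
  proof (intro CollectI ballI)
    fix g assume g: "g \<in> II"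
    then have gG: "g \<in> G" using II_G by blast
    have "\<psi> (\<rho> g v) = \<psi> v" if \<psi>: "\<psi> \<in> D" for \<psi>
    proof -
      have "lact g w = w" using w g unfolding W_def Inert_eq by blast
      from fun_cong[OF this, of \<psi>] have "w (ra \<psi> g) = w \<psi>" using \<psi> by (simp add: lact_def)
      then have "\<mu> (ra \<psi> g) = \<mu> \<psi>" by (simp add: \<mu>_def)
      then show ?thesis using ev[OF ra_D[OF \<psi> gG]] ev[OF \<psi>] by simp
    qed
    then show "\<rho> g v = v" by (rule D_separates)
  qed
  then have "\<mu> \<phi> = 0" using v ev[OF \<phi>] by simp
  then show False using nz lam(2) by (simp add: \<mu>_def)
qed

abbreviation "rr \<equiv> length (bas II)"
definition "kpW w = vec rr (%i. w (dualf II i))"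

text \<open>Subtracting from \<open>\<phi>\<close> the combination of the \<open>dualf\<close> that
  agrees with it on the invariants leaves a functional that kills them, to which
  \<open>W_vanish\<close> applies.\<close>

lemma W_expand:
  assumes w: "w \<in> W" and \<phi>: "\<phi> \<in> D"
  shows "w \<phi> = (\<Sum>i<rr. jf (\<phi> (bas II ! i)) * w (dualf II i))"
proof -
  note H = II_G and wV = VOD[OF W_VO[OF w]]
  define \<phi>0 where "\<phi>0 = (%v. \<phi> v + (\<Sum>i<rr. (- \<phi> (bas II ! i)) * dualf II i v))"
  have \<phi>0: "\<phi>0 \<in> D" unfolding \<phi>0_def by (rule D_sum[OF \<phi> dualf(1)[OF H]])
  have w0: "w \<phi>0 = 0"
  proof (rule W_vanish[OF w \<phi>0])
    fix v assume v: "v \<in> VI II"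
    show "\<phi>0 v = 0" unfolding \<phi>0_def functional_bas[OF H \<phi> v] using dualf(2)[OF H _ v] by (simp add: sum_negf)
  qed
  have "\<phi> = (%v. \<phi>0 v + (\<Sum>i<rr. \<phi> (bas II ! i) * dualf II i v))" by (simp add: \<phi>0_def sum_negf)
  then have "w \<phi> = w (%v. \<phi>0 v + (\<Sum>i<rr. \<phi> (bas II ! i) * dualf II i v))" by simp
  also have "\<dots> = w \<phi>0 + (\<Sum>i<rr. jf (\<phi> (bas II ! i)) * w (dualf II i))"
    by (rule functional_sum[where u = w and J = jf and \<phi> = \<phi>0 and \<psi> = "dualf II" and m = rr and c = "%i. \<phi> (bas II ! i)", OF wV(1) wV(2) \<phi>0 dualf(1)[OF H]])
  finally show ?thesis using w0 by simp
qed

lemma W_iso: "coord_iso W kpW rr"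
  unfolding coord_iso_def
proof (intro conjI ballI allI)
  fix u v assume uv: "u \<in> W" "v \<in> W"
  show "(%y. u y + v y) \<in> W" using uv VO_add unfolding W_def by (simp add: lact_add)
  show "kpW (%y. u y + v y) = kpW u + kpW v" unfolding kpW_def by (intro eq_vecI) simp_all
next
  fix c u assume u: "u \<in> W"
  show "(%y. c * u y) \<in> W" using u VO_scale unfolding W_def by (simp add: lact_scale)
  show "kpW (%y. c * u y) = c \<cdot>\<^sub>v kpW u" unfolding kpW_def by (intro eq_vecI) simp_all
next
  interpret jf: field_hom jf by (rule jf)
  note H = II_G
  show "bij_betw kpW W (carrier_vec rr)"
    unfolding bij_betw_def
  proof (intro conjI subset_antisym inj_onI subsetI)
    fix u v assume uv: "u \<in> W" "v \<in> W" and e: "kpW u = kpW v"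
    have "u (dualf II i) = v (dualf II i)" if "i < rr" for i using arg_cong[OF e, of "%x. vec_index x i"] that by (simp add: kpW_def)
    then have "u \<phi> = v \<phi>" if "\<phi> \<in> D" for \<phi> using W_expand[OF uv(1) that] W_expand[OF uv(2) that] by simp
    then show "u = v" using VOD(3)[OF W_VO[OF uv(1)]] VOD(3)[OF W_VO[OF uv(2)]] by (metis HOL.ext)
  next
    fix x assume "x \<in> kpW ` W"
    then show "x \<in> carrier_vec rr" by (auto simp: kpW_def)
  next
    fix x :: "'o vec" assume x: "x \<in> carrier_vec rr"
    define w where "w = (%\<phi>. if \<phi> \<in> D then \<Sum>i<rr. jf (\<phi> (bas II ! i)) * x $ i else 0)"
    have "w \<in> VO"
      unfolding VO_def w_def using ad_D sm_D
      by (simp add: jf.hom_add jf.hom_mult algebra_simps sum.distrib sum_distrib_left)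
    moreover have "lact g w = w" if g: "g \<in> II" for g
    proof
      fix \<phi>
      have gG: "g \<in> G" using g II_G by blast
      have "\<rho> g (bas II ! i) = bas II ! i" if "i < rr" for i using bas_VI[OF H that] g unfolding VI_def by blast
      then show "lact g w \<phi> = w \<phi>" using ra_D[OF _ gG, of \<phi>] by (simp add: lact_def w_def)
    qed
    ultimately have wW: "w \<in> W" unfolding W_def Inert_eq by blast
    have "kpW w = x"
    proof (rule eq_vecI)
      fix i assume "i < dim_vec x"
      then have i: "i < rr" using x by simp
      have "w (dualf II i) = (\<Sum>k<rr. jf (dualf II i (bas II ! k)) * x $ k)" unfolding w_def using dualf(1)[OF H i] by simp
      also have "\<dots> = (\<Sum>k<rr. if i = k then x $ k else 0)"
        using dualf_bas[OF H i] by (intro sum.cong refl) simp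
      finally show "kpW w $ i = x $ i" using i by (simp add: kpW_def)
    qed (use x in \<open>simp add: kpW_def\<close>)
    then show "x \<in> kpW ` W" using wW by blast
  qed
qed

text \<open>\<open>\<gamma>\<close> normalizes the inertia group: conjugating an inertia element by
  it preserves the q^d-th powers of the values of \<open>\<chi>0\<close>, and taking this power is
  injective.\<close>

lemma VI_\<gamma>: assumes v: "v \<in> VI II" shows "\<rho> \<gamma> v \<in> VI II"
  unfolding VI_def
proof (intro CollectI ballI)
  fix g assume g: "g \<in> II"
  note gG = subsetD[OF II_G g] note \<gamma>G = \<gamma>_Frob(1)
  let ?\<gamma>' = "inv_into UNIV \<gamma>"
  have G': "?\<gamma>' \<circ> (g \<circ> \<gamma>) \<in> G" by (intro Gal_comp Gal_inv gG \<gamma>G)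
  have "\<chi>0 ((?\<gamma>' \<circ> (g \<circ> \<gamma>)) x) = \<chi>0 x" if x: "x \<in> S" for x
  proof -
    have s3: "\<gamma> x \<in> S" by (rule Gal_S[OF \<gamma>G x])
    note s = Gal_S[OF gG s3] Gal_S[OF Gal_inv[OF \<gamma>G] Gal_S[OF gG s3]] s3
    have "\<chi>0 (?\<gamma>' (g (\<gamma> x))) ^ (q ^ d) = \<chi>0 (g (\<gamma> x))" using \<gamma>_Frob(2)[OF s(2)] Gal_inv_apply(2)[OF \<gamma>G] by simp
    also have "\<dots> = \<chi>0 (\<gamma> x)" using g s(3) unfolding inertia_iff by blast
    also have "\<dots> = \<chi>0 x ^ (q ^ d)" by (rule \<gamma>_Frob(2)[OF x, symmetric])
    finally have "\<chi>0 (?\<gamma>' (g (\<gamma> x))) = \<chi>0 x" by (rule power_inj_O)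
    then show ?thesis by simp
  qed
  then have "?\<gamma>' \<circ> (g \<circ> \<gamma>) \<in> II" unfolding inertia_iff using G' by blast
  then have "\<rho> (?\<gamma>' \<circ> (g \<circ> \<gamma>)) v = v" using v unfolding VI_def by blast
  then have "\<rho> \<gamma> (\<rho> (?\<gamma>' \<circ> (g \<circ> \<gamma>)) v) = \<rho> \<gamma> v" by simp
  then have "\<rho> (\<gamma> \<circ> (?\<gamma>' \<circ> (g \<circ> \<gamma>))) v = \<rho> \<gamma> v" unfolding \<rho>_comp[OF \<gamma>G G'] .
  moreover have "\<gamma> \<circ> (?\<gamma>' \<circ> (g \<circ> \<gamma>)) = g \<circ> \<gamma>" using Gal_inv_apply(2)[OF \<gamma>G] by (simp add: fun_eq_iff)
  ultimately show "\<rho> g (\<rho> \<gamma> v) = \<rho> \<gamma> v" using \<rho>_comp[OF gG \<gamma>G, of v] by simp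
qed

definition "AI = endo_mat (invariants sc \<rho> II) (\<rho> \<gamma>)"

lemma AI: "AI \<in> carrier_mat rr rr"
  unfolding AI_def vector_record.endo_mat_eq[OF inv_record[OF II_G]] by simp

lemma \<Phi>_eq:
  assumes w: "w \<in> W" shows "kpW (lact \<gamma> w) = map_mat jf AI *\<^sub>v kpW w"
proof (rule eq_vecI)
  note H = II_G
  fix i assume "i < dim_vec (map_mat jf AI *\<^sub>v kpW w)"
  then have i: "i < rr" using AI by simp
  have "kpW (lact \<gamma> w) $ i = w (ra (dualf II i) \<gamma>)" using i dualf(1)[OF H i] by (simp add: kpW_def lact_def)
  also have "\<dots> = (\<Sum>k<rr. jf (dualf II i (\<rho> \<gamma> (bas II ! k))) * w (dualf II k))"
    by (rule W_expand[OF w ra_D[OF dualf(1)[OF H i] \<gamma>_Frob(1)]])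
  also have "\<dots> = (\<Sum>k<rr. jf (AI $$ (i, k)) * w (dualf II k))"
    using i dualf(2)[OF H i VI_\<gamma>[OF bas_VI[OF H]]]
    by (intro sum.cong refl) (simp add: AI_def vector_record.endo_mat_eq[OF inv_record[OF H]])
  also have "\<dots> = (map_mat jf AI *\<^sub>v kpW w) $ i"
    using i AI by (simp add: kpW_def scalar_prod_def lessThan_atLeast0)
  finally show "kpW (lact \<gamma> w) $ i = (map_mat jf AI *\<^sub>v kpW w) $ i" .
qed (use AI in \<open>simp add: kpW_def\<close>)

end

section \<open>Coordinates dual to the tensor product\<close>

lemma sum_if_Suc:
  fixes F :: "nat => 'z::comm_monoid_add"
  assumes "0 < n"
  shows "(\<Sum>i<n. if 0 < i then F (i - 1) else 0) = (\<Sum>i<n. if Suc i < n then F i else 0)"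
    and "(\<Sum>i<n. if Suc i < n then F i else c i) = (\<Sum>i<n. if Suc i < n then F i else 0) + c (n - 1)"
proof -
  obtain m where n: "n = Suc m" using assms gr0_conv_Suc by blast
  have 1: "(\<Sum>i<Suc m. if 0 < i then F (i - 1) else 0) = (\<Sum>i<m. F i)" unfolding sum.lessThan_Suc_shift by simp
  have 2: "(\<Sum>i<m. if Suc i < Suc m then F i else c i) = (\<Sum>i<m. F i)" for c :: "nat => 'z" by (rule sum.cong) simp_all
  show "(\<Sum>i<n. if 0 < i then F (i - 1) else 0) = (\<Sum>i<n. if Suc i < n then F i else 0)"
    unfolding n 1 unfolding sum.lessThan_Suc 2 by simp
  show "(\<Sum>i<n. if Suc i < n then F i else c i) = (\<Sum>i<n. if Suc i < n then F i else 0) + c (n - 1)"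
    unfolding n sum.lessThan_Suc 2 by simp
qed

context prime_data
begin

abbreviation "BB \<equiv> int_ring (b \<circ> a) Quot Q"
abbreviation "et \<equiv> quot_emb (b \<circ> a) Q"
definition "MM = alg_power et BB n"
abbreviation "act \<equiv> (%g :: 'L => 'L. map ((`) g))"
definition "AA = dual_space sc"
definition "RR = (group_ring (Gal b) :: (('L => 'L) => 'k) set)"
definition "dra = dual_act \<iota> (Gal b) \<rho>"
definition "dla = left_act (Gal b) MM act"
text \<open>Vectors over the quotient are given by families of representatives indexed by all
  natural numbers, of which the first n count; index shifts then need no side condition.\<close>

definition "mk f = map (%i. coset Q (f i)) [0..<n]"

lemma mk_nth: "i < n ==> mk f ! i = coset Q (f i)" and mk_length: "length (mk f) = n" by (simp_all add: mk_def)

lemma MM_carrier: "carrier MM = {xs. length xs = n \<and> set xs \<subseteq> coset Q ` S}"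
  unfolding MM_def alg_power_def mk_module_def Quot_carrier[OF fhh Q_idl] by simp

lemma mk_MM: assumes "!!i. f i \<in> S" shows "mk f \<in> carrier MM"
  unfolding MM_carrier
proof (intro CollectI conjI subsetI)
  fix A assume "A \<in> set (mk f)"
  then obtain i where "A = coset Q (f i)" unfolding mk_def by auto
  then show "A \<in> coset Q ` S" using assms[of i] by blast
qed (rule mk_length)

lemma MM_ex: assumes "xs \<in> carrier MM" shows "\<exists>f. (\<forall>i. f i \<in> S) \<and> xs = mk f"
proof -
  have l: "length xs = n" and s: "set xs \<subseteq> coset Q ` S" using assms unfolding MM_carrier by blast+
  define f where "f = (%i. if i < n then SOME x. x \<in> S \<and> coset Q x = xs ! i else 0)"
  have f: "f i \<in> S \<and> coset Q (f i) = xs ! i" if "i < n" for i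
  proof -
    have "xs ! i \<in> coset Q ` S" using s l that nth_mem[of i xs] by blast
    then have "\<exists>x. x \<in> S \<and> coset Q x = xs ! i" by blast
    from someI_ex[OF this] show ?thesis unfolding f_def if_P[OF that] .
  qed
  have "f i \<in> S" for i
  proof (cases "i < n")
    case False
    show ?thesis unfolding f_def if_not_P[OF False] by (rule SD(1))
  qed (use f in blast)
  moreover have "xs = mk f" by (rule nth_equalityI) (simp_all add: l mk_length mk_nth f)
  ultimately show ?thesis by blast
qed

lemma MM_cases: assumes "xs \<in> carrier MM" obtains f where "!!i. f i \<in> S" "xs = mk f"
  using MM_ex[OF assms] by blast

lemma MM_add: "(!!i. f i \<in> S) ==> (!!i. g i \<in> S) ==> mk f \<oplus>\<^bsub>MM\<^esub> mk g = mk (%i. f i + g i)"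
  by (simp add: MM_def alg_power_def mk_module_def mk_def map2_map_map Quot_add[OF fhh Q_idl] del: mem_Collect_eq)

lemma MM_zero: "\<zero>\<^bsub>MM\<^esub> = mk (%_. 0)"
  by (simp add: MM_def alg_power_def mk_module_def mk_def map_replicate_const Quot_zero[OF fhh Q_idl])

lemma MM_smult: "(!!i. f i \<in> S) ==> c \<odot>\<^bsub>MM\<^esub> mk f = mk (%i. kp c * f i)"
  using kpS[of c] by (simp add: MM_def alg_power_def mk_module_def mk_def quot_emb_coset[OF fhh Q_idl] Quot_mult[OF fhh Q_idl] del: mem_Collect_eq)

lemma MM_group: "abelian_group MM"
proof (rule abelian_groupI)
  fix x y assume "x \<in> carrier MM" "y \<in> carrier MM"
  then obtain f g where f: "!!i. f i \<in> S" "x = mk f" and g: "!!i. g i \<in> S" "y = mk g" by (metis MM_cases)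
  note fg = SD(3)[OF f(1) g(1)]
  show "x \<oplus>\<^bsub>MM\<^esub> y \<in> carrier MM" unfolding f(2) g(2) MM_add[OF f(1) g(1)] by (rule mk_MM[OF fg])
  show "x \<oplus>\<^bsub>MM\<^esub> y = y \<oplus>\<^bsub>MM\<^esub> x" unfolding f(2) g(2) MM_add[OF f(1) g(1)] MM_add[OF g(1) f(1)] by (simp add: add.commute)
  fix w assume "w \<in> carrier MM"
  then obtain h where h: "!!i. h i \<in> S" "w = mk h" by (metis MM_cases)
  show "x \<oplus>\<^bsub>MM\<^esub> y \<oplus>\<^bsub>MM\<^esub> w = x \<oplus>\<^bsub>MM\<^esub> (y \<oplus>\<^bsub>MM\<^esub> w)"
    unfolding f(2) g(2) h(2) MM_add[OF f(1) g(1)] MM_add[OF g(1) h(1)] MM_add[OF fg h(1)] MM_add[OF f(1) SD(3)[OF g(1) h(1)]]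
    by (simp add: add.assoc)
next
  show "\<zero>\<^bsub>MM\<^esub> \<in> carrier MM" unfolding MM_zero by (rule mk_MM[OF SD(1)])
next
  fix x assume "x \<in> carrier MM"
  then obtain f where f: "!!i. f i \<in> S" "x = mk f" by (metis MM_cases)
  show "\<zero>\<^bsub>MM\<^esub> \<oplus>\<^bsub>MM\<^esub> x = x" unfolding f(2) MM_zero MM_add[OF SD(1) f(1)] by simp
  show "\<exists>y\<in>carrier MM. y \<oplus>\<^bsub>MM\<^esub> x = \<zero>\<^bsub>MM\<^esub>"
  proof
    show "mk (%i. - f i) \<oplus>\<^bsub>MM\<^esub> x = \<zero>\<^bsub>MM\<^esub>" unfolding f(2) MM_zero MM_add[OF SD(5)[OF f(1)] f(1)] by simp
    show "mk (%i. - f i) \<in> carrier MM" by (rule mk_MM[OF SD(5)[OF f(1)]])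
  qed
qed

lemma MM_finsum:
  assumes "finite A" shows "(!!g i. g \<in> A ==> F g i \<in> S) ==> (\<Oplus>\<^bsub>MM\<^esub>g\<in>A. mk (F g)) = mk (%i. \<Sum>g\<in>A. F g i)"
  using assms
proof (induction A)
  case empty
  interpret MM: abelian_group MM by (rule MM_group)
  show ?case by (simp add: MM_zero)
next
  case (insert g A)
  interpret MM: abelian_group MM by (rule MM_group)
  have c: "mk (F g') \<in> carrier MM" if "g' \<in> insert g A" for g' using insert.prems[OF that] by (rule mk_MM)
  have s: "(\<Sum>g\<in>A. F g i) \<in> S" for i using insert.prems by (intro subrng_sum[OF subS]) blast
  have "(\<Oplus>\<^bsub>MM\<^esub>g'\<in>insert g A. mk (F g')) = mk (F g) \<oplus>\<^bsub>MM\<^esub> (\<Oplus>\<^bsub>MM\<^esub>g'\<in>A. mk (F g'))"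
    by (rule MM.finsum_insert[OF insert.hyps(1,2)]) (use c in blast)+
  also have "(\<Oplus>\<^bsub>MM\<^esub>g'\<in>A. mk (F g')) = mk (%i. \<Sum>g\<in>A. F g i)" using insert.prems by (intro insert.IH) blast
  also have "mk (F g) \<oplus>\<^bsub>MM\<^esub> \<dots> = mk (%i. F g i + (\<Sum>g\<in>A. F g i))"
    by (rule MM_add[OF _ s]) (use insert.prems in blast)
  finally show ?case using insert.hyps by simp
qed

lemma act_mk: "g \<in> G ==> act g (mk f) = mk (%i. g (f i))" by (simp add: mk_def image_coset_Q)

lemma tw_sum_S: "(!!g. g \<in> G ==> x g \<in> S) ==> (\<Sum>g\<in>G. kp (r g) * x g) \<in> S"
  by (intro subrng_sum[OF subS] SD(4)[OF kpS])

lemma dla_mk: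
  assumes f: "!!i. f i \<in> S" shows "dla r (mk f) = mk (%i. \<Sum>g\<in>G. kp (r g) * g (f i))"
proof -
  interpret MM: abelian_group MM by (rule MM_group)
  have s: "kp (r g) * g (f i) \<in> S" if "g \<in> G" for g i by (rule SD(4)[OF kpS Gal_S[OF that f]])
  have "dla r (mk f) = (\<Oplus>\<^bsub>MM\<^esub>g\<in>G. r g \<odot>\<^bsub>MM\<^esub> act g (mk f))" unfolding dla_def left_act_def ..
  also have "\<dots> = (\<Oplus>\<^bsub>MM\<^esub>g\<in>G. mk (%i. kp (r g) * g (f i)))"
  proof (rule MM.finsum_cong'[OF refl])
    show "(%g. mk (%i. kp (r g) * g (f i))) \<in> G \<rightarrow> carrier MM" by (rule Pi_I) (rule mk_MM, rule s)
    show "r g \<odot>\<^bsub>MM\<^esub> act g (mk f) = mk (%i. kp (r g) * g (f i))" if "g \<in> G" for g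
      unfolding act_mk[OF that] by (rule MM_smult[OF Gal_S[OF that f]])
  qed
  also have "\<dots> = mk (%i. \<Sum>g\<in>G. kp (r g) * g (f i))" by (rule MM_finsum[OF G_fin s])
  finally show ?thesis .
qed

lemma AA_simps: "carrier AA = D" "\<zero>\<^bsub>AA\<^esub> = (%_. 0)" "\<phi> \<oplus>\<^bsub>AA\<^esub> \<psi> = ad \<phi> \<psi>" "c \<odot>\<^bsub>AA\<^esub> \<phi> = sm c \<phi>"
  by (simp_all add: AA_def dual_space_def mk_module_def D_def)

lemma AA_record: "vector_record AA"
proof (rule vector_record.intro)
  have z: "(%_. 0) \<in> D" by (simp add: D_iff)
  have neg: "\<exists>\<psi>\<in>D. ad \<psi> \<phi> = (%_. 0)" if "\<phi> \<in> D" for \<phi>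
    using sm_D[OF that, of "- 1"] by (intro bexI[of _ "sm (- 1) \<phi>"]) (simp_all add: fun_eq_iff)
  show "abelian_group AA"
    by (rule abelian_groupI) (simp_all add: AA_simps ad_D z neg add.assoc, simp add: add.commute)
qed (simp_all add: AA_simps ad_D sm_D algebra_simps)

lemma dra_eq: "dra \<phi> r = (%v. \<Sum>g\<in>G. \<iota> (r g) * \<phi> (\<rho> g v))" by (rule HOL.ext) (simp add: dra_def dual_act_def)

lemma dra_D: assumes \<phi>: "\<phi> \<in> D" shows "dra \<phi> r \<in> D"
  unfolding D_iff dra_eq
proof (intro conjI allI)
  fix x y c
  have 1: "\<iota> (r g) * \<phi> (\<rho> g (x + y)) = \<iota> (r g) * \<phi> (\<rho> g x) + \<iota> (r g) * \<phi> (\<rho> g y)"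
    "\<iota> (r g) * \<phi> (\<rho> g (sc c x)) = c * (\<iota> (r g) * \<phi> (\<rho> g x))" if "g \<in> G" for g
    using \<phi> \<rho>_lin[OF that] unfolding D_iff by (simp_all add: algebra_simps)
  show "(\<Sum>g\<in>G. \<iota> (r g) * \<phi> (\<rho> g (x + y))) = (\<Sum>g\<in>G. \<iota> (r g) * \<phi> (\<rho> g x)) + (\<Sum>g\<in>G. \<iota> (r g) * \<phi> (\<rho> g y))"
    unfolding sum.distrib[symmetric] by (rule sum.cong[OF refl 1(1)])
  show "(\<Sum>g\<in>G. \<iota> (r g) * \<phi> (\<rho> g (sc c x))) = c * (\<Sum>g\<in>G. \<iota> (r g) * \<phi> (\<rho> g x))"
    unfolding sum_distrib_left by (rule sum.cong[OF refl 1(2)])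
qed

lemma finite_MM: "finite (carrier MM)"
proof -
  have "finite (coset Q ` S)" using Quot_finite[OF fhh Q_idl fq_Q] unfolding Quot_carrier[OF fhh Q_idl] .
  from finite_lists_length_eq[OF this, of n] show ?thesis unfolding MM_carrier by (simp add: conj_commute)
qed

sublocale T: tensor_setup AA MM RR dra dla
proof (rule tensor_setup.intro[OF AA_record MM_group tensor_setup_axioms.intro])
  fix x r c
  show "dra x r \<in> carrier AA" if "x \<in> carrier AA" using dra_D that unfolding AA_simps by blast
  show "c \<odot>\<^bsub>AA\<^esub> dra x r = dra (c \<odot>\<^bsub>AA\<^esub> x) r" unfolding AA_simps dra_eq by (simp add: sum_distrib_left algebra_simps)
next
  fix m r assume "m \<in> carrier MM"
  then obtain f where f: "!!i. f i \<in> S" "m = mk f" by (metis MM_cases)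
  show "dla r m \<in> carrier MM" unfolding f(2) dla_mk[OF f(1)] by (intro mk_MM tw_sum_S Gal_S[OF _ f(1)])
next
  show "finite (carrier AA)" unfolding AA_simps by (rule finite_D)
qed (rule finite_MM)

text \<open>Identifies \<open>U\<close> with the functionals on the tensor module by adding up the
  coordinates. The representative chosen from each coset is irrelevant, since the components of
  \<open>u\<close> kill \<open>Q\<close>.\<close>

definition "toB u = (%(\<phi>, xs). if \<phi> \<in> D \<and> xs \<in> carrier MM then \<Sum>i<n. u (\<phi>, i, SOME x. x \<in> xs ! i) else (0 :: 'o))"

lemma coset_Q_rep: "x \<in> S ==> (SOME y. y \<in> coset Q x) \<in> S \<and> (SOME y. y \<in> coset Q x) - x \<in> Q"
proof -
  assume x: "x \<in> S"
  have "x \<in> coset Q x" using QD(1) by (simp add: in_coset)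
  then have "(SOME y. y \<in> coset Q x) \<in> coset Q x" by (rule someI)
  then have e: "(SOME y. y \<in> coset Q x) - x \<in> Q" by (simp add: in_coset)
  then have "(SOME y. y \<in> coset Q x) - x + x \<in> S" using SD(3)[OF QD(2)[OF e] x] by blast
  then show ?thesis using e by simp
qed

lemma toB_mk:
  assumes u: "u \<in> U" and \<phi>: "\<phi> \<in> D" and f: "!!i. f i \<in> S"
  shows "toB u (\<phi>, mk f) = (\<Sum>i<n. u (\<phi>, i, f i))"
proof -
  have "toB u (\<phi>, mk f) = (\<Sum>i<n. u (\<phi>, i, SOME x. x \<in> mk f ! i))" unfolding toB_def using \<phi> mk_MM[OF f] by simp
  also have "\<dots> = (\<Sum>i<n. u (\<phi>, i, f i))"
  proof (rule sum.cong[OF refl])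
    fix i assume "i \<in> {..<n}"
    then have i: "i < n" by simp
    show "u (\<phi>, i, SOME x. x \<in> mk f ! i) = u (\<phi>, i, f i)"
      unfolding mk_nth[OF i] using lin_cong[OF U_lin[OF u \<phi> i] _ f[of i]] coset_Q_rep[OF f[of i]] by blast
  qed
  finally show ?thesis .
qed

lemma VO_sum_D:
  assumes w: "w \<in> VO" and "finite A" shows "(!!g. g \<in> A ==> \<psi> g \<in> D) ==> w (%v. \<Sum>g\<in>A. c g * \<psi> g v) = (\<Sum>g\<in>A. jf (c g) * w (\<psi> g)) \<and> (%v. \<Sum>g\<in>A. c g * \<psi> g v) \<in> D"
  using assms(2)
proof (induction A)
  case empty
  have z: "(%_. 0) \<in> D" by (simp add: D_iff)
  interpret jf: field_hom jf by (rule jf)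
  have "w (sm 0 (%_. 0)) = jf 0 * w (%_. 0)" by (rule VOD(2)[OF w z])
  then have "w (%_. 0) = 0" unfolding jf.hom_zero mult_zero_left .
  then show ?case using z by simp
next
  case (insert g A)
  have I: "w (%v. \<Sum>g\<in>A. c g * \<psi> g v) = (\<Sum>g\<in>A. jf (c g) * w (\<psi> g))" "(%v. \<Sum>g\<in>A. c g * \<psi> g v) \<in> D"
    using insert.IH insert.prems by blast+
  have g: "\<psi> g \<in> D" using insert.prems by blast
  have e: "(%v. \<Sum>g\<in>insert g A. c g * \<psi> g v) = ad (sm (c g) (\<psi> g)) (%v. \<Sum>g\<in>A. c g * \<psi> g v)" using insert.hyps by simp
  show ?case
    unfolding e VOD(1)[OF w sm_D[OF g] I(2)] VOD(2)[OF w g] I(1) using insert.hyps ad_D[OF sm_D[OF g] I(2)] by simp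
qed

lemma lin_sum_kp:
  assumes f: "f \<in> lin" and "finite A" shows "(!!g. g \<in> A ==> x g \<in> S) ==> f (\<Sum>g\<in>A. kp (c g) * x g) = (\<Sum>g\<in>A. (jf \<circ> \<iota>) (c g) * f (x g))"
  using assms(2)
proof (induction A)
  case empty
  show ?case using linD(3)[OF f QD(1)] by simp
next
  case (insert g A)
  have s: "(\<Sum>g\<in>A. kp (c g) * x g) \<in> S" using insert.prems by (intro subrng_sum[OF subS] SD(4)[OF kpS]) blast
  have xg: "x g \<in> S" using insert.prems by blast
  have IH: "f (\<Sum>g\<in>A. kp (c g) * x g) = (\<Sum>g\<in>A. (jf \<circ> \<iota>) (c g) * f (x g))" using insert.IH insert.prems by blast
  show ?case
    unfolding sum.insert[OF insert.hyps] linD(1)[OF f SD(4)[OF kpS xg] s] linD(2)[OF f xg] IH ..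
qed

lemma toB_Bal:
  assumes u: "u \<in> U" shows "toB u \<in> T.Bal jf"
  unfolding T.Bal_def AA_simps
proof (intro CollectI conjI ballI allI impI)
  fix \<phi> \<psi> m assume \<phi>: "\<phi> \<in> D" and \<psi>: "\<psi> \<in> D" and "m \<in> carrier MM"
  then obtain f where f: "!!i. f i \<in> S" "m = mk f" by (metis MM_cases)
  show "toB u (ad \<phi> \<psi>, m) = toB u (\<phi>, m) + toB u (\<psi>, m)"
    unfolding f(2) toB_mk[OF u \<phi> f(1)] toB_mk[OF u \<psi> f(1)] toB_mk[OF u ad_D[OF \<phi> \<psi>] f(1)] sum.distrib[symmetric]
    by (rule sum.cong[OF refl]) (use VOD(1)[OF U_VO[OF u _ f(1)] \<phi> \<psi>] in simp)
next
  fix \<phi> m m' assume \<phi>: "\<phi> \<in> D" and "m \<in> carrier MM" "m' \<in> carrier MM"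
  then obtain f g where f: "!!i. f i \<in> S" "m = mk f" and g: "!!i. g i \<in> S" "m' = mk g" by (metis MM_cases)
  show "toB u (\<phi>, m \<oplus>\<^bsub>MM\<^esub> m') = toB u (\<phi>, m) + toB u (\<phi>, m')"
    unfolding f(2) g(2) MM_add[OF f(1) g(1)] toB_mk[OF u \<phi> f(1)] toB_mk[OF u \<phi> g(1)] toB_mk[OF u \<phi> SD(3)[OF f(1) g(1)]] sum.distrib[symmetric]
    by (rule sum.cong[OF refl]) (use linD(1)[OF U_lin[OF u \<phi>] f(1) g(1)] in simp)
next
  fix \<phi> r m assume \<phi>: "\<phi> \<in> D" and "m \<in> carrier MM"
  then obtain f where f: "!!i. f i \<in> S" "m = mk f" by (metis MM_cases)
  have "u (dra \<phi> r, i, f i) = u (\<phi>, i, \<Sum>g\<in>G. kp (r g) * g (f i))" if i: "i < n" for i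
  proof -
    have "u (dra \<phi> r, i, f i) = (\<Sum>g\<in>G. jf (\<iota> (r g)) * u (ra \<phi> g, i, f i))"
      unfolding dra_eq using VO_sum_D[OF U_VO[OF u i f(1)[of i]] G_fin, of "ra \<phi>" "%g. \<iota> (r g)"] ra_D[OF \<phi>] by blast
    also have "\<dots> = (\<Sum>g\<in>G. (jf \<circ> \<iota>) (r g) * u (\<phi>, i, g (f i)))"
      by (rule sum.cong[OF refl]) (use U_equiv[OF u \<phi> i f(1)[of i]] in simp)
    also have "\<dots> = u (\<phi>, i, \<Sum>g\<in>G. kp (r g) * g (f i))"
      by (rule lin_sum_kp[OF U_lin[OF u \<phi> i] G_fin Gal_S[OF _ f(1)], symmetric])
    finally show ?thesis .
  qed
  moreover have s: "(\<Sum>g\<in>G. kp (r g) * g (f i)) \<in> S" for i by (rule tw_sum_S) (rule Gal_S[OF _ f(1)])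
  ultimately show "toB u (dra \<phi> r, m) = toB u (\<phi>, dla r m)"
    unfolding f(2) dla_mk[OF f(1)] toB_mk[OF u dra_D[OF \<phi>] f(1)] toB_mk[OF u \<phi> s]
    by (intro sum.cong refl) simp
next
  fix c \<phi> m assume \<phi>: "\<phi> \<in> D" and "m \<in> carrier MM"
  then obtain f where f: "!!i. f i \<in> S" "m = mk f" by (metis MM_cases)
  show "toB u (sm c \<phi>, m) = jf c * toB u (\<phi>, m)"
    unfolding f(2) toB_mk[OF u \<phi> f(1)] toB_mk[OF u sm_D[OF \<phi>] f(1)] sum_distrib_left
    by (rule sum.cong[OF refl]) (use VOD(2)[OF U_VO[OF u _ f(1)] \<phi>] in simp)
next
  fix y assume "y \<notin> T.Sp"
  then show "toB u y = 0" unfolding T.Sp_def AA_simps toB_def by (cases y) (simp only: prod.case mem_Sigma_iff if_False)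
qed

definition "un i x = (%k. if k = i then x else (0 :: 'L))"

lemma un_S: "x \<in> S ==> un i x k \<in> S" using SD(1) unfolding un_def by (cases "k = i") simp_all

lemma toB_un:
  assumes u: "u \<in> U" and \<phi>: "\<phi> \<in> D" and i: "i < n" and x: "x \<in> S"
  shows "toB u (\<phi>, mk (un i x)) = u (\<phi>, i, x)"
proof -
  have "u (\<phi>, k, un i x k) = (if k = i then u (\<phi>, i, x) else 0)" if "k < n" for k
    using linD(3)[OF U_lin[OF u \<phi> that] QD(1)] by (simp add: un_def)
  then show ?thesis unfolding toB_mk[OF u \<phi> un_S[OF x]] using i by simp
qed

lemma toB_inj: assumes "u \<in> U" "v \<in> U" "toB u = toB v" shows "u = v"
proof
  fix y show "u y = v y"
  proof (cases y)
    case (fields \<phi> i x)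
    show ?thesis
    proof (cases "\<phi> \<in> D \<and> i < n")
      case True
      then show ?thesis
        using toB_un[OF assms(1), of \<phi> i x] toB_un[OF assms(2), of \<phi> i x] assms(3)
          linD(4)[OF U_lin[OF assms(1), of \<phi> i], of x] linD(4)[OF U_lin[OF assms(2), of \<phi> i], of x] fields
        by (cases "x \<in> S") simp_all
    next
      case False
      then show ?thesis using U_zero[OF assms(1), of \<phi> i x] U_zero[OF assms(2), of \<phi> i x] fields by auto
    qed
  qed
qed

lemma Bal_clauses:
  assumes "\<beta> \<in> T.Bal jf"
  shows "\<phi> \<in> D ==> \<psi> \<in> D ==> m \<in> carrier MM ==> \<beta> (ad \<phi> \<psi>, m) = \<beta> (\<phi>, m) + \<beta> (\<psi>, m)"
    "\<phi> \<in> D ==> m \<in> carrier MM ==> m' \<in> carrier MM ==> \<beta> (\<phi>, m \<oplus>\<^bsub>MM\<^esub> m') = \<beta> (\<phi>, m) + \<beta> (\<phi>, m')"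
    "\<phi> \<in> D ==> r \<in> RR ==> m \<in> carrier MM ==> \<beta> (dra \<phi> r, m) = \<beta> (\<phi>, dla r m)"
    "\<phi> \<in> D ==> m \<in> carrier MM ==> \<beta> (sm c \<phi>, m) = jf c * \<beta> (\<phi>, m)"
  using assms unfolding T.Bal_def AA_simps by blast+

text \<open>Balancing over the group ring, specialized to the element c g. The case of the identity
  yields k-linearity in the second argument, the case c = 1 yields equivariance.\<close>

lemma Bal_act:
  assumes \<beta>: "\<beta> \<in> T.Bal jf" and \<phi>: "\<phi> \<in> D" and g: "g \<in> G" and f: "!!i. f i \<in> S"
  shows "(jf \<circ> \<iota>) c * \<beta> (ra \<phi> g, mk f) = \<beta> (\<phi>, mk (%i. kp c * g (f i)))"
proof -
  interpret \<iota>: field_hom \<iota> by (rule \<iota>)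
  interpret k: field_hom kp by (rule field_hom_const_emb[OF fhh])
  have k0: "poly_emb (b \<circ> a) 0 = 0" using k.hom_zero by simp
  \<comment> \<open>Elements of \<open>group_ring\<close> are extensional functions, hence
    \<open>undefined\<close> outside \<open>G\<close>.\<close>
  define r where "r = (%g'. if g' \<in> G then if g' = g then c else 0 else undefined)"
  have rR: "r \<in> RR" unfolding RR_def group_ring_def r_def by auto
  have "(\<Sum>g'\<in>G. \<iota> (r g') * \<phi> (\<rho> g' v)) = (\<Sum>g'\<in>G. if g' = g then \<iota> c * \<phi> (\<rho> g v) else 0)" for v
    by (rule sum.cong) (simp_all add: r_def)
  then have d: "dra \<phi> r = sm (\<iota> c) (ra \<phi> g)" unfolding dra_eq using g G_fin by simp
  have "(\<Sum>g'\<in>G. kp (r g') * g' x) = (\<Sum>g'\<in>G. if g' = g then kp c * g x else 0)" for x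
    by (rule sum.cong) (simp_all add: r_def k0)
  then have l: "dla r (mk f) = mk (%i. kp c * g (f i))" unfolding dla_mk[OF f] using g G_fin by simp
  have "\<beta> (dra \<phi> r, mk f) = \<beta> (\<phi>, dla r (mk f))" by (rule Bal_clauses(3)[OF \<beta> \<phi> rR mk_MM[OF f]])
  then show ?thesis unfolding d l using Bal_clauses(4)[OF \<beta> ra_D[OF \<phi> g] mk_MM[OF f], of "\<iota> c"] by simp
qed

text \<open>The preimage is read off on vectors concentrated in one coordinate, and additivity in
  the second argument recovers the functional from these values.\<close>

lemma toB_surj: assumes \<beta>: "\<beta> \<in> T.Bal jf" shows "\<exists>u\<in>U. toB u = \<beta>"
proof -
  note B = Bal_clauses[OF \<beta>]
  define u where "u = (%(\<phi>, i, x). if \<phi> \<in> D \<and> i < n \<and> x \<in> S then \<beta> (\<phi>, mk (un i x)) else 0)"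
  have ue: "u (\<phi>, i, x) = \<beta> (\<phi>, mk (un i x))" if "\<phi> \<in> D" "i < n" "x \<in> S" for \<phi> i x unfolding u_def prod.case using that by (simp only: simp_thms if_True)
  have u0: "u (\<phi>, i, x) = 0" if "\<not> (\<phi> \<in> D \<and> i < n \<and> x \<in> S)" for \<phi> i x unfolding u_def prod.case using that by (rule if_not_P)
  have un_add: "mk (un i (x + y)) = mk (un i x) \<oplus>\<^bsub>MM\<^esub> mk (un i y)" if "x \<in> S" "y \<in> S" for i x y
    unfolding MM_add[OF un_S[OF that(1)] un_S[OF that(2)]] by (rule arg_cong[of _ _ mk]) (simp add: un_def fun_eq_iff)
  have un_g: "(%k. kp c * g (un i x k)) = un i (kp c * g x)" if "g \<in> G" for c g i x
    using rhomD(1)[OF Gal_rhom[OF that]] by (simp add: un_def fun_eq_iff)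
  have \<beta>0: "\<beta> (\<phi>, mk (%_. 0)) = 0" if "\<phi> \<in> D" for \<phi>
  proof -
    have "\<beta> (\<phi>, mk (%_. 0)) = \<beta> (\<phi>, mk (%_. 0)) + \<beta> (\<phi>, mk (%_. 0))"
      using B(2)[OF that mk_MM[of "%_. 0", OF SD(1)] mk_MM[of "%_. 0", OF SD(1)]] unfolding MM_add[of "%_. 0" "%_. 0", OF SD(1) SD(1)] add_0_left .
    then show ?thesis by (metis add_cancel_right_right)
  qed
  have u: "u \<in> U"
  proof (rule UI)
    fix \<phi> i assume \<phi>: "\<phi> \<in> D" and i: "i < n"
    show "(%x. u (\<phi>, i, x)) \<in> lin"
      unfolding lin_def
    proof (intro CollectI conjI ballI allI impI)
      fix x y assume xy: "x \<in> S" "y \<in> S"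
      show "u (\<phi>, i, x + y) = u (\<phi>, i, x) + u (\<phi>, i, y)"
        unfolding ue[OF \<phi> i xy(1)] ue[OF \<phi> i xy(2)] ue[OF \<phi> i SD(3)[OF xy]] un_add[OF xy]
        by (rule B(2)[OF \<phi> mk_MM[OF un_S[OF xy(1)]] mk_MM[OF un_S[OF xy(2)]]])
    next
      fix c x assume x: "x \<in> S"
      have "(jf \<circ> \<iota>) c * \<beta> (ra \<phi> id, mk (un i x)) = \<beta> (\<phi>, mk (%k. kp c * id (un i x k)))"
        by (rule Bal_act[OF \<beta> \<phi> Gal_id un_S[OF x]])
      then show "u (\<phi>, i, kp c * x) = (jf \<circ> \<iota>) c * u (\<phi>, i, x)"
        unfolding ue[OF \<phi> i x] ue[OF \<phi> i SD(4)[OF kpS x]] un_g[OF Gal_id] ra_id[OF \<phi>] by simp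
    next
      fix x assume x: "x \<in> Q"
      have "mk (un i x) = mk (%_. 0)"
        unfolding mk_def by (rule map_cong[OF refl]) (use x QD(1) in \<open>simp add: coset_eq_iff[OF Q_idl subS] un_def\<close>)
      then show "u (\<phi>, i, x) = 0" unfolding ue[OF \<phi> i QD(2)[OF x]] using \<beta>0[OF \<phi>] by simp
    next
      fix x assume "x \<notin> S"
      then show "u (\<phi>, i, x) = 0" by (intro u0) blast
    qed
  next
    fix i x assume i: "i < n" and x: "x \<in> S"
    note mx = mk_MM[OF un_S[OF x]]
    show "(%\<phi>. u (\<phi>, i, x)) \<in> VO"
      unfolding VO_def
    proof (intro CollectI conjI ballI allI impI)
      fix \<phi> \<psi> assume "\<phi> \<in> D" "\<psi> \<in> D"
      then show "u (ad \<phi> \<psi>, i, x) = u (\<phi>, i, x) + u (\<psi>, i, x)" using ue[OF _ i x] ad_D B(1)[OF _ _ mx] by simp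
    next
      fix c \<phi> assume "\<phi> \<in> D"
      then show "u (sm c \<phi>, i, x) = jf c * u (\<phi>, i, x)" using ue[OF _ i x] sm_D B(4)[OF _ mx] by simp
    next
      fix \<phi> assume "\<phi> \<notin> D"
      then show "u (\<phi>, i, x) = 0" by (intro u0) blast
    qed
  next
    interpret k: field_hom kp by (rule field_hom_const_emb[OF fhh])
    fix \<phi> i x g assume \<phi>: "\<phi> \<in> D" and i: "i < n" and x: "x \<in> S" and g: "g \<in> G"
    have "(jf \<circ> \<iota>) 1 * \<beta> (ra \<phi> g, mk (un i x)) = \<beta> (\<phi>, mk (un i (kp 1 * g x)))"
      using Bal_act[OF \<beta> \<phi> g, of "un i x" 1, OF un_S[OF x]] unfolding un_g[OF g] .
    then show "u (ra \<phi> g, i, x) = u (\<phi>, i, g x)"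
      unfolding ue[OF \<phi> i Gal_S[OF g x]] ue[OF ra_D[OF \<phi> g] i x] k.hom_one \<iota>j.hom_one by simp
  next
    fix \<phi> i x assume a: "\<phi> \<notin> D \<or> n \<le> i"
    have "\<not> (\<phi> \<in> D \<and> i < n \<and> x \<in> S)" using a leD by blast
    then show "u (\<phi>, i, x) = 0" by (rule u0)
  qed
  have "toB u = \<beta>"
  proof (rule T.Bal_ext[OF toB_Bal[OF u] \<beta>], unfold AA_simps)
    fix \<phi> m assume \<phi>: "\<phi> \<in> D" and "m \<in> carrier MM"
    then obtain f where f: "!!i. f i \<in> S" "m = mk f" by (metis MM_cases)
    \<comment> \<open>The first \<open>l\<close> coordinates of \<open>f\<close>, filled up with
      zeros; the induction adds one coordinate at a time.\<close>
    define fl where "fl = (%(l :: nat) k. if k < l then f k else 0)"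
    have flS: "fl l k \<in> S" for l k unfolding fl_def using f(1) SD(1) by (cases "k < l") simp_all
    have "\<beta> (\<phi>, mk (fl l)) = (\<Sum>i<l. u (\<phi>, i, f i))" if "l \<le> n" for l
      using that
    proof (induction l)
      case 0
      have "fl 0 = (%_. 0)" by (simp add: fl_def fun_eq_iff)
      then show ?case using \<beta>0[OF \<phi>] by simp
    next
      case (Suc l)
      have "fl (Suc l) = (%k. fl l k + un l (f l) k)" by (auto simp: fl_def un_def fun_eq_iff)
      then have "mk (fl (Suc l)) = mk (fl l) \<oplus>\<^bsub>MM\<^esub> mk (un l (f l))" using MM_add[of "fl l" "un l (f l)", OF flS un_S[OF f(1)]] by simp
      then have "\<beta> (\<phi>, mk (fl (Suc l))) = \<beta> (\<phi>, mk (fl l)) + \<beta> (\<phi>, mk (un l (f l)))"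
        using B(2)[OF \<phi> mk_MM[of "fl l", OF flS] mk_MM[of "un l (f l)", OF un_S[OF f(1)]]] by simp
      then show ?case using Suc ue[OF \<phi> _ f(1), of l l] by simp
    qed
    from this[of n] have "\<beta> (\<phi>, mk (fl n)) = (\<Sum>i<n. u (\<phi>, i, f i))" by simp
    moreover have "mk (fl n) = mk f" unfolding mk_def by (rule map_cong[OF refl]) (simp add: fl_def)
    ultimately show "toB u (\<phi>, m) = \<beta> (\<phi>, m)" unfolding f(2) toB_mk[OF u \<phi> f(1)] by simp
  qed
  then show ?thesis using u by blast
qed

abbreviation "mm \<equiv> length T.TMv.some_basis"
definition "kpU u = T.kap (toB u)"

lemma U_iso: "coord_iso U kpU mm"
proof -
  have K: "coord_iso (T.Bal jf) T.kap mm" by (rule T.coord_iso_kap[OF jf])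
  have bij: "bij_betw toB U (T.Bal jf)"
    unfolding bij_betw_def
  proof (intro conjI inj_onI subset_antisym subsetI)
    show "u = v" if "u \<in> U" "v \<in> U" "toB u = toB v" for u v by (rule toB_inj[OF that])
    show "\<beta> \<in> T.Bal jf" if "\<beta> \<in> toB ` U" for \<beta> using that toB_Bal by blast
    show "\<beta> \<in> toB ` U" if "\<beta> \<in> T.Bal jf" for \<beta> using toB_surj[OF that] by blast
  qed
  have a: "toB (%y. u y + v y) = (%y. toB u y + toB v y)" for u v by (rule HOL.ext) (simp add: toB_def split_beta sum.distrib)
  have s: "toB (%y. c * u y) = (%y. c * toB u y)" for c u by (rule HOL.ext) (simp add: toB_def split_beta sum_distrib_left)
  show ?thesis
    unfolding coord_iso_def
  proof (intro conjI ballI allI)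
    fix u v assume uv: "u \<in> U" "v \<in> U"
    show "(%y. u y + v y) \<in> U" by (rule add_U[OF uv])
    show "kpU (%y. u y + v y) = kpU u + kpU v" unfolding kpU_def a by (rule coord_iso_add(2)[OF K toB_Bal[OF uv(1)] toB_Bal[OF uv(2)]])
  next
    fix c u assume u: "u \<in> U"
    show "(%y. c * u y) \<in> U" by (rule scale_U[OF u])
    show "kpU (%y. c * u y) = c \<cdot>\<^sub>v kpU u" unfolding kpU_def s by (rule coord_iso_scale(2)[OF K toB_Bal[OF u]])
  next
    have "bij_betw (T.kap \<circ> toB) U (carrier_vec mm)" by (rule bij_betw_trans[OF bij]) (use K in \<open>simp add: coord_iso_def\<close>)
    then show "bij_betw kpU U (carrier_vec mm)" by (simp add: kpU_def[abs_def] comp_def)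
  qed
qed

text \<open>Both actions of t in one formula: the zero map for \<open>e\<close> gives the Lie
  algebra, the q-th power the Carlitz module.\<close>

definition "tM e f = (%i. z * f i + (if Suc i < n then f (Suc i) else e (f (0 :: nat))))"

lemma tM_S: "(!!x. x \<in> S ==> e x \<in> S) ==> (!!i. f i \<in> S) ==> tM e f i \<in> S"
  unfolding tM_def using SD(3)[OF SD(4)[OF z_S]] by (cases "Suc i < n") simp_all

lemma M_hom_tM:
  assumes t: "!!f. (!!i. f i \<in> S) ==> t (mk f) = mk (tM e f)" and e: "!!x. x \<in> S ==> e x \<in> S"
    and ea: "!!x y. e (x + y) = e x + e y" and er: "!!r x. x \<in> S ==> e (\<Sum>g\<in>G. kp (r g) * g x) = (\<Sum>g\<in>G. kp (r g) * g (e x))"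
  shows "T.M_hom t"
  unfolding T.M_hom_def
proof (intro conjI ballI)
  fix m assume "m \<in> carrier MM"
  then obtain f where f: "!!i. f i \<in> S" "m = mk f" by (metis MM_cases)
  show "t m \<in> carrier MM" unfolding f(2) t[of f, OF f(1)] by (rule mk_MM) (rule tM_S[OF e f(1)])
next
  fix m m' assume "m \<in> carrier MM" "m' \<in> carrier MM"
  then obtain f g where f: "!!i. f i \<in> S" "m = mk f" and g: "!!i. g i \<in> S" "m' = mk g" by (metis MM_cases)
  have tf: "tM e f i \<in> S" and tg: "tM e g i \<in> S" and fg: "f i + g i \<in> S" for i
    using tM_S[of e f i, OF e f(1)] tM_S[of e g i, OF e g(1)] SD(3)[OF f(1) g(1)] by (simp_all only:)
  show "t (m \<oplus>\<^bsub>MM\<^esub> m') = t m \<oplus>\<^bsub>MM\<^esub> t m'"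
    unfolding f(2) g(2) MM_add[of f g, OF f(1) g(1)] t[of f, OF f(1)] t[of g, OF g(1)] t[of "%i. f i + g i", OF fg] MM_add[of "tM e f" "tM e g", OF tf tg]
    by (rule arg_cong[of _ _ mk]) (auto simp: tM_def ea fun_eq_iff algebra_simps)
next
  fix m r assume "m \<in> carrier MM"
  then obtain f where f: "!!i. f i \<in> S" "m = mk f" by (metis MM_cases)
  have g: "g (z * x + y) = z * g x + g y" if "g \<in> G" "x \<in> S" "y \<in> S" for g x y
    using rhomD(3)[OF Gal_rhom[OF that(1)] SD(4)[OF z_S that(2)] that(3)] rhomD(4)[OF Gal_rhom[OF that(1)] z_S that(2)] Gal_poly[OF that(1)] by simp
  have "tM e (%i. \<Sum>g\<in>G. kp (r g) * g (f i)) i = (\<Sum>g\<in>G. kp (r g) * g (tM e f i))" for i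
  proof -
    define y where "y = (if Suc i < n then f (Suc i) else e (f 0))"
    have y: "y \<in> S" unfolding y_def using f(1) e by (cases "Suc i < n") simp_all
    have "tM e (%i. \<Sum>g\<in>G. kp (r g) * g (f i)) i = z * (\<Sum>g\<in>G. kp (r g) * g (f i)) + (\<Sum>g\<in>G. kp (r g) * g y)"
      unfolding tM_def y_def using er[OF f(1)] by (cases "Suc i < n") simp_all
    also have "\<dots> = (\<Sum>g\<in>G. kp (r g) * (z * g (f i) + g y))" by (simp add: sum_distrib_left sum.distrib algebra_simps)
    also have "\<dots> = (\<Sum>g\<in>G. kp (r g) * g (z * f i + y))" by (rule sum.cong[OF refl]) (simp only: g[OF _ f(1) y])
    finally show ?thesis unfolding tM_def y_def .
  qed
  then have "tM e (%i. \<Sum>g\<in>G. kp (r g) * g (f i)) = (%i. \<Sum>g\<in>G. kp (r g) * g (tM e f i))" by (rule HOL.ext)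
  moreover have s: "(\<Sum>g\<in>G. kp (r g) * g (f i)) \<in> S" for i by (rule tw_sum_S) (rule Gal_S[OF _ f(1)])
  moreover have tf: "tM e f i \<in> S" for i by (rule tM_S[OF e f(1)])
  ultimately show "t (dla r m) = dla r (t m)"
    unfolding f(2) dla_mk[of f, OF f(1)] t[of f, OF f(1)] t[of "%i. \<Sum>g\<in>G. kp (r g) * g (f i)", OF s] dla_mk[of "tM e f", OF tf]
    by (simp only:)
qed

definition "lieT = lie_carlitz_t et BB n"
definition "carT = carlitz_t et BB n"

lemma et_mult: "x \<in> S ==> et [:0, 1:] \<otimes>\<^bsub>BB\<^esub> coset Q x = coset Q (z * x)"
  unfolding quot_emb_coset[OF fhh Q_idl] by (rule Quot_mult[OF fhh Q_idl z_S])

lemma lieT_mk: assumes f: "!!i. f i \<in> S" shows "lieT (mk f) = mk (tM (%_. 0) f)"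
  unfolding lieT_def lie_carlitz_t_def mk_def[of "tM (%_. 0) f"]
proof (rule map_cong[OF refl])
  fix i assume "i \<in> set [0..<n]"
  then have i: "i < n" by simp
  show "et [:0, 1:] \<otimes>\<^bsub>BB\<^esub> mk f ! i \<oplus>\<^bsub>BB\<^esub> (if Suc i < n then mk f ! Suc i else \<zero>\<^bsub>BB\<^esub>) = coset Q (tM (%_. 0) f i)"
    unfolding mk_nth[OF i] et_mult[OF f] tM_def using Quot_add[OF fhh Q_idl SD(4)[OF z_S f[of i]] f[of "Suc i"]] Quot_add[OF fhh Q_idl SD(4)[OF z_S f[of i]] SD(1)]
    by (cases "Suc i < n") (simp_all add: mk_nth Quot_zero[OF fhh Q_idl] del: mem_Collect_eq)
qed

lemma carT_mk: assumes f: "!!i. f i \<in> S" shows "carT (mk f) = mk (tM (%x. x ^ q) f)"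
  unfolding carT_def carlitz_t_def mk_def[of "tM (%x. x ^ q) f"]
proof (rule map_cong[OF refl])
  fix i assume "i \<in> set [0..<n]"
  then have i: "i < n" by simp
  have n0: "0 < n" using i by simp
  show "et [:0, 1:] \<otimes>\<^bsub>BB\<^esub> mk f ! i \<oplus>\<^bsub>BB\<^esub> (if Suc i < n then mk f ! Suc i else mk f ! 0 [^]\<^bsub>BB\<^esub> card (UNIV :: 'k set)) = coset Q (tM (%x. x ^ q) f i)"
    unfolding mk_nth[OF i] mk_nth[OF n0] et_mult[OF f] tM_def qc[symmetric] Quot_pow[OF fhh Q_idl f]
    using Quot_add[OF fhh Q_idl SD(4)[OF z_S f[of i]] f[of "Suc i"]] Quot_add[OF fhh Q_idl SD(4)[OF z_S f[of i]] S_power[OF f[of 0], of q]]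
    by (cases "Suc i < n") (simp_all add: mk_nth del: mem_Collect_eq)
qed

lemma lieT_hom: "T.M_hom lieT"
proof (rule M_hom_tM[OF lieT_mk])
  show "0 = (\<Sum>g\<in>G. kp (r g) * g 0)" for r
    by (rule sum.neutral[symmetric], rule ballI) (simp add: rhomD(1)[OF Gal_rhom])
qed (simp_all add: SD(1) del: mem_Collect_eq)

lemma power_q_sum: "finite A ==> (\<Sum>g\<in>A. kp (c g) * x g) ^ q = (\<Sum>g\<in>A. kp (c g) * x g ^ q)"
proof (induction A rule: finite_induct)
  case empty
  then show ?case using q1 by simp
next
  case (insert g A)
  have k: "kp c ^ q = kp c" for c using power_L[of c 1] unfolding power_one_right .
  have ad: "(x + y) ^ q = x ^ q + y ^ q" for x y :: 'L using add_power_L[of x y 1] unfolding power_one_right .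
  show ?case unfolding sum.insert[OF insert.hyps] ad power_mult_distrib k insert.IH ..
qed

lemma carT_hom: "T.M_hom carT"
proof (rule M_hom_tM[OF carT_mk])
  show "x ^ q \<in> S" if "x \<in> S" for x by (rule S_power[OF that])
  show "(x + y) ^ q = x ^ q + y ^ q" for x y :: 'L using add_power_L[of x y 1] unfolding power_one_right .
  show "(\<Sum>g\<in>G. kp (r g) * g x) ^ q = (\<Sum>g\<in>G. kp (r g) * g (x ^ q))" if "x \<in> S" for r x
    unfolding power_q_sum[OF G_fin] by (rule sum.cong[OF refl]) (simp add: rhom_power[OF Gal_rhom subS that])
qed

text \<open>Moving the shift from the vector to the functional turns z x_i + x_(i+1) into
  \<open>Lop\<close>. Only the last coordinate falls outside this pattern and contributes the term
  with \<open>e\<close>.\<close>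

lemma toB_tM:
  assumes u: "u \<in> U" and \<phi>: "\<phi> \<in> D" and f: "!!i. f i \<in> S" and e: "!!x. x \<in> S ==> e x \<in> S"
  shows "toB u (\<phi>, mk (tM e f)) = toB (Lop u) (\<phi>, mk f) + u (\<phi>, n - 1, e (f 0))"
proof -
  have n0: "0 < n" using n1 by simp
  have tf: "tM e f i \<in> S" for i by (rule tM_S[OF e f])
  let ?F = "%i. u (\<phi>, i, f (Suc i))"
  have "toB (Lop u) (\<phi>, mk f) = (\<Sum>i<n. u (\<phi>, i, z * f i) + (if 0 < i then ?F (i - 1) else 0))"
    unfolding toB_mk[OF Lop_U[OF u] \<phi> f] using f by (intro sum.cong refl) (simp add: Lop_def mul_def del: mem_Collect_eq)
  also have "\<dots> = (\<Sum>i<n. u (\<phi>, i, z * f i)) + (\<Sum>i<n. if 0 < i then ?F (i - 1) else 0)" by (rule sum.distrib)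
  also have "(\<Sum>i<n. if 0 < i then ?F (i - 1) else 0) = (\<Sum>i<n. if Suc i < n then ?F i else 0)" by (rule sum_if_Suc(1)[OF n0])
  finally have L: "toB (Lop u) (\<phi>, mk f) = (\<Sum>i<n. u (\<phi>, i, z * f i)) + (\<Sum>i<n. if Suc i < n then ?F i else 0)" .
  have "toB u (\<phi>, mk (tM e f)) = (\<Sum>i<n. u (\<phi>, i, z * f i) + (if Suc i < n then ?F i else u (\<phi>, i, e (f 0))))"
    unfolding toB_mk[of u \<phi> "tM e f", OF u \<phi> tf]
  proof (rule sum.cong[OF refl])
    fix i assume "i \<in> {..<n}"
    then have i: "i < n" by simp
    show "u (\<phi>, i, tM e f i) = u (\<phi>, i, z * f i) + (if Suc i < n then ?F i else u (\<phi>, i, e (f 0)))"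
      unfolding tM_def using linD(1)[OF U_lin[OF u \<phi> i] SD(4)[OF z_S f[of i]] f[of "Suc i"]] linD(1)[OF U_lin[OF u \<phi> i] SD(4)[OF z_S f[of i]] e[OF f[of 0]]]
      by (cases "Suc i < n") simp_all
  qed
  also have "\<dots> = (\<Sum>i<n. u (\<phi>, i, z * f i)) + (\<Sum>i<n. if Suc i < n then ?F i else u (\<phi>, i, e (f 0)))" by (rule sum.distrib)
  also have "(\<Sum>i<n. if Suc i < n then ?F i else u (\<phi>, i, e (f 0))) = (\<Sum>i<n. if Suc i < n then ?F i else 0) + u (\<phi>, n - 1, e (f 0))"
    by (rule sum_if_Suc(2)[OF n0])
  finally show ?thesis unfolding L by (simp only: add.assoc)
qed

lemma toB_Lop: assumes u: "u \<in> U" shows "toB (Lop u) = T.pull lieT (toB u)"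
proof (rule T.Bal_ext[OF toB_Bal[OF Lop_U[OF u]] T.pull_Bal[OF lieT_hom toB_Bal[OF u]]], unfold AA_simps)
  fix \<phi> m assume \<phi>: "\<phi> \<in> D" and m: "m \<in> carrier MM"
  obtain f where f: "!!i. f i \<in> S" "m = mk f" using m by (metis MM_cases)
  have "u (\<phi>, n - 1, 0) = 0" using linD(3)[OF last_lin[OF u \<phi>] QD(1)] .
  moreover have "T.pull lieT (toB u) (\<phi>, mk f) = toB u (\<phi>, lieT (mk f))"
    unfolding T.pull_def T.Sp_def AA_simps using \<phi> mk_MM[of f, OF f(1)] by simp
  moreover have "toB u (\<phi>, lieT (mk f)) = toB (Lop u) (\<phi>, mk f) + u (\<phi>, n - 1, 0)"
    unfolding lieT_mk[of f, OF f(1)] by (rule toB_tM[OF u \<phi> f(1) SD(1)])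
  ultimately show "toB (Lop u) (\<phi>, m) = T.pull lieT (toB u) (\<phi>, m)" unfolding f(2) by (simp only: add_0_right)
qed

lemma toB_sig: assumes u: "u \<in> U" shows "toB (%y. Lop u y + sig u y) = T.pull carT (toB u)"
proof (rule T.Bal_ext[OF toB_Bal[OF add_U[OF Lop_U[OF u] sig_U[OF u]]] T.pull_Bal[OF carT_hom toB_Bal[OF u]]], unfold AA_simps)
  fix \<phi> m assume \<phi>: "\<phi> \<in> D" and m: "m \<in> carrier MM"
  obtain f where f: "!!i. f i \<in> S" "m = mk f" using m by (metis MM_cases)
  have n0: "0 < n" using n1 by simp
  have "(\<Sum>i<n. sig u (\<phi>, i, f i)) = (\<Sum>i<n. if i = 0 then u (\<phi>, n - 1, f 0 ^ q) else 0)"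
    by (rule sum.cong[OF refl]) (use f(1) in \<open>simp add: sig_def frob_def del: mem_Collect_eq\<close>)
  then have sg: "(\<Sum>i<n. sig u (\<phi>, i, f i)) = u (\<phi>, n - 1, f 0 ^ q)" using n0 by simp
  have "toB (%y. Lop u y + sig u y) (\<phi>, mk f) = toB (Lop u) (\<phi>, mk f) + u (\<phi>, n - 1, f 0 ^ q)"
    unfolding toB_mk[OF add_U[OF Lop_U[OF u] sig_U[OF u]] \<phi> f(1)] toB_mk[OF Lop_U[OF u] \<phi> f(1)] sum.distrib sg ..
  moreover have "T.pull carT (toB u) (\<phi>, mk f) = toB u (\<phi>, carT (mk f))"
    unfolding T.pull_def T.Sp_def AA_simps using \<phi> mk_MM[of f, OF f(1)] by simp
  moreover have "toB u (\<phi>, carT (mk f)) = toB (Lop u) (\<phi>, mk f) + u (\<phi>, n - 1, f 0 ^ q)"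
    unfolding carT_mk[of f, OF f(1)] by (rule toB_tM[OF u \<phi> f(1) S_power])
  ultimately show "toB (%y. Lop u y + sig u y) (\<phi>, m) = T.pull carT (toB u) (\<phi>, m)" unfolding f(2) by (simp only:)
qed

definition "LE = endo_mat T.TM (tensor_map RR AA dra MM dla id lieT)"
definition "CE = endo_mat T.TM (tensor_map RR AA dra MM dla id carT)"
definition "LMt = transpose_mat (map_mat jf LE)"
definition "CMt = transpose_mat (map_mat jf CE)"

lemma LE: "LE \<in> carrier_mat mm mm" and CE: "CE \<in> carrier_mat mm mm"
  unfolding LE_def CE_def by (rule T.endo_mat_carrier)+

lemma LMt: "LMt \<in> carrier_mat mm mm" and CMt: "CMt \<in> carrier_mat mm mm"
  using LE CE by (simp_all add: LMt_def CMt_def)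

lemma LM_eq: "u \<in> U ==> kpU (Lop u) = LMt *\<^sub>v kpU u"
  unfolding kpU_def toB_Lop LMt_def LE_def by (rule T.kap_pull[OF jf lieT_hom toB_Bal])

text \<open>The matrix of \<open>sig\<close> is obtained as the difference of the matrices of the
  Carlitz and the Lie action, \<open>sig\<close> being the difference of their transposes on
  \<open>U\<close>.\<close>

lemma SM_eq: assumes u: "u \<in> U" shows "kpU (sig u) = (CMt - LMt) *\<^sub>v kpU u"
proof -
  note L = Lop_U[OF u] and a = add_U[OF Lop_U[OF u] sig_U[OF u]]
  have C: "kpU (%y. Lop u y + sig u y) = CMt *\<^sub>v kpU u"
    unfolding kpU_def toB_sig[OF u] CMt_def CE_def by (rule T.kap_pull[OF jf carT_hom toB_Bal[OF u]])
  have "kpU (%y. (Lop u y + sig u y) - Lop u y) = CMt *\<^sub>v kpU u - LMt *\<^sub>v kpU u"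
    unfolding coord_iso_diff(2)[OF U_iso a L] C LM_eq[OF u] ..
  then show ?thesis
    using minus_mult_distrib_mat_vec[OF CMt LMt coord_iso_carrier[OF U_iso u]] by simp
qed

lemma carlitz_size_eq: "carlitz_size \<iota> a b sc \<rho> n p = char_poly CE"
  and lie_carlitz_size_eq: "lie_carlitz_size \<iota> a b sc \<rho> n p = char_poly LE"
  unfolding CE_def LE_def T.TM_def unfolding carlitz_size_def lie_carlitz_size_def dual_tensor_size_def mod_size_def Let_def
    carT_def lieT_def RR_def dra_def dla_def AA_def MM_def by (rule refl)+

end

section \<open>Unconditional products of power series\<close>

lemma fps_mult_nth_cong:
  fixes f g f' g' :: "'f::comm_ring_1 fps"
  assumes "!!k. k < m ==> fps_nth f k = fps_nth f' k" "!!k. k < m ==> fps_nth g k = fps_nth g' k" "k < m"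
  shows "fps_nth (f * g) k = fps_nth (f' * g') k"
  unfolding fps_mult_nth using assms by (intro sum.cong) auto

lemma fps_prod_nth_one:
  fixes F :: "'i => 'f::comm_ring_1 fps"
  assumes "!!i k. i \<in> A ==> k < m ==> fps_nth (F i) k = fps_nth 1 k"
  shows "k < m ==> fps_nth (\<Prod>i\<in>A. F i) k = fps_nth 1 k"
  using assms
proof (induction A arbitrary: k rule: infinite_finite_induct)
  case (insert i A)
  have "fps_nth (F i * (\<Prod>i\<in>A. F i)) k = fps_nth (1 * 1) k"
    by (rule fps_mult_nth_cong[of m]) (use insert in blast)+
  then show ?case using insert.hyps by simp
qed simp_all

lemma fps_to_fls_prod:
  fixes F :: "'i => 'f::comm_ring_1 fps"
  shows "fps_to_fls (\<Prod>i\<in>A. F i) = (\<Prod>i\<in>A. fps_to_fls (F i))"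
  by (induction A rule: infinite_finite_induct) (simp_all add: fls_times_fps_to_fls)

lemma dist_fps_to_fls_le:
  fixes f g :: "'f::field fps"
  assumes "!!k. k < m ==> fps_nth f k = fps_nth g k" shows "dist (fps_to_fls f) (fps_to_fls g) \<le> (1 / 2) ^ m"
proof (cases "f = g")
  case False
  then have ne: "f - g ~= 0" by simp
  have "m \<le> subdegree (f - g)" using assms by (intro subdegree_geI ne) simp
  then have "(2 :: real) ^ m \<le> 2 ^ subdegree (f - g)" by (rule power_increasing) simp
  then have "inverse (2 ^ subdegree (f - g)) \<le> inverse ((2 :: real) ^ m)" by (rule le_imp_inverse_le) simp
  moreover have "fls_subdegree (fps_to_fls f - fps_to_fls g) = int (subdegree (f - g))"
    unfolding fps_to_fls_minus[symmetric] by (rule fls_subdegree_fls_to_fps)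
  ultimately show ?thesis using False by (simp add: dist_fls_def power_one_over inverse_eq_divide)
qed simp

text \<open>Outside the finite set \<open>J m\<close> all factors are 1 modulo the m-th power of the
  variable, so enlarging a finite product that contains \<open>J m\<close> does not change its
  coefficients below m.\<close>

lemma uncond_prod_fps:
  fixes F :: "'i => 'f::field fps"
  assumes F0: "!!i. i \<in> I ==> fps_nth (F i) 0 = 1" and fin: "!!m. finite {i \<in> I. \<exists>k<m. 0 < k \<and> fps_nth (F i) k ~= 0}"
  shows "\<exists>l. has_uncond_prod (%i. fps_to_fls (F i)) I (fps_to_fls l) \<and> fps_nth l 0 = 1"
proof -
  define J where "J = (%m. {i \<in> I. \<exists>k<m. 0 < k \<and> fps_nth (F i) k ~= 0})"
  have finJ: "finite (J m)" and JI: "J m \<subseteq> I" for m using fin unfolding J_def by blast+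
  have one: "fps_nth (F i) k = fps_nth 1 k" if "i \<in> I - J m" "k < m" for i k m
    using F0[of i] that unfolding J_def by (cases "k = 0") auto
  have stable: "fps_nth (\<Prod>i\<in>S. F i) k = fps_nth (\<Prod>i\<in>J m. F i) k" if S: "finite S" "J m \<subseteq> S" "S \<subseteq> I" and k: "k < m" for S k m
  proof -
    have "(\<Prod>i\<in>S. F i) = (\<Prod>i\<in>S - J m. F i) * (\<Prod>i\<in>J m. F i)" by (rule prod.subset_diff[OF S(2,1)])
    moreover have "fps_nth ((\<Prod>i\<in>S - J m. F i) * (\<Prod>i\<in>J m. F i)) k = fps_nth (1 * (\<Prod>i\<in>J m. F i)) k"
    proof (rule fps_mult_nth_cong[of m])
      show "fps_nth (\<Prod>i\<in>S - J m. F i) k = fps_nth 1 k" if "k < m" for k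
        by (rule fps_prod_nth_one[OF _ that, of _ F]) (rule one, use S(3) in blast)
    qed (use k in simp_all)
    ultimately show ?thesis by simp
  qed
  \<comment> \<open>The coefficient at k has stabilized as soon as all factors that differ from 1 at
    a positive exponent up to k are included, which is what \<open>J (Suc k)\<close>
    collects.\<close>
  define l where "l = Abs_fps (%k. fps_nth (\<Prod>i\<in>J (Suc k). F i) k)"
  have lim: "fps_nth (\<Prod>i\<in>S. F i) k = fps_nth l k" if S: "finite S" "J m \<subseteq> S" "S \<subseteq> I" and k: "k < m" for S k m
  proof -
    have "J (Suc k) \<subseteq> J m"
      unfolding J_def
    proof (rule subsetI)
      fix i assume "i \<in> {i \<in> I. \<exists>k'<Suc k. 0 < k' \<and> fps_nth (F i) k' ~= 0}"
      then obtain k' where k': "i \<in> I" "k' < Suc k" "0 < k'" "fps_nth (F i) k' ~= 0" by blast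
      have "k' < m" using k k'(2) by linarith
      then show "i \<in> {i \<in> I. \<exists>k<m. 0 < k \<and> fps_nth (F i) k ~= 0}" using k'(1,3,4) by blast
    qed
    then show ?thesis using stable[of S "Suc k" k] S by (simp add: l_def)
  qed
  have "has_uncond_prod (%i. fps_to_fls (F i)) I (fps_to_fls l)"
    unfolding has_uncond_prod_def tendsto_iff fps_to_fls_prod[symmetric]
  proof (intro allI impI)
    fix e :: real assume "0 < e"
    then obtain m where m: "(1 / 2) ^ m < e" using real_arch_pow_inv[of e "1 / 2"] by auto
    have "dist (fps_to_fls (\<Prod>i\<in>S. F i)) (fps_to_fls l) < e" if "finite S" "J m \<subseteq> S" "S \<subseteq> I" for S
      by (rule le_less_trans[OF dist_fps_to_fls_le m]) (rule lim[OF that])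
    then show "\<forall>\<^sub>F S in finite_subsets_at_top I. dist (fps_to_fls (\<Prod>i\<in>S. F i)) (fps_to_fls l) < e"
      unfolding eventually_finite_subsets_at_top using finJ[of m] JI[of m] by blast
  qed
  moreover have "fps_nth l 0 = 1"
  proof -
    have "fps_nth (\<Prod>i\<in>J 1. F i) 0 = fps_nth 1 0" by (rule fps_prod_nth_one[of _ 1]) (use F0 JI in auto)
    then show ?thesis by (simp add: l_def)
  qed
  ultimately show ?thesis by blast
qed

lemma has_uncond_prod_unique:
  fixes f :: "'i => 'a::{comm_monoid_mult,t2_space}"
  assumes "has_uncond_prod f I l" "has_uncond_prod f I l'" shows "l = l'"
  using assms unfolding has_uncond_prod_def by (rule tendsto_unique[OF finite_subsets_at_top_neq_bot])

lemma has_uncond_prod_cong: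
  assumes "!!i. i \<in> I ==> f i = g i" "has_uncond_prod f I l" shows "has_uncond_prod g I l"
proof -
  have "\<forall>\<^sub>F S in finite_subsets_at_top I. (\<Prod>i\<in>S. f i) = (\<Prod>i\<in>S. g i)"
    by (rule eventually_finite_subsets_at_top_weakI) (use assms(1) in \<open>auto intro: prod.cong\<close>)
  then show ?thesis using assms(2) unfolding has_uncond_prod_def by (rule Lim_transform_eventually[rotated])
qed

section \<open>Polynomials as Laurent series\<close>

lemma comm_ring_hom_fls_const: "comm_ring_hom (fls_const :: 'f::field => 'f fls)"
  by unfold_locales (simp_all add: fls_plus_const)

lemma comm_ring_hom_poly_eval:
  assumes "comm_ring_hom (h :: 'a::comm_ring_1 => 'b::comm_ring_1)" shows "comm_ring_hom (%p. poly (map_poly h p) x)"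
proof -
  interpret h: comm_ring_hom h by (rule assms)
  interpret mp: map_poly_comm_ring_hom h ..
  show ?thesis by unfold_locales (simp_all add: mp.hom_add mp.hom_mult)
qed

lemma comm_ring_hom_poly_at_t: "comm_ring_hom (poly_at_t :: 'f::field poly => 'f fls)"
  unfolding poly_at_t_def[abs_def] by (rule comm_ring_hom_poly_eval[OF comm_ring_hom_fls_const])

lemma poly_at_t_pCons: "poly_at_t (pCons c p) = fls_const c + fls_X_inv * poly_at_t p"
proof -
  interpret c: comm_ring_hom "fls_const :: 'a => 'a fls" by (rule comm_ring_hom_fls_const)
  show ?thesis by (simp add: poly_at_t_def c.map_poly_pCons_hom)
qed

lemma poly_at_t_0: "poly_at_t 0 = 0" by (simp add: poly_at_t_def)

lemma poly_at_t_const: "poly_at_t [:c:] = fls_const c" by (simp add: poly_at_t_pCons poly_at_t_0)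

lemma fps_to_fls_const: "fps_to_fls (fps_const c) = fls_const c" by (intro fls_eqI) simp

lemma fps_to_fls_fps_X: "fps_to_fls fps_X = (fls_X :: 'f::field fls)" by (intro fls_eqI) auto

lemma fls_X_inv_mult_X: "fls_X_inv * fls_X = (1 :: 'f::field fls)"
proof -
  have "inverse fls_X = (fls_X_inv :: 'f fls)" by (rule fls_inverse_X)
  moreover have "(fls_X :: 'f fls) ~= 0" by simp
  ultimately show ?thesis by (metis left_inverse)
qed

lemma fls_X_inv_power_mult: "fls_X_inv ^ k * fls_X ^ k = (1 :: 'f::field fls)"
  unfolding power_mult_distrib[symmetric] fls_X_inv_mult_X by simp

text \<open>\<open>g\<close> is the reversed polynomial, a polynomial in the inverse of t whose
  constant term is the leading coefficient. For monic polynomials it is therefore invertible as a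
  power series.\<close>

lemma poly_at_t_fps: "\<exists>g. poly_at_t p = fls_X_inv ^ degree p * fps_to_fls g \<and> fps_nth g 0 = lead_coeff p"
proof (induction p)
  case 0
  show ?case by (intro exI[of _ 0]) (simp add: poly_at_t_0)
next
  case (pCons c p)
  show ?case
  proof (cases "p = 0")
    case True
    then show ?thesis by (intro exI[of _ "fps_const c"]) (simp add: poly_at_t_const fps_to_fls_const)
  next
    case False
    obtain g where g: "poly_at_t p = fls_X_inv ^ degree p * fps_to_fls g" "fps_nth g 0 = lead_coeff p" using pCons.IH by blast
    let ?k = "Suc (degree p)"
    let ?g = "g + fps_X ^ ?k * fps_const c"
    have "fls_X_inv ^ ?k * fps_to_fls ?g = fls_X_inv ^ ?k * fps_to_fls g + (fls_X_inv ^ ?k * fls_X ^ ?k) * fls_const c"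
      by (simp add: fls_times_fps_to_fls fps_to_fls_power fps_to_fls_fps_X fps_to_fls_const algebra_simps)
    also have "\<dots> = poly_at_t (pCons c p)" unfolding fls_X_inv_power_mult poly_at_t_pCons g(1) by (simp add: algebra_simps)
    finally have "poly_at_t (pCons c p) = fls_X_inv ^ degree (pCons c p) * fps_to_fls ?g" using False by simp
    moreover have "fps_nth ?g 0 = lead_coeff (pCons c p)" using False g(2) by (simp add: fps_mult_nth)
    ultimately show ?thesis by blast
  qed
qed

lemma poly_at_t_neq_0: assumes "p ~= 0" shows "poly_at_t p ~= 0"
proof -
  obtain g where g: "poly_at_t p = fls_X_inv ^ degree p * fps_to_fls g" "fps_nth g 0 = lead_coeff p" using poly_at_t_fps by blast
  have "g ~= 0" using g(2) assms by auto
  moreover have "fls_X_inv ^ degree p ~= (0 :: 'a fls)" using fls_X_inv_power_mult[of "degree p", where ?'f = 'a] by auto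
  ultimately show ?thesis unfolding g(1) by simp
qed

lemma inverse_poly_at_t:
  assumes "lead_coeff p = 1"
  shows "\<exists>h. inverse (poly_at_t p ^ n) = fps_to_fls (fps_X ^ (degree p * n) * h)"
proof -
  obtain g where g: "poly_at_t p = fls_X_inv ^ degree p * fps_to_fls g" "fps_nth g 0 = lead_coeff p" using poly_at_t_fps by blast
  have g0: "fps_nth g 0 ~= 0" using g(2) assms by simp
  then have sd: "subdegree g = 0" by (simp add: subdegree_eq_0_iff)
  let ?h = "fps_X ^ (degree p * n) * inverse g ^ n"
  have "fps_to_fls g * fps_to_fls (inverse g) = 1"
    unfolding fls_times_fps_to_fls[symmetric] inverse_mult_eq_1'[OF g0] by simp
  then have "(fls_X_inv ^ degree p * fls_X ^ degree p) * (fps_to_fls g * fps_to_fls (inverse g)) = 1"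
    unfolding fls_X_inv_power_mult by simp
  then have "(poly_at_t p * (fls_X ^ degree p * fps_to_fls (inverse g))) ^ n = 1" unfolding g(1) by (simp add: algebra_simps)
  then have "poly_at_t p ^ n * fps_to_fls ?h = 1"
    by (simp add: fls_times_fps_to_fls fps_to_fls_power fps_to_fls_fps_X power_mult_distrib power_mult)
  then have "inverse (poly_at_t p ^ n) = fps_to_fls ?h" by (rule inverse_unique)
  then show ?thesis by blast
qed

text \<open>The determinant is the value at \<open>y\<close> of a polynomial with constant term
  1.\<close>

lemma det_one_minus_smult:
  fixes A :: "'a::comm_ring_1 mat"
  assumes A: "A \<in> carrier_mat r r" shows "\<exists>w. det (1\<^sub>m r - y \<cdot>\<^sub>m A) = 1 + y * w"
proof -
  define M where "M = mat r r (%(i, k). [:(if i = k then 1 else 0), - (A $$ (i, k)):])"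
  have M: "M \<in> carrier_mat r r" by (simp add: M_def)
  have ev: "poly (det M) x = det (1\<^sub>m r - x \<cdot>\<^sub>m A)" for x
    by (rule poly_det_cong[OF _ M]) (use A in \<open>auto simp: M_def\<close>)
  have "1\<^sub>m r - 0 \<cdot>\<^sub>m A = 1\<^sub>m r" using A by (intro eq_matI) auto
  then have "poly (det M) 0 = 1" using ev[of 0] by simp
  moreover obtain c w where "det M = pCons c w" by (cases "det M") auto
  ultimately have "poly (det M) y = 1 + y * poly w y" by simp
  then show ?thesis unfolding ev by blast
qed

text \<open>Since \<open>u\<close> is divisible by \<open>fps_X ^ N\<close>, the determinant is 1
  modulo that power, and so is its inverse.\<close>

lemma inverse_det_fps:
  fixes A :: "'f::field mat"
  assumes A: "A \<in> carrier_mat r r" and u: "u = fps_to_fls (fps_X ^ N * h)" and N: "0 < N"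
  shows "\<exists>f. inverse (det (1\<^sub>m r - u \<cdot>\<^sub>m map_mat fls_const A)) = fps_to_fls f \<and> fps_nth f 0 = 1 \<and> (\<forall>k. 0 < k \<longrightarrow> fps_nth f k ~= 0 \<longrightarrow> N \<le> k)"
proof -
  interpret H: comm_ring_hom "fps_to_fls :: 'f fps => 'f fls" by unfold_locales (simp_all add: fls_times_fps_to_fls)
  let ?A = "map_mat fps_const A"
  have Ac: "?A \<in> carrier_mat r r" using A by simp
  obtain w where w: "det (1\<^sub>m r - (fps_X ^ N * h) \<cdot>\<^sub>m ?A) = 1 + (fps_X ^ N * h) * w" using det_one_minus_smult[OF Ac] by blast
  let ?g = "1 + (fps_X ^ N * h) * w"
  have "map_mat fps_to_fls (1\<^sub>m r - (fps_X ^ N * h) \<cdot>\<^sub>m ?A) = 1\<^sub>m r - u \<cdot>\<^sub>m map_mat fls_const A"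
    unfolding u using A by (intro eq_matI) (auto simp: fls_times_fps_to_fls fps_to_fls_const)
  then have d: "det (1\<^sub>m r - u \<cdot>\<^sub>m map_mat fls_const A) = fps_to_fls ?g" using H.hom_det[of "1\<^sub>m r - (fps_X ^ N * h) \<cdot>\<^sub>m ?A"] w by simp
  have nth: "fps_nth ((fps_X ^ N * h) * w * f) k = 0" if "k < N" for f k
    using that by (simp add: mult.assoc fps_X_power_mult_nth)
  have g0: "fps_nth ?g 0 = 1" using nth[OF N, of 1] by simp
  let ?f = "inverse ?g"
  have "fps_nth ?g 0 ~= 0" unfolding g0 by (rule one_neq_zero)
  then have gf: "?g * ?f = 1" by (rule inverse_mult_eq_1')
  have inv: "inverse (fps_to_fls ?g) = fps_to_fls ?f"
    by (rule inverse_unique) (simp only: fls_times_fps_to_fls[symmetric] gf fps_to_fls_eq_1_iff)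
  have f: "fps_nth ?f k = fps_nth 1 k" if "k < N" for k
  proof -
    have "?f + (fps_X ^ N * h) * w * ?f = 1" using gf by (simp add: algebra_simps)
    then have "fps_nth ?f k + fps_nth ((fps_X ^ N * h) * w * ?f) k = fps_nth 1 k" by (metis fps_add_nth)
    then show ?thesis using nth[OF that] by simp
  qed
  have "N \<le> k" if "0 < k" "fps_nth ?f k ~= 0" for k
  proof (rule ccontr)
    assume "\<not> N \<le> k"
    then have "fps_nth ?f k = 0" using f[of k] that(1) by simp
    then show False using that(2) by blast
  qed
  moreover have "fps_nth ?f 0 = 1" using f[OF N] by simp
  ultimately show ?thesis unfolding d inv by blast
qed

text \<open>Over a finite field, 1 plus the product of all T - x is nonconstant without a
  root.\<close>

lemma infinite_alg_closed: "infinite (UNIV :: 'o::alg_closed_field set)"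
proof
  assume fin: "finite (UNIV :: 'o set)"
  let ?P = "\<Prod>x\<in>(UNIV :: 'o set). [:- x, 1:]"
  have dP: "degree ?P = card (UNIV :: 'o set)" by (subst degree_prod_sum_eq) simp_all
  have "0 < degree ?P" unfolding dP using fin by (simp add: card_gt_0_iff)
  then have "0 < degree (?P + 1)" by (simp add: degree_add_eq_left)
  then obtain y where "poly (?P + 1) y = 0" using alg_closed_imp_poly_has_root by blast
  moreover have "poly ?P y = 0" unfolding poly_prod by (rule prod_zero[OF fin]) (rule bexI[of _ y], simp_all)
  ultimately show False by simp
qed

section \<open>The local factors\<close>

context prime_data
begin

lemma char_poly_eval:
  assumes A: "A \<in> carrier_mat m m"
  shows "poly (map_poly jf (char_poly A)) s = det (s \<cdot>\<^sub>m 1\<^sub>m m - transpose_mat (map_mat jf A))"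
proof -
  interpret jf: field_hom jf by (rule jf)
  let ?B = "map_mat jf A"
  have B: "?B \<in> carrier_mat m m" using A by simp
  have c: "s \<cdot>\<^sub>m 1\<^sub>m m - ?B \<in> carrier_mat m m" using B by (rule minus_carrier_mat)
  have "poly (map_poly jf (char_poly A)) s = poly (det (char_poly_matrix ?B)) s"
    by (simp only: char_poly_def[of ?B, symmetric] jf.char_poly_hom[OF A])
  also have "\<dots> = det (s \<cdot>\<^sub>m 1\<^sub>m m - ?B)"
    by (rule poly_det_cong[OF c]) (use B in \<open>auto simp: char_poly_matrix_def\<close>)
  also have "\<dots> = det (transpose_mat (s \<cdot>\<^sub>m 1\<^sub>m m - ?B))" by (rule det_transpose[OF c, symmetric])
  also have "transpose_mat (s \<cdot>\<^sub>m 1\<^sub>m m - ?B) = s \<cdot>\<^sub>m 1\<^sub>m m - transpose_mat ?B" using B by (intro eq_matI) auto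
  finally show ?thesis .
qed

abbreviation "RS \<equiv> residue_size a p"

lemma prod_cyclic_shift:
  fixes f :: "nat => 'z::comm_monoid_mult"
  assumes "0 < k" "f k = f 0" shows "(\<Prod>i\<in>{1..k}. f i) = (\<Prod>i<k. f i)"
proof -
  obtain m where m: "k = Suc m" using assms(1) gr0_conv_Suc by blast
  have "(\<Prod>i\<in>{1..k}. f i) = (\<Prod>i<k. f (Suc i))" using prod.atLeast1_atMost_eq[of f k] by simp
  also have "\<dots> = (\<Prod>i<m. f (Suc i)) * f 0" unfolding m prod.lessThan_Suc using assms(2) m by simp
  also have "\<dots> = (\<Prod>i<k. f i)" unfolding m prod.lessThan_Suc_shift by (rule mult.commute)
  finally show ?thesis .
qed

text \<open>The size formula has exponents 0 .. d - 1, the cycle has 1 .. d. The products agree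
  because z comes from O_K, where the values of \<open>\<chi>0\<close> are fixed by the d-th
  Frobenius power.\<close>

lemma RS_eval: "poly (map_poly (jf \<circ> \<iota>) RS) s = (\<Prod>i\<in>{1..d}. s - \<chi>0 z ^ (q ^ i))"
proof -
  let ?t = "poly_emb a [:0, 1:]"
  have t: "?t \<in> int_set a" by (rule poly_emb_int_set[OF fha])
  have "poly (map_poly (jf \<circ> \<iota>) RS) s = (\<Prod>i<d. s - \<chi>0 z ^ (q ^ i))"
    unfolding RK.residue_size_eval[OF rK_chars[OF \<chi>0_chars]] rK_apply[OF t] poly_emb_comp ..
  also have "\<dots> = (\<Prod>i\<in>{1..d}. s - \<chi>0 z ^ (q ^ i))"
    by (rule prod_cyclic_shift[symmetric, OF d_pos]) (use \<chi>0_period[OF t] in \<open>simp add: poly_emb_comp\<close>)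
  finally show ?thesis .
qed

text \<open>\<open>det_local\<close> for the transposed matrices of the two actions;
  \<open>RS_eval\<close> turns the scalar \<open>cc d\<close> into the inverse n-th power of
  |kappa_p| at \<open>s\<close>.\<close>

lemma local_identity:
  assumes lie: "poly (map_poly jf (char_poly LE)) s ~= 0" and e: "poly_emb a e \<in> p" "poly (map_poly (jf \<circ> \<iota>) e) s ~= 0"
  shows "poly (map_poly jf (char_poly CE)) s = poly (map_poly jf (char_poly LE)) s *
    det (1\<^sub>m rr - inverse (poly (map_poly (jf \<circ> \<iota>) RS) s ^ n) \<cdot>\<^sub>m map_mat jf AI)"
proof -
  interpret ld: local_det S Q kp "jf \<circ> \<iota>" q G z n d \<chi>0 \<gamma> D ad sm ra jf kpU mm LMt "CMt - LMt" kpW rr "map_mat jf AI" s e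
  proof (rule local_det.intro[OF local_prime_axioms], rule local_det_axioms.intro)
    show "coord_iso U kpU mm" by (rule U_iso)
    show "LMt \<in> carrier_mat mm mm" by (rule LMt)
    show "CMt - LMt \<in> carrier_mat mm mm" by (rule minus_carrier_mat[OF LMt])
    show "kpU (Lop u) = LMt *\<^sub>v kpU u" if "u \<in> U" for u by (rule LM_eq[OF that])
    show "kpU (sig u) = (CMt - LMt) *\<^sub>v kpU u" if "u \<in> U" for u by (rule SM_eq[OF that])
    show "coord_iso W kpW rr" by (rule W_iso)
    show "map_mat jf AI \<in> carrier_mat rr rr" using AI by simp
    show "kpW (lact \<gamma> w) = map_mat jf AI *\<^sub>v kpW w" if "w \<in> W" for w by (rule \<Phi>_eq[OF that])
    show "det (s \<cdot>\<^sub>m 1\<^sub>m mm - LMt) ~= 0" using lie unfolding char_poly_eval[OF LE] LMt_def .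
    have "poly (map_poly kp e) z = b (poly_emb a e)" using poly_const_emb[OF fhh, of e] poly_emb_comp[of e] by (rule trans)
    then show "poly (map_poly kp e) z \<in> Q" using bp_Q[OF e(1)] by (simp only:)
    show "poly (map_poly (jf \<circ> \<iota>) e) s ~= 0" by (rule e(2))
  qed
  have c: "LMt + (CMt - LMt) = CMt" using LMt CMt by (intro eq_matI) auto
  have ccd: "ld.cc d = inverse (poly (map_poly (jf \<circ> \<iota>) RS) s ^ n)"
    unfolding ld.cc_def RS_eval prod_power_distrib prod_inversef[symmetric] power_inverse by simp
  have dl: "det (s \<cdot>\<^sub>m 1\<^sub>m mm - CMt) = det (s \<cdot>\<^sub>m 1\<^sub>m mm - LMt) * det (1\<^sub>m rr - ld.cc d \<cdot>\<^sub>m map_mat jf AI)"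
    using ld.det_local unfolding c .
  show ?thesis unfolding char_poly_eval[OF LE, folded LMt_def] char_poly_eval[OF CE, folded CMt_def] dl ccd ..
qed

definition "Rf = map_poly \<iota> RS"

lemma Rf: "degree Rf = d" "lead_coeff Rf = 1" "map_poly jf Rf = map_poly (jf \<circ> \<iota>) RS"
proof -
  interpret jf: field_hom jf by (rule jf)
  interpret \<iota>: field_hom \<iota> by (rule \<iota>)
  show dg: "degree Rf = d" unfolding Rf_def using RK.degree_residue_size(1) by simp
  show "lead_coeff Rf = 1" using RK.degree_residue_size(2) dg unfolding Rf_def by (simp add: coeff_map_poly)
  show "map_poly jf Rf = map_poly (jf \<circ> \<iota>) RS" unfolding Rf_def by (simp add: map_poly_map_poly)
qed

text \<open>\<open>local_identity\<close> multiplied by \<open>Rf ^ (n * rr)\<close>, which clears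
  the inverse n-th powers from a determinant of size \<open>rr\<close>. It holds at all but finitely
  many points of an infinite field, hence as an identity of polynomials.\<close>

lemma polynomial_identity:
  "char_poly CE * Rf ^ (n * rr) = char_poly LE * det (Rf ^ n \<cdot>\<^sub>m 1\<^sub>m rr - map_mat (%c. [:c:]) AI)"
proof -
  interpret jf: field_hom jf by (rule jf)
  interpret \<iota>: field_hom \<iota> by (rule \<iota>)
  obtain e where e: "irreducible e" "poly_emb a e \<in> p" using irreducible_in_p by blast
  define \<Delta> where "\<Delta> = char_poly CE * Rf ^ (n * rr) - char_poly LE * det (Rf ^ n \<cdot>\<^sub>m 1\<^sub>m rr - map_mat (%c. [:c:]) AI)"
  \<comment> \<open>\<open>B\<close> vanishes at every excluded \<open>s\<close>, namely the zeros
    of the Lie characteristic polynomial, of \<open>e\<close> and of |kappa_p|; thus the product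
    with \<open>\<Delta>\<close> vanishes everywhere.\<close>
  define B where "B = char_poly LE * map_poly \<iota> e * Rf"
  have e0: "e ~= 0" using e(1) by auto
  have "map_poly \<iota> e ~= 0" using e0 by (simp add: map_poly_eq_0_iff)
  moreover have "Rf ~= 0" using Rf(2) by auto
  moreover have "char_poly LE ~= 0" using degree_monic_char_poly[OF LE] by auto
  ultimately have B0: "B ~= 0" by (simp add: B_def)
  have me: "map_poly jf (map_poly \<iota> e) = map_poly (jf \<circ> \<iota>) e" by (simp add: map_poly_map_poly)
  have z: "poly (map_poly jf (\<Delta> * B)) s = 0" for s
  proof -
    interpret H: comm_ring_hom "%p. poly (map_poly jf p) s" by (rule comm_ring_hom_poly_eval) (rule jf.comm_ring_hom_axioms)
    let ?R = "poly (map_poly (jf \<circ> \<iota>) RS) s"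
    show ?thesis
    proof (cases "poly (map_poly jf (char_poly LE)) s = 0 \<or> poly (map_poly (jf \<circ> \<iota>) e) s = 0 \<or> ?R = 0")
      case True
      then show ?thesis unfolding B_def H.hom_mult me Rf(3) by auto
    next
      case False
      then have R0: "?R ^ n ~= 0" by simp
      have m: "map_mat (%p. poly (map_poly jf p) s) (Rf ^ n \<cdot>\<^sub>m 1\<^sub>m rr - map_mat (%c. [:c:]) AI) =
          ?R ^ n \<cdot>\<^sub>m (1\<^sub>m rr - inverse (?R ^ n) \<cdot>\<^sub>m map_mat jf AI)"
      proof (rule eq_matI)
        fix i k assume "i < dim_row (?R ^ n \<cdot>\<^sub>m (1\<^sub>m rr - inverse (?R ^ n) \<cdot>\<^sub>m map_mat jf AI))" "k < dim_col (?R ^ n \<cdot>\<^sub>m (1\<^sub>m rr - inverse (?R ^ n) \<cdot>\<^sub>m map_mat jf AI))"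
        then have ik: "i < rr" "k < rr" using AI by auto
        have cst: "poly (map_poly jf [:c:]) s = jf c" for c by (simp add: jf.map_poly_pCons_hom)
        have Rn: "poly (map_poly jf (Rf ^ n)) s = ?R ^ n" unfolding H.hom_power Rf(3) ..
        have "map_mat (%p. poly (map_poly jf p) s) (Rf ^ n \<cdot>\<^sub>m 1\<^sub>m rr - map_mat (%c. [:c:]) AI) $$ (i, k) =
            poly (map_poly jf ((if i = k then Rf ^ n else 0) - [:AI $$ (i, k):])) s" using ik AI by simp
        also have "\<dots> = (if i = k then ?R ^ n else 0) - jf (AI $$ (i, k))" unfolding H.hom_minus cst using Rn by simp
        also have "\<dots> = (?R ^ n \<cdot>\<^sub>m (1\<^sub>m rr - inverse (?R ^ n) \<cdot>\<^sub>m map_mat jf AI)) $$ (i, k)"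
        proof -
          have c: "?R ^ n * (inverse (?R ^ n) * x) = x" for x unfolding mult.assoc[symmetric] right_inverse[OF R0] by (rule mult_1)
          have "(?R ^ n \<cdot>\<^sub>m (1\<^sub>m rr - inverse (?R ^ n) \<cdot>\<^sub>m map_mat jf AI)) $$ (i, k) =
              ?R ^ n * ((if i = k then 1 else 0) - inverse (?R ^ n) * jf (AI $$ (i, k)))" using ik AI by simp
          also have "\<dots> = (if i = k then ?R ^ n else 0) - jf (AI $$ (i, k))" unfolding right_diff_distrib c by simp
          finally show ?thesis by (rule sym)
        qed
        finally show "map_mat (%p. poly (map_poly jf p) s) (Rf ^ n \<cdot>\<^sub>m 1\<^sub>m rr - map_mat (%c. [:c:]) AI) $$ (i, k) =
            (?R ^ n \<cdot>\<^sub>m (1\<^sub>m rr - inverse (?R ^ n) \<cdot>\<^sub>m map_mat jf AI)) $$ (i, k)" .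
      qed (use AI in auto)
      have "poly (map_poly jf (det (Rf ^ n \<cdot>\<^sub>m 1\<^sub>m rr - map_mat (%c. [:c:]) AI))) s = det (?R ^ n \<cdot>\<^sub>m (1\<^sub>m rr - inverse (?R ^ n) \<cdot>\<^sub>m map_mat jf AI))"
        unfolding m[symmetric] by (rule H.hom_det[symmetric])
      also have "\<dots> = ?R ^ (n * rr) * det (1\<^sub>m rr - inverse (?R ^ n) \<cdot>\<^sub>m map_mat jf AI)" using AI by (simp add: det_smult power_mult)
      finally have dt: "poly (map_poly jf (det (Rf ^ n \<cdot>\<^sub>m 1\<^sub>m rr - map_mat (%c. [:c:]) AI))) s =
          ?R ^ (n * rr) * det (1\<^sub>m rr - inverse (?R ^ n) \<cdot>\<^sub>m map_mat jf AI)" .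
      have "poly (map_poly jf (char_poly CE)) s = poly (map_poly jf (char_poly LE)) s * det (1\<^sub>m rr - inverse (?R ^ n) \<cdot>\<^sub>m map_mat jf AI)"
        by (rule local_identity[OF _ e(2)]) (use False in blast)+
      then have "poly (map_poly jf \<Delta>) s = 0" unfolding \<Delta>_def H.hom_minus H.hom_mult dt H.hom_power Rf(3) by (simp add: algebra_simps)
      then show ?thesis unfolding H.hom_mult by simp
    qed
  qed
  have "map_poly jf (\<Delta> * B) = 0"
  proof (rule ccontr)
    assume "map_poly jf (\<Delta> * B) ~= 0"
    then have "finite {x. poly (map_poly jf (\<Delta> * B)) x = 0}" by (rule poly_roots_finite)
    then show False unfolding z using infinite_alg_closed[where ?'o = 'o] by simp
  qed
  then have "\<Delta> * B = 0" by (simp add: map_poly_eq_0_iff)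
  then have "\<Delta> = 0" using B0 by simp
  then show ?thesis by (simp add: \<Delta>_def)
qed

lemma L_factor_eq: "L_factor \<iota> a b sc \<rho> n p P = inverse (det (1\<^sub>m rr - inverse (poly_at_t Rf ^ n) \<cdot>\<^sub>m map_mat fls_const AI))"
  using AI unfolding L_factor_def Let_def AI_def[symmetric, unfolded \<gamma>_def] Rf_def by (simp add: AI_def \<gamma>_def)

text \<open>The polynomial identity read in F((t^(-1))), where nonzero polynomials stay nonzero and
  \<open>?R ^ (n * rr)\<close> can be cancelled. The Lie size ends up in the numerator, matching the
  inverse in \<open>L_factor\<close>.\<close>

lemma L_factor_quotient:
  "poly_at_t (lie_carlitz_size \<iota> a b sc \<rho> n p) / poly_at_t (carlitz_size \<iota> a b sc \<rho> n p) = L_factor \<iota> a b sc \<rho> n p P"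
proof -
  interpret H: comm_ring_hom "poly_at_t :: 'f poly => 'f fls" by (rule comm_ring_hom_poly_at_t)
  let ?R = "poly_at_t Rf" and ?d = "det (1\<^sub>m rr - inverse (poly_at_t Rf ^ n) \<cdot>\<^sub>m map_mat fls_const AI)"
  have R0: "?R ~= 0" using Rf(2) by (intro poly_at_t_neq_0) auto
  then have Rn: "?R ^ n ~= 0" by simp
  have "map_mat poly_at_t (Rf ^ n \<cdot>\<^sub>m 1\<^sub>m rr - map_mat (%c. [:c:]) AI) = ?R ^ n \<cdot>\<^sub>m (1\<^sub>m rr - inverse (?R ^ n) \<cdot>\<^sub>m map_mat fls_const AI)"
  proof (rule eq_matI)
    fix i k assume "i < dim_row (?R ^ n \<cdot>\<^sub>m (1\<^sub>m rr - inverse (?R ^ n) \<cdot>\<^sub>m map_mat fls_const AI))" "k < dim_col (?R ^ n \<cdot>\<^sub>m (1\<^sub>m rr - inverse (?R ^ n) \<cdot>\<^sub>m map_mat fls_const AI))"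
    then have ik: "i < rr" "k < rr" using AI by auto
    have "map_mat poly_at_t (Rf ^ n \<cdot>\<^sub>m 1\<^sub>m rr - map_mat (%c. [:c:]) AI) $$ (i, k) = poly_at_t ((if i = k then Rf ^ n else 0) - [:AI $$ (i, k):])"
      using ik AI by simp
    also have "\<dots> = (if i = k then ?R ^ n else 0) - fls_const (AI $$ (i, k))" unfolding H.hom_minus poly_at_t_const by (simp add: H.hom_power)
    also have "\<dots> = (?R ^ n \<cdot>\<^sub>m (1\<^sub>m rr - inverse (?R ^ n) \<cdot>\<^sub>m map_mat fls_const AI)) $$ (i, k)"
    proof -
      have c: "?R ^ n * (inverse (?R ^ n) * x) = x" for x unfolding mult.assoc[symmetric] right_inverse[OF Rn] by (rule mult_1)
      have "(?R ^ n \<cdot>\<^sub>m (1\<^sub>m rr - inverse (?R ^ n) \<cdot>\<^sub>m map_mat fls_const AI)) $$ (i, k) =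
          ?R ^ n * ((if i = k then 1 else 0) - inverse (?R ^ n) * fls_const (AI $$ (i, k)))" using ik AI by simp
      also have "\<dots> = (if i = k then ?R ^ n else 0) - fls_const (AI $$ (i, k))" unfolding right_diff_distrib c by simp
      finally show ?thesis by (rule sym)
    qed
    finally show "map_mat poly_at_t (Rf ^ n \<cdot>\<^sub>m 1\<^sub>m rr - map_mat (%c. [:c:]) AI) $$ (i, k) =
        (?R ^ n \<cdot>\<^sub>m (1\<^sub>m rr - inverse (?R ^ n) \<cdot>\<^sub>m map_mat fls_const AI)) $$ (i, k)" .
  qed (use AI in auto)
  then have "poly_at_t (det (Rf ^ n \<cdot>\<^sub>m 1\<^sub>m rr - map_mat (%c. [:c:]) AI)) = ?R ^ (n * rr) * ?d"
    using H.hom_det[of "Rf ^ n \<cdot>\<^sub>m 1\<^sub>m rr - map_mat (%c. [:c:]) AI"] AI by (simp add: det_smult power_mult)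
  then have "poly_at_t (char_poly CE) * ?R ^ (n * rr) = poly_at_t (char_poly LE) * (?R ^ (n * rr) * ?d)"
    using arg_cong[OF polynomial_identity, of poly_at_t] unfolding H.hom_mult H.hom_power by simp
  then have "?R ^ (n * rr) * poly_at_t (char_poly CE) = ?R ^ (n * rr) * (poly_at_t (char_poly LE) * ?d)" by (simp only: mult.commute mult.left_commute)
  then have eq: "poly_at_t (char_poly CE) = poly_at_t (char_poly LE) * ?d" using R0 by (metis mult_left_cancel power_not_zero)
  have C0: "poly_at_t (char_poly CE) ~= 0" by (rule poly_at_t_neq_0) (use degree_monic_char_poly[OF CE] in auto)
  then have nz: "poly_at_t (char_poly LE) ~= 0" "?d ~= 0" unfolding eq by auto
  show ?thesis unfolding carlitz_size_eq lie_carlitz_size_eq L_factor_eq eq using nz by (simp only: divide_inverse inverse_mult_distrib) (simp add: mult.assoc[symmetric])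
qed

text \<open>The factor is 1 modulo t^(-d n), and kappa_p has q^d elements. The bound is expressed
  through the cardinality because that is how \<open>finite_maximal_bounded\<close> counts
  primes.\<close>

lemma L_factor_fps:
  "\<exists>f. L_factor \<iota> a b sc \<rho> n p P = fps_to_fls f \<and> fps_nth f 0 = 1 \<and>
     (\<forall>k. 0 < k \<longrightarrow> fps_nth f k ~= 0 \<longrightarrow> card (carrier (int_ring a Quot p)) \<le> q ^ k)"
proof -
  obtain h where h: "inverse (poly_at_t Rf ^ n) = fps_to_fls (fps_X ^ (degree Rf * n) * h)" using inverse_poly_at_t[OF Rf(2)] by blast
  have N: "0 < degree Rf * n" using d_pos n1 unfolding Rf(1) by simp
  obtain f where f: "L_factor \<iota> a b sc \<rho> n p P = fps_to_fls f" "fps_nth f 0 = 1" "!!k. 0 < k ==> fps_nth f k ~= 0 ==> degree Rf * n \<le> k"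
    using inverse_det_fps[OF AI h N] unfolding L_factor_eq by blast
  have "card (carrier (int_ring a Quot p)) \<le> q ^ k" if "0 < k" "fps_nth f k ~= 0" for k
  proof -
    have "d \<le> d * n" using n1 by simp
    then have "d \<le> k" using f(3)[OF that] unfolding Rf(1) by linarith
    then show ?thesis unfolding RK.card_residue using q1 by (intro power_increasing) simp_all
  qed
  then show ?thesis using f(1,2) by blast
qed

end

section \<open>The product over all primes\<close>

lemma field_hom_to_ac: "field_hom (to_ac :: 'f::field => 'f alg_closure)"
  by unfold_locales simp_all

theorem lemma1p4:
  fixes \<iota> :: "'k::{field,finite} \<Rightarrow> 'f::field"
    and a :: "'k poly fract \<Rightarrow> 'K::field"
    and b :: "'K \<Rightarrow> 'L::field"
    and sc :: "'f \<Rightarrow> 'v::ab_group_add \<Rightarrow> 'v"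
    and \<rho> :: "('L \<Rightarrow> 'L) \<Rightarrow> 'v \<Rightarrow> 'v"
    and PP :: "'K set \<Rightarrow> 'L set"
    and n :: nat
  assumes "finite_ext \<iota>"
    and "finite_ext a"
    and "finite_galois_ext b"
    and "\<forall>\<pp>\<in>Max_ideals (int_ring a). lies_above a b (PP \<pp>) \<pp>"
    and "finite_dim_space sc"
    and "\<rho> \<in> hom (Gal b) (GL sc)"
    and "n \<ge> 1"
  shows "has_uncond_prod (\<lambda>\<pp>. L_factor \<iota> a b sc \<rho> n \<pp> (PP \<pp>)) (Max_ideals (int_ring a))
           (L_value \<iota> a b sc \<rho> PP n) \<and>
         has_uncond_prod
           (\<lambda>\<pp>. poly_at_t (lie_carlitz_size \<iota> a b sc \<rho> n \<pp>) / poly_at_t (carlitz_size \<iota> a b sc \<rho> n \<pp>))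
           (Max_ideals (int_ring a)) (L_value \<iota> a b sc \<rho> PP n) \<and>
         L_value \<iota> a b sc \<rho> PP n \<in> fps_to_fls ` {f. fps_nth f 0 = 1}"
proof -
  let ?I = "Max_ideals (int_ring a)" and ?q = "card (UNIV :: 'k set)"
  let ?L = "\<lambda>\<pp>. L_factor \<iota> a b sc \<rho> n \<pp> (PP \<pp>)"
  have pd: "prime_data \<iota> a b sc \<rho> n \<pp> (PP \<pp>) (to_ac :: 'f \<Rightarrow> 'f alg_closure) ?q" if "\<pp> \<in> ?I" for \<pp>
    by (rule prime_data.intro[OF refl assms(1-3) that bspec[OF assms(4) that] assms(5-7) field_hom_to_ac])
  have "\<forall>\<pp>\<in>?I. \<exists>f. ?L \<pp> = fps_to_fls f \<and> fps_nth f 0 = 1 \<and>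
      (\<forall>k. 0 < k \<longrightarrow> fps_nth f k \<noteq> 0 \<longrightarrow> card (carrier (int_ring a Quot \<pp>)) \<le> ?q ^ k)"
    using prime_data.L_factor_fps[OF pd] by blast
  from bchoice[OF this] obtain F where F: "\<And>\<pp>. \<pp> \<in> ?I \<Longrightarrow> ?L \<pp> = fps_to_fls (F \<pp>)" "\<And>\<pp>. \<pp> \<in> ?I \<Longrightarrow> fps_nth (F \<pp>) 0 = 1"
    "\<And>\<pp> k. \<pp> \<in> ?I \<Longrightarrow> 0 < k \<Longrightarrow> fps_nth (F \<pp>) k \<noteq> 0 \<Longrightarrow> card (carrier (int_ring a Quot \<pp>)) \<le> ?q ^ k" by blast
  have q1: "1 \<le> ?q" using card_UNIV_finite_field[where ?'k = 'k] by simp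
  \<comment> \<open>A factor that differs from 1 at a positive exponent below m belongs to a prime
    with at most q^m residue classes, and there are finitely many of these.\<close>
  have "finite {\<pp> \<in> ?I. \<exists>k<m. 0 < k \<and> fps_nth (F \<pp>) k \<noteq> 0}" for m
  proof (rule finite_subset[OF _ finite_maximal_bounded[OF assms(2), of "?q ^ m"]], rule subsetI)
    fix \<pp> assume "\<pp> \<in> {\<pp> \<in> ?I. \<exists>k<m. 0 < k \<and> fps_nth (F \<pp>) k \<noteq> 0}"
    then obtain k where k: "\<pp> \<in> ?I" "k < m" "0 < k" "fps_nth (F \<pp>) k \<noteq> 0" by blast
    have "?q ^ k \<le> ?q ^ m" using k(2) q1 by (intro power_increasing) simp_all
    then show "\<pp> \<in> {\<pp> \<in> ?I. card (carrier (int_ring a Quot \<pp>)) \<le> ?q ^ m}" using F(3)[OF k(1,3,4)] k(1) by simp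
  qed
  from uncond_prod_fps[where I = ?I and F = F, OF F(2) this]
  obtain l where l: "has_uncond_prod (\<lambda>\<pp>. fps_to_fls (F \<pp>)) ?I (fps_to_fls l)" "fps_nth l 0 = 1" by blast
  have L: "has_uncond_prod ?L ?I (fps_to_fls l)" by (rule has_uncond_prod_cong[OF _ l(1)]) (rule F(1)[symmetric])
  then have V: "L_value \<iota> a b sc \<rho> PP n = fps_to_fls l"
    unfolding L_value_def by (intro the_equality) (auto intro: has_uncond_prod_unique)
  have "has_uncond_prod (\<lambda>\<pp>. poly_at_t (lie_carlitz_size \<iota> a b sc \<rho> n \<pp>) / poly_at_t (carlitz_size \<iota> a b sc \<rho> n \<pp>)) ?I (fps_to_fls l)"
    by (rule has_uncond_prod_cong[OF _ L]) (rule prime_data.L_factor_quotient[OF pd, symmetric])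
  then show ?thesis unfolding V using L l(2) by blast
qed

end
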